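(* Let $A_1,A_0,A_{-1},B\in B(\mathfrak k)$ and $u^t_s=u^t_s(A_1,A_0,A_{-1};B)$ for $s<t$. The mapping $$\mathcal O(u^t_s):\mathcal K\to\Gamma$$ can be extended (for all $s<t$) to a unitary mapping $U^t_s:\Gamma\to\Gamma$ if and only if there exists a unitary operator $\Upsilon$ on $\mathfrak k$ such that \begin{align*} A_0&=\Upsilon-1, \\ A_1&=-\Upsilon A_{-1}^+, \\ B+B^+&=-A_1^+A_1=-A_{-1}A_{-1}^+. \end{align*}
   Context: $\mathfrak k$ is a Hilbert space with countable base, $A^+$ the adjoint of $A\in B(\mathfrak k)$. $\mathfrak R=\{\emptyset\}+\mathbb R+\mathbb R^2+\cdots$ (disjoint union). For a finite index set $\alpha$, $t_\alpha=(t_c)_{c\in\alpha}$; for symmetric $f$ on $\mathfrak R$, $f(\alpha)$ abbreviates $f(t_\alpha)$; $+$ of index sets is disjoint union. $\int f(\alpha)\lambda_\alpha=f(\emptyset)+\sum_{n\ge1}\frac1{n!}\int_{\mathbb R^n}f(t_1,\dots,t_n)dt_1\cdots dt_n$. $\Gamma$ is the Fock space $L^2_s(\mathfrak R,\mathfrak k,\lambda)$ of symmetric square integrable functions $\mathfrak R\to\mathfrak k$, $\|f\|_\Gamma^2=\int\|f(\alpha)\|^2\lambda_\alpha$. $\mathcal K$ is the space of symmetric norm-continuous functions $\mathfrak R\to\mathfrak k$ with compact support (hence vanishing on $\mathbb R^n$ for large $n$). For locally integrable $F:\mathfrak R^3\to B(\mathfrak k)$, symmetric in each variable, and $g\in\mathcal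 K$, $$(\mathcal O(F)g)(\omega)=\sum_{\alpha\subset\omega}\sum_{\beta\subset\omega\setminus\alpha}\int\lambda_\upsilon\,F(\alpha,\beta,\upsilon)\,g((\omega\setminus\alpha)+\upsilon).$$ Kernel $u^t_s(A_1,A_0,A_{-1};B)$: for $s<t$ and $(t_\sigma,t_\tau,t_\upsilon)$ such that $s,t$ and all coordinates are pairwise different, let $s_1<\dots<s_n$ be all coordinates in increasing order and $i_j=1,0,-1$ according to whether $s_j$ belongs to $t_\sigma,t_\tau,t_\upsilon$; then $$u^t_s(t_\sigma,t_\tau,t_\upsilon)=\mathbf 1\{s<s_1<\dots<s_n<t\}\,e^{(t-s_n)B}A_{i_n}e^{(s_n-s_{n-1})B}A_{i_{n-1}}\cdots A_{i_2}e^{(s_2-s_1)B}A_{i_1}e^{(s_1-s)B},$$ with $u^t_s(\emptyset,\emptyset,\emptyset)=e^{(t-s)B}$. *)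

theory Defs
  imports "HOL-Analysis.Analysis" "HOL-Library.Multiset"
begin

section \<open>Complex inner product spaces\<close>

text \<open>
  The inner product \<open>cinner\<close> is antilinear in its first argument. Norm, metric and topology are
  those of the underlying real inner product space, whose inner product is the real part of
  \<open>cinner\<close>; positivity and definiteness are therefore inherited from \<^class>\<open>real_inner\<close>.
\<close>

class complex_inner = real_inner +
  fixes scaleC :: "complex \<Rightarrow> 'a \<Rightarrow> 'a"  (infixr "*\<^sub>C" 75)
    and cinner :: "'a \<Rightarrow> 'a \<Rightarrow> complex"
  assumes scaleC_of_real: "scaleC (of_real r) x = scaleR r x"
    and scaleC_add_right: "scaleC c (x + y) = scaleC c x + scaleC c y"
    and scaleC_add_left: "scaleC (c + d) x = scaleC c x + scaleC d x"
    and scaleC_scaleC: "scaleC c (scaleC d x) = scaleC (c * d) x"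
    and cinner_commute: "cinner x y = cnj (cinner y x)"
    and cinner_add_left: "cinner (x + y) z = cinner x z + cinner y z"
    and cinner_scaleC_left: "cinner (scaleC c x) y = cnj c * cinner x y"
    and inner_eq_Re_cinner: "inner x y = Re (cinner x y)"

class separable_hilbert = complex_inner + banach + second_countable_topology

lemma cinner_add_right: "cinner x (y + z) = cinner x y + cinner x (z :: 'a :: complex_inner)"
  by (metis cinner_add_left cinner_commute complex_cnj_add)

lemma cinner_scaleC_right: "cinner x (c *\<^sub>C y) = c * cinner x (y :: 'a :: complex_inner)"
  by (metis cinner_commute cinner_scaleC_left complex_cnj_cnj complex_cnj_mult)

lemma norm_scaleC: "norm (c *\<^sub>C x) = cmod c * norm (x :: 'a :: complex_inner)"
proof -
  have "cinner (c *\<^sub>C x) (c *\<^sub>C x) = (cnj c * c) * cinner x x"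
    by (simp add: cinner_scaleC_left cinner_scaleC_right)
  also have "cnj c * c = of_real ((cmod c)\<^sup>2)"
    by (simp only: complex_norm_square mult.commute)
  finally have "inner (c *\<^sub>C x) (c *\<^sub>C x) = (cmod c)\<^sup>2 * inner x x"
    by (simp add: inner_eq_Re_cinner)
  then show ?thesis
    by (simp add: norm_eq_sqrt_inner real_sqrt_mult)
qed

lemma bounded_linear_scaleC: "bounded_linear (\<lambda>x :: 'a :: complex_inner. c *\<^sub>C x)"
proof (rule bounded_linear_intro[where K = "cmod c"])
  fix r and x :: 'a
  show "c *\<^sub>C r *\<^sub>R x = r *\<^sub>R c *\<^sub>C x"
    by (simp flip: scaleC_of_real add: scaleC_scaleC mult.commute)
qed (simp_all add: scaleC_add_right norm_scaleC mult.commute)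

lemma cinner_eq_Complex:
  "cinner x y = Complex (inner x y) (inner (\<i> *\<^sub>C x) (y :: 'a :: complex_inner))"
  by (simp add: inner_eq_Re_cinner cinner_scaleC_left complex_eq_iff)

definition unitary :: "('a :: complex_inner \<Rightarrow> 'b :: complex_inner) \<Rightarrow> bool" where
  "unitary U \<longleftrightarrow>
     (\<forall>x y. U (x + y) = U x + U y) \<and> (\<forall>c x. U (c *\<^sub>C x) = c *\<^sub>C U x) \<and>
     (\<forall>x y. cinner (U x) (U y) = cinner x y) \<and> surj U"


section \<open>Bounded operators\<close>

text \<open>
  \<open>'a \<Rightarrow>\<^sub>L 'a\<close> consists of the real-linear bounded maps, with the operator norm; the algebra of
  bounded operators is its complex-linear part.
\<close>

definition bounded_operators :: "('a :: complex_inner \<Rightarrow>\<^sub>L 'a) set" where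
  "bounded_operators = {A. \<forall>c x. blinfun_apply A (c *\<^sub>C x) = c *\<^sub>C blinfun_apply A x}"

definition hadjoint :: "('a :: complex_inner \<Rightarrow>\<^sub>L 'a) \<Rightarrow> ('a \<Rightarrow>\<^sub>L 'a)" where
  "hadjoint A = (THE A'. \<forall>x y. cinner (blinfun_apply A' x) y = cinner x (blinfun_apply A y))"

definition blinfun_exp :: "('a :: real_normed_vector \<Rightarrow>\<^sub>L 'a) \<Rightarrow> ('a \<Rightarrow>\<^sub>L 'a)" where
  "blinfun_exp A = (\<Sum>n. (1 / fact n) *\<^sub>R ((\<lambda>C. A o\<^sub>L C) ^^ n) id_blinfun)"


section \<open>The configuration space\<close>

text \<open>
  The disjoint union of all \<open>\<real>\<^sup>n\<close>, \<open>n \<ge> 0\<close>, is represented by \<^typ>\<open>real list\<close>: the lists of length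
  \<open>n\<close> form \<open>\<real>\<^sup>n\<close>. The charts below identify the functions on \<open>{..<n}\<close> (extended by
  \<^term>\<open>undefined\<close>, as for \<^const>\<open>product_topology\<close> and \<^const>\<open>PiM\<close>) with these lists. Topology and
  \<open>\<sigma>\<close>-algebra are the disjoint union structures, and on \<open>\<real>\<^sup>n\<close> the measure is \<open>1/n!\<close> times
  Lebesgue measure.
\<close>

definition chart :: "nat \<Rightarrow> (nat \<Rightarrow> real) \<Rightarrow> real list" where
  "chart n x = map x [0..<n]"

abbreviation euclidean_top :: "nat \<Rightarrow> (nat \<Rightarrow> real) topology" where
  "euclidean_top n \<equiv> product_topology (\<lambda>_. euclideanreal) {..<n}"

definition config_topology :: "real list topology" where
  "config_topology =
     topology (\<lambda>S. \<forall>n. openin (euclidean_top n) {x \<in> topspace (euclidean_top n). chart n x \<in> S})"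

lemma openin_config_topology:
  "openin config_topology S \<longleftrightarrow>
     (\<forall>n. openin (euclidean_top n) {x \<in> topspace (euclidean_top n). chart n x \<in> S})"
proof -
  have "istopology
      (\<lambda>S. \<forall>n. openin (euclidean_top n) {x \<in> topspace (euclidean_top n). chart n x \<in> S})"
    unfolding istopology_def
  proof (intro conjI allI impI)
    fix S T :: "real list set" and n
    assume "\<forall>n. openin (euclidean_top n) {x \<in> topspace (euclidean_top n). chart n x \<in> S}"
      and "\<forall>n. openin (euclidean_top n) {x \<in> topspace (euclidean_top n). chart n x \<in> T}"
    then have "openin (euclidean_top n) ({x \<in> topspace (euclidean_top n). chart n x \<in> S} \<inter>
        {x \<in> topspace (euclidean_top n). chart n x \<in> T})"
      by blast
    then show "openin (euclidean_top n) {x \<in> topspace (euclidean_top n). chart n x \<in> S \<inter> T}"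
      by (rule back_subst[of "openin _"]) blast
  next
    fix \<S> :: "real list set set" and n
    assume "\<forall>S\<in>\<S>. \<forall>n. openin (euclidean_top n) {x \<in> topspace (euclidean_top n). chart n x \<in> S}"
    then have "openin (euclidean_top n)
        (\<Union>S\<in>\<S>. {x \<in> topspace (euclidean_top n). chart n x \<in> S})"
      by blast
    then show "openin (euclidean_top n) {x \<in> topspace (euclidean_top n). chart n x \<in> \<Union>\<S>}"
      by (rule back_subst[of "openin _"]) blast
  qed
  then show ?thesis
    by (simp add: config_topology_def topology_inverse')
qed

abbreviation lebesgue_pow :: "nat \<Rightarrow> (nat \<Rightarrow> real) measure" where
  "lebesgue_pow n \<equiv> PiM {..<n} (\<lambda>_. lborel)"

definition config_sets :: "real list set set" where
  "config_sets = {S. \<forall>n. chart n -` S \<inter> space (lebesgue_pow n) \<in> sets (lebesgue_pow n)}"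

definition config_measure :: "real list measure" where
  "config_measure = measure_of UNIV config_sets
     (\<lambda>S. \<Sum>n. ennreal (1 / fact n) * emeasure (lebesgue_pow n) (chart n -` S \<inter> space (lebesgue_pow n)))"

lemma sigma_algebra_config_sets: "sigma_algebra UNIV config_sets"
proof (rule sigma_algebra_iff2[THEN iffD2], intro conjI allI impI ballI)
  fix S assume S: "S \<in> config_sets"
  have "chart n -` (UNIV - S) \<inter> space (lebesgue_pow n) =
      space (lebesgue_pow n) - (chart n -` S \<inter> space (lebesgue_pow n))" for n
    by blast
  with S show "UNIV - S \<in> config_sets"
    by (simp add: config_sets_def)
next
  fix A :: "nat \<Rightarrow> real list set" assume A: "range A \<subseteq> config_sets"
  have "chart n -` (\<Union>i. A i) \<inter> space (lebesgue_pow n) =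
      (\<Union>i. chart n -` A i \<inter> space (lebesgue_pow n))" for n
    by blast
  moreover have "(\<Union>i. chart n -` A i \<inter> space (lebesgue_pow n)) \<in> sets (lebesgue_pow n)" for n
    using A by (intro sets.countable_UN) (auto simp: config_sets_def)
  ultimately show "(\<Union>i. A i) \<in> config_sets"
    by (simp add: config_sets_def)
qed (simp_all add: config_sets_def)

lemma space_config_measure [simp]: "space config_measure = UNIV"
  by (simp add: config_measure_def)

lemma sets_config_measure: "sets config_measure = config_sets"
  by (simp add: config_measure_def sigma_algebra.sets_measure_of_eq[OF sigma_algebra_config_sets])

lemma emeasure_config_measure:
  assumes "S \<in> config_sets"
  shows "emeasure config_measure S =
    (\<Sum>n. ennreal (1 / fact n) * emeasure (lebesgue_pow n) (chart n -` S \<inter> space (lebesgue_pow n)))"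
    (is "_ = ?\<mu> S")
proof (rule emeasure_measure_of[OF config_measure_def])
  show "positive (sets config_measure) ?\<mu>"
    by (simp add: positive_def)
  show "countably_additive (sets config_measure) ?\<mu>"
  proof (rule countably_additiveI)
    fix A :: "nat \<Rightarrow> real list set"
    assume A: "range A \<subseteq> sets config_measure" and disj: "disjoint_family A"
    let ?A = "\<lambda>n i. chart n -` A i \<inter> space (lebesgue_pow n)"
    have "(\<Sum>i. ?\<mu> (A i)) = (\<Sum>n. \<Sum>i. ennreal (1 / fact n) * emeasure (lebesgue_pow n) (?A n i))"
      unfolding nn_integral_count_space_nat[symmetric]
      by (rule pair_sigma_finite.Fubini')
        (auto simp: pair_sigma_finite_def sigma_finite_measure_count_space pair_measure_countable)
    also have "\<dots> = (\<Sum>n. ennreal (1 / fact n) * emeasure (lebesgue_pow n) (\<Union>i. ?A n i))"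
    proof (intro suminf_cong)
      fix n
      have "range (?A n) \<subseteq> sets (lebesgue_pow n)" 
        using A by (auto simp: sets_config_measure config_sets_def)
      moreover have "disjoint_family (?A n)"
        using disj unfolding disjoint_family_on_def by blast
      ultimately show "(\<Sum>i. ennreal (1 / fact n) * emeasure (lebesgue_pow n) (?A n i)) =
          ennreal (1 / fact n) * emeasure (lebesgue_pow n) (\<Union>i. ?A n i)"
        by (simp add: suminf_emeasure)
    qed
    also have "\<dots> = ?\<mu> (\<Union>i. A i)"
      by (intro suminf_cong arg_cong2[where f = "(*)"] refl arg_cong2[where f = emeasure]) blast
    finally show "(\<Sum>i. ?\<mu> (A i)) = ?\<mu> (\<Union>i. A i)" .
  qed
qed (use assms in \<open>auto simp: sets_config_measure\<close>)

definition symmetric :: "(real list \<Rightarrow> 'b) \<Rightarrow> bool" where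
  "symmetric f \<longleftrightarrow> (\<forall>xs ys. mset xs = mset ys \<longrightarrow> f xs = f ys)"


section \<open>Fock space\<close>

definition square_integrable :: "(real list \<Rightarrow> 'k :: separable_hilbert) set" where
  "square_integrable = {f. symmetric f \<and> f \<in> borel_measurable config_measure \<and>
     integrable config_measure (\<lambda>\<omega>. (norm (f \<omega>))\<^sup>2)}"

lemma square_integrable_zero: "(\<lambda>_. 0) \<in> square_integrable"
  by (simp add: square_integrable_def symmetric_def)

lemma square_integrable_add:
  assumes "f \<in> square_integrable" "g \<in> square_integrable"
  shows "(\<lambda>\<omega>. f \<omega> + g \<omega>) \<in> square_integrable"
proof -
  have [measurable]: "f \<in> borel_measurable config_measure" "g \<in> borel_measurable config_measure"
    using assms by (auto simp: square_integrable_def)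
  have "integrable config_measure (\<lambda>\<omega>. 2 * (norm (f \<omega>))\<^sup>2 + 2 * (norm (g \<omega>))\<^sup>2)"
    using assms by (auto simp: square_integrable_def)
  moreover have "(norm (f \<omega> + g \<omega>))\<^sup>2 \<le> 2 * (norm (f \<omega>))\<^sup>2 + 2 * (norm (g \<omega>))\<^sup>2" for \<omega>
  proof -
    have "(norm (f \<omega> + g \<omega>))\<^sup>2 \<le> (norm (f \<omega>) + norm (g \<omega>))\<^sup>2"
      by (intro power_mono norm_triangle_ineq) simp
    also have "\<dots> \<le> 2 * (norm (f \<omega>))\<^sup>2 + 2 * (norm (g \<omega>))\<^sup>2"
      using zero_le_power2[of "norm (f \<omega>) - norm (g \<omega>)"] by (simp add: power2_eq_square algebra_simps)
    finally show ?thesis .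
  qed
  ultimately have "integrable config_measure (\<lambda>\<omega>. (norm (f \<omega> + g \<omega>))\<^sup>2)"
    by (elim Bochner_Integration.integrable_bound) (auto intro!: AE_I2)
  moreover have "symmetric (\<lambda>\<omega>. f \<omega> + g \<omega>)"
    using assms unfolding square_integrable_def symmetric_def mem_Collect_eq by metis
  ultimately show ?thesis
    by (simp add: square_integrable_def)
qed

lemma borel_measurable_scaleC [measurable (raw)]:
  fixes f :: "'a \<Rightarrow> 'k :: complex_inner"
  assumes "f \<in> borel_measurable M"
  shows "(\<lambda>x. c *\<^sub>C f x) \<in> borel_measurable M"
  by (rule borel_measurable_continuous_on[OF linear_continuous_on[OF bounded_linear_scaleC] assms])

lemma square_integrable_scaleC:
  assumes "f \<in> square_integrable"
  shows "(\<lambda>\<omega>. c *\<^sub>C f \<omega>) \<in> square_integrable"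
proof -
  have [measurable]: "f \<in> borel_measurable config_measure"
    using assms by (auto simp: square_integrable_def)
  have "integrable config_measure (\<lambda>\<omega>. (cmod c)\<^sup>2 * (norm (f \<omega>))\<^sup>2)"
    using assms by (auto simp: square_integrable_def)
  moreover have "symmetric (\<lambda>\<omega>. c *\<^sub>C f \<omega>)"
    using assms unfolding square_integrable_def symmetric_def mem_Collect_eq by metis
  ultimately show ?thesis
    by (simp add: square_integrable_def norm_scaleC power_mult_distrib)
qed

lemma integrable_inner:
  assumes "f \<in> square_integrable" "g \<in> square_integrable"
  shows "integrable config_measure (\<lambda>\<omega>. inner (f \<omega>) (g \<omega>))"
proof -
  have [measurable]: "f \<in> borel_measurable config_measure" "g \<in> borel_measurable config_measure"
    using assms by (auto simp: square_integrable_def)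
  have "integrable config_measure (\<lambda>\<omega>. (norm (f \<omega>))\<^sup>2 + (norm (g \<omega>))\<^sup>2)"
    using assms by (auto simp: square_integrable_def)
  moreover have "\<bar>inner (f \<omega>) (g \<omega>)\<bar> \<le> (norm (f \<omega>))\<^sup>2 + (norm (g \<omega>))\<^sup>2" for \<omega>
  proof -
    have "\<bar>inner (f \<omega>) (g \<omega>)\<bar> \<le> norm (f \<omega>) * norm (g \<omega>)"
      by (rule Cauchy_Schwarz_ineq2)
    also have "\<dots> \<le> (norm (f \<omega>))\<^sup>2 + (norm (g \<omega>))\<^sup>2"
      using sum_squares_bound[of "norm (f \<omega>)" "norm (g \<omega>)"] mult_nonneg_nonneg[of "norm (f \<omega>)" "norm (g \<omega>)"]
      by (simp del: mult_nonneg_nonneg)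
    finally show ?thesis .
  qed
  ultimately show ?thesis
    by (elim Bochner_Integration.integrable_bound) (auto intro!: AE_I2)
qed

lemma integrable_cinner:
  assumes "f \<in> square_integrable" "g \<in> square_integrable"
  shows "integrable config_measure (\<lambda>\<omega>. cinner (f \<omega>) (g \<omega>))"
proof -
  have "integrable config_measure
      (\<lambda>\<omega>. of_real (inner (f \<omega>) (g \<omega>)) + \<i> * of_real (inner (\<i> *\<^sub>C f \<omega>) (g \<omega>)) :: complex)"
    using assms
    by (intro Bochner_Integration.integrable_add integrable_mult_right integrable_of_real
        integrable_inner square_integrable_scaleC)
  then show ?thesis
    by (simp add: cinner_eq_Complex Complex_eq)
qed

definition fock_rel :: "(real list \<Rightarrow> 'k) \<Rightarrow> (real list \<Rightarrow> 'k :: separable_hilbert) \<Rightarrow> bool" where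
  "fock_rel f g \<longleftrightarrow> f \<in> square_integrable \<and> g \<in> square_integrable \<and> (AE \<omega> in config_measure. f \<omega> = g \<omega>)"

quotient_type (overloaded) 'k fock = "real list \<Rightarrow> 'k :: separable_hilbert" / partial: fock_rel
  morphisms rep_fock fock_of
proof (rule part_equivpI)
  show "\<exists>f. fock_rel f (f :: real list \<Rightarrow> 'k)"
    using square_integrable_zero by (auto simp: fock_rel_def)
  show "symp (fock_rel :: (real list \<Rightarrow> 'k) \<Rightarrow> _)"
    by (auto simp: symp_def fock_rel_def elim: AE_mp)
  show "transp (fock_rel :: (real list \<Rightarrow> 'k) \<Rightarrow> _)"
    unfolding transp_def fock_rel_def by (auto elim: AE_mp)
qed

instantiation fock :: (separable_hilbert) complex_inner
begin

lift_definition zero_fock :: "'a fock" is "\<lambda>_. 0"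
  by (simp add: fock_rel_def square_integrable_zero)

lift_definition plus_fock :: "'a fock \<Rightarrow> 'a fock \<Rightarrow> 'a fock" is "\<lambda>f g \<omega>. f \<omega> + g \<omega>"
  by (auto simp: fock_rel_def square_integrable_add elim!: AE_mp)

lift_definition scaleC_fock :: "complex \<Rightarrow> 'a fock \<Rightarrow> 'a fock" is "\<lambda>c f \<omega>. c *\<^sub>C f \<omega>"
  by (auto simp: fock_rel_def square_integrable_scaleC elim!: AE_mp)

lift_definition cinner_fock :: "'a fock \<Rightarrow> 'a fock \<Rightarrow> complex" is
  "\<lambda>f g. \<integral>\<omega>. cinner (f \<omega>) (g \<omega>) \<partial>config_measure"
  unfolding fock_rel_def
  by (intro integral_cong_AE borel_measurable_integrable integrable_cinner) (auto elim!: AE_mp)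

definition scaleR_fock :: "real \<Rightarrow> 'a fock \<Rightarrow> 'a fock" where
  "scaleR_fock r f = of_real r *\<^sub>C f"

definition uminus_fock :: "'a fock \<Rightarrow> 'a fock" where
  "uminus_fock f = (-1) *\<^sub>C f"

definition minus_fock :: "'a fock \<Rightarrow> 'a fock \<Rightarrow> 'a fock" where
  "minus_fock f g = f + (-1) *\<^sub>C g"

definition inner_fock :: "'a fock \<Rightarrow> 'a fock \<Rightarrow> real" where
  "inner_fock f g = Re (cinner f g)"

definition norm_fock :: "'a fock \<Rightarrow> real" where
  "norm_fock f = sqrt (inner f f)"

definition dist_fock :: "'a fock \<Rightarrow> 'a fock \<Rightarrow> real" where
  "dist_fock f g = norm (f - g)"

definition sgn_fock :: "'a fock \<Rightarrow> 'a fock" where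
  "sgn_fock f = inverse (norm f) *\<^sub>R f"

definition uniformity_fock :: "('a fock \<times> 'a fock) filter" where
  "uniformity_fock = (INF e\<in>{0 <..}. principal {(f, g). dist f g < e})"

definition open_fock :: "'a fock set \<Rightarrow> bool" where
  "open_fock S = (\<forall>f\<in>S. \<forall>\<^sub>F (f', g) in uniformity. f' = f \<longrightarrow> g \<in> S)"

instance
proof
  have one: "1 *\<^sub>C x = (x :: 'b :: complex_inner)" for x
    using scaleC_of_real[of 1 x] by simp
  have zero: "0 *\<^sub>C x = (0 :: 'b :: complex_inner)" for x
    using scaleC_of_real[of 0 x] by simp
  have mone: "(-1) *\<^sub>C x = - (x :: 'b :: complex_inner)" for x
    using scaleC_of_real[of "-1" x] by simp
  fix f g h :: "'a fock" and r q :: real and c d :: complex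
  show add_assoc: "f + g + h = f + (g + h)"
    by transfer (auto simp: fock_rel_def add.assoc intro!: square_integrable_add)
  show "f + g = g + f"
    by transfer (auto simp: fock_rel_def add.commute intro!: square_integrable_add)
  show "0 + f = f"
    by transfer (auto simp: fock_rel_def)
  show "- f + f = 0"
    unfolding uminus_fock_def
    by transfer (auto simp: fock_rel_def mone square_integrable_zero)
  show "f - g = f + - g"
    by (simp add: minus_fock_def uminus_fock_def)
  show add_right: "c *\<^sub>C (f + g) = c *\<^sub>C f + c *\<^sub>C g" for c
    by transfer (auto simp: fock_rel_def scaleC_add_right
        intro!: square_integrable_add square_integrable_scaleC)
  show add_left: "(c + d) *\<^sub>C f = c *\<^sub>C f + d *\<^sub>C f" for c d
    by transfer (auto simp: fock_rel_def scaleC_add_left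
        intro!: square_integrable_add square_integrable_scaleC)
  show scale: "c *\<^sub>C d *\<^sub>C f = (c * d) *\<^sub>C f" for c d
    by transfer (auto simp: fock_rel_def scaleC_scaleC intro!: square_integrable_scaleC)
  show "of_real r *\<^sub>C f = r *\<^sub>R f"
    by (simp add: scaleR_fock_def)
  show "r *\<^sub>R (f + g) = r *\<^sub>R f + r *\<^sub>R g"
    by (simp add: scaleR_fock_def add_right)
  show "(r + q) *\<^sub>R f = r *\<^sub>R f + q *\<^sub>R f"
    by (simp add: scaleR_fock_def add_left)
  show "r *\<^sub>R q *\<^sub>R f = (r * q) *\<^sub>R f"
    by (simp add: scaleR_fock_def scale)
  show "1 *\<^sub>R f = f"
    unfolding scaleR_fock_def of_real_1
    by transfer (auto simp: fock_rel_def one)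
  show commute: "cinner f g = cnj (cinner g f)" for f g :: "'a fock"
  proof transfer
    fix f g :: "real list \<Rightarrow> 'a"
    have "(\<integral>\<omega>. cinner (f \<omega>) (g \<omega>) \<partial>config_measure) =
        (\<integral>\<omega>. cnj (cinner (g \<omega>) (f \<omega>)) \<partial>config_measure)"
      by (simp flip: cinner_commute)
    then show "(\<integral>\<omega>. cinner (f \<omega>) (g \<omega>) \<partial>config_measure) =
        cnj (\<integral>\<omega>. cinner (g \<omega>) (f \<omega>) \<partial>config_measure)"
      by simp
  qed
  show cadd: "cinner (f + g) h = cinner f h + cinner g h"
    by transfer (simp add: fock_rel_def cinner_add_left integrable_cinner)
  show cscale: "cinner (c *\<^sub>C f) g = cnj c * cinner f g" for c
    by transfer (simp add: cinner_scaleC_left)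
  show "inner f g = Re (cinner f g)"
    by (simp add: inner_fock_def)
  show "inner f g = inner g f"
    unfolding inner_fock_def by (subst commute) simp
  show "inner (f + g) h = inner f h + inner g h"
    by (simp add: inner_fock_def cadd)
  show "inner (r *\<^sub>R f) g = r * inner f g"
    by (simp add: inner_fock_def scaleR_fock_def cscale)
  have inner_self: "Re (\<integral>\<omega>. cinner (f \<omega>) (f \<omega>) \<partial>config_measure) =
      (\<integral>\<omega>. (norm (f \<omega>))\<^sup>2 \<partial>config_measure)"
    if "fock_rel f f" for f :: "real list \<Rightarrow> 'a"
  proof -
    have "integrable config_measure (\<lambda>\<omega>. cinner (f \<omega>) (f \<omega>))"
      using that by (intro integrable_cinner) (auto simp: fock_rel_def)
    then have "Re (\<integral>\<omega>. cinner (f \<omega>) (f \<omega>) \<partial>config_measure) =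
        (\<integral>\<omega>. Re (cinner (f \<omega>) (f \<omega>)) \<partial>config_measure)"
      by simp
    then show ?thesis
      by (simp flip: inner_eq_Re_cinner add: power2_norm_eq_inner)
  qed
  show "0 \<le> inner f f"
    unfolding inner_fock_def by transfer (simp add: inner_self)
  show "inner f f = 0 \<longleftrightarrow> f = 0"
    unfolding inner_fock_def
  proof transfer
    fix f :: "real list \<Rightarrow> 'a" assume f: "fock_rel f f"
    then have "(\<integral>\<omega>. (norm (f \<omega>))\<^sup>2 \<partial>config_measure) = 0 \<longleftrightarrow>
        (AE \<omega> in config_measure. (norm (f \<omega>))\<^sup>2 = 0)"
      by (intro integral_nonneg_eq_0_iff_AE) (auto simp: fock_rel_def square_integrable_def)
    with f show "Re (\<integral>\<omega>. cinner (f \<omega>) (f \<omega>) \<partial>config_measure) = 0 \<longleftrightarrow> fock_rel f (\<lambda>_. 0)"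
      by (simp add: inner_self) (simp add: fock_rel_def square_integrable_zero)
  qed
  show "norm f = sqrt (inner f f)" by (simp add: norm_fock_def)
  show "dist f g = norm (f - g)" by (simp add: dist_fock_def)
  show "sgn f = inverse (norm f) *\<^sub>R f" by (simp add: sgn_fock_def)
  show "(uniformity :: ('a fock \<times> 'a fock) filter) = (INF e\<in>{0 <..}. principal {(f, g). dist f g < e})"
    by (simp add: uniformity_fock_def)
  show "open S \<longleftrightarrow> (\<forall>f\<in>S. \<forall>\<^sub>F (f', g) in uniformity. f' = f \<longrightarrow> g \<in> S)" for S :: "'a fock set"
    by (simp add: open_fock_def)
qed

end


section \<open>Normal ordered operators and the evolution kernel\<close>

definition test_functions :: "(real list \<Rightarrow> 'k :: separable_hilbert) set" where
  "test_functions = {g. symmetric g \<and> continuous_map config_topology euclidean g \<and>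
     compactin config_topology (config_topology closure_of {\<omega>. g \<omega> \<noteq> 0})}"

text \<open>
  Subsets of the configuration \<open>\<omega>\<close> are subsets of its index set \<open>{..<length \<omega>}\<close>, and
  \<^term>\<open>nths \<omega> \<alpha>\<close> is the corresponding subconfiguration.
\<close>

definition normal_ordered ::
  "(real list \<Rightarrow> real list \<Rightarrow> real list \<Rightarrow> ('k :: separable_hilbert \<Rightarrow>\<^sub>L 'k)) \<Rightarrow>
   (real list \<Rightarrow> 'k) \<Rightarrow> real list \<Rightarrow> 'k" where
  "normal_ordered F g \<omega> =
     (\<Sum>\<alpha>\<in>Pow {..<length \<omega>}. \<Sum>\<beta>\<in>Pow ({..<length \<omega>} - \<alpha>).
        \<integral>\<upsilon>. blinfun_apply (F (nths \<omega> \<alpha>) (nths \<omega> \<beta>) \<upsilon>) (g (nths \<omega> ({..<length \<omega>} - \<alpha>) @ \<upsilon>))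
          \<partial>config_measure)"

text \<open>
  \<open>ordered_product B s t [(s\<^sub>1, C\<^sub>1), \<dots>, (s\<^sub>n, C\<^sub>n)]\<close> is
  \<open>e\<^bsup>(t - s\<^sub>n)B\<^esup> C\<^sub>n e\<^bsup>(s\<^sub>n - s\<^sub>n\<^sub>-\<^sub>1)B\<^esup> \<cdots> C\<^sub>1 e\<^bsup>(s\<^sub>1 - s)B\<^esup>\<close>.
\<close>

fun ordered_product ::
  "('k :: real_normed_vector \<Rightarrow>\<^sub>L 'k) \<Rightarrow> real \<Rightarrow> real \<Rightarrow> (real \<times> ('k \<Rightarrow>\<^sub>L 'k)) list \<Rightarrow> ('k \<Rightarrow>\<^sub>L 'k)" where
  "ordered_product B s t [] = blinfun_exp ((t - s) *\<^sub>R B)"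
| "ordered_product B s t ((r, C) # ps) =
     ordered_product B r t ps o\<^sub>L C o\<^sub>L blinfun_exp ((r - s) *\<^sub>R B)"

text \<open>
  On the null set of coinciding coordinates the kernel is set to zero. Every coordinate is paired
  with its operator before sorting.
\<close>

definition evolution_kernel ::
  "('k :: real_normed_vector \<Rightarrow>\<^sub>L 'k) \<Rightarrow> ('k \<Rightarrow>\<^sub>L 'k) \<Rightarrow> ('k \<Rightarrow>\<^sub>L 'k) \<Rightarrow> ('k \<Rightarrow>\<^sub>L 'k) \<Rightarrow> real \<Rightarrow> real \<Rightarrow>
   real list \<Rightarrow> real list \<Rightarrow> real list \<Rightarrow> ('k \<Rightarrow>\<^sub>L 'k)" where
  "evolution_kernel A\<^sub>1 A\<^sub>0 A\<^sub>m B s t \<sigma> \<tau> \<upsilon> =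
     (if distinct (\<sigma> @ \<tau> @ \<upsilon>) \<and> set (\<sigma> @ \<tau> @ \<upsilon>) \<subseteq> {s<..<t}
      then ordered_product B s t (sort_key fst
        (map (\<lambda>r. (r, A\<^sub>1)) \<sigma> @ map (\<lambda>r. (r, A\<^sub>0)) \<tau> @ map (\<lambda>r. (r, A\<^sub>m)) \<upsilon>))
      else 0)"

definition extends_to_fock ::
  "((real list \<Rightarrow> 'k) \<Rightarrow> real list \<Rightarrow> 'k) \<Rightarrow> ('k :: separable_hilbert fock \<Rightarrow> 'k fock) \<Rightarrow> bool" where
  "extends_to_fock T U \<longleftrightarrow>
     (\<forall>g\<in>test_functions. T g \<in> square_integrable \<and> U (fock_of g) = fock_of (T g))"

end

(*
  On a test function g the path G(r) = O(u^r_s) g solves the integral equation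
    G(r)(w) = g(w) + int_s^r (B G(q)(w) + A_{-1} G(q)(w + q)) dq
              + sum over the points q of w in (s, r) of (A_1 G(q)(w - q) + A_0 G(q)(w)),
  and the sum-integral formula turns this into an energy balance: |G(t)|^2 - |g|^2 is the time
  integral of the integral over w of Q(G(q)(w), G(q)(w + q)), where
    Q(x, y) = 2 Re <x, B x + A_{-1} y> + |A_1 x + (A_0 + 1) y|^2 - |y|^2.
  So O(u^t_s) is isometric for all s < t iff Q = 0: in the nontrivial direction let t decrease to s
  and choose g with prescribed values x on the empty and y on a one-point configuration.
  The adjoint of O(u^t_s) solves the backward equation with (A_{-1}^+, A_0^+, A_1^+, B^+), which
  time reversal makes a forward equation, so the same criterion applies to it. Test functions being
  dense, a unitary extension exists iff both operators are isometric, and Q = 0 for both sets of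
  coefficients is equivalent to the conditions on Upsilon = 1 + A_0.
*)
theory Submission
  imports Defs
begin

section \<open>Integration over configurations\<close>

text \<open>The adjoint relation and the energy balance rest on one product rule for paths with
  jumps. The obstacle is the value at a jump: the forward path carries the left limit, the backward
  path the right limit, and exactly this pairing leaves no diagonal terms. For the energy the
  backward path is G itself run back from its final value, so a jump b contributes |G + b|^2 -
  |G|^2; here almost every configuration has to have distinct points. All functions are bounded by C
  c^n on [-R,R]^n and vanish off this box. Such bounds survive adding a point (a factor c), summing
  over subconfigurations (a larger c) and annihilation (a factor exp(2 R M c)), which justifies
  every interchange of integrals. Real linearity of O(u^t_s) is not computed from the kernel: on the
  dense test functions it follows from the adjoint relation alone. Isometry of O(u^t_s) by itself
  makes \<Upsilon> only an isometry; that U and \<Upsilon> are onto comes in both cases from the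
  isometry of the adjoint.\<close>

lemma length_chart [simp]: "length (chart n x) = n"
  by (simp add: chart_def)

lemma chart_fun_upd: "chart (Suc n) (x(n := q)) = chart n x @ [q]"
  by (simp add: chart_def)

lemma chart_nth [simp]: "i < n \<Longrightarrow> chart n x ! i = x i"
  by (simp add: chart_def)

lemma chart_restrict_nth: "chart (length \<omega>) (\<lambda>i\<in>{..<length \<omega>}. \<omega> ! i) = \<omega>"
  by (rule nth_equalityI) simp_all

lemma measurable_chart [measurable]: "chart n \<in> measurable (lebesgue_pow n) config_measure"
  by (rule measurableI) (auto simp: sets_config_measure config_sets_def)

lemma measurable_from_config_measure:
  assumes "\<And>n. (\<lambda>x. f (chart n x)) \<in> measurable (lebesgue_pow n) N"
  shows "f \<in> measurable config_measure N"
proof (rule measurableI)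
  fix \<omega> :: "real list" assume "\<omega> \<in> space config_measure"
  have "f (chart (length \<omega>) (\<lambda>i\<in>{..<length \<omega>}. \<omega> ! i)) \<in> space N"
    by (rule measurable_space[OF assms]) (simp add: space_PiM)
  then show "f \<omega> \<in> space N" by (simp only: chart_restrict_nth)
next
  fix A assume A: "A \<in> sets N"
  have "chart n -` (f -` A) \<inter> space (lebesgue_pow n) \<in> sets (lebesgue_pow n)" for n
    using measurable_sets[OF assms[of n] A] by (simp add: vimage_def)
  then show "f -` A \<inter> space config_measure \<in> sets config_measure"
    by (simp add: sets_config_measure config_sets_def)
qed

lemma measurable_length_config [measurable]: "length \<in> measurable config_measure (count_space UNIV)"
  by (rule measurable_from_config_measure) simp

lemma measurable_nth_config:
  "(\<lambda>\<omega>. if i < length \<omega> then \<omega> ! i else 0) \<in> borel_measurable config_measure"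
proof (rule measurable_from_config_measure)
  fix n
  have "(\<lambda>x. if i < n then x i else (0::real)) \<in> borel_measurable (lebesgue_pow n)"
    by (cases "i < n") auto
  then show "(\<lambda>x. if i < length (chart n x) then chart n x ! i else 0) \<in> borel_measurable (lebesgue_pow n)"
    by (simp cong: if_cong)
qed

text \<open>A list is determined by its length and its entries. On the countable partition of
  \<open>M\<close> by length, \<open>h\<close> is a chart applied to a finite family of measurable
  real functions; the padding value 0 makes the i-th entry a total function.\<close>

lemma measurable_into_config_measure:
  assumes len: "(\<lambda>m. length (h m)) \<in> measurable M (count_space UNIV)"
    and nth: "\<And>i. (\<lambda>m. if i < length (h m) then h m ! i else 0) \<in> borel_measurable M"
  shows "h \<in> measurable M config_measure"
proof -
  let ?c = "\<lambda>n m. chart n (\<lambda>i\<in>{..<n}. if i < length (h m) then h m ! i else 0)"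
  have "(\<lambda>m. ?c (length (h m)) m) \<in> measurable M config_measure"
  proof (rule measurable_compose_countable[where f = ?c, OF _ len])
    fix n show "?c n \<in> measurable M config_measure"
      by (rule measurable_compose[OF measurable_restrict measurable_chart]) (use nth in simp)
  qed
  moreover have "?c (length (h m)) m = h m" for m
    by (rule trans[OF _ chart_restrict_nth]) (simp add: chart_def)
  ultimately show ?thesis by simp
qed

lemma measurable_append_config [measurable (raw)]:
  assumes f[measurable]: "f \<in> measurable M config_measure" and g[measurable]: "g \<in> measurable M config_measure"
  shows "(\<lambda>m. f m @ g m) \<in> measurable M config_measure"
proof (rule measurable_into_config_measure)
  show "(\<lambda>m. length (f m @ g m)) \<in> measurable M (count_space UNIV)"
    unfolding length_append by measurable
  fix i
  note [measurable] = measurable_compose[OF f measurable_nth_config] measurable_compose[OF g measurable_nth_config]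
  \<comment> \<open>For a fixed length n of the first list, the i-th entry of the concatenation
    comes from a fixed list at a fixed index.\<close>
  have "(\<lambda>m. (\<lambda>n m. if i < n then (if i < length (f m) then f m ! i else 0)
      else (if i - n < length (g m) then g m ! (i - n) else 0)) (length (f m)) m) \<in> borel_measurable M"
    by (rule measurable_compose_countable) measurable
  also have "?this \<longleftrightarrow> (\<lambda>m. if i < length (f m @ g m) then (f m @ g m) ! i else 0) \<in> borel_measurable M"
    by (intro arg_cong2[where f="(\<in>)"] ext refl) (auto simp: nth_append)
  finally show "(\<lambda>m. if i < length (f m @ g m) then (f m @ g m) ! i else 0) \<in> borel_measurable M" .
qed

lemma measurable_singleton_config [measurable (raw)]:
  assumes [measurable]: "f \<in> borel_measurable M"
  shows "(\<lambda>m. [f m]) \<in> measurable M config_measure"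
  by (rule measurable_into_config_measure) (auto simp: less_Suc_eq cong: if_cong)

lemma measurable_map_config:
  assumes "\<And>f. f \<in> set fs \<Longrightarrow> f \<in> borel_measurable M"
  shows "(\<lambda>m. map (\<lambda>f. f m) fs) \<in> measurable M config_measure"
proof (rule measurable_into_config_measure)
  fix i
  show "(\<lambda>m. if i < length (map (\<lambda>f. f m) fs) then map (\<lambda>f. f m) fs ! i else 0) \<in> borel_measurable M"
    using assms by (cases "i < length fs") auto
qed simp

text \<open>Functions defined by recursion over a list or by positions in it have no evident joint
  measurability. On each set of constant length the configuration becomes a fixed list of measurable
  real functions, so that \<open>distinct\<close>, \<open>sum_delete\<close>,
  \<open>split_sum\<close> and the sorted kernel reduce to finite combinations of such
  functions.\<close>

lemma measurable_config_cases:
  assumes h: "h \<in> measurable M config_measure"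
    and F: "\<And>fs. (\<And>f. f \<in> set fs \<Longrightarrow> f \<in> borel_measurable M) \<Longrightarrow>
      (\<lambda>m. F m (map (\<lambda>f. f m) fs)) \<in> measurable M N"
  shows "(\<lambda>m. F m (h m)) \<in> measurable M N"
proof -
  let ?f = "\<lambda>i m. if i < length (h m) then h m ! i else 0"
  let ?c = "\<lambda>n m. map (\<lambda>f. f m) (map ?f [0..<n])"
  have "(\<lambda>m. F m (?c (length (h m)) m)) \<in> measurable M N"
  proof (rule measurable_compose_countable[where f = "\<lambda>n m. F m (?c n m)"])
    fix n show "(\<lambda>m. F m (?c n m)) \<in> measurable M N"
      by (rule F) (use measurable_compose[OF h measurable_nth_config] in auto)
  qed (rule measurable_compose[OF h measurable_length_config])
  moreover have "?c (length (h m)) m = h m" for m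
    by (rule nth_equalityI) simp_all
  ultimately show ?thesis by simp
qed

lemma measurable_map_real_config:
  assumes [measurable]: "(f :: real \<Rightarrow> real) \<in> borel_measurable borel"
  shows "map f \<in> measurable config_measure config_measure"
proof -
  have "(\<lambda>\<omega>. map f \<omega>) \<in> measurable config_measure config_measure"
  proof (rule measurable_config_cases[where F = "\<lambda>_. map f" and h = "\<lambda>\<omega>. \<omega>"])
    fix fs :: "(real list \<Rightarrow> real) list" assume *: "\<And>g. g \<in> set fs \<Longrightarrow> g \<in> borel_measurable config_measure"
    have "(\<lambda>m. map (\<lambda>g. g m) (map (\<lambda>g m. f (g m)) fs)) \<in> measurable config_measure config_measure"
      by (rule measurable_map_config) (use * in auto)
    then show "(\<lambda>m. map f (map (\<lambda>g. g m) fs)) \<in> measurable config_measure config_measure"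
      by (simp add: o_def)
  qed simp
  then show ?thesis by simp
qed

lemma pred_set_subset_config [measurable]:
  assumes [measurable]: "A \<in> sets borel"
  shows "Measurable.pred config_measure (\<lambda>\<omega>. set \<omega> \<subseteq> A)"
proof (rule measurable_config_cases[where F = "\<lambda>_ \<omega>. set \<omega> \<subseteq> A" and h = "\<lambda>\<omega>. \<omega>"])
  fix fs :: "(real list \<Rightarrow> real) list" assume *: "\<And>f. f \<in> set fs \<Longrightarrow> f \<in> borel_measurable config_measure"
  have "Measurable.pred config_measure (\<lambda>m. f m \<in> A)" if "f \<in> set fs" for f
    using *[OF that] by measurable
  then have "Measurable.pred config_measure (\<lambda>m. \<forall>f\<in>set fs. f m \<in> A)"
    by (intro pred_intros_finite finite_set)
  then show "Measurable.pred config_measure (\<lambda>m. set (map (\<lambda>f. f m) fs) \<subseteq> A)"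
    by (simp add: image_subset_iff)
qed simp

lemma nn_integral_config_measure:
  assumes "f \<in> borel_measurable config_measure"
  shows "(\<integral>\<^sup>+\<omega>. f \<omega> \<partial>config_measure) =
    (\<Sum>n. ennreal (1 / fact n) * (\<integral>\<^sup>+x. f (chart n x) \<partial>lebesgue_pow n))"
  using assms
proof (induction rule: borel_measurable_induct)
  case (cong f g)
  then show ?case by (simp cong: nn_integral_cong)
next
  case (set A)
  have "(\<integral>\<^sup>+x. indicator A (chart n x) \<partial>lebesgue_pow n) =
      emeasure (lebesgue_pow n) (chart n -` A \<inter> space (lebesgue_pow n))" for n
  proof -
    have "(\<integral>\<^sup>+x. indicator A (chart n x) \<partial>lebesgue_pow n) =
      (\<integral>\<^sup>+x. indicator (chart n -` A \<inter> space (lebesgue_pow n)) x \<partial>lebesgue_pow n)"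
      by (intro nn_integral_cong) (simp split: split_indicator)
    with set show ?thesis
      by (simp add: nn_integral_indicator measurable_sets[OF measurable_chart])
  qed
  with set show ?case
    by (simp add: emeasure_config_measure sets_config_measure)
next
  case (mult u c)
  have [measurable]: "(\<lambda>x. u (chart n x)) \<in> borel_measurable (lebesgue_pow n)" for n
    using mult by measurable
  show ?case using mult by (simp add: nn_integral_cmult mult.left_commute flip: ennreal_suminf_cmult)
next
  case (add u v)
  have [measurable]: "(\<lambda>x. u (chart n x)) \<in> borel_measurable (lebesgue_pow n)" "(\<lambda>x. v (chart n x)) \<in> borel_measurable (lebesgue_pow n)" for n
    using add by measurable
  show ?case using add by (simp add: nn_integral_add distrib_left suminf_add)
next
  case (seq U)
  have [measurable]: "(\<lambda>x. U i (chart n x)) \<in> borel_measurable (lebesgue_pow n)" for n i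
    using seq by measurable
  have inc: "incseq (\<lambda>i x. U i (chart n x))" for n
    using \<open>incseq U\<close> by (auto simp: incseq_def le_fun_def)
  have "integral\<^sup>N config_measure (Sup (range U)) = (\<integral>\<^sup>+\<omega>. (SUP i. U i \<omega>) \<partial>config_measure)"
    by (intro nn_integral_cong) (simp add: image_comp)
  also have "\<dots> = (SUP i. \<integral>\<^sup>+\<omega>. U i \<omega> \<partial>config_measure)"
    using seq by (intro nn_integral_monotone_convergence_SUP) auto
  \<comment> \<open>The series is an integral over the counting measure, which lets monotone
    convergence exchange it with the supremum.\<close>
  also have "\<dots> = (SUP i. \<integral>\<^sup>+n. ennreal (1 / fact n) * (\<integral>\<^sup>+x. U i (chart n x) \<partial>lebesgue_pow n) \<partial>count_space UNIV)"
    using seq by (simp add: nn_integral_count_space_nat)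
  also have "\<dots> = (\<integral>\<^sup>+n. (SUP i. ennreal (1 / fact n) * (\<integral>\<^sup>+x. U i (chart n x) \<partial>lebesgue_pow n)) \<partial>count_space UNIV)"
    using inc by (intro nn_integral_monotone_convergence_SUP[symmetric])
      (auto simp: incseq_def le_fun_def intro!: mult_left_mono nn_integral_mono)
  also have "\<dots> = (\<integral>\<^sup>+n. ennreal (1 / fact n) * (\<integral>\<^sup>+x. Sup (range U) (chart n x) \<partial>lebesgue_pow n) \<partial>count_space UNIV)"
    using inc by (intro nn_integral_cong)
      (simp add: image_comp SUP_mult_left_ennreal nn_integral_monotone_convergence_SUP)
  finally show ?case unfolding nn_integral_count_space_nat .
qed

interpretation lborel_product: product_sigma_finite "\<lambda>_ :: nat. lborel :: real measure"
  by standard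

lemma sigma_finite_lebesgue_pow: "sigma_finite_measure (lebesgue_pow n)"
  by (rule lborel_product.sigma_finite) simp

lemma nn_integral_lebesgue_pow_Suc:
  assumes [measurable]: "f \<in> borel_measurable config_measure"
  shows "(\<integral>\<^sup>+x. f (chart (Suc n) x) \<partial>lebesgue_pow (Suc n)) =
    (\<integral>\<^sup>+x. \<integral>\<^sup>+q. f (chart n x @ [q]) \<partial>lborel \<partial>lebesgue_pow n)"
proof -
  have 1: "(\<lambda>x. f (chart (Suc n) x)) \<in> borel_measurable (PiM (insert n {..<n}) (\<lambda>_. lborel))"
    using measurable_compose[OF measurable_chart assms, of "Suc n"] by (simp add: lessThan_Suc)
  show ?thesis
    using lborel_product.product_nn_integral_insert[OF _ _ 1] by (simp add: chart_fun_upd lessThan_Suc)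
qed

lemma nn_integral_lebesgue_pow_0: "(\<integral>\<^sup>+x. f (chart 0 x) \<partial>lebesgue_pow 0) = f []"
  by (simp add: chart_def product_sigma_finite.nn_integral_empty[OF lborel_product.product_sigma_finite_axioms] PiM_empty nn_integral_count_space_finite)

text \<open>The exponential vector of the one-point function c times the indicator of [-R,R]. All
  bounds below have this form: it is multiplicative under concatenation, its integral is finite for
  every c \<ge> 0, and adding a point costs at most the factor c.\<close>

definition cutoff_power :: "real \<Rightarrow> real \<Rightarrow> real list \<Rightarrow> real" where
  "cutoff_power c R \<omega> = (if set \<omega> \<subseteq> {-R..R} then c ^ length \<omega> else 0)"

lemma measurable_cutoff_power [measurable]: "cutoff_power c R \<in> borel_measurable config_measure"
  unfolding cutoff_power_def[abs_def] by measurable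

lemma cutoff_power_snoc:
  "cutoff_power c R (\<omega> @ [q]) = cutoff_power c R \<omega> * (c * indicator {-R..R} q)"
  by (auto simp: cutoff_power_def split: split_indicator)

lemma cutoff_power_nonneg: "0 \<le> c \<Longrightarrow> 0 \<le> cutoff_power c R \<omega>"
  by (simp add: cutoff_power_def)

text \<open>The layer of n points contributes (2 R c)^n / n!, so the integral is an exponential
  series.\<close>

lemma nn_integral_cutoff_power:
  assumes "0 \<le> c" "0 \<le> R"
  shows "(\<integral>\<^sup>+\<omega>. cutoff_power c R \<omega> \<partial>config_measure) = ennreal (exp (2 * R * c))"
proof -
  have *: "(\<integral>\<^sup>+x. cutoff_power c R (chart n x) \<partial>lebesgue_pow n) = ennreal ((2 * R * c) ^ n)" for n
  proof (induction n)
    case 0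
    show ?case by (subst nn_integral_lebesgue_pow_0) (simp add: cutoff_power_def)
  next
    case (Suc n)
    have "(\<integral>\<^sup>+x. cutoff_power c R (chart (Suc n) x) \<partial>lebesgue_pow (Suc n)) =
        (\<integral>\<^sup>+x. \<integral>\<^sup>+q. ennreal (cutoff_power c R (chart n x)) * (ennreal c * indicator {-R..R} q) \<partial>lborel \<partial>lebesgue_pow n)"
      using assms by (subst nn_integral_lebesgue_pow_Suc)
        (auto simp: cutoff_power_snoc ennreal_mult cutoff_power_nonneg ennreal_indicator intro!: nn_integral_cong)
    also have "\<dots> = (\<integral>\<^sup>+x. cutoff_power c R (chart n x) \<partial>lebesgue_pow n) * (ennreal c * (2 * R))"
      using assms by (simp add: nn_integral_cmult nn_integral_multc mult.assoc)
    also have "\<dots> = ennreal ((2 * R * c) ^ Suc n)"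
      using assms by (simp add: Suc ennreal_mult[symmetric] mult_ac)
    finally show ?case .
  qed
  have "(\<integral>\<^sup>+\<omega>. cutoff_power c R \<omega> \<partial>config_measure) = (\<Sum>n. ennreal ((2 * R * c) ^ n /\<^sub>R fact n))"
    using assms by (subst nn_integral_config_measure) (simp_all add: * ennreal_mult[symmetric] divide_inverse)
  also have "\<dots> = ennreal (exp (2 * R * c))"
    using assms exp_converges[of "2 * R * c"] by (intro suminf_ennreal_eq) auto
  finally show ?thesis .
qed

lemma integrable_cutoff_power [simp]:
  assumes "0 \<le> c" "0 \<le> R"
  shows "integrable config_measure (cutoff_power c R)"
  using assms by (intro integrableI_nonneg)
    (auto simp: nn_integral_cutoff_power cutoff_power_nonneg)

lemma config_bounded: "\<exists>n::nat. length \<omega> \<le> n \<and> set \<omega> \<subseteq> {- real n..real n}"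
proof -
  obtain b where b: "\<forall>q\<in>set \<omega>. \<bar>q\<bar> \<le> b"
    using finite_imp_bounded[OF finite_set[of \<omega>]] by (auto simp: bounded_iff)
  obtain m where "b \<le> real m" using real_arch_simple by blast
  with b have "set \<omega> \<subseteq> {- real (max (length \<omega>) m)..real (max (length \<omega>) m)}"
    by (fastforce simp: abs_le_iff)
  then show ?thesis by (intro exI[of _ "max (length \<omega>) m"]) simp
qed

text \<open>The configurations inside [-n,n] have measure exp(2 n), and every configuration lies in
  one of these sets.\<close>

interpretation config: sigma_finite_measure config_measure
proof
  let ?A = "\<lambda>n::nat. {\<omega>. set \<omega> \<subseteq> {- real n..real n}}"
  have "?A n \<in> sets config_measure" for n
    using pred_set_subset_config[of "{- real n..real n}"] by (simp add: pred_def)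
  moreover have "emeasure config_measure (?A n) \<noteq> \<infinity>" for n
  proof -
    have "emeasure config_measure (?A n) = (\<integral>\<^sup>+\<omega>. cutoff_power 1 n \<omega> \<partial>config_measure)"
      unfolding nn_integral_indicator[OF \<open>?A n \<in> _\<close>, symmetric]
      by (intro nn_integral_cong) (simp add: cutoff_power_def split: split_indicator)
    then show ?thesis by (simp add: nn_integral_cutoff_power)
  qed
  moreover have "(\<Union>n. ?A n) = UNIV"
    using config_bounded by fast
  ultimately show "\<exists>A. countable A \<and> A \<subseteq> sets config_measure \<and> \<Union> A = space config_measure \<and>
      (\<forall>a\<in>A. emeasure config_measure a \<noteq> \<infinity>)"
    by (intro exI[of _ "range ?A"]) auto
qed

interpretation config_lborel: pair_sigma_finite config_measure "lborel :: real measure"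
  by standard

text \<open>The empty configuration is an atom of mass one. Values at it can be read off from
  integrals, which later isolates initial data and point values of the energy form.\<close>

lemma integral_config_Nil:
  fixes f :: "'a :: {banach, second_countable_topology}"
  shows "(\<integral>\<omega>. (if \<omega> = [] then f else 0) \<partial>config_measure) = f"
    and "integrable config_measure (\<lambda>\<omega>. if \<omega> = [] then f else 0)"
proof -
  have [measurable]: "Measurable.pred config_measure (\<lambda>\<omega>. \<omega> = [])"
    unfolding length_0_conv[symmetric] by measurable
  have m: "{[]} \<in> sets config_measure"
    using \<open>Measurable.pred _ _\<close> by (simp add: pred_def)
  have "emeasure config_measure {[]} = (\<Sum>n. ennreal (1 / fact n) * (\<integral>\<^sup>+x. indicator {[]} (chart n x) \<partial>lebesgue_pow n))"
    using nn_integral_config_measure[of "indicator {[]}"] m by simp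
  also have "\<dots> = (\<Sum>n. if n = 0 then 1 else 0)"
  proof (intro suminf_cong)
    fix n
    show "ennreal (1 / fact n) * (\<integral>\<^sup>+x. indicator {[]} (chart n x) \<partial>lebesgue_pow n) = (if n = 0 then 1 else 0)"
    proof (cases n)
      case 0
      then show ?thesis using nn_integral_lebesgue_pow_0[of "indicator {[]}"] by simp
    next
      case (Suc k)
      then have "indicator {[]} (chart n x) = (0::ennreal)" for x
        using length_chart[of n x] by (auto simp del: length_chart split: split_indicator)
      with Suc show ?thesis by simp
    qed
  qed
  also have "\<dots> = 1" by (subst suminf_finite[of "{0}"]) auto
  finally have e: "emeasure config_measure {[]} = 1" .
  have eq: "(\<lambda>\<omega>. if \<omega> = [] then f else 0) = (\<lambda>\<omega>::real list. indicator {[]} \<omega> *\<^sub>R f)"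
    by (auto split: split_indicator)
  show "(\<integral>\<omega>. (if \<omega> = [] then f else 0) \<partial>config_measure) = f"
    "integrable config_measure (\<lambda>\<omega>. if \<omega> = [] then f else 0)"
    unfolding eq using m e by (simp_all add: measure_def)
qed

section \<open>Sums over the points of a configuration\<close>

text \<open>Deletion is by position and not by value, so that coinciding coordinates are counted
  separately and the sum splits over concatenations. It is the sum in the one-point sum-integral
  formula.\<close>

definition sum_delete :: "('a \<Rightarrow> 'a list \<Rightarrow> 'b :: comm_monoid_add) \<Rightarrow> 'a list \<Rightarrow> 'b" where
  "sum_delete h xs = (\<Sum>i<length xs. h (xs ! i) (take i xs @ drop (Suc i) xs))"

lemma mset_delete: "i < length xs \<Longrightarrow> mset ((take i xs @ drop (Suc i) xs) @ [xs ! i]) = mset xs"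
  by (subst (4) id_take_nth_drop[of i xs]) simp_all

lemma sum_delete_Nil [simp]: "sum_delete h [] = 0"
  by (simp add: sum_delete_def)

lemma sum_delete_append:
  fixes h :: "'a \<Rightarrow> 'a list \<Rightarrow> 'b :: comm_monoid_add"
  shows "sum_delete h (xs @ ys) =
    sum_delete (\<lambda>q xs'. h q (xs' @ ys)) xs + sum_delete (\<lambda>q ys'. h q (xs @ ys')) ys"
proof -
  have "(\<Sum>i<m + n. f i) = (\<Sum>i<m. f i) + (\<Sum>j<n. f (m + j))" for f :: "nat \<Rightarrow> 'b" and m n
    by (induction n) (simp_all add: add.assoc)
  then show ?thesis
    unfolding sum_delete_def length_append
    by (auto simp: nth_append intro!: arg_cong2[where f = "(+)"] sum.cong)
qed

lemma sum_delete_single [simp]: "sum_delete h [q] = h q []"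
  by (simp add: sum_delete_def)

lemma sum_delete_snoc: "sum_delete h (xs @ [q]) = sum_delete (\<lambda>p xs'. h p (xs' @ [q])) xs + h q xs"
  by (simp add: sum_delete_append)

lemma sum_delete_map:
  "sum_delete h (map f xs) = sum_delete (\<lambda>q xs'. h (f q) (map f xs')) xs"
  by (simp add: sum_delete_def take_map drop_map)

text \<open>About a deleted point and its remainder only \<open>mset (xs' @ [q]) = mset xs\<close>
  is remembered. For symmetric functions nothing else matters, and positions drop out of later
  arguments.\<close>

lemma sum_delete_cong:
  assumes "\<And>q xs'. mset (xs' @ [q]) = mset xs \<Longrightarrow> h q xs' = k q xs'"
  shows "sum_delete h xs = sum_delete k xs"
  unfolding sum_delete_def by (intro sum.cong refl assms mset_delete) simp

lemma sum_delete_neutral: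
  assumes "\<And>q xs'. mset (xs' @ [q]) = mset xs \<Longrightarrow> h q xs' = 0"
  shows "sum_delete h xs = 0"
  using sum_delete_cong[of xs h "\<lambda>_ _. 0"] assms by (simp add: sum_delete_def)

lemma sum_delete_add:
  "sum_delete (\<lambda>q xs'. h q xs' + k q xs') xs = sum_delete h xs + sum_delete k xs"
  by (simp add: sum_delete_def sum.distrib)

lemma sum_delete_diff:
  fixes h k :: "'a \<Rightarrow> 'a list \<Rightarrow> 'b :: ab_group_add"
  shows "sum_delete (\<lambda>q xs'. h q xs' - k q xs') xs = sum_delete h xs - sum_delete k xs"
  by (simp add: sum_delete_def sum_subtractf)

lemma sum_delete_linear:
  assumes "linear f"
  shows "f (sum_delete h xs) = sum_delete (\<lambda>q xs'. f (h q xs')) xs"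
  by (simp add: sum_delete_def linear_sum[OF assms])

lemma norm_sum_delete:
  fixes h :: "'a \<Rightarrow> 'a list \<Rightarrow> 'b :: real_normed_vector"
  shows "norm (sum_delete h xs) \<le> sum_delete (\<lambda>q xs'. norm (h q xs')) xs"
  unfolding sum_delete_def by (rule norm_sum)

lemma ennreal_sum_delete:
  assumes "\<And>q xs'. 0 \<le> h q xs'"
  shows "ennreal (sum_delete h xs) = sum_delete (\<lambda>q xs'. ennreal (h q xs')) xs"
  unfolding sum_delete_def using assms by (simp add: sum_ennreal)

lemma measurable_sum_delete [measurable (raw)]:
  fixes h :: "'m \<Rightarrow> real \<Rightarrow> real list \<Rightarrow> 'b :: {second_countable_topology, topological_comm_monoid_add}"
  assumes xs: "xs \<in> measurable M config_measure"
    and h: "(\<lambda>(m, q, \<omega>). h m q \<omega>) \<in> borel_measurable (M \<Otimes>\<^sub>M borel \<Otimes>\<^sub>M config_measure)"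
  shows "(\<lambda>m. sum_delete (h m) (xs m)) \<in> borel_measurable M"
proof (rule measurable_config_cases[OF xs, where F = "\<lambda>m. sum_delete (h m)"])
  fix fs :: "('m \<Rightarrow> real) list" assume fs: "\<And>f. f \<in> set fs \<Longrightarrow> f \<in> borel_measurable M"
  have "(\<lambda>m. \<Sum>i<length fs. h m ((fs ! i) m) (map (\<lambda>f. f m) (take i fs @ drop (Suc i) fs))) \<in> borel_measurable M"
  proof (rule borel_measurable_sum)
    fix i assume i: "i \<in> {..<length fs}"
    have [measurable]: "fs ! i \<in> borel_measurable M"
      "(\<lambda>m. map (\<lambda>f. f m) (take i fs @ drop (Suc i) fs)) \<in> measurable M config_measure"
      using fs i by (auto intro!: measurable_map_config dest!: in_set_takeD in_set_dropD simp del: map_append)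
    have "(\<lambda>m. (m, (fs ! i) m, map (\<lambda>f. f m) (take i fs @ drop (Suc i) fs)))
        \<in> measurable M (M \<Otimes>\<^sub>M borel \<Otimes>\<^sub>M config_measure)"
      by measurable
    from measurable_compose[OF this h]
    show "(\<lambda>m. h m ((fs ! i) m) (map (\<lambda>f. f m) (take i fs @ drop (Suc i) fs))) \<in> borel_measurable M"
      by simp
  qed
  also have "(\<lambda>m. \<Sum>i<length fs. h m ((fs ! i) m) (map (\<lambda>f. f m) (take i fs @ drop (Suc i) fs))) =
      (\<lambda>m. sum_delete (h m) (map (\<lambda>f. f m) fs))"
    unfolding sum_delete_def by (intro ext sum.cong) (auto simp: take_map drop_map)
  finally show "(\<lambda>m. sum_delete (h m) (map (\<lambda>f. f m) fs)) \<in> borel_measurable M" .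
qed

text \<open>Each of the n deletions has the same integral. The induction splits off the last
  coordinate: deleting it gives one copy, and the other copies come from the induction hypothesis
  for \<open>h p (\<omega> @ [q])\<close>, with q moved outside by Fubini. At n = 0 the truncated
  \<open>n - 1\<close> is harmless because of the factor n.\<close>

lemma nn_integral_sum_delete_chart:
  assumes "case_prod h \<in> borel_measurable (borel \<Otimes>\<^sub>M config_measure)"
  shows "(\<integral>\<^sup>+x. sum_delete h (chart n x) \<partial>lebesgue_pow n) =
    of_nat n * (\<integral>\<^sup>+x. \<integral>\<^sup>+q. h q (chart (n - 1) x) \<partial>lborel \<partial>lebesgue_pow (n - 1))"
  using assms
proof (induction n arbitrary: h)
  case 0
  show ?case by (simp add: chart_def)
next
  case (Suc n)
  note [measurable] = Suc.prems
  interpret P: sigma_finite_measure "lebesgue_pow n" by (rule sigma_finite_lebesgue_pow)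
  define k where "k = n - 1"
  interpret Q: sigma_finite_measure "lebesgue_pow k" by (rule sigma_finite_lebesgue_pow)
  interpret PL: pair_sigma_finite "lebesgue_pow n" "lborel :: real measure" by standard
  interpret QL: pair_sigma_finite "lebesgue_pow k" "lborel :: real measure" by standard
  let ?J = "\<integral>\<^sup>+x. \<integral>\<^sup>+q. h q (chart n x) \<partial>lborel \<partial>lebesgue_pow n"
  have "(\<integral>\<^sup>+x. sum_delete h (chart (Suc n) x) \<partial>lebesgue_pow (Suc n)) =
      (\<integral>\<^sup>+x. (\<integral>\<^sup>+q. sum_delete (\<lambda>p \<omega>. h p (\<omega> @ [q])) (chart n x) \<partial>lborel) +
        (\<integral>\<^sup>+q. h q (chart n x) \<partial>lborel) \<partial>lebesgue_pow n)"
    by (subst nn_integral_lebesgue_pow_Suc) (simp_all add: sum_delete_snoc nn_integral_add)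
  also have "\<dots> = (\<integral>\<^sup>+x. \<integral>\<^sup>+q. sum_delete (\<lambda>p \<omega>. h p (\<omega> @ [q])) (chart n x) \<partial>lborel \<partial>lebesgue_pow n) + ?J"
    by (rule nn_integral_add) simp_all
  also have "(\<integral>\<^sup>+x. \<integral>\<^sup>+q. sum_delete (\<lambda>p \<omega>. h p (\<omega> @ [q])) (chart n x) \<partial>lborel \<partial>lebesgue_pow n) =
      (\<integral>\<^sup>+q. \<integral>\<^sup>+x. sum_delete (\<lambda>p \<omega>. h p (\<omega> @ [q])) (chart n x) \<partial>lebesgue_pow n \<partial>lborel)"
    by (rule PL.Fubini'[symmetric]) simp
  also have "\<dots> = (\<integral>\<^sup>+q. of_nat n * (\<integral>\<^sup>+x. \<integral>\<^sup>+p. h p (chart k x @ [q]) \<partial>lborel \<partial>lebesgue_pow k) \<partial>lborel)"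
    unfolding k_def by (intro nn_integral_cong Suc.IH) measurable
  also have "\<dots> = of_nat n * (\<integral>\<^sup>+q. \<integral>\<^sup>+x. \<integral>\<^sup>+p. h p (chart k x @ [q]) \<partial>lborel \<partial>lebesgue_pow k \<partial>lborel)"
    by (rule nn_integral_cmult) measurable
  also have "\<dots> = of_nat n * (\<integral>\<^sup>+x. \<integral>\<^sup>+q. \<integral>\<^sup>+p. h p (chart k x @ [q]) \<partial>lborel \<partial>lborel \<partial>lebesgue_pow k)"
    by (subst QL.Fubini') simp_all
  also have "\<dots> = of_nat n * ?J"
  proof (cases n)
    case (Suc l)
    then show ?thesis
      using nn_integral_lebesgue_pow_Suc[of "\<lambda>\<omega>. \<integral>\<^sup>+p. h p \<omega> \<partial>lborel" k] by (simp add: k_def)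
  qed simp
  finally show ?case by (simp add: distrib_right add.commute)
qed

text \<open>The one-point case of the sum-integral formula: n equal deletions turn 1/n! into
  1/(n-1)!, the weight of the layer with one point fewer.\<close>

lemma nn_integral_sum_delete:
  assumes [measurable]: "case_prod h \<in> borel_measurable (borel \<Otimes>\<^sub>M config_measure)"
  shows "(\<integral>\<^sup>+\<omega>. sum_delete h \<omega> \<partial>config_measure) = (\<integral>\<^sup>+\<omega>. \<integral>\<^sup>+q. h q \<omega> \<partial>lborel \<partial>config_measure)"
proof -
  let ?J = "\<lambda>n. \<integral>\<^sup>+x. \<integral>\<^sup>+q. h q (chart n x) \<partial>lborel \<partial>lebesgue_pow n"
  let ?S = "\<lambda>n. ennreal (1 / fact n) * (of_nat n * ?J (n - 1))"
  have *: "?S (Suc n) = ennreal (1 / fact n) * ?J n" for n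
  proof -
    have "ennreal (1 / fact (Suc n)) * of_nat (Suc n) = ennreal (1 / fact n)"
      by (simp add: ennreal_of_nat_eq_real_of_nat ennreal_mult[symmetric] del: of_nat_Suc)
    then show ?thesis by (simp add: mult.assoc[symmetric] del: of_nat_Suc)
  qed
  \<comment> \<open>The term n = 0 carries the factor 0, so the series may be shifted by
    one.\<close>
  have "(\<lambda>n. ?S (Suc n)) sums (\<Sum>n. ?S (Suc n))"
    by (rule summable_sums) simp
  from sums_unique[OF sums_Suc[OF this]] have "(\<Sum>n. ?S n) = (\<Sum>n. ?S (Suc n))"
    by simp
  moreover have "(\<integral>\<^sup>+\<omega>. sum_delete h \<omega> \<partial>config_measure) = (\<Sum>n. ?S n)"
    by (subst nn_integral_config_measure) (simp_all add: nn_integral_sum_delete_chart[OF assms])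
  moreover have "(\<integral>\<^sup>+\<omega>. \<integral>\<^sup>+q. h q \<omega> \<partial>lborel \<partial>config_measure) = (\<Sum>n. ?S (Suc n))"
    unfolding * by (subst nn_integral_config_measure) simp_all
  ultimately show ?thesis by simp
qed

text \<open>The nonnegative case is \<open>nn_integral_sum_delete\<close>. Since
  \<open>sum_delete\<close> is linear in h, real functions follow from positive and negative parts,
  and vector functions from their inner products with each fixed y.\<close>

lemma
  fixes h :: "real \<Rightarrow> real list \<Rightarrow> 'a :: {banach, second_countable_topology, real_inner}"
  assumes h: "integrable (config_measure \<Otimes>\<^sub>M lborel) (\<lambda>(\<omega>, q). h q \<omega>)"
  shows integrable_sum_delete: "integrable config_measure (sum_delete h)"
    and integral_sum_delete: "(\<integral>\<omega>. sum_delete h \<omega> \<partial>config_measure) = (\<integral>(\<omega>, q). h q \<omega> \<partial>(config_measure \<Otimes>\<^sub>M lborel))"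
proof -
  have I: "integrable config_measure (sum_delete h)"
    if h: "integrable (config_measure \<Otimes>\<^sub>M lborel) (\<lambda>(\<omega>, q). h q \<omega>)"
    for h :: "real \<Rightarrow> real list \<Rightarrow> 'b :: {banach, second_countable_topology, real_inner}"
  proof (rule integrableI_bounded)
    have [measurable]: "(\<lambda>(\<omega>, q). h q \<omega>) \<in> borel_measurable (config_measure \<Otimes>\<^sub>M lborel)"
      using h by auto
    show "sum_delete h \<in> borel_measurable config_measure" by measurable
    have "(\<integral>\<^sup>+\<omega>. norm (sum_delete h \<omega>) \<partial>config_measure) \<le> (\<integral>\<^sup>+\<omega>. sum_delete (\<lambda>q \<omega>'. ennreal (norm (h q \<omega>'))) \<omega> \<partial>config_measure)"
      by (intro nn_integral_mono) (simp add: ennreal_sum_delete[symmetric] norm_sum_delete ennreal_leI)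
    also have "\<dots> = (\<integral>\<^sup>+\<omega>. \<integral>\<^sup>+q. norm (h q \<omega>) \<partial>lborel \<partial>config_measure)"
      by (rule nn_integral_sum_delete) measurable
    also have "\<dots> = (\<integral>\<^sup>+z. norm (case z of (\<omega>, q) \<Rightarrow> h q \<omega>) \<partial>(config_measure \<Otimes>\<^sub>M lborel))"
      using lborel.nn_integral_fst[OF measurable_compose[OF borel_measurable_integrable[OF h],
        of "\<lambda>x. ennreal (norm x)"]] by simp
    also have "\<dots> < \<infinity>" using h by (simp add: integrable_iff_bounded)
    finally show "(\<integral>\<^sup>+\<omega>. norm (sum_delete h \<omega>) \<partial>config_measure) < \<infinity>" .
  qed
  then show "integrable config_measure (sum_delete h)" using h .
  have pos: "(\<integral>\<omega>. sum_delete h \<omega> \<partial>config_measure) = (\<integral>(\<omega>, q). h q \<omega> \<partial>(config_measure \<Otimes>\<^sub>M lborel))"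
    if h: "integrable (config_measure \<Otimes>\<^sub>M lborel) (\<lambda>(\<omega>, q). h q \<omega>)" and nn: "\<And>q \<omega>. 0 \<le> h q \<omega>"
    for h :: "real \<Rightarrow> real list \<Rightarrow> real"
  proof -
    have [measurable]: "(\<lambda>(\<omega>, q). h q \<omega>) \<in> borel_measurable (config_measure \<Otimes>\<^sub>M lborel)"
      using h by auto
    have nn2: "0 \<le> sum_delete h \<omega>" for \<omega>
      unfolding sum_delete_def by (intro sum_nonneg nn)
    have "ennreal (\<integral>\<omega>. sum_delete h \<omega> \<partial>config_measure) = (\<integral>\<^sup>+\<omega>. sum_delete h \<omega> \<partial>config_measure)"
      using I[OF h] nn2 by (intro nn_integral_eq_integral[symmetric]) auto
    also have "\<dots> = (\<integral>\<^sup>+\<omega>. \<integral>\<^sup>+q. h q \<omega> \<partial>lborel \<partial>config_measure)"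
      unfolding ennreal_sum_delete[of h, OF nn] by (rule nn_integral_sum_delete) measurable
    also have "\<dots> = (\<integral>\<^sup>+z. (case z of (\<omega>, q) \<Rightarrow> h q \<omega>) \<partial>(config_measure \<Otimes>\<^sub>M lborel))"
      using lborel.nn_integral_fst[OF measurable_compose[OF borel_measurable_integrable[OF h], of ennreal]]
      by simp
    also have "\<dots> = ennreal (\<integral>(\<omega>, q). h q \<omega> \<partial>(config_measure \<Otimes>\<^sub>M lborel))"
      using nn by (intro nn_integral_eq_integral h) auto
    finally have "ennreal (\<integral>\<omega>. sum_delete h \<omega> \<partial>config_measure) =
        ennreal (\<integral>(\<omega>, q). h q \<omega> \<partial>(config_measure \<Otimes>\<^sub>M lborel))" .
    then show ?thesis
      using nn nn2 by (subst (asm) ennreal_inj) (auto intro!: Bochner_Integration.integral_nonneg)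
  qed
  have real: "(\<integral>\<omega>. sum_delete h \<omega> \<partial>config_measure) = (\<integral>(\<omega>, q). h q \<omega> \<partial>(config_measure \<Otimes>\<^sub>M lborel))"
    if h: "integrable (config_measure \<Otimes>\<^sub>M lborel) (\<lambda>(\<omega>, q). h q \<omega>)"
    for h :: "real \<Rightarrow> real list \<Rightarrow> real"
  proof -
    let ?p = "\<lambda>q \<omega>. max 0 (h q \<omega>)" and ?n = "\<lambda>q \<omega>. max 0 (- h q \<omega>)"
    have ip: "integrable (config_measure \<Otimes>\<^sub>M lborel) (\<lambda>(\<omega>, q). ?p q \<omega>)"
      using integrable_max[OF integrable_zero h] by (simp add: case_prod_unfold)
    have "integrable (config_measure \<Otimes>\<^sub>M lborel) (\<lambda>z. max 0 (- (case z of (\<omega>, q) \<Rightarrow> h q \<omega>)))"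
      using h by (intro integrable_max) auto
    then have im: "integrable (config_measure \<Otimes>\<^sub>M lborel) (\<lambda>(\<omega>, q). ?n q \<omega>)"
      by (simp add: case_prod_unfold)
    have eq: "h = (\<lambda>q \<omega>. ?p q \<omega> - ?n q \<omega>)" by (auto simp: fun_eq_iff)
    have "sum_delete h \<omega> = sum_delete ?p \<omega> - sum_delete ?n \<omega>" for \<omega>
      by (rule trans[OF arg_cong[OF eq, of "\<lambda>h. sum_delete h \<omega>"] sum_delete_diff])
    then have "(\<integral>\<omega>. sum_delete h \<omega> \<partial>config_measure) = (\<integral>\<omega>. sum_delete ?p \<omega> - sum_delete ?n \<omega> \<partial>config_measure)"
      by simp
    also have "\<dots> = (\<integral>(\<omega>, q). ?p q \<omega> \<partial>(config_measure \<Otimes>\<^sub>M lborel)) - (\<integral>(\<omega>, q). ?n q \<omega> \<partial>(config_measure \<Otimes>\<^sub>M lborel))"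
      using I[OF ip] I[OF im] pos[OF ip] pos[OF im] by simp
    also have "\<dots> = (\<integral>z. (case z of (\<omega>, q) \<Rightarrow> ?p q \<omega>) - (case z of (\<omega>, q) \<Rightarrow> ?n q \<omega>) \<partial>(config_measure \<Otimes>\<^sub>M lborel))"
      by (rule Bochner_Integration.integral_diff[OF ip im, symmetric])
    also have "\<dots> = (\<integral>(\<omega>, q). h q \<omega> \<partial>(config_measure \<Otimes>\<^sub>M lborel))"
      by (intro Bochner_Integration.integral_cong) auto
    finally show ?thesis .
  qed
  have "(\<integral>\<omega>. sum_delete h \<omega> \<partial>config_measure) \<bullet> y = (\<integral>(\<omega>, q). h q \<omega> \<partial>(config_measure \<Otimes>\<^sub>M lborel)) \<bullet> y" for y
  proof -
    have hy: "integrable (config_measure \<Otimes>\<^sub>M lborel) (\<lambda>(\<omega>, q). h q \<omega> \<bullet> y)"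
      using integrable_inner_left[of y, OF h] by (simp add: case_prod_unfold)
    have "(\<integral>\<omega>. sum_delete h \<omega> \<partial>config_measure) \<bullet> y = (\<integral>\<omega>. sum_delete h \<omega> \<bullet> y \<partial>config_measure)"
      using I[OF h] by (simp add: integral_inner_left)
    also have "\<dots> = (\<integral>\<omega>. sum_delete (\<lambda>q \<omega>'. h q \<omega>' \<bullet> y) \<omega> \<partial>config_measure)"
      by (simp add: sum_delete_def inner_sum_left)
    also have "\<dots> = (\<integral>(\<omega>, q). h q \<omega> \<bullet> y \<partial>(config_measure \<Otimes>\<^sub>M lborel))"
      by (rule real[OF hy])
    also have "\<dots> = (\<integral>z. (case z of (\<omega>, q) \<Rightarrow> h q \<omega>) \<bullet> y \<partial>(config_measure \<Otimes>\<^sub>M lborel))"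
      by (simp add: case_prod_unfold)
    also have "\<dots> = (\<integral>(\<omega>, q). h q \<omega> \<partial>(config_measure \<Otimes>\<^sub>M lborel)) \<bullet> y"
      using h by (intro integral_inner_left)
    finally show ?thesis .
  qed
  then show "(\<integral>\<omega>. sum_delete h \<omega> \<partial>config_measure) = (\<integral>(\<omega>, q). h q \<omega> \<partial>(config_measure \<Otimes>\<^sub>M lborel))"
    using vector_eq_rdot by blast
qed

section \<open>Distinct configurations and reflection of time\<close>

lemma pred_distinct_config [measurable]: "Measurable.pred config_measure distinct"
proof (rule measurable_config_cases[where F = "\<lambda>_. distinct" and h = "\<lambda>\<omega>. \<omega>"])
  fix fs :: "(real list \<Rightarrow> real) list" assume fs: "\<And>f. f \<in> set fs \<Longrightarrow> f \<in> borel_measurable config_measure"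
  have "Measurable.pred config_measure (\<lambda>m. (fs ! i) m = (fs ! j) m)" if "i < length fs" "j < length fs" for i j
    using fs[OF nth_mem[OF that(1)]] fs[OF nth_mem[OF that(2)]] by measurable
  then have ne: "Measurable.pred config_measure (\<lambda>m. i \<noteq> j \<longrightarrow> (fs ! i) m \<noteq> (fs ! j) m)"
    if "i < length fs" "j < length fs" for i j
    using that by (cases "i = j") simp_all
  have "Measurable.pred config_measure (\<lambda>m. \<forall>i\<in>{..<length fs}. \<forall>j\<in>{..<length fs}. i \<noteq> j \<longrightarrow> (fs ! i) m \<noteq> (fs ! j) m)"
    by (intro pred_intros_finite finite_lessThan ne) simp_all
  moreover have "distinct (map (\<lambda>f. f m) fs) \<longleftrightarrow>
      (\<forall>i\<in>{..<length fs}. \<forall>j\<in>{..<length fs}. i \<noteq> j \<longrightarrow> (fs ! i) m \<noteq> (fs ! j) m)" for m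
    by (auto simp: distinct_conv_nth)
  ultimately show "Measurable.pred config_measure (\<lambda>m. distinct (map (\<lambda>f. f m) fs))"
    by (simp only:)
qed simp

lemma pred_member_config [measurable (raw)]:
  assumes [measurable]: "q \<in> borel_measurable M" and w: "w \<in> measurable M config_measure"
  shows "Measurable.pred M (\<lambda>m. q m \<in> set (w m))"
proof (rule measurable_config_cases[OF w, where F = "\<lambda>m \<omega>. q m \<in> set \<omega>"])
  fix fs :: "(_ \<Rightarrow> real) list" assume fs: "\<And>f. f \<in> set fs \<Longrightarrow> f \<in> borel_measurable M"
  have "Measurable.pred M (\<lambda>m. q m = f m)" if "f \<in> set fs" for f
    using fs[OF that] by measurable
  then have "Measurable.pred M (\<lambda>m. \<exists>f\<in>set fs. q m = f m)"
    by (intro pred_intros_finite finite_set)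
  then show "Measurable.pred M (\<lambda>m. q m \<in> set (map (\<lambda>f. f m) fs))"
    by (simp add: image_iff)
qed

text \<open>A configuration with a repetition has a point that still lies in the remainder after its
  deletion. The sum-integral formula turns the count of such points into the Lebesgue measure of the
  finite set of remaining points, which is zero.\<close>

lemma AE_distinct_config: "AE \<omega> in config_measure. distinct \<omega>"
proof -
  have *: "indicator {\<omega>. \<not> distinct \<omega>} \<omega> \<le> sum_delete (\<lambda>q \<omega>'. indicator {(q, \<omega>'). q \<in> set \<omega>'} (q, \<omega>') :: ennreal) \<omega>" for \<omega> :: "real list"
  proof (cases "distinct \<omega>")
    case False
    then obtain i j where ij: "i < j" "j < length \<omega>" "\<omega> ! i = \<omega> ! j"
      by (metis distinct_conv_nth linorder_neqE_nat)
    then have "\<omega> ! i \<in> set (drop (Suc i) \<omega>)"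
      by (auto simp: in_set_conv_nth intro!: exI[of _ "j - Suc i"])
    then have "1 \<le> (indicator {(q, \<omega>'). q \<in> set \<omega>'} (\<omega> ! i, take i \<omega> @ drop (Suc i) \<omega>) :: ennreal)"
      by simp
    also have "\<dots> \<le> sum_delete (\<lambda>q \<omega>'. indicator {(q, \<omega>'). q \<in> set \<omega>'} (q, \<omega>') :: ennreal) \<omega>"
      unfolding sum_delete_def using ij by (intro member_le_sum) auto
    finally show ?thesis by (simp add: indicator_def)
  qed simp
  have [measurable]: "{\<omega>. \<not> distinct \<omega>} \<in> sets config_measure"
  proof -
    have "{\<omega> \<in> space config_measure. \<not> distinct \<omega>} \<in> sets config_measure" by measurable
    then show ?thesis by simp
  qed
  have "emeasure config_measure {\<omega>. \<not> distinct \<omega>} = (\<integral>\<^sup>+\<omega>. indicator {\<omega>. \<not> distinct \<omega>} \<omega> \<partial>config_measure)"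
    by simp
  also have "\<dots> \<le> (\<integral>\<^sup>+\<omega>. sum_delete (\<lambda>q \<omega>'. indicator {(q, \<omega>'). q \<in> set \<omega>'} (q, \<omega>')) \<omega> \<partial>config_measure)"
    by (intro nn_integral_mono *)
  also have "\<dots> = (\<integral>\<^sup>+\<omega>. \<integral>\<^sup>+q. indicator (set \<omega>) q \<partial>lborel \<partial>config_measure)"
    by (subst nn_integral_sum_delete) (auto simp: case_prod_unfold indicator_def intro!: nn_integral_cong)
  also have "\<dots> = 0"
  proof -
    have "integral\<^sup>N lborel (indicator (set \<omega>)) = 0" for \<omega> :: "real list"
      by (subst nn_integral_indicator)
        (simp_all add: emeasure_lborel_countable countable_finite finite_imp_closed borel_closed)
    then show ?thesis by simp
  qed
  finally show ?thesis
    by (intro AE_I'[of "{\<omega>. \<not> distinct \<omega>}"]) (auto simp: null_sets_def)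
qed

text \<open>Each coordinate is reflected separately, and Lebesgue measure on the line is invariant.
  This lets time reversal exchange forward and backward evolutions without changing norms.\<close>

lemma nn_integral_config_uminus:
  assumes [measurable]: "f \<in> borel_measurable config_measure"
  shows "(\<integral>\<^sup>+\<omega>. f (map uminus \<omega>) \<partial>config_measure) = (\<integral>\<^sup>+\<omega>. f \<omega> \<partial>config_measure)"
proof -
  note [measurable] = measurable_map_real_config[of uminus, simplified]
  have "(\<integral>\<^sup>+x. f (map uminus (chart n x)) \<partial>lebesgue_pow n) = (\<integral>\<^sup>+x. f (chart n x) \<partial>lebesgue_pow n)"
    if "f \<in> borel_measurable config_measure" for n and f :: "real list \<Rightarrow> ennreal"
    using that
  proof (induction n arbitrary: f)
    case 0
    show ?case by (simp add: chart_def)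
  next
    case (Suc n)
    note [measurable] = Suc.prems
    have "(\<integral>\<^sup>+x. f (map uminus (chart (Suc n) x)) \<partial>lebesgue_pow (Suc n)) =
        (\<integral>\<^sup>+x. \<integral>\<^sup>+q. f (map uminus (chart n x) @ [- q]) \<partial>lborel \<partial>lebesgue_pow n)"
      by (subst nn_integral_lebesgue_pow_Suc[of "\<lambda>\<omega>. f (map uminus \<omega>)"]) simp_all
    also have "\<dots> = (\<integral>\<^sup>+x. \<integral>\<^sup>+q. f (map uminus (chart n x) @ [q]) \<partial>lborel \<partial>lebesgue_pow n)"
    proof (rule nn_integral_cong)
      fix x
      show "(\<integral>\<^sup>+q. f (map uminus (chart n x) @ [- q]) \<partial>lborel) = (\<integral>\<^sup>+q. f (map uminus (chart n x) @ [q]) \<partial>lborel)"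
        by (subst (2) nn_integral_real_affine[where c = "-1" and t = 0]) simp_all
    qed
    also have "\<dots> = (\<integral>\<^sup>+x. \<integral>\<^sup>+q. f (chart n x @ [q]) \<partial>lborel \<partial>lebesgue_pow n)"
      by (rule Suc.IH[of "\<lambda>\<omega>. \<integral>\<^sup>+q. f (\<omega> @ [q]) \<partial>lborel"]) measurable
    finally show ?case by (simp add: nn_integral_lebesgue_pow_Suc)
  qed
  then show ?thesis by (simp add: nn_integral_config_measure)
qed

lemma distr_config_uminus: "distr config_measure config_measure (map uminus) = config_measure"
proof (rule measure_eqI)
  note [measurable] = measurable_map_real_config[of uminus, simplified]
  fix A assume "A \<in> sets (distr config_measure config_measure (map uminus))"
  then have [measurable]: "A \<in> sets config_measure" by simp
  have "emeasure (distr config_measure config_measure (map uminus)) A =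
      (\<integral>\<^sup>+\<omega>. indicator A \<omega> \<partial>distr config_measure config_measure (map uminus))" by simp
  also have "\<dots> = (\<integral>\<^sup>+\<omega>. indicator A (map uminus \<omega>) \<partial>config_measure)"
    by (rule nn_integral_distr) measurable
  also have "\<dots> = emeasure config_measure A"
    by (subst nn_integral_config_uminus) simp_all
  finally show "emeasure (distr config_measure config_measure (map uminus)) A = emeasure config_measure A" .
qed simp

section \<open>Evolutions\<close>

lemma measurable_blinfun_apply [measurable (raw)]:
  fixes A :: "'a :: real_normed_vector \<Rightarrow>\<^sub>L 'b :: real_normed_vector"
  assumes "f \<in> borel_measurable M"
  shows "(\<lambda>x. blinfun_apply A (f x)) \<in> borel_measurable M"
  by (rule borel_measurable_continuous_on[OF _ assms]) (intro continuous_intros)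

lemma integrable_pair_product:
  fixes f g :: "real \<Rightarrow> real"
  assumes f: "integrable lborel f" and g: "integrable lborel g"
  shows "integrable (lborel \<Otimes>\<^sub>M lborel) (\<lambda>(q, p). f q * g p)"
proof (rule lborel_pair.Fubini_integrable)
  have [measurable]: "f \<in> borel_measurable lborel" "g \<in> borel_measurable lborel"
    using assms by auto
  show "(\<lambda>(q, p). f q * g p) \<in> borel_measurable (lborel \<Otimes>\<^sub>M lborel)" by measurable
  show "integrable lborel (\<lambda>q. \<integral>p. norm (case (q, p) of (q, p) \<Rightarrow> f q * g p) \<partial>lborel)"
    using f g by (simp add: abs_mult)
  show "AE q in lborel. integrable lborel (\<lambda>p. case (q, p) of (q, p) \<Rightarrow> f q * g p)"
    using g by simp
qed

section \<open>Integration by parts for paths with jumps\<close>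

text \<open>The product rule for G \<bullet> H, integrated over the whole line. G has increments a
  and jumps b, H has increments -a' and jumps -b'. Both sums use strict inequalities, so at a jump G
  takes its left and H its right limit; the jump of the product is then b \<bullet> H - G \<bullet>
  b', with no term b \<bullet> b' at coinciding times. Several indices may share one time.\<close>

lemma
  fixes a a' :: "real \<Rightarrow> 'k :: {banach, second_countable_topology, real_inner}"
    and g h :: 'k and p :: "'i \<Rightarrow> real" and b b' :: "'i \<Rightarrow> 'k"
  assumes "finite J" and a: "integrable lborel a" and a': "integrable lborel a'"
  defines "G \<equiv> \<lambda>r. g + (\<integral>q. indicator {..<r} q *\<^sub>R a q \<partial>lborel) + (\<Sum>i\<in>J. if p i < r then b i else 0)"
    and "H \<equiv> \<lambda>r. h + (\<integral>q. indicator {r<..} q *\<^sub>R a' q \<partial>lborel) + (\<Sum>i\<in>J. if r < p i then b' i else 0)"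
  shows integrable_jump_parts: "integrable lborel (\<lambda>q. a q \<bullet> H q - G q \<bullet> a' q)"
    and integral_jump_parts:
      "(g + (\<integral>q. a q \<partial>lborel) + sum b J) \<bullet> h - g \<bullet> (h + (\<integral>q. a' q \<partial>lborel) + sum b' J) =
        (\<integral>q. a q \<bullet> H q - G q \<bullet> a' q \<partial>lborel) + (\<Sum>i\<in>J. b i \<bullet> H (p i) - G (p i) \<bullet> b' i)"
proof -
  have [measurable]: "a \<in> borel_measurable lborel" "a' \<in> borel_measurable lborel"
    using a a' by auto
  let ?f = "\<lambda>q p. indicator {q<..} p * (a q \<bullet> a' p) :: real"
  have F: "integrable (lborel \<Otimes>\<^sub>M lborel) (\<lambda>(q, p). ?f q p)"
  proof (rule Bochner_Integration.integrable_bound)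
    show "integrable (lborel \<Otimes>\<^sub>M lborel) (\<lambda>(q, p). norm (a q) * norm (a' p))"
      using a a' by (intro integrable_pair_product integrable_norm)
    have eq: "(\<lambda>(q, p). ?f q p) = (\<lambda>(q, p). if q < p then a q \<bullet> a' p else 0)"
      by (auto simp: fun_eq_iff indicator_def)
    show "(\<lambda>(q, p). ?f q p) \<in> borel_measurable (lborel \<Otimes>\<^sub>M lborel)"
      unfolding eq by measurable
    show "AE z in lborel \<Otimes>\<^sub>M lborel. norm (case z of (q, p) \<Rightarrow> ?f q p) \<le> norm (case z of (q, p) \<Rightarrow> norm (a q) * norm (a' p))"
      by (auto simp: indicator_def Cauchy_Schwarz_ineq2)
  qed
  have ia: "integrable lborel (\<lambda>q. indicator S q *\<^sub>R a q)" and ia': "integrable lborel (\<lambda>q. indicator S q *\<^sub>R a' q)"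
    if "S \<in> sets borel" for S
    using that a a' by (auto intro: integrable_mult_indicator)
  have e1: "a q \<bullet> (\<integral>p. indicator {q<..} p *\<^sub>R a' p \<partial>lborel) = (\<integral>p. ?f q p \<partial>lborel)" for q
    by (subst integral_inner_right[symmetric]) (simp_all add: ia')
  have e2: "(\<integral>q. indicator {..<p} q *\<^sub>R a q \<partial>lborel) \<bullet> a' p = (\<integral>q. ?f q p \<partial>lborel)" for p
  proof -
    have "(\<integral>q. indicator {..<p} q *\<^sub>R a q \<partial>lborel) \<bullet> a' p = (\<integral>q. (indicator {..<p} q *\<^sub>R a q) \<bullet> a' p \<partial>lborel)"
      by (subst integral_inner_left[symmetric]) (simp_all add: ia)
    also have "\<dots> = (\<integral>q. ?f q p \<partial>lborel)"
      by (intro Bochner_Integration.integral_cong) (auto simp: indicator_def)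
    finally show ?thesis .
  qed
  have e3: "a q \<bullet> (\<Sum>i\<in>J. if q < p i then b' i else 0) = (\<Sum>i\<in>J. (indicator {..<p i} q *\<^sub>R a q) \<bullet> b' i)" for q
    by (simp add: inner_sum_right indicator_def if_distrib cong: if_cong)
      (intro sum.cong, auto)
  have e4: "(\<Sum>i\<in>J. if p i < q then b i else 0) \<bullet> a' q = (\<Sum>i\<in>J. b i \<bullet> (indicator {p i<..} q *\<^sub>R a' q))" for q
    by (simp add: inner_sum_left indicator_def if_distrib cong: if_cong)
      (intro sum.cong, auto)
  have i1: "integrable lborel (\<lambda>q. \<integral>p. ?f q p \<partial>lborel)" and i2: "integrable lborel (\<lambda>p. \<integral>q. ?f q p \<partial>lborel)"
    using lborel_pair.integrable_fst[OF F] lborel_pair.integrable_snd[OF F] by auto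
  have fub: "(\<integral>q. (\<integral>p. ?f q p \<partial>lborel) \<partial>lborel) = (\<integral>p. (\<integral>q. ?f q p \<partial>lborel) \<partial>lborel)"
    using lborel_pair.integral_fst[OF F] lborel_pair.integral_snd[OF F] by simp
  have ah: "a q \<bullet> H q = a q \<bullet> h + (\<integral>p. ?f q p \<partial>lborel) + (\<Sum>i\<in>J. (indicator {..<p i} q *\<^sub>R a q) \<bullet> b' i)" for q
    unfolding H_def inner_add_right e1 e3 ..
  have ga: "G q \<bullet> a' q = g \<bullet> a' q + (\<integral>p. ?f p q \<partial>lborel) + (\<Sum>i\<in>J. b i \<bullet> (indicator {p i<..} q *\<^sub>R a' q))" for q
    unfolding G_def inner_add_left e2 e4 ..
  have I1: "integrable lborel (\<lambda>q. a q \<bullet> h)" "\<And>i. integrable lborel (\<lambda>q. (indicator {..<p i} q *\<^sub>R a q) \<bullet> b' i)"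
    "integrable lborel (\<lambda>q. g \<bullet> a' q)" "\<And>i. integrable lborel (\<lambda>q. b i \<bullet> (indicator {p i<..} q *\<^sub>R a' q))"
    using a a' ia ia' by (auto intro!: integrable_inner_left integrable_inner_right simp del: inner_scaleR_left inner_scaleR_right)
  have J1: "integrable lborel (\<lambda>q. a q \<bullet> H q)" and J2: "integrable lborel (\<lambda>q. G q \<bullet> a' q)"
    unfolding ah ga using I1 i1 i2 by (auto simp del: inner_scaleR_left inner_scaleR_right)
  then show "integrable lborel (\<lambda>q. a q \<bullet> H q - G q \<bullet> a' q)" by simp
  have K1: "(\<integral>q. a q \<bullet> H q \<partial>lborel) = (\<integral>q. a q \<partial>lborel) \<bullet> h + (\<integral>q. (\<integral>p. ?f q p \<partial>lborel) \<partial>lborel) +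
      (\<Sum>i\<in>J. (\<integral>q. indicator {..<p i} q *\<^sub>R a q \<partial>lborel) \<bullet> b' i)"
  proof -
    have "(\<integral>q. (indicator {..<p i} q *\<^sub>R a q) \<bullet> b' i \<partial>lborel) = (\<integral>q. indicator {..<p i} q *\<^sub>R a q \<partial>lborel) \<bullet> b' i" for i
      by (rule integral_inner_left) (simp add: ia)
    with a show ?thesis unfolding ah using I1 i1
      by (simp add: integral_inner_left del: inner_scaleR_left inner_scaleR_right)
  qed
  have K2: "(\<integral>q. G q \<bullet> a' q \<partial>lborel) = g \<bullet> (\<integral>q. a' q \<partial>lborel) + (\<integral>q. (\<integral>p. ?f p q \<partial>lborel) \<partial>lborel) +
      (\<Sum>i\<in>J. b i \<bullet> (\<integral>q. indicator {p i<..} q *\<^sub>R a' q \<partial>lborel))"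
  proof -
    have "(\<integral>q. b i \<bullet> (indicator {p i<..} q *\<^sub>R a' q) \<partial>lborel) = b i \<bullet> (\<integral>q. indicator {p i<..} q *\<^sub>R a' q \<partial>lborel)" for i
      by (rule integral_inner_right) (simp add: ia')
    with a' show ?thesis unfolding ga using I1 i2
      by (simp add: integral_inner_right del: inner_scaleR_left inner_scaleR_right)
  qed
  have S: "(\<Sum>i\<in>J. b i \<bullet> H (p i) - G (p i) \<bullet> b' i) = sum b J \<bullet> h - g \<bullet> sum b' J +
      (\<Sum>i\<in>J. b i \<bullet> (\<integral>q. indicator {p i<..} q *\<^sub>R a' q \<partial>lborel)) - (\<Sum>i\<in>J. (\<integral>q. indicator {..<p i} q *\<^sub>R a q \<partial>lborel) \<bullet> b' i) +
      ((\<Sum>i\<in>J. \<Sum>j\<in>J. if p i < p j then b i \<bullet> b' j else 0) - (\<Sum>i\<in>J. \<Sum>j\<in>J. if p j < p i then b j \<bullet> b' i else 0))"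
    unfolding G_def H_def
    by (simp add: inner_add_left inner_add_right inner_sum_left inner_sum_right sum.distrib sum_subtractf if_distrib
      [where f = "\<lambda>x. x \<bullet> _"] if_distrib[where f = "\<lambda>x. _ \<bullet> x"] cong: if_cong)
  \<comment> \<open>A pair of jumps with \<open>p i < p j\<close> is seen by H at \<open>p i\<close>
    and by G at \<open>p j\<close>, with opposite signs. The equation \<open>fub\<close> does the
    same for pairs of times in the integrals.\<close>
  also have "(\<Sum>i\<in>J. \<Sum>j\<in>J. if p j < p i then b j \<bullet> b' i else 0) = (\<Sum>i\<in>J. \<Sum>j\<in>J. if p i < p j then b i \<bullet> b' j else 0)"
    by (rule sum.swap)
  finally show "(g + (\<integral>q. a q \<partial>lborel) + sum b J) \<bullet> h - g \<bullet> (h + (\<integral>q. a' q \<partial>lborel) + sum b' J) =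
        (\<integral>q. a q \<bullet> H q - G q \<bullet> a' q \<partial>lborel) + (\<Sum>i\<in>J. b i \<bullet> H (p i) - G (p i) \<bullet> b' i)"
    using J1 J2 by (simp add: K1 K2 fub inner_add_left inner_add_right)
qed

section \<open>Paths dominated by an exponential on a box\<close>

lemma cutoff_power_snoc_le:
  assumes "0 \<le> c" shows "cutoff_power c R (\<omega> @ [q]) \<le> c * cutoff_power c R \<omega>"
  using assms by (auto simp: cutoff_power_snoc cutoff_power_nonneg mult.commute split: split_indicator)

lemma cutoff_power_mono:
  assumes "0 \<le> c" "c \<le> c'" "R \<le> R'" shows "cutoff_power c R \<omega> \<le> cutoff_power c' R' \<omega>"
  using assms by (auto simp: cutoff_power_def intro: power_mono)

lemma cutoff_power_square: "(cutoff_power c R \<omega>)\<^sup>2 = cutoff_power (c\<^sup>2) R \<omega>"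
  by (simp add: cutoff_power_def power_mult_distrib power2_eq_square)

lemma integrable_config_lborel:
  fixes F :: "real list \<Rightarrow> real \<Rightarrow> 'a :: {banach, second_countable_topology}"
  assumes m: "case_prod F \<in> borel_measurable (config_measure \<Otimes>\<^sub>M lborel)"
    and le: "\<And>\<omega> q. norm (F \<omega> q) \<le> C * cutoff_power c R \<omega> * indicator {s<..<t} q"
    and c: "0 \<le> c" "0 \<le> R"
  shows "integrable (config_measure \<Otimes>\<^sub>M lborel) (case_prod F)"
proof (rule Bochner_Integration.integrable_bound[OF _ m])
  show "integrable (config_measure \<Otimes>\<^sub>M lborel) (\<lambda>(\<omega>, q). C * cutoff_power c R \<omega> * indicator {s<..<t} q)"
  proof (rule config_lborel.Fubini_integrable)
    show "(\<lambda>(\<omega>, q). C * cutoff_power c R \<omega> * indicator {s<..<t} q) \<in> borel_measurable (config_measure \<Otimes>\<^sub>M lborel)"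
      by measurable
    show "integrable config_measure (\<lambda>\<omega>. \<integral>q. norm (case (\<omega>, q) of (\<omega>, q) \<Rightarrow> C * cutoff_power c R \<omega> * indicator {s<..<t} q) \<partial>lborel)"
      using c by (simp add: abs_mult cutoff_power_nonneg)
    show "AE \<omega> in config_measure. integrable lborel (\<lambda>q. case (\<omega>, q) of (\<omega>, q) \<Rightarrow> C * cutoff_power c R \<omega> * indicator {s<..<t} q)"
      by (cases "s \<le> t") (auto intro!: integrable_mult_right)
  qed
  show "AE z in config_measure \<Otimes>\<^sub>M lborel. norm (case z of (\<omega>, q) \<Rightarrow> F \<omega> q) \<le>
      norm (case z of (\<omega>, q) \<Rightarrow> C * cutoff_power c R \<omega> * indicator {s<..<t} q)"
    using le by (auto intro!: AE_I2 order_trans[OF le])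
qed

text \<open>One bound serves all times r, so that it may be integrated over time and configuration
  together. The condition c \<ge> 1 lets a single constant bound both \<open>G r \<omega>\<close>
  and \<open>G r (\<omega> @ [q])\<close>. A function without time dependence is treated as a
  constant path.\<close>

definition dominated :: "(real \<Rightarrow> real list \<Rightarrow> 'k :: real_normed_vector) \<Rightarrow> bool" where
  "dominated G \<longleftrightarrow> (\<lambda>(r, \<omega>). G r \<omega>) \<in> borel_measurable (borel \<Otimes>\<^sub>M config_measure) \<and> (\<forall>r. symmetric (G r)) \<and>
    (\<exists>C c R. 0 \<le> C \<and> 1 \<le> c \<and> 0 \<le> R \<and> (\<forall>r \<omega>. norm (G r \<omega>) \<le> C * cutoff_power c R \<omega>))"

lemma dominated_bound:
  assumes "dominated G"
  obtains C c R where "0 \<le> C" "1 \<le> c" "0 \<le> R"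
    "\<And>r \<omega>. norm (G r \<omega>) \<le> C * cutoff_power c R \<omega>"
    "\<And>r q \<omega>. norm (G r (\<omega> @ [q])) \<le> C * cutoff_power c R \<omega>"
proof -
  obtain C c R where *: "0 \<le> C" "1 \<le> c" "0 \<le> R" "\<And>r \<omega>. norm (G r \<omega>) \<le> C * cutoff_power c R \<omega>"
    using assms unfolding dominated_def by blast
  have "norm (G r \<omega>) \<le> (C * c) * cutoff_power c R \<omega>" for r \<omega>
  proof -
    have "C * cutoff_power c R \<omega> \<le> (C * c) * cutoff_power c R \<omega>"
      using * by (intro mult_right_mono) (auto simp: cutoff_power_nonneg mult_le_cancel_left1)
    with *(4)[of r \<omega>] show ?thesis by linarith
  qed
  moreover have "norm (G r (\<omega> @ [q])) \<le> (C * c) * cutoff_power c R \<omega>" for r q \<omega>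
  proof -
    have "C * cutoff_power c R (\<omega> @ [q]) \<le> C * (c * cutoff_power c R \<omega>)"
      using * by (intro mult_left_mono cutoff_power_snoc_le) auto
    with *(4)[of r "\<omega> @ [q]"] show ?thesis by (simp add: mult.assoc)
  qed
  ultimately show thesis using that[of "C * c" c R] * by simp
qed

lemma dominated_bound2:
  assumes "dominated G" "dominated H"
  obtains C c R where "0 \<le> C" "1 \<le> c" "0 \<le> R"
    "\<And>r \<omega>. norm (G r \<omega>) \<le> C * cutoff_power c R \<omega>"
    "\<And>r q \<omega>. norm (G r (\<omega> @ [q])) \<le> C * cutoff_power c R \<omega>"
    "\<And>r \<omega>. norm (H r \<omega>) \<le> C * cutoff_power c R \<omega>"
    "\<And>r q \<omega>. norm (H r (\<omega> @ [q])) \<le> C * cutoff_power c R \<omega>"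
proof -
  obtain C c R where G: "0 \<le> C" "1 \<le> c" "0 \<le> R"
    "\<And>r \<omega>. norm (G r \<omega>) \<le> C * cutoff_power c R \<omega>"
    "\<And>r q \<omega>. norm (G r (\<omega> @ [q])) \<le> C * cutoff_power c R \<omega>" using dominated_bound[OF assms(1)] by blast
  obtain C' c' R' where H: "0 \<le> C'" "1 \<le> c'" "0 \<le> R'"
    "\<And>r \<omega>. norm (H r \<omega>) \<le> C' * cutoff_power c' R' \<omega>"
    "\<And>r q \<omega>. norm (H r (\<omega> @ [q])) \<le> C' * cutoff_power c' R' \<omega>" using dominated_bound[OF assms(2)] by blast
  let ?D = "\<lambda>\<omega>. max C C' * cutoff_power (max c c') (max R R') \<omega>"
  have 1: "C * cutoff_power c R \<omega> \<le> ?D \<omega>" and 2: "C' * cutoff_power c' R' \<omega> \<le> ?D \<omega>" for \<omega>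
    using G(1-3) H(1-3) by (auto intro!: mult_mono cutoff_power_mono cutoff_power_nonneg)
  show thesis
    by (rule that[of "max C C'" "max c c'" "max R R'"])
      (use G H in \<open>auto intro: order_trans[OF _ 1] order_trans[OF _ 2]\<close>)
qed

section \<open>The forward and the backward integral equation\<close>

text \<open>Only points strictly before r contribute to \<open>G r\<close>, so \<open>G q\<close> is
  the value just before a jump at q. In \<open>G q (\<omega> @ [q])\<close> the extra point sits at
  the current time and has not acted yet; it is absorbed by \<open>A\<^sub>m\<close> or kept by
  \<open>A\<^sub>0\<close>. Outside [s,t] the path only has to stay dominated.\<close>

definition evolution ::
  "('k \<Rightarrow>\<^sub>L 'k) \<Rightarrow> ('k \<Rightarrow>\<^sub>L 'k) \<Rightarrow> ('k \<Rightarrow>\<^sub>L 'k) \<Rightarrow> ('k \<Rightarrow>\<^sub>L 'k) \<Rightarrow> real \<Rightarrow> real \<Rightarrow>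
    (real list \<Rightarrow> 'k) \<Rightarrow> (real \<Rightarrow> real list \<Rightarrow> 'k :: separable_hilbert) \<Rightarrow> bool" where
  "evolution A\<^sub>1 A\<^sub>0 A\<^sub>m B s t g G \<longleftrightarrow> dominated G \<and>
    (\<forall>r\<in>{s..t}. \<forall>\<omega>. G r \<omega> = g \<omega> +
      (\<integral>q. indicator {s<..<r} q *\<^sub>R (B (G q \<omega>) + A\<^sub>m (G q (\<omega> @ [q]))) \<partial>lborel) +
      sum_delete (\<lambda>q \<omega>'. if s < q \<and> q < r then A\<^sub>1 (G q \<omega>') + A\<^sub>0 (G q (\<omega>' @ [q])) else 0) \<omega>)"

text \<open>The strict inequality r < q makes the values at jumps right limits, the counterpart that
  the product rule needs for a forward path. In applications the first coefficient is the adjoint of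
  the annihilation coefficient and the third that of the creation coefficient.\<close>

definition backward_evolution ::
  "('k \<Rightarrow>\<^sub>L 'k) \<Rightarrow> ('k \<Rightarrow>\<^sub>L 'k) \<Rightarrow> ('k \<Rightarrow>\<^sub>L 'k) \<Rightarrow> ('k \<Rightarrow>\<^sub>L 'k) \<Rightarrow> real \<Rightarrow> real \<Rightarrow>
    (real list \<Rightarrow> 'k) \<Rightarrow> (real \<Rightarrow> real list \<Rightarrow> 'k :: separable_hilbert) \<Rightarrow> bool" where
  "backward_evolution A\<^sub>1 A\<^sub>0 A\<^sub>m B s t h H \<longleftrightarrow> dominated H \<and>
    (\<forall>r\<in>{s..t}. \<forall>\<omega>. H r \<omega> = h \<omega> +
      (\<integral>q. indicator {r<..<t} q *\<^sub>R (B (H q \<omega>) + A\<^sub>m (H q (\<omega> @ [q]))) \<partial>lborel) +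
      sum_delete (\<lambda>q \<omega>'. if r < q \<and> q < t then A\<^sub>1 (H q \<omega>') + A\<^sub>0 (H q (\<omega>' @ [q])) else 0) \<omega>)"

lemma symmetric_uminus: "symmetric g \<Longrightarrow> symmetric (\<lambda>\<omega>. g (map uminus \<omega>))"
  by (simp add: symmetric_def)

lemma cutoff_power_uminus: "cutoff_power c R (map uminus \<omega>) = cutoff_power c R \<omega>"
  unfolding cutoff_power_def by (auto simp: subset_eq)

text \<open>Reflecting both the time and the points of a configuration turns the interval (r,t) into
  (-t,-r) and a final condition into an initial one. Solutions of the backward equation thus come
  from the forward kernels.\<close>

lemma backward_evolution_uminus:
  assumes "evolution A\<^sub>1 A\<^sub>0 A\<^sub>m B (- t) (- s) (\<lambda>\<omega>. h (map uminus \<omega>)) G"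
  shows "backward_evolution A\<^sub>1 A\<^sub>0 A\<^sub>m B s t h (\<lambda>r \<omega>. G (- r) (map uminus \<omega>))"
  unfolding backward_evolution_def
proof (intro conjI ballI allI)
  have dom: "dominated G" using assms by (simp add: evolution_def)
  then have G: "(\<lambda>(r, \<omega>). G r \<omega>) \<in> borel_measurable (borel \<Otimes>\<^sub>M config_measure)"
    by (simp add: dominated_def)
  note [measurable] = measurable_map_real_config[of uminus, simplified]
  have "(\<lambda>(r :: real, \<omega>). (- r, map uminus \<omega>)) \<in> measurable (borel \<Otimes>\<^sub>M config_measure) (borel \<Otimes>\<^sub>M config_measure)"
    by measurable
  from measurable_compose[OF this G]
  have m: "(\<lambda>(r, \<omega>). G (- r) (map uminus \<omega>)) \<in> borel_measurable (borel \<Otimes>\<^sub>M config_measure)"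
    by (simp only: case_prod_unfold fst_conv snd_conv)
  show "dominated (\<lambda>r \<omega>. G (- r) (map uminus \<omega>))"
    unfolding dominated_def
  proof (intro conjI allI m)
    show "symmetric (\<lambda>\<omega>. G (- r) (map uminus \<omega>))" for r
      using dom by (intro symmetric_uminus) (simp add: dominated_def)
    have "\<exists>C c R. 0 \<le> C \<and> 1 \<le> c \<and> 0 \<le> R \<and> (\<forall>r \<omega>. norm (G r \<omega>) \<le> C * cutoff_power c R \<omega>)"
      using dom by (simp add: dominated_def)
    then show "\<exists>C c R. 0 \<le> C \<and> 1 \<le> c \<and> 0 \<le> R \<and>
        (\<forall>r \<omega>. norm (G (- r) (map uminus \<omega>)) \<le> C * cutoff_power c R \<omega>)"
      by (metis cutoff_power_uminus)
  qed
  fix r \<omega> assume r: "r \<in> {s..t}"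
  let ?a = "\<lambda>q. indicator {- t<..<- r} q *\<^sub>R (B (G q (map uminus \<omega>)) + A\<^sub>m (G q (map uminus \<omega> @ [q])))"
  have "G (- r) (map uminus \<omega>) = h \<omega> + (\<integral>q. ?a q \<partial>lborel) +
      sum_delete (\<lambda>q \<omega>'. if - t < q \<and> q < - r then A\<^sub>1 (G q \<omega>') + A\<^sub>0 (G q (\<omega>' @ [q])) else 0) (map uminus \<omega>)"
  proof -
    have "- r \<in> {- t..- s}" using r by auto
    moreover have "map uminus (map uminus \<omega>) = \<omega>" by (simp add: o_def)
    ultimately show ?thesis
      using assms unfolding evolution_def by auto
  qed
  also have "(\<integral>q. ?a q \<partial>lborel) = (\<integral>q. ?a (- q) \<partial>lborel)"
    by (subst lborel_integral_real_affine[where c = "-1" and t = 0]) simp_all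
  also have "(\<lambda>q. ?a (- q)) = (\<lambda>q. indicator {r<..<t} q *\<^sub>R (B (G (- q) (map uminus \<omega>)) + A\<^sub>m (G (- q) (map uminus (\<omega> @ [q])))))"
    by (auto simp: indicator_def fun_eq_iff)
  finally show "G (- r) (map uminus \<omega>) = h \<omega> +
      (\<integral>q. indicator {r<..<t} q *\<^sub>R (B (G (- q) (map uminus \<omega>)) + A\<^sub>m (G (- q) (map uminus (\<omega> @ [q])))) \<partial>lborel) +
      sum_delete (\<lambda>q \<omega>'. if r < q \<and> q < t then A\<^sub>1 (G (- q) (map uminus \<omega>')) + A\<^sub>0 (G (- q) (map uminus (\<omega>' @ [q]))) else 0) \<omega>"
    by (simp add: sum_delete_map conj_commute cong: if_cong)
qed

lemma symmetric_delete:
  assumes "symmetric f" "i < length \<omega>"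
  shows "f ((take i \<omega> @ drop (Suc i) \<omega>) @ [\<omega> ! i]) = f \<omega>"
  using assms mset_delete[OF assms(2)] unfolding symmetric_def by blast

lemma integrable_evolution_integrand:
  fixes G :: "real \<Rightarrow> real list \<Rightarrow> 'k :: separable_hilbert" and B A\<^sub>m :: "'k \<Rightarrow>\<^sub>L 'k"
  assumes "dominated G"
  shows "integrable lborel (\<lambda>q. indicator {s<..<t} q *\<^sub>R (B (G q \<omega>) + A\<^sub>m (G q (\<omega> @ [q]))))"
proof -
  obtain C c R where *: "0 \<le> C" "1 \<le> c" "0 \<le> R"
    "\<And>r \<omega>. norm (G r \<omega>) \<le> C * cutoff_power c R \<omega>"
    "\<And>r q \<omega>. norm (G r (\<omega> @ [q])) \<le> C * cutoff_power c R \<omega>" using dominated_bound[OF assms] by blast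
  have G: "(\<lambda>(r, \<omega>). G r \<omega>) \<in> borel_measurable (borel \<Otimes>\<^sub>M config_measure)"
    using assms by (simp add: dominated_def)
  have [measurable]: "(\<lambda>q. G q \<omega>) \<in> borel_measurable borel" "(\<lambda>q. G q (\<omega> @ [q])) \<in> borel_measurable borel"
    using measurable_compose[OF _ G, of "\<lambda>q. (q, \<omega>)"] measurable_compose[OF _ G, of "\<lambda>q. (q, \<omega> @ [q])"] by auto
  let ?K = "(norm B + norm A\<^sub>m) * (C * cutoff_power c R \<omega>)"
  show ?thesis
  proof (rule Bochner_Integration.integrable_bound)
    show "integrable lborel (\<lambda>q. ?K * indicator {s<..<t} q)"
      by (cases "s \<le> t") auto
    show "AE q in lborel. norm (indicator {s<..<t} q *\<^sub>R (B (G q \<omega>) + A\<^sub>m (G q (\<omega> @ [q])))) \<le> norm (?K * indicator {s<..<t} q)"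
    proof (rule AE_I2)
      fix q
      have "norm (B (G q \<omega>) + A\<^sub>m (G q (\<omega> @ [q]))) \<le> norm B * norm (G q \<omega>) + norm A\<^sub>m * norm (G q (\<omega> @ [q]))"
        by (intro order_trans[OF norm_triangle_ineq] add_mono norm_blinfun)
      also have "\<dots> \<le> ?K"
        unfolding distrib_right by (intro add_mono mult_left_mono * norm_ge_zero)
      finally show "norm (indicator {s<..<t} q *\<^sub>R (B (G q \<omega>) + A\<^sub>m (G q (\<omega> @ [q])))) \<le> norm (?K * indicator {s<..<t} q)"
        by (auto simp: indicator_def)
    qed
  qed measurable
qed

lemma measurable_evolution_pair:
  assumes "dominated G" "q \<in> borel_measurable M" "w \<in> measurable M config_measure"
  shows "(\<lambda>m. G (q m) (w m)) \<in> borel_measurable M"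
proof -
  have "(\<lambda>(r, \<omega>). G r \<omega>) \<in> borel_measurable (borel \<Otimes>\<^sub>M config_measure)"
    using assms by (simp add: dominated_def)
  from measurable_compose[OF measurable_Pair[OF assms(2,3)] this] show ?thesis by simp
qed

lemma integrable_dominated_inner:
  fixes G H :: "real \<Rightarrow> real list \<Rightarrow> 'k :: separable_hilbert"
  assumes "dominated G" "dominated H"
  shows "integrable config_measure (\<lambda>\<omega>. G r \<omega> \<bullet> H r' \<omega>)"
proof -
  obtain C c R where *: "0 \<le> C" "1 \<le> c" "0 \<le> R"
      "\<And>r \<omega>. norm (G r \<omega>) \<le> C * cutoff_power c R \<omega>" "\<And>r q \<omega>. norm (G r (\<omega> @ [q])) \<le> C * cutoff_power c R \<omega>"
      "\<And>r \<omega>. norm (H r \<omega>) \<le> C * cutoff_power c R \<omega>" "\<And>r q \<omega>. norm (H r (\<omega> @ [q])) \<le> C * cutoff_power c R \<omega>"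
    using dominated_bound2[OF assms] by blast
  note [measurable (raw)] = measurable_evolution_pair[OF assms(1)] measurable_evolution_pair[OF assms(2)]
  show ?thesis
  proof (rule Bochner_Integration.integrable_bound)
    show "integrable config_measure (\<lambda>\<omega>. C\<^sup>2 * cutoff_power (c\<^sup>2) R \<omega>)"
      using * by simp
    show "AE \<omega> in config_measure. norm (G r \<omega> \<bullet> H r' \<omega>) \<le> norm (C\<^sup>2 * cutoff_power (c\<^sup>2) R \<omega>)"
    proof (rule AE_I2)
      fix \<omega>
      have "norm (G r \<omega> \<bullet> H r' \<omega>) \<le> norm (G r \<omega>) * norm (H r' \<omega>)"
        by (simp add: Cauchy_Schwarz_ineq2)
      also have "\<dots> \<le> (C * cutoff_power c R \<omega>) * (C * cutoff_power c R \<omega>)"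
        using * by (intro mult_mono) (auto intro!: cutoff_power_nonneg mult_nonneg_nonneg)
      also have "\<dots> = C\<^sup>2 * cutoff_power (c\<^sup>2) R \<omega>"
        unfolding cutoff_power_square[symmetric] by (simp add: power2_eq_square)
      finally show "norm (G r \<omega> \<bullet> H r' \<omega>) \<le> norm (C\<^sup>2 * cutoff_power (c\<^sup>2) R \<omega>)" by simp
    qed
  qed (intro borel_measurable_inner measurable_evolution_pair[OF assms(1), where q = "\<lambda>_. r" and w = "\<lambda>\<omega>. \<omega>"]
      measurable_evolution_pair[OF assms(2), where q = "\<lambda>_. r'" and w = "\<lambda>\<omega>. \<omega>"], auto)
qed

lemma evolution_initial:
  assumes "evolution A\<^sub>1 A\<^sub>0 A\<^sub>m B s t g G" "s \<le> t"
  shows "G s \<omega> = g \<omega>"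
proof -
  have "sum_delete (\<lambda>q \<omega>'. if s < q \<and> q < s then A\<^sub>1 (G q \<omega>') + A\<^sub>0 (G q (\<omega>' @ [q])) else 0) \<omega> = 0"
    by (rule sum_delete_neutral) auto
  moreover have "s \<in> {s..t}" using assms by simp
  ultimately show ?thesis
    using assms unfolding evolution_def by simp
qed

lemma backward_evolution_final:
  assumes "backward_evolution A\<^sub>1 A\<^sub>0 A\<^sub>m B s t h H" "s \<le> t"
  shows "H t \<omega> = h \<omega>"
proof -
  have "sum_delete (\<lambda>q \<omega>'. if t < q \<and> q < t then A\<^sub>1 (H q \<omega>') + A\<^sub>0 (H q (\<omega>' @ [q])) else 0) \<omega> = 0"
    by (rule sum_delete_neutral) auto
  moreover have "t \<in> {s..t}" using assms by simp
  ultimately show ?thesis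
    using assms unfolding backward_evolution_def by simp
qed

section \<open>Adjoint relation and energy balance\<close>

definition jump_indices :: "real \<Rightarrow> real \<Rightarrow> real list \<Rightarrow> nat set" where
  "jump_indices s t \<omega> = {i. i < length \<omega> \<and> s < \<omega> ! i \<and> \<omega> ! i < t}"

lemma finite_jump_indices [simp]: "finite (jump_indices s t \<omega>)"
  by (simp add: jump_indices_def)

lemma sum_delete_jump_indices:
  assumes "\<And>q \<omega>'. \<not> (s < q \<and> q < t) \<Longrightarrow> F q \<omega>' = 0"
  shows "sum_delete F \<omega> = (\<Sum>i\<in>jump_indices s t \<omega>. F (\<omega> ! i) (take i \<omega> @ drop (Suc i) \<omega>))"
  unfolding sum_delete_def using assms by (intro sum.mono_neutral_right) (auto simp: jump_indices_def)

text \<open>Brings the equation into the shape of \<open>integral_jump_parts\<close>: the increments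
  and the jump indices no longer depend on r, which enters only through \<open>{..<r}\<close> and
  the test \<open>\<omega> ! i < r\<close>.\<close>

lemma evolution_path:
  assumes G: "evolution A\<^sub>1 A\<^sub>0 A\<^sub>m B s t g G" and r: "s \<le> r" "r \<le> t"
  shows "G r \<omega> = g \<omega> +
    (\<integral>q. indicator {..<r} q *\<^sub>R indicator {s<..<t} q *\<^sub>R (B (G q \<omega>) + A\<^sub>m (G q (\<omega> @ [q]))) \<partial>lborel) +
    (\<Sum>i\<in>jump_indices s t \<omega>. if \<omega> ! i < r
      then A\<^sub>1 (G (\<omega> ! i) (take i \<omega> @ drop (Suc i) \<omega>)) + A\<^sub>0 (G (\<omega> ! i) \<omega>) else 0)"
proof -
  have sG: "symmetric (G r)" for r
    using G by (simp add: evolution_def dominated_def)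
  have "G r \<omega> = g \<omega> +
      (\<integral>q. indicator {s<..<r} q *\<^sub>R (B (G q \<omega>) + A\<^sub>m (G q (\<omega> @ [q]))) \<partial>lborel) +
      sum_delete (\<lambda>q \<omega>'. if s < q \<and> q < r then A\<^sub>1 (G q \<omega>') + A\<^sub>0 (G q (\<omega>' @ [q])) else 0) \<omega>"
    using G r unfolding evolution_def by auto
  moreover have "(\<lambda>q. indicator {s<..<r} q *\<^sub>R (B (G q \<omega>) + A\<^sub>m (G q (\<omega> @ [q])))) =
      (\<lambda>q. indicator {..<r} q *\<^sub>R indicator {s<..<t} q *\<^sub>R (B (G q \<omega>) + A\<^sub>m (G q (\<omega> @ [q]))))"
    using r by (auto simp: indicator_def)
  moreover have "sum_delete (\<lambda>q \<omega>'. if s < q \<and> q < r then A\<^sub>1 (G q \<omega>') + A\<^sub>0 (G q (\<omega>' @ [q])) else 0) \<omega> =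
      (\<Sum>i\<in>jump_indices s t \<omega>. if \<omega> ! i < r
        then A\<^sub>1 (G (\<omega> ! i) (take i \<omega> @ drop (Suc i) \<omega>)) + A\<^sub>0 (G (\<omega> ! i) \<omega>) else 0)"
    using r by (subst sum_delete_jump_indices[of s t])
      (auto simp: jump_indices_def symmetric_delete[OF sG] intro!: sum.cong simp del: append_assoc)
  ultimately show ?thesis by simp
qed

lemma backward_evolution_path:
  assumes H: "backward_evolution A\<^sub>1 A\<^sub>0 A\<^sub>m B s t h H" and r: "s \<le> r" "r \<le> t"
  shows "H r \<omega> = h \<omega> +
    (\<integral>q. indicator {r<..} q *\<^sub>R indicator {s<..<t} q *\<^sub>R (B (H q \<omega>) + A\<^sub>m (H q (\<omega> @ [q]))) \<partial>lborel) +
    (\<Sum>i\<in>jump_indices s t \<omega>. if r < \<omega> ! i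
      then A\<^sub>1 (H (\<omega> ! i) (take i \<omega> @ drop (Suc i) \<omega>)) + A\<^sub>0 (H (\<omega> ! i) \<omega>) else 0)"
proof -
  have sH: "symmetric (H r)" for r
    using H by (simp add: backward_evolution_def dominated_def)
  have "H r \<omega> = h \<omega> +
      (\<integral>q. indicator {r<..<t} q *\<^sub>R (B (H q \<omega>) + A\<^sub>m (H q (\<omega> @ [q]))) \<partial>lborel) +
      sum_delete (\<lambda>q \<omega>'. if r < q \<and> q < t then A\<^sub>1 (H q \<omega>') + A\<^sub>0 (H q (\<omega>' @ [q])) else 0) \<omega>"
    using H r unfolding backward_evolution_def by auto
  moreover have "(\<lambda>q. indicator {r<..<t} q *\<^sub>R (B (H q \<omega>) + A\<^sub>m (H q (\<omega> @ [q])))) =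
      (\<lambda>q. indicator {r<..} q *\<^sub>R indicator {s<..<t} q *\<^sub>R (B (H q \<omega>) + A\<^sub>m (H q (\<omega> @ [q]))))"
    using r by (auto simp: indicator_def)
  moreover have "sum_delete (\<lambda>q \<omega>'. if r < q \<and> q < t then A\<^sub>1 (H q \<omega>') + A\<^sub>0 (H q (\<omega>' @ [q])) else 0) \<omega> =
      (\<Sum>i\<in>jump_indices s t \<omega>. if r < \<omega> ! i
        then A\<^sub>1 (H (\<omega> ! i) (take i \<omega> @ drop (Suc i) \<omega>)) + A\<^sub>0 (H (\<omega> ! i) \<omega>) else 0)"
    using r by (subst sum_delete_jump_indices[of s t])
      (auto simp: jump_indices_def symmetric_delete[OF sH] intro!: sum.cong simp del: append_assoc)
  ultimately show ?thesis by simp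
qed

text \<open>The balance \<open>K\<close> of creation against annihilation enters once through the absolutely
  continuous part and once, with the opposite sign, through the jumps; the two contributions
  cancel after integration over all configurations.\<close>

lemma evolution_adjoint:
  fixes G H :: "real \<Rightarrow> real list \<Rightarrow> 'k :: separable_hilbert"
  assumes G: "evolution A\<^sub>1 A\<^sub>0 A\<^sub>m B s t g G" and H: "backward_evolution A\<^sub>m' A\<^sub>0' A\<^sub>1' B' s t h H"
    and "s \<le> t"
    and adj: "\<And>x y. A\<^sub>1 x \<bullet> y = x \<bullet> A\<^sub>1' y" "\<And>x y. A\<^sub>0 x \<bullet> y = x \<bullet> A\<^sub>0' y"
      "\<And>x y. A\<^sub>m x \<bullet> y = x \<bullet> A\<^sub>m' y" "\<And>x y. B x \<bullet> y = x \<bullet> B' y"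
  shows "(\<integral>\<omega>. G t \<omega> \<bullet> h \<omega> \<partial>config_measure) = (\<integral>\<omega>. g \<omega> \<bullet> H s \<omega> \<partial>config_measure)"
proof -
  have dG: "dominated G" and dH: "dominated H"
    using G H by (auto simp: evolution_def backward_evolution_def)
  note [measurable (raw)] = measurable_evolution_pair[OF dG] measurable_evolution_pair[OF dH]
  have sG: "symmetric (G r)" and sH: "symmetric (H r)" for r
    using dG dH by (auto simp: dominated_def)
  have hg: "H t \<omega> = h \<omega>" "G s \<omega> = g \<omega>" for \<omega>
    using evolution_initial[OF G \<open>s \<le> t\<close>] backward_evolution_final[OF H \<open>s \<le> t\<close>] by auto
  define K where "K q \<omega> = indicator {s<..<t} q * (A\<^sub>m (G q (\<omega> @ [q])) \<bullet> H q \<omega> - G q \<omega> \<bullet> A\<^sub>1' (H q (\<omega> @ [q])))"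
    for q :: real and \<omega> :: "real list"
  \<comment> \<open>Product rule on a single configuration. The terms with \<open>B\<close> and
    \<open>A\<^sub>0\<close> cancel against their adjoints; between jumps \<open>A\<^sub>m\<close>
    is left against \<open>A\<^sub>1'\<close>, which is \<open>K\<close>, and at a jump the roles
    are exchanged, which gives \<open>- K\<close> at the configuration without the jumping
    point.\<close>
  have pw: "G t \<omega> \<bullet> h \<omega> - g \<omega> \<bullet> H s \<omega> = (\<integral>q. K q \<omega> \<partial>lborel) - sum_delete K \<omega>" for \<omega>
  proof -
    let ?p = "\<lambda>i. \<omega> ! i" and ?d = "\<lambda>i. take i \<omega> @ drop (Suc i) \<omega>"
    define J where "J = jump_indices s t \<omega>"
    define a where "a q = indicator {s<..<t} q *\<^sub>R (B (G q \<omega>) + A\<^sub>m (G q (\<omega> @ [q])))" for q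
    define a' where "a' q = indicator {s<..<t} q *\<^sub>R (B' (H q \<omega>) + A\<^sub>1' (H q (\<omega> @ [q])))" for q
    define b where "b i = A\<^sub>1 (G (?p i) (?d i)) + A\<^sub>0 (G (?p i) \<omega>)" for i
    define b' where "b' i = A\<^sub>m' (H (?p i) (?d i)) + A\<^sub>0' (H (?p i) \<omega>)" for i
    have J: "finite J" by (simp add: J_def)
    have a: "integrable lborel a" and a': "integrable lborel a'"
      unfolding a_def a'_def using integrable_evolution_integrand dG dH by blast+
    have G1: "G r \<omega> = g \<omega> + (\<integral>q. indicator {..<r} q *\<^sub>R a q \<partial>lborel) + (\<Sum>i\<in>J. if ?p i < r then b i else 0)"
      if "s \<le> r" "r \<le> t" for r
      unfolding a_def b_def J_def by (rule evolution_path[OF G that])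
    have H1: "H r \<omega> = h \<omega> + (\<integral>q. indicator {r<..} q *\<^sub>R a' q \<partial>lborel) + (\<Sum>i\<in>J. if r < ?p i then b' i else 0)"
      if "s \<le> r" "r \<le> t" for r
      unfolding a'_def b'_def J_def by (rule backward_evolution_path[OF H that])
    have "(\<lambda>q. indicator {..<t} q *\<^sub>R a q) = a" "(\<lambda>q. indicator {s<..} q *\<^sub>R a' q) = a'"
      by (auto simp: a_def a'_def indicator_def)
    moreover have "(\<Sum>i\<in>J. if ?p i < t then b i else 0) = sum b J" "(\<Sum>i\<in>J. if s < ?p i then b' i else 0) = sum b' J"
      by (auto simp: J_def jump_indices_def intro!: sum.cong)
    ultimately have "G t \<omega> \<bullet> h \<omega> - g \<omega> \<bullet> H s \<omega> =
        (g \<omega> + (\<integral>q. a q \<partial>lborel) + sum b J) \<bullet> h \<omega> - g \<omega> \<bullet> (h \<omega> + (\<integral>q. a' q \<partial>lborel) + sum b' J)"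
      using G1[of t] H1[of s] \<open>s \<le> t\<close> by simp
    also have "\<dots> = (\<integral>q. a q \<bullet> (h \<omega> + (\<integral>p. indicator {q<..} p *\<^sub>R a' p \<partial>lborel) + (\<Sum>i\<in>J. if q < ?p i then b' i else 0)) -
          (g \<omega> + (\<integral>p. indicator {..<q} p *\<^sub>R a p \<partial>lborel) + (\<Sum>i\<in>J. if ?p i < q then b i else 0)) \<bullet> a' q \<partial>lborel) +
        (\<Sum>i\<in>J. b i \<bullet> (h \<omega> + (\<integral>p. indicator {?p i<..} p *\<^sub>R a' p \<partial>lborel) + (\<Sum>j\<in>J. if ?p i < ?p j then b' j else 0)) -
          (g \<omega> + (\<integral>p. indicator {..<?p i} p *\<^sub>R a p \<partial>lborel) + (\<Sum>j\<in>J. if ?p j < ?p i then b j else 0)) \<bullet> b' i)"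
      by (rule integral_jump_parts[OF J a a'])
    \<comment> \<open>Outside (s,t) the increments vanish, so the two expressions have to be
      recognised as \<open>H q \<omega>\<close> and \<open>G q \<omega>\<close> only inside, where
      the path equations hold.\<close>
    also have "\<dots> = (\<integral>q. a q \<bullet> H q \<omega> - G q \<omega> \<bullet> a' q \<partial>lborel) + (\<Sum>i\<in>J. b i \<bullet> H (?p i) \<omega> - G (?p i) \<omega> \<bullet> b' i)"
    proof (intro arg_cong2[where f = "(+)"] Bochner_Integration.integral_cong sum.cong refl)
      fix q
      show "a q \<bullet> (h \<omega> + (\<integral>p. indicator {q<..} p *\<^sub>R a' p \<partial>lborel) + (\<Sum>i\<in>J. if q < ?p i then b' i else 0)) -
          (g \<omega> + (\<integral>p. indicator {..<q} p *\<^sub>R a p \<partial>lborel) + (\<Sum>i\<in>J. if ?p i < q then b i else 0)) \<bullet> a' q =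
          a q \<bullet> H q \<omega> - G q \<omega> \<bullet> a' q"
      proof (cases "s < q \<and> q < t")
        case True
        then show ?thesis using G1[of q] H1[of q] by simp
      next
        case False
        then have "a q = 0" "a' q = 0" by (auto simp: a_def a'_def)
        then show ?thesis by simp
      qed
    next
      fix i assume "i \<in> J"
      then show "b i \<bullet> (h \<omega> + (\<integral>p. indicator {?p i<..} p *\<^sub>R a' p \<partial>lborel) + (\<Sum>j\<in>J. if ?p i < ?p j then b' j else 0)) -
          (g \<omega> + (\<integral>p. indicator {..<?p i} p *\<^sub>R a p \<partial>lborel) + (\<Sum>j\<in>J. if ?p j < ?p i then b j else 0)) \<bullet> b' i =
          b i \<bullet> H (?p i) \<omega> - G (?p i) \<omega> \<bullet> b' i"
        using G1[of "?p i"] H1[of "?p i"] by (simp add: J_def jump_indices_def)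
    qed
    also have "(\<lambda>q. a q \<bullet> H q \<omega> - G q \<omega> \<bullet> a' q) = (\<lambda>q. K q \<omega>)"
      by (auto simp: a_def a'_def K_def inner_add_left inner_add_right adj indicator_def)
    also have "(\<Sum>i\<in>J. b i \<bullet> H (?p i) \<omega> - G (?p i) \<omega> \<bullet> b' i) = - (\<Sum>i\<in>J. K (?p i) (?d i))"
      unfolding sum_negf[symmetric]
    proof (rule sum.cong)
      fix i assume "i \<in> J"
      then have i: "i < length \<omega>" "s < ?p i" "?p i < t" by (auto simp: J_def jump_indices_def)
      show "b i \<bullet> H (?p i) \<omega> - G (?p i) \<omega> \<bullet> b' i = - K (?p i) (?d i)"
        unfolding K_def symmetric_delete[OF sG i(1)] symmetric_delete[OF sH i(1)]
        using i by (simp add: b_def b'_def inner_add_left inner_add_right adj)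
    qed simp
    also have "(\<Sum>i\<in>J. K (?p i) (?d i)) = sum_delete K \<omega>"
      unfolding J_def by (rule sum_delete_jump_indices[symmetric]) (auto simp: K_def)
    finally show ?thesis by simp
  qed
  have K: "integrable (config_measure \<Otimes>\<^sub>M lborel) (\<lambda>(\<omega>, q). K q \<omega>)"
  proof -
    obtain C c R where *: "0 \<le> C" "1 \<le> c" "0 \<le> R"
      "\<And>r \<omega>. norm (G r \<omega>) \<le> C * cutoff_power c R \<omega>" "\<And>r q \<omega>. norm (G r (\<omega> @ [q])) \<le> C * cutoff_power c R \<omega>"
      "\<And>r \<omega>. norm (H r \<omega>) \<le> C * cutoff_power c R \<omega>" "\<And>r q \<omega>. norm (H r (\<omega> @ [q])) \<le> C * cutoff_power c R \<omega>"
      using dominated_bound2[OF dG dH] by blast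
    show ?thesis
    proof (rule integrable_config_lborel)
      show "(\<lambda>(\<omega>, q). K q \<omega>) \<in> borel_measurable (config_measure \<Otimes>\<^sub>M lborel)"
        unfolding K_def by measurable
      fix \<omega> q
      let ?D = "C * cutoff_power c R \<omega>"
      have D: "0 \<le> ?D" using * by (simp add: cutoff_power_nonneg)
      have "\<bar>A\<^sub>m (G q (\<omega> @ [q])) \<bullet> H q \<omega>\<bar> \<le> norm (A\<^sub>m (G q (\<omega> @ [q]))) * norm (H q \<omega>)"
        by (rule Cauchy_Schwarz_ineq2)
      also have "\<dots> \<le> (norm A\<^sub>m * ?D) * ?D"
        using * D by (intro mult_mono order_trans[OF norm_blinfun] mult_left_mono) auto
      finally have 1: "\<bar>A\<^sub>m (G q (\<omega> @ [q])) \<bullet> H q \<omega>\<bar> \<le> (norm A\<^sub>m * ?D) * ?D" .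
      have "\<bar>G q \<omega> \<bullet> A\<^sub>1' (H q (\<omega> @ [q]))\<bar> \<le> norm (G q \<omega>) * norm (A\<^sub>1' (H q (\<omega> @ [q])))"
        by (rule Cauchy_Schwarz_ineq2)
      also have "\<dots> \<le> ?D * (norm A\<^sub>1' * ?D)"
        using * D by (intro mult_mono order_trans[OF norm_blinfun] mult_left_mono) auto
      finally have 2: "\<bar>G q \<omega> \<bullet> A\<^sub>1' (H q (\<omega> @ [q]))\<bar> \<le> ?D * (norm A\<^sub>1' * ?D)" .
      have "\<bar>A\<^sub>m (G q (\<omega> @ [q])) \<bullet> H q \<omega> - G q \<omega> \<bullet> A\<^sub>1' (H q (\<omega> @ [q]))\<bar> \<le> (norm A\<^sub>m * ?D) * ?D + ?D * (norm A\<^sub>1' * ?D)"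
        using 1 2 by linarith
      also have "\<dots> = (norm A\<^sub>m + norm A\<^sub>1') * C\<^sup>2 * cutoff_power (c\<^sup>2) R \<omega>"
        unfolding cutoff_power_square[symmetric] by (simp add: power2_eq_square algebra_simps)
      finally show "norm (K q \<omega>) \<le> (norm A\<^sub>m + norm A\<^sub>1') * C\<^sup>2 * cutoff_power (c\<^sup>2) R \<omega> * indicator {s<..<t} q"
        by (auto simp: K_def indicator_def)
    qed (use * in auto)
  qed
  have iG: "integrable config_measure (\<lambda>\<omega>. G t \<omega> \<bullet> h \<omega>)" and ig: "integrable config_measure (\<lambda>\<omega>. g \<omega> \<bullet> H s \<omega>)"
    using integrable_dominated_inner[OF dG dH, of t t] integrable_dominated_inner[OF dG dH, of s s] by (simp_all add: hg)
  have "(\<integral>\<omega>. G t \<omega> \<bullet> h \<omega> \<partial>config_measure) - (\<integral>\<omega>. g \<omega> \<bullet> H s \<omega> \<partial>config_measure) =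
      (\<integral>\<omega>. (\<integral>q. K q \<omega> \<partial>lborel) - sum_delete K \<omega> \<partial>config_measure)"
    using iG ig by (simp flip: pw)
  also have "\<dots> = 0"
    using config_lborel.integrable_fst[OF K] integrable_sum_delete[OF K]
    by (simp add: config_lborel.integral_fst[OF K] integral_sum_delete[OF K])
  finally show ?thesis by simp
qed


text \<open>The product rule for G and a copy of G run backward from its final value. Off the jumps
  both agree, which gives 2 (G \<bullet> a); at a jump b the copy is already at G + b, so the
  contribution is b \<bullet> (G + b) + G \<bullet> b = |G + b|^2 - |G|^2.\<close>

lemma evolution_energy:
  fixes G :: "real \<Rightarrow> real list \<Rightarrow> 'k :: separable_hilbert"
  assumes G: "evolution A\<^sub>1 A\<^sub>0 A\<^sub>m B s t g G" and "s \<le> t"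
  defines "Q \<equiv> \<lambda>x y. 2 * (x \<bullet> (B x + A\<^sub>m y)) + ((norm (A\<^sub>1 x + A\<^sub>0 y + y))\<^sup>2 - (norm y)\<^sup>2)"
  shows "(\<integral>\<omega>. (norm (G t \<omega>))\<^sup>2 \<partial>config_measure) - (\<integral>\<omega>. (norm (g \<omega>))\<^sup>2 \<partial>config_measure) =
    (\<integral>q. indicator {s<..<t} q * (\<integral>\<omega>. Q (G q \<omega>) (G q (\<omega> @ [q])) \<partial>config_measure) \<partial>lborel)"
proof -
  have dG: "dominated G" using G by (simp add: evolution_def)
  note [measurable (raw)] = measurable_evolution_pair[OF dG]
  have sG: "symmetric (G r)" for r
    using dG by (simp add: dominated_def)
  note g = evolution_initial[OF G \<open>s \<le> t\<close>]
  define L where "L q \<omega> = indicator {s<..<t} q * (2 * (G q \<omega> \<bullet> (B (G q \<omega>) + A\<^sub>m (G q (\<omega> @ [q])))))"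
    for q :: real and \<omega> :: "real list"
  define M where "M q \<omega> = indicator {s<..<t} q * ((norm (A\<^sub>1 (G q \<omega>) + A\<^sub>0 (G q (\<omega> @ [q])) + G q (\<omega> @ [q])))\<^sup>2 - (norm (G q (\<omega> @ [q])))\<^sup>2)"
    for q :: real and \<omega> :: "real list"
  have pw: "(norm (G t \<omega>))\<^sup>2 - (norm (g \<omega>))\<^sup>2 = (\<integral>q. L q \<omega> \<partial>lborel) + sum_delete M \<omega>" if "distinct \<omega>" for \<omega>
  proof -
    let ?p = "\<lambda>i. \<omega> ! i" and ?d = "\<lambda>i. take i \<omega> @ drop (Suc i) \<omega>"
    define J where "J = jump_indices s t \<omega>"
    define a where "a q = indicator {s<..<t} q *\<^sub>R (B (G q \<omega>) + A\<^sub>m (G q (\<omega> @ [q])))" for q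
    define b where "b i = A\<^sub>1 (G (?p i) (?d i)) + A\<^sub>0 (G (?p i) \<omega>)" for i
    \<comment> \<open>The increments of G with reversed sign, started from \<open>G t\<close>. On
      [s,t] this is the right-continuous version of G, as \<open>Hr\<close> shows.\<close>
    define H where "H r = G t \<omega> + (\<integral>q. indicator {r<..} q *\<^sub>R (- a q) \<partial>lborel) + (\<Sum>i\<in>J. if r < ?p i then - b i else 0)" for r
    have J: "finite J" by (simp add: J_def)
    have a: "integrable lborel a"
      unfolding a_def using integrable_evolution_integrand dG by blast
    have G1: "G r \<omega> = g \<omega> + (\<integral>q. indicator {..<r} q *\<^sub>R a q \<partial>lborel) + (\<Sum>i\<in>J. if ?p i < r then b i else 0)"
      if "s \<le> r" "r \<le> t" for r
      unfolding a_def b_def J_def by (rule evolution_path[OF G that])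
    have at: "(\<lambda>q. indicator {..<t} q *\<^sub>R a q) = a"
      by (auto simp: a_def indicator_def)
    have bt: "(\<Sum>i\<in>J. if ?p i < t then b i else 0) = sum b J"
      by (auto simp: J_def jump_indices_def intro!: sum.cong)
    have Gt: "G t \<omega> = g \<omega> + (\<integral>q. a q \<partial>lborel) + sum b J"
      using G1[of t] \<open>s \<le> t\<close> at bt by simp
    have Hr: "H r = G r \<omega> + (\<Sum>i\<in>J. if ?p i = r then b i else 0)" if r: "s \<le> r" "r \<le> t" for r
    proof -
      have i: "integrable lborel (\<lambda>q. indicator {..<r} q *\<^sub>R a q)" "integrable lborel (\<lambda>q. indicator {r<..} q *\<^sub>R a q)"
        using a by (auto intro: integrable_mult_indicator)
      have "(\<integral>q. a q \<partial>lborel) = (\<integral>q. indicator {..<r} q *\<^sub>R a q + indicator {r<..} q *\<^sub>R a q \<partial>lborel)"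
      proof (rule integral_cong_AE)
        show "AE q in lborel. a q = indicator {..<r} q *\<^sub>R a q + indicator {r<..} q *\<^sub>R a q"
          using AE_lborel_singleton[of r] by eventually_elim (auto simp: indicator_def)
      qed (use a i in auto)
      also have "\<dots> = (\<integral>q. indicator {..<r} q *\<^sub>R a q \<partial>lborel) + (\<integral>q. indicator {r<..} q *\<^sub>R a q \<partial>lborel)"
        using i by simp
      finally have A: "(\<integral>q. a q \<partial>lborel) = \<dots>" .
      have B: "sum b J = (\<Sum>i\<in>J. if ?p i < r then b i else 0) + (\<Sum>i\<in>J. if ?p i = r then b i else 0) + (\<Sum>i\<in>J. if r < ?p i then b i else 0)"
        unfolding sum.distrib[symmetric] by (intro sum.cong) auto
      have C: "(\<Sum>i\<in>J. if r < ?p i then - b i else 0) = - (\<Sum>i\<in>J. if r < ?p i then b i else 0)"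
        unfolding sum_negf[symmetric] by (intro sum.cong) auto
      show ?thesis
        unfolding H_def Gt G1[OF r] A B C by simp
    qed
    have "(norm (G t \<omega>))\<^sup>2 - (norm (g \<omega>))\<^sup>2 =
        (g \<omega> + (\<integral>q. a q \<partial>lborel) + sum b J) \<bullet> G t \<omega> - g \<omega> \<bullet> (G t \<omega> + (\<integral>q. - a q \<partial>lborel) + (\<Sum>i\<in>J. - b i))"
      by (simp add: Gt power2_norm_eq_inner inner_add_left inner_add_right inner_diff_right sum_negf)
    also have "\<dots> = (\<integral>q. a q \<bullet> H q -
          (g \<omega> + (\<integral>p. indicator {..<q} p *\<^sub>R a p \<partial>lborel) + (\<Sum>i\<in>J. if ?p i < q then b i else 0)) \<bullet> (- a q) \<partial>lborel) +
        (\<Sum>i\<in>J. b i \<bullet> H (?p i) -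
          (g \<omega> + (\<integral>p. indicator {..<?p i} p *\<^sub>R a p \<partial>lborel) + (\<Sum>j\<in>J. if ?p j < ?p i then b j else 0)) \<bullet> (- b i))"
      unfolding H_def by (rule integral_jump_parts[OF J a]) (use a in simp)
    also have "(\<integral>q. a q \<bullet> H q -
          (g \<omega> + (\<integral>p. indicator {..<q} p *\<^sub>R a p \<partial>lborel) + (\<Sum>i\<in>J. if ?p i < q then b i else 0)) \<bullet> (- a q) \<partial>lborel) =
        (\<integral>q. L q \<omega> \<partial>lborel)"
    proof (rule integral_cong_AE)
      \<comment> \<open>H and G differ only at the finitely many jump times, a Lebesgue null
        set.\<close>
      have "AE q in lborel. \<forall>i\<in>J. q \<noteq> ?p i"
        using J AE_lborel_singleton by (subst AE_finite_all) auto
      then show "AE q in lborel. a q \<bullet> H q -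
          (g \<omega> + (\<integral>p. indicator {..<q} p *\<^sub>R a p \<partial>lborel) + (\<Sum>i\<in>J. if ?p i < q then b i else 0)) \<bullet> (- a q) = L q \<omega>"
      proof eventually_elim
        case (elim q)
        show ?case
        proof (cases "s < q \<and> q < t")
          case True
          have "(\<Sum>i\<in>J. if ?p i = q then b i else 0) = 0"
            using elim by (intro sum.neutral) auto
          then have "H q = G q \<omega>" using Hr[of q] True by simp
          moreover have "L q \<omega> = 2 * (G q \<omega> \<bullet> a q)" using True by (simp add: L_def a_def)
          moreover have "s \<le> q" "q \<le> t" using True by auto
          ultimately show ?thesis
            unfolding G1[OF \<open>s \<le> q\<close> \<open>q \<le> t\<close>, symmetric] by (simp add: inner_commute)
        next
          case False
          then have "a q = 0" "L q \<omega> = 0" by (auto simp: a_def L_def)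
          then show ?thesis by simp
        qed
      qed
      show "(\<lambda>q. a q \<bullet> H q -
          (g \<omega> + (\<integral>p. indicator {..<q} p *\<^sub>R a p \<partial>lborel) + (\<Sum>i\<in>J. if ?p i < q then b i else 0)) \<bullet> (- a q)) \<in> borel_measurable lborel"
        unfolding H_def by (rule borel_measurable_integrable, rule integrable_jump_parts[OF J a]) (use a in simp)
      show "(\<lambda>q. L q \<omega>) \<in> borel_measurable lborel" unfolding L_def by measurable
    qed
    also have "(\<Sum>i\<in>J. b i \<bullet> H (?p i) -
          (g \<omega> + (\<integral>p. indicator {..<?p i} p *\<^sub>R a p \<partial>lborel) + (\<Sum>j\<in>J. if ?p j < ?p i then b j else 0)) \<bullet> (- b i)) =
        (\<Sum>i\<in>J. M (?p i) (?d i))"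
    proof (rule sum.cong)
      fix i assume iJ: "i \<in> J"
      then have i: "i < length \<omega>" "s < ?p i" "?p i < t" by (auto simp: J_def jump_indices_def)
      \<comment> \<open>Points are distinct, so only the jump i happens at its time and the right
        limit exceeds the left one by \<open>b i\<close> alone.\<close>
      have "?p j = ?p i \<longleftrightarrow> j = i" if "j \<in> J" for j
        using that i(1) \<open>distinct \<omega>\<close> by (auto simp: J_def jump_indices_def nth_eq_iff_index_eq)
      then have "(\<Sum>j\<in>J. if ?p j = ?p i then b j else 0) = (\<Sum>j\<in>J. if j = i then b j else 0)"
        by (intro sum.cong) auto
      then have "H (?p i) = G (?p i) \<omega> + b i"
        using Hr[of "?p i"] i iJ J by simp
      moreover have "M (?p i) (?d i) = (norm (b i + G (?p i) \<omega>))\<^sup>2 - (norm (G (?p i) \<omega>))\<^sup>2"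
        unfolding M_def symmetric_delete[OF sG i(1)] using i by (simp add: b_def)
      moreover have "s \<le> ?p i" "?p i \<le> t" using i by auto
      ultimately show "b i \<bullet> H (?p i) -
          (g \<omega> + (\<integral>p. indicator {..<?p i} p *\<^sub>R a p \<partial>lborel) + (\<Sum>j\<in>J. if ?p j < ?p i then b j else 0)) \<bullet> (- b i) = M (?p i) (?d i)"
        unfolding G1[OF \<open>s \<le> ?p i\<close> \<open>?p i \<le> t\<close>, symmetric]
        by (simp add: power2_norm_eq_inner inner_add_left inner_add_right inner_commute)
    qed simp
    also have "(\<Sum>i\<in>J. M (?p i) (?d i)) = sum_delete M \<omega>"
      unfolding J_def by (rule sum_delete_jump_indices[symmetric]) (auto simp: M_def)
    finally show ?thesis .
  qed
  obtain C c R where *: "0 \<le> C" "1 \<le> c" "0 \<le> R"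
    "\<And>r \<omega>. norm (G r \<omega>) \<le> C * cutoff_power c R \<omega>" "\<And>r q \<omega>. norm (G r (\<omega> @ [q])) \<le> C * cutoff_power c R \<omega>"
    using dominated_bound[OF dG] by blast
  let ?D = "\<lambda>\<omega>. C * cutoff_power c R \<omega>"
  have D: "0 \<le> ?D \<omega>" for \<omega> using * by (simp add: cutoff_power_nonneg)
  have D2: "?D \<omega> * ?D \<omega> = C\<^sup>2 * cutoff_power (c\<^sup>2) R \<omega>" for \<omega>
    unfolding cutoff_power_square[symmetric] by (simp add: power2_eq_square)
  have L: "integrable (config_measure \<Otimes>\<^sub>M lborel) (\<lambda>(\<omega>, q). L q \<omega>)"
  proof (rule integrable_config_lborel)
    show "(\<lambda>(\<omega>, q). L q \<omega>) \<in> borel_measurable (config_measure \<Otimes>\<^sub>M lborel)"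
      unfolding L_def by measurable
    fix \<omega> q
    have "\<bar>G q \<omega> \<bullet> (B (G q \<omega>) + A\<^sub>m (G q (\<omega> @ [q])))\<bar> \<le> norm (G q \<omega>) * norm (B (G q \<omega>) + A\<^sub>m (G q (\<omega> @ [q])))"
      by (rule Cauchy_Schwarz_ineq2)
    also have "\<dots> \<le> ?D \<omega> * (norm B * ?D \<omega> + norm A\<^sub>m * ?D \<omega>)"
      using * D by (intro mult_mono order_trans[OF norm_triangle_ineq] add_mono order_trans[OF norm_blinfun] mult_left_mono) auto
    also have "\<dots> = (norm B + norm A\<^sub>m) * (?D \<omega> * ?D \<omega>)" by (simp add: algebra_simps)
    finally show "norm (L q \<omega>) \<le> (2 * (norm B + norm A\<^sub>m) * C\<^sup>2) * cutoff_power (c\<^sup>2) R \<omega> * indicator {s<..<t} q"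
      unfolding D2 by (auto simp: L_def indicator_def abs_mult algebra_simps)
  qed (use * in auto)
  have M: "integrable (config_measure \<Otimes>\<^sub>M lborel) (\<lambda>(\<omega>, q). M q \<omega>)"
  proof (rule integrable_config_lborel)
    show "(\<lambda>(\<omega>, q). M q \<omega>) \<in> borel_measurable (config_measure \<Otimes>\<^sub>M lborel)"
      unfolding M_def by measurable
    fix \<omega> q
    let ?N = "norm A\<^sub>1 + norm A\<^sub>0 + 1"
    have "norm (A\<^sub>1 (G q \<omega>) + A\<^sub>0 (G q (\<omega> @ [q])) + G q (\<omega> @ [q])) \<le> norm A\<^sub>1 * ?D \<omega> + norm A\<^sub>0 * ?D \<omega> + ?D \<omega>"
      using * D by (intro order_trans[OF norm_triangle_ineq] add_mono order_trans[OF norm_blinfun] mult_left_mono) auto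
    also have "\<dots> = ?N * ?D \<omega>" by (simp add: algebra_simps)
    finally have "(norm (A\<^sub>1 (G q \<omega>) + A\<^sub>0 (G q (\<omega> @ [q])) + G q (\<omega> @ [q])))\<^sup>2 \<le> (?N * ?D \<omega>)\<^sup>2"
      by (intro power_mono) auto
    moreover have "(norm (G q (\<omega> @ [q])))\<^sup>2 \<le> (?D \<omega>)\<^sup>2"
      using * by (intro power_mono) auto
    moreover have "(?N * ?D \<omega>)\<^sup>2 + (?D \<omega>)\<^sup>2 = (?N\<^sup>2 + 1) * C\<^sup>2 * cutoff_power (c\<^sup>2) R \<omega>"
      unfolding power_mult_distrib cutoff_power_square by (simp add: distrib_right)
    ultimately have "\<bar>(norm (A\<^sub>1 (G q \<omega>) + A\<^sub>0 (G q (\<omega> @ [q])) + G q (\<omega> @ [q])))\<^sup>2 - (norm (G q (\<omega> @ [q])))\<^sup>2\<bar>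
        \<le> (?N\<^sup>2 + 1) * C\<^sup>2 * cutoff_power (c\<^sup>2) R \<omega>"
      using zero_le_power2[of "norm (A\<^sub>1 (G q \<omega>) + A\<^sub>0 (G q (\<omega> @ [q])) + G q (\<omega> @ [q]))"]
        zero_le_power2[of "norm (G q (\<omega> @ [q]))"] zero_le_power2[of "?N * ?D \<omega>"] zero_le_power2[of "?D \<omega>"] by linarith
    then show "norm (M q \<omega>) \<le> ((?N\<^sup>2 + 1) * C\<^sup>2) * cutoff_power (c\<^sup>2) R \<omega> * indicator {s<..<t} q"
      by (auto simp: M_def indicator_def)
  qed (use * in auto)
  have LM: "integrable (config_measure \<Otimes>\<^sub>M lborel) (\<lambda>(\<omega>, q). L q \<omega> + M q \<omega>)"
    using Bochner_Integration.integrable_add[OF L M] by (simp add: case_prod_unfold)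
  have iG: "integrable config_measure (\<lambda>\<omega>. (norm (G t \<omega>))\<^sup>2)" and ig: "integrable config_measure (\<lambda>\<omega>. (norm (g \<omega>))\<^sup>2)"
    using integrable_dominated_inner[OF dG dG, of t t] integrable_dominated_inner[OF dG dG, of s s]
    by (simp_all add: g power2_norm_eq_inner)
  have "(\<integral>\<omega>. (norm (G t \<omega>))\<^sup>2 \<partial>config_measure) - (\<integral>\<omega>. (norm (g \<omega>))\<^sup>2 \<partial>config_measure) =
      (\<integral>\<omega>. (norm (G t \<omega>))\<^sup>2 - (norm (g \<omega>))\<^sup>2 \<partial>config_measure)"
    using iG ig by simp
  also have "\<dots> = (\<integral>\<omega>. (\<integral>q. L q \<omega> \<partial>lborel) + sum_delete M \<omega> \<partial>config_measure)"
  proof (rule integral_cong_AE)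
    show "AE \<omega> in config_measure. (norm (G t \<omega>))\<^sup>2 - (norm (g \<omega>))\<^sup>2 = (\<integral>q. L q \<omega> \<partial>lborel) + sum_delete M \<omega>"
      using AE_distinct_config by eventually_elim (rule pw)
  qed (use iG ig config_lborel.integrable_fst[OF L] integrable_sum_delete[OF M] in auto)
  \<comment> \<open>The sum-integral formula moves the jumps into the same double integral as the
    drift. The configuration before deletion is now \<open>\<omega> @ [q]\<close>, and the two
    integrands add up to Q.\<close>
  also have "\<dots> = (\<integral>(\<omega>, q). L q \<omega> \<partial>(config_measure \<Otimes>\<^sub>M lborel)) + (\<integral>(\<omega>, q). M q \<omega> \<partial>(config_measure \<Otimes>\<^sub>M lborel))"
    using config_lborel.integrable_fst[OF L] integrable_sum_delete[OF M]
    by (simp add: config_lborel.integral_fst[OF L] integral_sum_delete[OF M])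
  also have "\<dots> = (\<integral>(\<omega>, q). L q \<omega> + M q \<omega> \<partial>(config_measure \<Otimes>\<^sub>M lborel))"
    using Bochner_Integration.integral_add[OF L M] by (simp add: case_prod_unfold)
  also have "\<dots> = (\<integral>q. (\<integral>\<omega>. L q \<omega> + M q \<omega> \<partial>config_measure) \<partial>lborel)"
    by (rule config_lborel.integral_snd[OF LM, symmetric])
  also have "\<dots> = (\<integral>q. indicator {s<..<t} q * (\<integral>\<omega>. Q (G q \<omega>) (G q (\<omega> @ [q])) \<partial>config_measure) \<partial>lborel)"
    by (intro Bochner_Integration.integral_cong) (auto simp: L_def M_def Q_def indicator_def)
  finally show ?thesis .
qed

section \<open>The evolution kernel\<close>

lemma norm_blinfun_power:
  fixes A :: "'k :: real_normed_vector \<Rightarrow>\<^sub>L 'k"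
  shows "norm (((\<lambda>C. A o\<^sub>L C) ^^ n) id_blinfun) \<le> norm A ^ n"
proof (induction n)
  case 0
  show ?case by (simp add: norm_blinfun_id_le)
next
  case (Suc n)
  then show ?case
    by (auto intro!: order_trans[OF norm_blinfun_compose] mult_left_mono)
qed

lemma blinfun_power_scaleR:
  fixes A :: "'k :: real_normed_vector \<Rightarrow>\<^sub>L 'k"
  shows "((\<lambda>C. (c *\<^sub>R A) o\<^sub>L C) ^^ n) id_blinfun = c ^ n *\<^sub>R ((\<lambda>C. A o\<^sub>L C) ^^ n) id_blinfun"
  by (induction n) (simp_all add: bounded_bilinear.scaleR_left[OF bounded_bilinear_blinfun_compose]
    bounded_bilinear.scaleR_right[OF bounded_bilinear_blinfun_compose])

lemma summable_blinfun_exp: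
  fixes A :: "'k :: real_normed_vector \<Rightarrow>\<^sub>L 'k"
  shows "summable (\<lambda>n. norm ((1 / fact n) *\<^sub>R ((\<lambda>C. A o\<^sub>L C) ^^ n) id_blinfun))"
proof (rule summable_comparison_test)
  show "\<exists>N. \<forall>n\<ge>N. norm (norm ((1 / fact n) *\<^sub>R ((\<lambda>C. A o\<^sub>L C) ^^ n) id_blinfun)) \<le> norm A ^ n /\<^sub>R fact n"
    using norm_blinfun_power[of _ A] by (auto simp: divide_inverse intro!: exI[of _ 0] mult_left_mono)
  show "summable (\<lambda>n. norm A ^ n /\<^sub>R fact n)"
    by (rule summable_exp_generic)
qed

lemma norm_blinfun_exp:
  fixes A :: "'k :: banach \<Rightarrow>\<^sub>L 'k"
  shows "norm (blinfun_exp A) \<le> exp (norm A)"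
proof -
  have "norm (blinfun_exp A) \<le> (\<Sum>n. norm ((1 / fact n) *\<^sub>R ((\<lambda>C. A o\<^sub>L C) ^^ n) id_blinfun))"
    unfolding blinfun_exp_def by (rule summable_norm[OF summable_blinfun_exp])
  also have "\<dots> \<le> (\<Sum>n. norm A ^ n /\<^sub>R fact n)"
    using norm_blinfun_power[of _ A]
    by (intro suminf_le summable_blinfun_exp summable_exp_generic) (auto simp: divide_inverse intro!: mult_left_mono)
  finally show ?thesis by (simp add: exp_def)
qed

lemma blinfun_exp_sums:
  fixes B :: "'k :: banach \<Rightarrow>\<^sub>L 'k"
  shows "(\<lambda>n. (r ^ n / fact n) *\<^sub>R (((\<lambda>C. B o\<^sub>L C) ^^ n) id_blinfun) x) sums blinfun_exp (r *\<^sub>R B) x"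
proof -
  have "(\<lambda>n. (1 / fact n) *\<^sub>R ((\<lambda>C. (r *\<^sub>R B) o\<^sub>L C) ^^ n) id_blinfun) sums blinfun_exp (r *\<^sub>R B)"
    unfolding blinfun_exp_def by (rule summable_sums[OF summable_norm_cancel[OF summable_blinfun_exp]])
  from bounded_linear.sums[OF blinfun.bounded_linear_left[of x] this]
  show ?thesis by (simp add: blinfun_power_scaleR blinfun.scaleR_left)
qed

lemma blinfun_exp_zero: "blinfun_exp 0 x = (x :: 'k :: banach)"
proof -
  have "(\<lambda>n. (0 ^ n / fact n) *\<^sub>R (((\<lambda>C. 0 o\<^sub>L C) ^^ n) id_blinfun) x) sums blinfun_exp (0 *\<^sub>R 0) x"
    by (rule blinfun_exp_sums)
  moreover have "(\<lambda>n. (0 ^ n / fact n) *\<^sub>R (((\<lambda>C. 0 o\<^sub>L C) ^^ n) id_blinfun) x) = (\<lambda>n. if n = 0 then x else 0)"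
    by (auto simp: fun_eq_iff)
  moreover have "(\<lambda>n. if n = 0 then x else 0) sums x"
    by (rule sums_single)
  ultimately show ?thesis by (auto dest: sums_unique2)
qed

text \<open>Applied to a vector, the exponential is a pointwise limit of measurable partial sums in
  a separable space. The operators with their norm form in general no separable space, so
  measurability of kernels is always stated after application to a vector.\<close>

lemma measurable_blinfun_exp [measurable (raw)]:
  fixes B :: "'k :: {banach, second_countable_topology} \<Rightarrow>\<^sub>L 'k"
  assumes [measurable]: "f \<in> borel_measurable M" "v \<in> borel_measurable M"
  shows "(\<lambda>m. blinfun_exp (f m *\<^sub>R B) (v m)) \<in> borel_measurable M"
proof (rule borel_measurable_LIMSEQ_metric)
  show "(\<lambda>m. \<Sum>n<N. (f m ^ n / fact n) *\<^sub>R (((\<lambda>C. B o\<^sub>L C) ^^ n) id_blinfun) (v m)) \<in> borel_measurable M" for N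
    by measurable
  show "(\<lambda>N. \<Sum>n<N. (f m ^ n / fact n) *\<^sub>R (((\<lambda>C. B o\<^sub>L C) ^^ n) id_blinfun) (v m)) \<longlonglongrightarrow> blinfun_exp (f m *\<^sub>R B) (v m)" for m
    using blinfun_exp_sums[of "f m" B "v m"] by (simp add: sums_def)
qed

lemma blinfun_exp_inner_series:
  fixes B :: "'k :: {banach, real_inner} \<Rightarrow>\<^sub>L 'k"
  shows "(\<lambda>n. (((\<lambda>C. B o\<^sub>L C) ^^ n) id_blinfun) x \<bullet> y / fact n * r ^ n) sums (blinfun_exp (r *\<^sub>R B) x \<bullet> y)"
  using bounded_linear.sums[OF bounded_linear_inner_left[of y] blinfun_exp_sums[of r B x]] by (simp add: mult.commute)

text \<open>Tested against y, the exponential is a real power series in r, to which termwise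
  differentiation applies; the derivative is again a series of this kind.\<close>

lemma has_derivative_blinfun_exp_inner:
  fixes B :: "'k :: {banach, real_inner} \<Rightarrow>\<^sub>L 'k"
  shows "((\<lambda>r. blinfun_exp (r *\<^sub>R B) x \<bullet> y) has_real_derivative B (blinfun_exp (r *\<^sub>R B) x) \<bullet> y) (at r)"
    and "isCont (\<lambda>r. B (blinfun_exp (r *\<^sub>R B) x) \<bullet> y) r"
proof -
  let ?P = "\<lambda>n. ((\<lambda>C. B o\<^sub>L C) ^^ n) id_blinfun"
  let ?c = "\<lambda>n. ?P n x \<bullet> y / fact n"
  have sums: "(\<lambda>n. ?c n * r ^ n) sums (blinfun_exp (r *\<^sub>R B) x \<bullet> y)" for r
    by (rule blinfun_exp_inner_series)
  have D: "diffs ?c = (\<lambda>n. B (?P n x) \<bullet> y / fact n)"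
    by (auto simp: diffs_def fun_eq_iff field_simps simp del: of_nat_Suc)
  have sums': "(\<lambda>n. B (?P n x) \<bullet> y / fact n * r ^ n) sums (B (blinfun_exp (r *\<^sub>R B) x) \<bullet> y)" for r
    using bounded_linear.sums[OF bounded_linear_compose[OF bounded_linear_inner_left[of y] blinfun.bounded_linear_right[of B]] blinfun_exp_sums[of r B x]]
    by (simp add: mult.commute blinfun.scaleR_right)
  have "((\<lambda>r. \<Sum>n. ?c n * r ^ n) has_real_derivative (\<Sum>n. diffs ?c n * r ^ n)) (at r)"
    by (rule termdiffs_strong_converges_everywhere) (rule sums_summable[OF sums])
  then show "((\<lambda>r. blinfun_exp (r *\<^sub>R B) x \<bullet> y) has_real_derivative B (blinfun_exp (r *\<^sub>R B) x) \<bullet> y) (at r)"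
    unfolding D sums_unique[OF sums, symmetric] sums_unique[OF sums', symmetric] .
  have "isCont (\<lambda>r. \<Sum>n. B (?P n x) \<bullet> y / fact n * r ^ n) r"
    by (rule isCont_powser_converges_everywhere) (rule sums_summable[OF sums'])
  then show "isCont (\<lambda>r. B (blinfun_exp (r *\<^sub>R B) x) \<bullet> y) r"
    unfolding sums_unique[OF sums', symmetric] .
qed

lemma integrable_blinfun_exp:
  fixes B :: "'k :: {banach, second_countable_topology} \<Rightarrow>\<^sub>L 'k"
  shows "integrable lborel (\<lambda>q. indicator {m<..<r} q *\<^sub>R B (blinfun_exp ((q - m) *\<^sub>R B) x))"
proof (rule Bochner_Integration.integrable_bound)
  let ?K = "norm B * (exp (\<bar>r - m\<bar> * norm B) * norm x)"
  show "integrable lborel (\<lambda>q. ?K * indicator {m<..<r} q)"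
    by (cases "m \<le> r") auto
  have "norm (B (blinfun_exp ((q - m) *\<^sub>R B) x)) \<le> ?K" if "m < q" "q < r" for q
  proof -
    have "norm (blinfun_exp ((q - m) *\<^sub>R B)) \<le> exp (\<bar>r - m\<bar> * norm B)"
      using that by (intro order_trans[OF norm_blinfun_exp]) (auto intro!: mult_right_mono)
    then show ?thesis
      by (intro order_trans[OF norm_blinfun] mult_left_mono mult_right_mono) auto
  qed
  then show "AE q in lborel. norm (indicator {m<..<r} q *\<^sub>R B (blinfun_exp ((q - m) *\<^sub>R B) x)) \<le> norm (?K * indicator {m<..<r} q)"
    by (auto simp: indicator_def intro!: AE_I2)
qed measurable

text \<open>The fundamental theorem of calculus for the inner products with all y.\<close>

lemma integral_blinfun_exp:
  fixes B :: "'k :: {banach, second_countable_topology, real_inner} \<Rightarrow>\<^sub>L 'k"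
  assumes "m \<le> r"
  shows "(\<integral>q. indicator {m<..<r} q *\<^sub>R B (blinfun_exp ((q - m) *\<^sub>R B) x) \<partial>lborel) = blinfun_exp ((r - m) *\<^sub>R B) x - x"
proof -
  have "(\<integral>q. indicator {m<..<r} q *\<^sub>R B (blinfun_exp ((q - m) *\<^sub>R B) x) \<partial>lborel) \<bullet> y = (blinfun_exp ((r - m) *\<^sub>R B) x - x) \<bullet> y" for y
  proof -
    let ?f = "\<lambda>q. B (blinfun_exp ((q - m) *\<^sub>R B) x) \<bullet> y"
    have "(\<integral>q. indicator {m<..<r} q *\<^sub>R B (blinfun_exp ((q - m) *\<^sub>R B) x) \<partial>lborel) \<bullet> y =
        (\<integral>q. (indicator {m<..<r} q *\<^sub>R B (blinfun_exp ((q - m) *\<^sub>R B) x)) \<bullet> y \<partial>lborel)"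
      by (rule integral_inner_left[symmetric]) (rule integrable_blinfun_exp)
    also have "\<dots> = (\<integral>q. ?f q * indicator {m..r} q \<partial>lborel)"
    proof (rule integral_cong_AE)
      show "AE q in lborel. (indicator {m<..<r} q *\<^sub>R B (blinfun_exp ((q - m) *\<^sub>R B) x)) \<bullet> y = ?f q * indicator {m..r} q"
        using AE_lborel_singleton[of m] AE_lborel_singleton[of r] by eventually_elim (auto simp: indicator_def)
    qed measurable
    also have "\<dots> = blinfun_exp ((r - m) *\<^sub>R B) x \<bullet> y - blinfun_exp ((m - m) *\<^sub>R B) x \<bullet> y"
    proof (rule integral_FTC_Icc_real[OF assms])
      fix q
      show "((\<lambda>q. blinfun_exp ((q - m) *\<^sub>R B) x \<bullet> y) has_real_derivative ?f q) (at q)"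
      proof -
        have "((\<lambda>q. q - m) has_real_derivative 1) (at q)" by (auto intro!: derivative_eq_intros)
        from DERIV_chain2[where f = "\<lambda>r. blinfun_exp (r *\<^sub>R B) x \<bullet> y", OF has_derivative_blinfun_exp_inner(1) this]
        show ?thesis by simp
      qed
      show "isCont ?f q"
        using isCont_o2[of q "\<lambda>q. q - m", OF _ has_derivative_blinfun_exp_inner(2)] by simp
    qed
    finally show ?thesis by (simp add: blinfun_exp_zero inner_diff_left)
  qed
  then show ?thesis using vector_eq_rdot by blast
qed

section \<open>The kernel as a function of labelled points\<close>

text \<open>A point carries the operator that acts at its time, in place of membership in one of
  three lists. The kernel becomes a function of one multiset, and deletions need no case distinction
  by type.\<close>

definition typed_kernel ::
  "('k :: real_normed_vector \<Rightarrow>\<^sub>L 'k) \<Rightarrow> real \<Rightarrow> real \<Rightarrow> (real \<times> ('k \<Rightarrow>\<^sub>L 'k)) list \<Rightarrow> ('k \<Rightarrow>\<^sub>L 'k)" where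
  "typed_kernel B s r ps = (if distinct (map fst ps) \<and> fst ` set ps \<subseteq> {s<..<r}
    then ordered_product B s r (sort_key fst ps) else 0)"

text \<open>With distinct times the sorted list is determined by the multiset; with a repeated time
  both kernels vanish.\<close>

lemma typed_kernel_eqI:
  assumes "mset ps = mset qs" shows "typed_kernel B s r ps = typed_kernel B s r qs"
proof -
  have "distinct (map fst ps) \<longleftrightarrow> distinct (map fst qs)"
    using assms by (metis mset_eq_imp_distinct_iff mset_map)
  moreover have "set ps = set qs" using assms by (metis set_mset_mset)
  moreover have "sort_key fst ps = sort_key fst qs" if "distinct (map fst ps)"
    using that assms by (intro sort_key_inj_key_eq) (auto simp: distinct_map)
  ultimately show ?thesis by (simp add: typed_kernel_def)
qed

text \<open>The defining recursion peels off the earliest factor, whereas an equation in the end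
  time r needs the latest one.\<close>

lemma ordered_product_snoc:
  "ordered_product B s r (ps @ [(m, A)]) = blinfun_exp ((r - m) *\<^sub>R B) o\<^sub>L A o\<^sub>L ordered_product B s m ps"
proof (induction ps arbitrary: s)
  case (Cons p ps)
  then show ?case by (cases p) (simp add: blinfun_eqI)
qed simp

text \<open>As m is later than every time in \<open>ps\<close>, the interval (s,r) may be shortened
  to (s,m) for \<open>ps\<close>, and appending m keeps the sorted list sorted.\<close>

lemma typed_kernel_snoc:
  assumes "\<And>p. p \<in> set ps \<Longrightarrow> fst p < m" "s < m" "m < r"
  shows "typed_kernel B s r (ps @ [(m, A)]) = blinfun_exp ((r - m) *\<^sub>R B) o\<^sub>L A o\<^sub>L typed_kernel B s m ps"
proof -
  have 1: "distinct (map fst (ps @ [(m, A)])) \<and> fst ` set (ps @ [(m, A)]) \<subseteq> {s<..<r} \<longleftrightarrow>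
      distinct (map fst ps) \<and> fst ` set ps \<subseteq> {s<..<m}"
    using assms by (fastforce simp: image_subset_iff)
  have 2: "sort_key fst (ps @ [(m, A)]) = sort_key fst ps @ [(m, A)]" if "distinct (map fst ps)"
  proof (rule sort_key_inj_key_eq)
    show "inj_on fst (set (ps @ [(m, A)]))"
      using that assms(1) by (fastforce simp: distinct_map inj_on_def)
    show "sorted (map fst (sort_key fst ps @ [(m, A)]))"
      using assms(1) by (auto simp: sorted_append intro: less_imp_le)
  qed simp
  show ?thesis
  proof (cases "distinct (map fst ps) \<and> fst ` set ps \<subseteq> {s<..<m}")
    case True
    have "typed_kernel B s r (ps @ [(m, A)]) = ordered_product B s r (sort_key fst (ps @ [(m, A)]))"
      unfolding typed_kernel_def by (rule if_P) (use 1 True in blast)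
    moreover have "typed_kernel B s m ps = ordered_product B s m (sort_key fst ps)"
      unfolding typed_kernel_def by (rule if_P) (rule True)
    ultimately show ?thesis
      using 2 True by (simp only: ordered_product_snoc)
  next
    case False
    have "typed_kernel B s r (ps @ [(m, A)]) = 0"
      unfolding typed_kernel_def by (rule if_not_P) (use 1 False in blast)
    moreover have "typed_kernel B s m ps = 0"
      unfolding typed_kernel_def by (rule if_not_P) (rule False)
    ultimately show ?thesis by (simp add: blinfun_eqI)
  qed
qed

lemma typed_kernel_eq_0: "p \<in> set ps \<Longrightarrow> \<not> (s < fst p \<and> fst p < r) \<Longrightarrow> typed_kernel B s r ps = 0"
  by (auto simp: typed_kernel_def)

text \<open>A symmetric h depends on the remainder through its multiset only, so the sum can be
  rewritten as one over the multiset of points.\<close>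

lemma sum_delete_eqI:
  assumes "mset xs = mset ys" and sym: "\<And>x zs zs'. mset zs = mset zs' \<Longrightarrow> h x zs = h x zs'"
  shows "sum_delete h xs = sum_delete h ys"
proof -
  \<comment> \<open>\<open>SOME\<close> picks a list that represents M; by symmetry every choice
    gives the same value.\<close>
  define k where "k x M = h x (SOME zs. mset zs = M)" for x M
  have k: "h x zs = k x (mset zs)" for x zs
    unfolding k_def by (rule sym) (rule someI[of "\<lambda>l. mset l = mset zs" zs, symmetric, OF refl])
  have "sum_delete h xs = sum_mset (image_mset (\<lambda>x. k x (mset xs - {#x#})) (mset xs))" for xs
  proof -
    have "sum_delete h xs = (\<Sum>i<length xs. k (xs ! i) (mset xs - {#xs ! i#}))"
      unfolding sum_delete_def
    proof (rule sum.cong)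
      fix i assume "i \<in> {..<length xs}"
      then have "mset ((take i xs @ drop (Suc i) xs) @ [xs ! i]) = mset xs"
        by (intro mset_delete) simp
      then have "mset (take i xs @ drop (Suc i) xs) + {#xs ! i#} = mset xs"
        by (simp only: mset_append[of _ "[_]"] mset_single_iff_right mset.simps add_mset_add_single[symmetric] empty_neutral)
      then have "mset (take i xs @ drop (Suc i) xs) = mset xs - {#xs ! i#}"
        by (rule add_diff_cancel_right'[symmetric, THEN trans, OF arg_cong[where f = "\<lambda>M. M - {#xs ! i#}"]])
      then show "h (xs ! i) (take i xs @ drop (Suc i) xs) = k (xs ! i) (mset xs - {#xs ! i#})"
        by (simp only: k)
    qed simp
    also have "\<dots> = sum_list (map (\<lambda>x. k x (mset xs - {#x#})) xs)"
      by (simp add: sum_list_sum_nth atLeast0LessThan)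
    finally show ?thesis by (simp only: sum_mset_sum_list mset_map[symmetric])
  qed
  then show ?thesis using assms(1) by simp
qed

text \<open>Either no configuration of the list contributes up to time \<open>r\<close>, or the point \<open>m\<close> with the
  latest time splits off.\<close>

lemma typed_kernel_last:
  assumes "ps \<noteq> []" and F: "\<And>q. F q 0 = 0"
  obtains (zero) "\<And>q. q \<le> r \<Longrightarrow> typed_kernel B s q ps = 0"
      "sum_delete (\<lambda>(q, A) ps'. if s < q \<and> q < r then F q (blinfun_apply A (typed_kernel B s q ps' v)) else 0) ps = 0"
    | (last) m A ps' where "s < m" "m < r" "length ps' < length ps"
      "\<And>q. q \<le> r \<Longrightarrow> typed_kernel B s q ps =
        (if m < q then blinfun_exp ((q - m) *\<^sub>R B) o\<^sub>L A o\<^sub>L typed_kernel B s m ps' else 0)"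
      "sum_delete (\<lambda>(q, A) ps'. if s < q \<and> q < r then F q (blinfun_apply A (typed_kernel B s q ps' v)) else 0) ps =
        F m (A (typed_kernel B s m ps' v))"
proof (cases "distinct (map fst ps)")
  case False
  show thesis
  proof (rule zero)
    show "typed_kernel B s q ps = 0" for q using False by (simp add: typed_kernel_def)
    show "sum_delete (\<lambda>(q, A) ps'. if s < q \<and> q < r then F q (blinfun_apply A (typed_kernel B s q ps' v)) else 0) ps = 0"
    proof (rule sum_delete_neutral, clarify)
      fix q and A :: "'a \<Rightarrow>\<^sub>L 'a" and ps' assume "mset (ps' @ [(q, A)]) = mset ps"
      then have "\<not> distinct (map fst (ps' @ [(q, A)]))"
        using False by (metis mset_eq_imp_distinct_iff mset_map)
      \<comment> \<open>A repeated time either survives in the remainder or is the time q itself,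
        and a kernel with end time q admits only points before q.\<close>
      then have "typed_kernel B s q ps' = 0"
        by (auto simp: typed_kernel_def)
      then show "(if s < q \<and> q < r then F q (blinfun_apply A (typed_kernel B s q ps' v)) else 0) = 0"
        by (simp add: F)
    qed
  qed
next
  case True
  let ?h = "\<lambda>(q, A) ps'. if s < q \<and> q < r then F q (blinfun_apply A (typed_kernel B s q ps' v)) else 0"
  obtain ps' m A where srt: "sort_key fst ps = ps' @ [(m, A)]"
    using \<open>ps \<noteq> []\<close> by (metis length_sort length_0_conv rev_exhaust surj_pair)
  then have ms: "mset ps = mset (ps' @ [(m, A)])" by (metis mset_sort)
  have "sorted (map fst (ps' @ [(m, A)]))" using srt by (metis sorted_sort_key)
  moreover have "distinct (map fst (ps' @ [(m, A)]))" using True ms by (metis mset_eq_imp_distinct_iff mset_map)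
  ultimately have less: "fst p < m" if "p \<in> set ps'" for p
    using that by (force simp: sorted_append less_le)
  have len: "length ps' < length ps"
    using mset_eq_length[OF ms] by simp
  have "?h x zs = ?h x zs'" if "mset zs = mset zs'" for x zs zs'
    by (cases x) (simp add: typed_kernel_eqI[OF that])
  then have "sum_delete ?h ps = sum_delete ?h (ps' @ [(m, A)])"
    by (intro sum_delete_eqI[OF ms]) blast
  also have "\<dots> = ?h (m, A) ps'"
  proof -
    \<comment> \<open>Deleting an earlier point q leaves m behind, beyond the end time q of the
      remaining kernel.\<close>
    have "sum_delete (\<lambda>p xs. ?h p (xs @ [(m, A)])) ps' = 0"
    proof (rule sum_delete_neutral, clarify)
      fix q and C :: "'a \<Rightarrow>\<^sub>L 'a" and xs assume "mset (xs @ [(q, C)]) = mset ps'"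
      then have "(q, C) \<in> set ps'" by (metis in_set_conv_decomp set_mset_mset)
      then have "q < m" using less by force
      then have "typed_kernel B s q (xs @ [(m, A)]) = 0"
        by (intro typed_kernel_eq_0[of "(m, A)"]) auto
      then show "(if s < q \<and> q < r then F q (blinfun_apply C (typed_kernel B s q (xs @ [(m, A)]) v)) else 0) = 0"
        by (simp add: F)
    qed
    then show ?thesis by (simp add: sum_delete_snoc)
  qed
  finally have sd: "sum_delete ?h ps = ?h (m, A) ps'" .
  have mem: "(m, A) \<in> set ps" using ms by (metis in_set_conv_decomp set_mset_mset)
  show thesis
  proof (cases "s < m \<and> m < r")
    case True
    show thesis
    proof (rule last)
      fix q
      show "typed_kernel B s q ps = (if m < q then blinfun_exp ((q - m) *\<^sub>R B) o\<^sub>L A o\<^sub>L typed_kernel B s m ps' else 0)"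
        using True less typed_kernel_eq_0[OF mem, of s q B]
        by (simp add: typed_kernel_eqI[OF ms] typed_kernel_snoc)
    qed (use True sd len in auto)
  next
    case False
    show thesis
    proof (rule zero)
      show "typed_kernel B s q ps = 0" if "q \<le> r" for q
        using False that by (intro typed_kernel_eq_0[OF mem]) auto
      show "sum_delete ?h ps = 0" using False sd by auto
    qed
  qed
qed

lemma typed_kernel_Nil [simp]: "typed_kernel B s r [] = blinfun_exp ((r - s) *\<^sub>R B)"
  by (simp add: typed_kernel_def)

text \<open>After its last point m the kernel is the exponential flow started at the value right
  after the jump. The integral over (m,r) is the final value minus this starting value, which the
  sum over deletions supplies. Without points, v takes the place of the starting value.\<close>

lemma typed_kernel_integral_equation:
  fixes B :: "'k :: {banach, second_countable_topology, real_inner} \<Rightarrow>\<^sub>L 'k"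
  assumes "s \<le> r"
  shows "typed_kernel B s r ps v = (if ps = [] then v else 0) +
    (\<integral>q. indicator {s<..<r} q *\<^sub>R B (typed_kernel B s q ps v) \<partial>lborel) +
    sum_delete (\<lambda>(q, A) ps'. if s < q \<and> q < r then blinfun_apply A (typed_kernel B s q ps' v) else 0) ps"
proof (cases "ps = []")
  case True
  then show ?thesis using integral_blinfun_exp[OF assms, of B v] by simp
next
  case False
  then show ?thesis
  proof (cases rule: typed_kernel_last[where F = "\<lambda>_ x. x" and r = r and B = B and s = s and v = v, OF False refl, case_names zero last])
    case zero
    have "(\<lambda>q. indicator {s<..<r} q *\<^sub>R B (typed_kernel B s q ps v)) = (\<lambda>_. 0)"
      using zero(1) by (auto simp: indicator_def)
    with zero False show ?thesis by simp
  next
    case (last m A ps')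
    let ?x = "A (typed_kernel B s m ps' v)"
    have "(\<lambda>q. indicator {s<..<r} q *\<^sub>R B (typed_kernel B s q ps v)) = (\<lambda>q. indicator {m<..<r} q *\<^sub>R B (blinfun_exp ((q - m) *\<^sub>R B) ?x))"
      using last(1,2) last(4) by (auto simp: indicator_def fun_eq_iff)
    then have "(\<integral>q. indicator {s<..<r} q *\<^sub>R B (typed_kernel B s q ps v) \<partial>lborel) = blinfun_exp ((r - m) *\<^sub>R B) ?x - ?x"
      using last(2) by (simp add: integral_blinfun_exp)
    with last False show ?thesis by simp
  qed
qed

text \<open>Of all deletions at most that of the last point survives, and the exponential after it
  is put in explicitly. The formula contains no sorting, which makes it the basis for
  measurability.\<close>

lemma typed_kernel_recursion:
  assumes "ps \<noteq> []"
  shows "blinfun_apply (typed_kernel B s r ps) v =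
    sum_delete (\<lambda>(q, A) ps'. if s < q \<and> q < r then blinfun_exp ((r - q) *\<^sub>R B) (blinfun_apply A (typed_kernel B s q ps' v)) else 0) ps"
  using assms
proof (cases rule: typed_kernel_last[where F = "\<lambda>q x. blinfun_exp ((r - q) *\<^sub>R B) x" and r = r and B = B and s = s and v = v,
    OF assms blinfun.zero_right, case_names zero last])
  case zero
  then show ?thesis by simp
next
  case (last m A ps')
  then show ?thesis by simp
qed

lemma norm_ordered_product:
  fixes B :: "'k :: banach \<Rightarrow>\<^sub>L 'k"
  assumes "sorted (map fst ps)" "fst ` set ps \<subseteq> {s..r}" "s \<le> r" "\<And>p. p \<in> set ps \<Longrightarrow> norm (snd p) \<le> M" "0 \<le> M"
  shows "norm (ordered_product B s r ps) \<le> exp ((r - s) * norm B) * M ^ length ps"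
  using assms
proof (induction ps arbitrary: s)
  case Nil
  then show ?case using norm_blinfun_exp[of "(r - s) *\<^sub>R B"] by simp
next
  case (Cons p ps)
  obtain q A where p: "p = (q, A)" by (cases p)
  have q: "s \<le> q" "q \<le> r" "norm A \<le> M" using Cons.prems(1-3) Cons.prems(4)[of p] p by auto
  have 1: "norm (ordered_product B q r ps) \<le> exp ((r - q) * norm B) * M ^ length ps"
  proof (rule Cons.IH)
    show "fst ` set ps \<subseteq> {q..r}" using Cons.prems(1,2) p by fastforce
    show "norm (snd p') \<le> M" if "p' \<in> set ps" for p' using Cons.prems(4)[of p'] that by simp
  qed (use Cons.prems q p in auto)
  have 2: "norm (blinfun_exp ((q - s) *\<^sub>R B)) \<le> exp ((q - s) * norm B)"
    using norm_blinfun_exp[of "(q - s) *\<^sub>R B"] q by simp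
  have "norm (ordered_product B s r (p # ps)) \<le> norm (ordered_product B q r ps) * norm A * norm (blinfun_exp ((q - s) *\<^sub>R B))"
    unfolding p by (auto intro!: order_trans[OF norm_blinfun_compose] mult_right_mono)
  also have "\<dots> \<le> (exp ((r - q) * norm B) * M ^ length ps) * M * exp ((q - s) * norm B)"
    using 1 2 q \<open>0 \<le> M\<close> by (intro mult_mono) auto
  also have "\<dots> = exp ((r - q) * norm B + (q - s) * norm B) * M ^ length (p # ps)"
    by (simp add: exp_add)
  \<comment> \<open>The gaps add up to r - s, so the exponential factor does not grow with the
    number of points.\<close>
  also have "(r - q) * norm B + (q - s) * norm B = (r - s) * norm B"
    by (simp add: algebra_simps)
  finally show ?case .
qed

lemma norm_typed_kernel:
  fixes B :: "'k :: banach \<Rightarrow>\<^sub>L 'k"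
  assumes "s \<le> r" "\<And>p. p \<in> set ps \<Longrightarrow> norm (snd p) \<le> M" "0 \<le> M"
  shows "norm (typed_kernel B s r ps) \<le> exp ((r - s) * norm B) * M ^ length ps"
proof (cases "distinct (map fst ps) \<and> fst ` set ps \<subseteq> {s<..<r}")
  case True
  then have "norm (ordered_product B s r (sort_key fst ps)) \<le> exp ((r - s) * norm B) * M ^ length (sort_key fst ps)"
    using assms by (intro norm_ordered_product) force+
  with True show ?thesis by (simp add: typed_kernel_def)
next
  case False
  then have "typed_kernel B s r ps = 0" by (simp only: typed_kernel_def if_False)
  then show ?thesis using \<open>0 \<le> M\<close> by simp
qed

text \<open>Induction on the number of points through \<open>typed_kernel_recursion\<close>. The end
  time has to be a measurable function too, because the shorter kernels end at the deleted
  point.\<close>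

lemma measurable_typed_kernel_map:
  fixes B :: "'k :: {banach, second_countable_topology} \<Rightarrow>\<^sub>L 'k"
  assumes "\<And>f A. (f, A) \<in> set fs \<Longrightarrow> f \<in> borel_measurable M"
    and "r \<in> borel_measurable M" and [measurable]: "v \<in> borel_measurable M"
  shows "(\<lambda>m. typed_kernel B s (r m) (map (\<lambda>(f, A). (f m, A)) fs) (v m)) \<in> borel_measurable M"
  using assms(1,2)
proof (induction "length fs" arbitrary: fs r rule: less_induct)
  case less
  note [measurable] = less.prems(2)
  show ?case
  proof (cases "fs = []")
    case True
    then show ?thesis by simp
  next
    case False
    let ?d = "\<lambda>i. take i fs @ drop (Suc i) fs" and ?f = "\<lambda>i. fst (fs ! i)" and ?A = "\<lambda>i. snd (fs ! i)"
    have "(\<lambda>m. \<Sum>i<length fs. if s < ?f i m \<and> ?f i m < r m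
        then blinfun_exp ((r m - ?f i m) *\<^sub>R B) (?A i (typed_kernel B s (?f i m) (map (\<lambda>(f, A). (f m, A)) (?d i)) (v m))) else 0)
        \<in> borel_measurable M"
    proof (rule borel_measurable_sum)
      fix i assume i: "i \<in> {..<length fs}"
      then have [measurable]: "?f i \<in> borel_measurable M"
        by (intro less.prems(1)[of "?f i" "?A i"]) simp
      have "(f, A) \<in> set (?d i) \<Longrightarrow> (f, A) \<in> set fs" for f A
        by (auto dest: in_set_takeD in_set_dropD)
      then have [measurable]: "(\<lambda>m. typed_kernel B s (?f i m) (map (\<lambda>(f, A). (f m, A)) (?d i)) (v m)) \<in> borel_measurable M"
        using i less.prems(1) by (intro less.hyps) (simp, blast, measurable)
      show "(\<lambda>m. if s < ?f i m \<and> ?f i m < r m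
        then blinfun_exp ((r m - ?f i m) *\<^sub>R B) (?A i (typed_kernel B s (?f i m) (map (\<lambda>(f, A). (f m, A)) (?d i)) (v m))) else 0)
        \<in> borel_measurable M"
        by measurable
    qed
    also have "(\<lambda>m. \<Sum>i<length fs. if s < ?f i m \<and> ?f i m < r m
        then blinfun_exp ((r m - ?f i m) *\<^sub>R B) (?A i (typed_kernel B s (?f i m) (map (\<lambda>(f, A). (f m, A)) (?d i)) (v m))) else 0) =
      (\<lambda>m. typed_kernel B s (r m) (map (\<lambda>(f, A). (f m, A)) fs) (v m))"
    proof
      fix m
      have ne: "map (\<lambda>(f, A). (f m, A)) fs \<noteq> []" using False by simp
      show "(\<Sum>i<length fs. if s < ?f i m \<and> ?f i m < r m
        then blinfun_exp ((r m - ?f i m) *\<^sub>R B) (?A i (typed_kernel B s (?f i m) (map (\<lambda>(f, A). (f m, A)) (?d i)) (v m))) else 0) =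
        typed_kernel B s (r m) (map (\<lambda>(f, A). (f m, A)) fs) (v m)"
        unfolding typed_kernel_recursion[OF ne] sum_delete_def length_map
        by (intro sum.cong refl) (auto simp: take_map drop_map case_prod_unfold)
    qed
    finally show ?thesis .
  qed
qed

section \<open>Normal ordered operators as evolutions\<close>

text \<open>The third argument is the complement of the first and contains the second; it is the
  part of \<omega> that enters g in the normal ordered operator.\<close>

definition split_sum ::
  "(real list \<Rightarrow> real list \<Rightarrow> real list \<Rightarrow> 'b :: comm_monoid_add) \<Rightarrow> real list \<Rightarrow> 'b" where
  "split_sum \<Phi> \<omega> = (\<Sum>\<alpha>\<in>Pow {..<length \<omega>}. \<Sum>\<beta>\<in>Pow ({..<length \<omega>} - \<alpha>).
    \<Phi> (nths \<omega> \<alpha>) (nths \<omega> \<beta>) (nths \<omega> ({..<length \<omega>} - \<alpha>)))"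

lemma nths_cong: "(\<And>i. i < length xs \<Longrightarrow> i \<in> A \<longleftrightarrow> i \<in> B) \<Longrightarrow> nths xs A = nths xs B"
  unfolding nths_def by (rule arg_cong[where f = "map fst"], rule filter_cong) (auto simp: set_zip)

lemma nths_snoc: "nths (xs @ [x]) A = nths xs A @ (if length xs \<in> A then [x] else [])"
  by (simp add: nths_append nths_singleton)

lemma sum_Pow_insert:
  assumes "finite X" "n \<notin> X"
  shows "(\<Sum>\<alpha>\<in>Pow (insert n X). f \<alpha>) = (\<Sum>\<alpha>\<in>Pow X. f \<alpha> + f (insert n \<alpha>))"
proof -
  have "inj_on (insert n) (Pow X)"
    using assms(2) by (auto intro!: inj_onI dest: insert_ident[THEN iffD1, rotated -1])
  moreover have "Pow X \<inter> insert n ` Pow X = {}" using assms(2) by auto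
  ultimately show ?thesis
    using assms(1) by (simp add: Pow_insert sum.union_disjoint sum.reindex sum.distrib)
qed

lemma split_sum_Nil [simp]: "split_sum \<Phi> [] = \<Phi> [] [] []"
  by (simp add: split_sum_def)

text \<open>A further point has three places: in \<sigma>, in \<tau> and then also in \<rho>, or in
  \<rho> alone. The inductions below run along this recursion and avoid index sets.\<close>

lemma split_sum_snoc:
  "split_sum \<Phi> (\<omega> @ [q]) =
    split_sum (\<lambda>\<sigma> \<tau> \<rho>. \<Phi> (\<sigma> @ [q]) \<tau> \<rho> + \<Phi> \<sigma> (\<tau> @ [q]) (\<rho> @ [q]) + \<Phi> \<sigma> \<tau> (\<rho> @ [q])) \<omega>"
proof -
  let ?n = "length \<omega>"
  let ?f = "\<lambda>\<alpha> \<beta>. \<Phi> (nths (\<omega> @ [q]) \<alpha>) (nths (\<omega> @ [q]) \<beta>) (nths (\<omega> @ [q]) ({..<Suc ?n} - \<alpha>))"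
  have "split_sum \<Phi> (\<omega> @ [q]) = (\<Sum>\<alpha>\<in>Pow (insert ?n {..<?n}). \<Sum>\<beta>\<in>Pow ({..<Suc ?n} - \<alpha>). ?f \<alpha> \<beta>)"
    by (simp add: split_sum_def lessThan_Suc)
  also have "\<dots> = (\<Sum>\<alpha>\<in>Pow {..<?n}. (\<Sum>\<beta>\<in>Pow ({..<Suc ?n} - \<alpha>). ?f \<alpha> \<beta>) +
      (\<Sum>\<beta>\<in>Pow ({..<Suc ?n} - insert ?n \<alpha>). ?f (insert ?n \<alpha>) \<beta>))"
    by (rule sum_Pow_insert) auto
  also have "\<dots> = split_sum (\<lambda>\<sigma> \<tau> \<rho>. \<Phi> (\<sigma> @ [q]) \<tau> \<rho> + \<Phi> \<sigma> (\<tau> @ [q]) (\<rho> @ [q]) + \<Phi> \<sigma> \<tau> (\<rho> @ [q])) \<omega>"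
    unfolding split_sum_def
  proof (rule sum.cong[OF refl])
    fix \<alpha> assume "\<alpha> \<in> Pow {..<?n}"
    then have \<alpha>: "\<alpha> \<subseteq> {..<?n}" "?n \<notin> \<alpha>" by auto
    let ?c = "{..<?n} - \<alpha>"
    have c: "{..<Suc ?n} - \<alpha> = insert ?n ?c" "{..<Suc ?n} - insert ?n \<alpha> = ?c" "?n \<notin> ?c"
      using \<alpha> by auto
    have i: "nths \<omega> (insert ?n X) = nths \<omega> X" for X
      by (rule nths_cong) auto
    have "(\<Sum>\<beta>\<in>Pow ({..<Suc ?n} - \<alpha>). ?f \<alpha> \<beta>) = (\<Sum>\<beta>\<in>Pow ?c. ?f \<alpha> \<beta> + ?f \<alpha> (insert ?n \<beta>))"
      unfolding c(1) by (subst sum_Pow_insert) auto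
    also have "\<dots> = (\<Sum>\<beta>\<in>Pow ?c. \<Phi> (nths \<omega> \<alpha>) (nths \<omega> \<beta>) (nths \<omega> ?c @ [q]) + \<Phi> (nths \<omega> \<alpha>) (nths \<omega> \<beta> @ [q]) (nths \<omega> ?c @ [q]))"
      using \<alpha> by (intro sum.cong refl) (auto simp: nths_snoc c i)
    finally have 1: "(\<Sum>\<beta>\<in>Pow ({..<Suc ?n} - \<alpha>). ?f \<alpha> \<beta>) = \<dots>" .
    have 2: "(\<Sum>\<beta>\<in>Pow ({..<Suc ?n} - insert ?n \<alpha>). ?f (insert ?n \<alpha>) \<beta>) = (\<Sum>\<beta>\<in>Pow ?c. \<Phi> (nths \<omega> \<alpha> @ [q]) (nths \<omega> \<beta>) (nths \<omega> ?c))"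
      unfolding c(2) using \<alpha> by (intro sum.cong refl) (auto simp: nths_snoc c i)
    show "(\<Sum>\<beta>\<in>Pow ({..<Suc ?n} - \<alpha>). ?f \<alpha> \<beta>) + (\<Sum>\<beta>\<in>Pow ({..<Suc ?n} - insert ?n \<alpha>). ?f (insert ?n \<alpha>) \<beta>) =
        (\<Sum>\<beta>\<in>Pow ?c. \<Phi> (nths \<omega> \<alpha> @ [q]) (nths \<omega> \<beta>) (nths \<omega> ?c) + \<Phi> (nths \<omega> \<alpha>) (nths \<omega> \<beta> @ [q]) (nths \<omega> ?c @ [q]) +
          \<Phi> (nths \<omega> \<alpha>) (nths \<omega> \<beta>) (nths \<omega> ?c @ [q]))"
      unfolding 1 2 by (simp add: sum.distrib add_ac)
  qed
  finally show ?thesis .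
qed

lemma split_sum_add:
  "split_sum (\<lambda>\<sigma> \<tau> \<rho>. \<Phi> \<sigma> \<tau> \<rho> + \<Psi> \<sigma> \<tau> \<rho>) \<omega> = split_sum \<Phi> \<omega> + split_sum \<Psi> \<omega>"
  by (simp add: split_sum_def sum.distrib)

lemma split_sum_linear:
  assumes "linear f" shows "f (split_sum \<Phi> \<omega>) = split_sum (\<lambda>\<sigma> \<tau> \<rho>. f (\<Phi> \<sigma> \<tau> \<rho>)) \<omega>"
  by (simp add: split_sum_def linear_sum[OF assms])

lemma split_sum_zero [simp]: "split_sum (\<lambda>_ _ _. 0) \<omega> = 0"
  by (simp add: split_sum_def)

lemma integral_split_sum:
  fixes \<Phi> :: "'m \<Rightarrow> real list \<Rightarrow> real list \<Rightarrow> real list \<Rightarrow> 'b :: {banach, second_countable_topology}"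
  assumes "\<And>\<sigma> \<tau> \<rho>. integrable M (\<lambda>m. \<Phi> m \<sigma> \<tau> \<rho>)"
  shows "(\<integral>m. split_sum (\<Phi> m) \<omega> \<partial>M) = split_sum (\<lambda>\<sigma> \<tau> \<rho>. \<integral>m. \<Phi> m \<sigma> \<tau> \<rho> \<partial>M) \<omega>"
  unfolding split_sum_def using assms by simp

lemma split_sum_initial:
  "split_sum (\<lambda>\<sigma> \<tau> \<rho>. if \<sigma> = [] \<and> \<tau> = [] then g \<rho> else 0) \<omega> = g \<omega>"
proof (induction \<omega> arbitrary: g rule: rev_induct)
  case (snoc q \<omega>)
  from snoc[of "\<lambda>\<rho>. g (\<rho> @ [q])"] show ?case by (simp add: split_sum_snoc)
qed simp

text \<open>Decomposing \<omega> and then marking a point of \<sigma> counts the same data as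
  removing the point from \<omega> and then decomposing the rest.\<close>

lemma split_sum_delete1:
  "split_sum (\<lambda>\<sigma> \<tau> \<rho>. sum_delete (\<lambda>q \<sigma>'. \<psi> q \<sigma>' \<tau> \<rho>) \<sigma>) \<omega> = sum_delete (\<lambda>q. split_sum (\<psi> q)) \<omega>"
proof (induction \<omega> arbitrary: \<psi> rule: rev_induct)
  case (snoc q \<omega>)
  have "split_sum (\<lambda>\<sigma> \<tau> \<rho>. sum_delete (\<lambda>q \<sigma>'. \<psi> q \<sigma>' \<tau> \<rho>) \<sigma>) (\<omega> @ [q]) =
      split_sum (\<lambda>\<sigma> \<tau> \<rho>. sum_delete (\<lambda>p \<sigma>'. \<psi> p (\<sigma>' @ [q]) \<tau> \<rho> + \<psi> p \<sigma>' (\<tau> @ [q]) (\<rho> @ [q]) + \<psi> p \<sigma>' \<tau> (\<rho> @ [q])) \<sigma>) \<omega> +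
      split_sum (\<psi> q) \<omega>"
    by (simp add: split_sum_snoc sum_delete_snoc split_sum_add sum_delete_add add_ac)
  then show ?case
    by (simp add: snoc sum_delete_snoc split_sum_snoc)
qed simp

text \<open>As for \<sigma>, except that a point of \<tau> also belongs to \<rho>: after its removal
  from \<omega> it is put back at the end of \<rho>, and symmetry in \<rho> absorbs the change of
  position.\<close>

lemma split_sum_delete2:
  assumes "\<And>q \<sigma> \<tau>. symmetric (\<psi> q \<sigma> \<tau>)"
  shows "split_sum (\<lambda>\<sigma> \<tau> \<rho>. sum_delete (\<lambda>q \<tau>'. \<psi> q \<sigma> \<tau>' \<rho>) \<tau>) \<omega> =
    sum_delete (\<lambda>q. split_sum (\<lambda>\<sigma> \<tau> \<rho>. \<psi> q \<sigma> \<tau> (\<rho> @ [q]))) \<omega>"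
  using assms
proof (induction \<omega> arbitrary: \<psi> rule: rev_induct)
  case (snoc p \<omega>)
  let ?\<psi> = "\<lambda>q \<sigma> \<tau> \<rho>. \<psi> q (\<sigma> @ [p]) \<tau> \<rho> + \<psi> q \<sigma> (\<tau> @ [p]) (\<rho> @ [p]) + \<psi> q \<sigma> \<tau> (\<rho> @ [p])"
  have s: "\<psi> q \<sigma> \<tau> \<rho> = \<psi> q \<sigma> \<tau> \<rho>'" if "mset \<rho> = mset \<rho>'" for q \<sigma> \<tau> \<rho> \<rho>'
    using snoc.prems that unfolding symmetric_def by blast
  have sym: "symmetric (?\<psi> q \<sigma> \<tau>)" for q \<sigma> \<tau>
    unfolding symmetric_def by (intro allI impI arg_cong2[where f = "(+)"] s) simp_all
  have "split_sum (\<lambda>\<sigma> \<tau> \<rho>. sum_delete (\<lambda>q \<tau>'. \<psi> q \<sigma> \<tau>' \<rho>) \<tau>) (\<omega> @ [p]) =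
      split_sum (\<lambda>\<sigma> \<tau> \<rho>. sum_delete (\<lambda>q \<tau>'. ?\<psi> q \<sigma> \<tau>' \<rho>) \<tau>) \<omega> + split_sum (\<lambda>\<sigma> \<tau> \<rho>. \<psi> p \<sigma> \<tau> (\<rho> @ [p])) \<omega>"
    by (simp add: split_sum_snoc sum_delete_snoc split_sum_add sum_delete_add add_ac)
  also have "split_sum (\<lambda>\<sigma> \<tau> \<rho>. sum_delete (\<lambda>q \<tau>'. ?\<psi> q \<sigma> \<tau>' \<rho>) \<tau>) \<omega> =
      sum_delete (\<lambda>q. split_sum (\<lambda>\<sigma> \<tau> \<rho>. ?\<psi> q \<sigma> \<tau> (\<rho> @ [q]))) \<omega>"
    by (rule snoc.IH[OF sym])
  also have "(\<lambda>q. split_sum (\<lambda>\<sigma> \<tau> \<rho>. ?\<psi> q \<sigma> \<tau> (\<rho> @ [q]))) = (\<lambda>q \<omega>'. split_sum (\<lambda>\<sigma> \<tau> \<rho>. \<psi> q \<sigma> \<tau> (\<rho> @ [q])) (\<omega>' @ [p]))"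
    unfolding split_sum_snoc
    by (intro ext arg_cong2[where f = split_sum] arg_cong2[where f = "(+)"] s refl) simp_all
  finally show ?case by (simp add: sum_delete_snoc)
qed simp

text \<open>Splitting off two points in either order gives the same summands up to the order inside
  the arguments, so a point may be split off at any place of the list (\<open>mid\<close>).
  Induction on \<omega> then matches its last point wherever it occurs in the permuted list.\<close>

lemma symmetric_split_sum:
  fixes \<Phi> :: "real list \<Rightarrow> real list \<Rightarrow> real list \<Rightarrow> 'a :: comm_monoid_add"
  assumes "\<And>\<sigma> \<sigma>' \<tau> \<tau>' \<rho> \<rho>'. mset \<sigma> = mset \<sigma>' \<Longrightarrow> mset \<tau> = mset \<tau>' \<Longrightarrow> mset \<rho> = mset \<rho>' \<Longrightarrow> \<Phi> \<sigma> \<tau> \<rho> = \<Phi> \<sigma>' \<tau>' \<rho>'"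
  shows "symmetric (split_sum \<Phi>)"
proof -
  let ?P = "\<lambda>\<Phi>. \<forall>\<sigma> \<sigma>' \<tau> \<tau>' \<rho> \<rho>'. mset \<sigma> = mset \<sigma>' \<longrightarrow> mset \<tau> = mset \<tau>' \<longrightarrow> mset \<rho> = mset \<rho>' \<longrightarrow> \<Phi> \<sigma> \<tau> \<rho> = (\<Phi> \<sigma>' \<tau>' \<rho>' :: 'a)"
  let ?A = "\<lambda>(q :: real) \<Phi> \<sigma> \<tau> \<rho>. \<Phi> (\<sigma> @ [q]) \<tau> \<rho> + \<Phi> \<sigma> (\<tau> @ [q]) (\<rho> @ [q]) + (\<Phi> \<sigma> \<tau> (\<rho> @ [q]) :: 'a)"
  have PA: "?P (?A q \<Phi>)" if P: "?P \<Phi>" for q \<Phi>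
  proof (intro allI impI)
    fix \<sigma> \<sigma>' \<tau> \<tau>' \<rho> \<rho>' :: "real list"
    assume m: "mset \<sigma> = mset \<sigma>'" "mset \<tau> = mset \<tau>'" "mset \<rho> = mset \<rho>'"
    show "?A q \<Phi> \<sigma> \<tau> \<rho> = ?A q \<Phi> \<sigma>' \<tau>' \<rho>'"
      by (intro arg_cong2[where f = "(+)"] P[rule_format]) (simp_all add: m)
  qed
  have mid: "split_sum \<Phi> (\<omega>\<^sub>1 @ q # \<omega>\<^sub>2) = split_sum (?A q \<Phi>) (\<omega>\<^sub>1 @ \<omega>\<^sub>2)" if P: "?P \<Phi>" for \<Phi> q \<omega>\<^sub>1 \<omega>\<^sub>2
    using P
  proof (induction \<omega>\<^sub>2 arbitrary: \<Phi> rule: rev_induct)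
    case Nil
    show ?case by (simp add: split_sum_snoc)
  next
    case (snoc p \<omega>\<^sub>2)
    have "split_sum \<Phi> (\<omega>\<^sub>1 @ q # \<omega>\<^sub>2 @ [p]) = split_sum (?A p \<Phi>) (\<omega>\<^sub>1 @ q # \<omega>\<^sub>2)"
      using split_sum_snoc[of \<Phi> "\<omega>\<^sub>1 @ q # \<omega>\<^sub>2" p] by simp
    also have "\<dots> = split_sum (?A q (?A p \<Phi>)) (\<omega>\<^sub>1 @ \<omega>\<^sub>2)"
      by (rule snoc.IH[OF PA[OF snoc.prems]])
    also have "?A q (?A p \<Phi>) = ?A p (?A q \<Phi>)"
    proof (intro ext)
      fix \<sigma> \<tau> \<rho>
      have 1: "\<Phi> (\<sigma> @ [q, p]) \<tau> \<rho> = \<Phi> (\<sigma> @ [p, q]) \<tau> \<rho>"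
        "\<Phi> \<sigma> (\<tau> @ [q, p]) (\<rho> @ [q, p]) = \<Phi> \<sigma> (\<tau> @ [p, q]) (\<rho> @ [p, q])"
        "\<Phi> \<sigma> \<tau> (\<rho> @ [q, p]) = \<Phi> \<sigma> \<tau> (\<rho> @ [p, q])"
        "\<Phi> \<sigma> (\<tau> @ [q]) (\<rho> @ [q, p]) = \<Phi> \<sigma> (\<tau> @ [q]) (\<rho> @ [p, q])"
        "\<Phi> \<sigma> (\<tau> @ [p]) (\<rho> @ [q, p]) = \<Phi> \<sigma> (\<tau> @ [p]) (\<rho> @ [p, q])"
        by (rule snoc.prems[rule_format]; simp)+
      show "?A q (?A p \<Phi>) \<sigma> \<tau> \<rho> = ?A p (?A q \<Phi>) \<sigma> \<tau> \<rho>"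
        by (simp add: 1 add_ac)
    qed
    also have "split_sum (?A p (?A q \<Phi>)) (\<omega>\<^sub>1 @ \<omega>\<^sub>2) = split_sum (?A q \<Phi>) (\<omega>\<^sub>1 @ \<omega>\<^sub>2 @ [p])"
      using split_sum_snoc[of "?A q \<Phi>" "\<omega>\<^sub>1 @ \<omega>\<^sub>2" p] by simp
    finally show ?case .
  qed
  have "split_sum \<Phi> \<omega> = split_sum \<Phi> \<omega>'" if "?P \<Phi>" "mset \<omega> = mset \<omega>'" for \<Phi> \<omega> \<omega>'
    using that
  proof (induction \<omega> arbitrary: \<Phi> \<omega>' rule: rev_induct)
    case (snoc q \<omega>)
    have "q \<in> set \<omega>'" using snoc.prems(2) by (metis in_set_conv_decomp set_mset_mset)
    then obtain \<omega>\<^sub>1 \<omega>\<^sub>2 where w: "\<omega>' = \<omega>\<^sub>1 @ q # \<omega>\<^sub>2" by (meson split_list)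
    have "mset \<omega> = mset (\<omega>\<^sub>1 @ \<omega>\<^sub>2)" using snoc.prems(2) w by simp
    from snoc.IH[OF PA[OF snoc.prems(1)] this]
    show ?case unfolding w mid[OF snoc.prems(1)] split_sum_snoc .
  next
    case Nil
    from Nil.prems(2) have "\<omega>' = []" by simp
    then show ?case by (rule arg_cong[symmetric])
  qed
  then show ?thesis using assms unfolding symmetric_def by blast
qed

lemma cutoff_power_append: "cutoff_power c R (\<omega> @ \<omega>') = cutoff_power c R \<omega> * cutoff_power c R \<omega>'"
  by (simp add: cutoff_power_def power_add)

lemma cutoff_power_mult: "cutoff_power c R \<omega> * cutoff_power c' R \<omega> = cutoff_power (c * c') R \<omega>"
  by (simp add: cutoff_power_def power_mult_distrib)

text \<open>Each point contributes the sum over its three places: M in \<sigma>, M times c in \<tau>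
  together with \<rho>, and c in \<rho> alone.\<close>

lemma norm_split_sum:
  fixes \<Phi> :: "real list \<Rightarrow> real list \<Rightarrow> real list \<Rightarrow> 'b :: real_normed_vector"
  assumes "0 \<le> M" "0 \<le> c" "0 \<le> K"
    and "\<And>\<sigma> \<tau> \<rho>. norm (\<Phi> \<sigma> \<tau> \<rho>) \<le> K * (cutoff_power M R \<sigma> * cutoff_power M R \<tau> * cutoff_power c R \<rho>)"
  shows "norm (split_sum \<Phi> \<omega>) \<le> K * cutoff_power (M + M * c + c) R \<omega>"
  using assms
proof (induction \<omega> arbitrary: \<Phi> K rule: rev_induct)
  case Nil
  from Nil(4)[of "[]" "[]" "[]"] show ?case by (simp add: cutoff_power_def)
next
  case (snoc q \<omega>)
  let ?i = "indicator {-R..R} q :: real"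
  let ?C = "\<lambda>\<sigma> \<tau> \<rho>. cutoff_power M R \<sigma> * cutoff_power M R \<tau> * cutoff_power c R \<rho>"
  let ?K = "K * ((M + M * c + c) * ?i)"
  have i: "?i * ?i = ?i" by (simp add: indicator_def)
  have "norm (split_sum (\<lambda>\<sigma> \<tau> \<rho>. \<Phi> (\<sigma> @ [q]) \<tau> \<rho> + \<Phi> \<sigma> (\<tau> @ [q]) (\<rho> @ [q]) + \<Phi> \<sigma> \<tau> (\<rho> @ [q])) \<omega>) \<le>
      ?K * cutoff_power (M + M * c + c) R \<omega>"
  proof (rule snoc.IH)
    show "0 \<le> ?K" using snoc.prems by simp
    fix \<sigma> \<tau> \<rho>
    have "norm (\<Phi> (\<sigma> @ [q]) \<tau> \<rho> + \<Phi> \<sigma> (\<tau> @ [q]) (\<rho> @ [q]) + \<Phi> \<sigma> \<tau> (\<rho> @ [q])) \<le>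
        K * ?C (\<sigma> @ [q]) \<tau> \<rho> + K * ?C \<sigma> (\<tau> @ [q]) (\<rho> @ [q]) + K * ?C \<sigma> \<tau> (\<rho> @ [q])"
      by (intro order_trans[OF norm_triangle_ineq] add_mono snoc.prems(4))
    also have "\<dots> = ?K * ?C \<sigma> \<tau> \<rho>"
      by (simp add: cutoff_power_snoc indicator_def algebra_simps)
    finally show "norm (\<Phi> (\<sigma> @ [q]) \<tau> \<rho> + \<Phi> \<sigma> (\<tau> @ [q]) (\<rho> @ [q]) + \<Phi> \<sigma> \<tau> (\<rho> @ [q])) \<le> ?K * ?C \<sigma> \<tau> \<rho>" .
  qed (use snoc.prems in auto)
  then show ?case by (simp add: split_sum_snoc cutoff_power_snoc mult_ac)
qed

lemma measurable_split_sum: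
  fixes \<Phi> :: "'m \<Rightarrow> real list \<Rightarrow> real list \<Rightarrow> real list \<Rightarrow> 'b :: {second_countable_topology, topological_comm_monoid_add}"
  assumes w: "w \<in> measurable M config_measure"
    and \<Phi>: "(\<lambda>(m, \<sigma>, \<tau>, \<rho>). \<Phi> m \<sigma> \<tau> \<rho>) \<in> borel_measurable (M \<Otimes>\<^sub>M config_measure \<Otimes>\<^sub>M config_measure \<Otimes>\<^sub>M config_measure)"
  shows "(\<lambda>m. split_sum (\<Phi> m) (w m)) \<in> borel_measurable M"
proof (rule measurable_config_cases[OF w, where F = "\<lambda>m. split_sum (\<Phi> m)"])
  fix fs :: "('m \<Rightarrow> real) list" assume fs: "\<And>f. f \<in> set fs \<Longrightarrow> f \<in> borel_measurable M"
  have [measurable]: "(\<lambda>m. map (\<lambda>f. f m) (nths fs A)) \<in> measurable M config_measure" for A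
    by (rule measurable_map_config) (use fs set_nths_subset in fast)
  have "(\<lambda>m. \<Phi> m (map (\<lambda>f. f m) (nths fs A)) (map (\<lambda>f. f m) (nths fs B)) (map (\<lambda>f. f m) (nths fs C))) \<in> borel_measurable M" for A B C
  proof -
    have "(\<lambda>m. (m, map (\<lambda>f. f m) (nths fs A), map (\<lambda>f. f m) (nths fs B), map (\<lambda>f. f m) (nths fs C)))
        \<in> measurable M (M \<Otimes>\<^sub>M config_measure \<Otimes>\<^sub>M config_measure \<Otimes>\<^sub>M config_measure)"
      by measurable
    from measurable_compose[OF this \<Phi>] show ?thesis by simp
  qed
  then show "(\<lambda>m. split_sum (\<Phi> m) (map (\<lambda>f. f m) fs)) \<in> borel_measurable M"
    unfolding split_sum_def length_map nths_map by (intro borel_measurable_sum)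
qed

section \<open>Integration over the annihilated points\<close>

definition kernel_integral ::
  "('k \<Rightarrow>\<^sub>L 'k) \<Rightarrow> ('k \<Rightarrow>\<^sub>L 'k) \<Rightarrow> ('k \<Rightarrow>\<^sub>L 'k) \<Rightarrow> ('k \<Rightarrow>\<^sub>L 'k) \<Rightarrow> real \<Rightarrow> (real list \<Rightarrow> 'k) \<Rightarrow> real \<Rightarrow>
    real list \<Rightarrow> real list \<Rightarrow> real list \<Rightarrow> 'k :: separable_hilbert" where
  "kernel_integral A\<^sub>1 A\<^sub>0 A\<^sub>m B s g r \<sigma> \<tau> \<rho> =
    (\<integral>\<upsilon>. typed_kernel B s r (map (\<lambda>q. (q, A\<^sub>1)) \<sigma> @ map (\<lambda>q. (q, A\<^sub>0)) \<tau> @ map (\<lambda>q. (q, A\<^sub>m)) \<upsilon>) (g (\<rho> @ \<upsilon>)) \<partial>config_measure)"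

lemma evolution_kernel_eq_typed_kernel:
  "evolution_kernel A\<^sub>1 A\<^sub>0 A\<^sub>m B s r \<sigma> \<tau> \<upsilon> =
    typed_kernel B s r (map (\<lambda>q. (q, A\<^sub>1)) \<sigma> @ map (\<lambda>q. (q, A\<^sub>0)) \<tau> @ map (\<lambda>q. (q, A\<^sub>m)) \<upsilon>)"
proof -
  let ?ps = "map (\<lambda>q. (q, A\<^sub>1)) \<sigma> @ map (\<lambda>q. (q, A\<^sub>0)) \<tau> @ map (\<lambda>q. (q, A\<^sub>m)) \<upsilon>"
  have 1: "map fst ?ps = \<sigma> @ \<tau> @ \<upsilon>" by (simp add: o_def)
  have 2: "fst ` set ?ps = set (\<sigma> @ \<tau> @ \<upsilon>)" unfolding 1[symmetric] by (simp only: set_map)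
  show ?thesis unfolding evolution_kernel_def typed_kernel_def 1 2 ..
qed

lemma normal_ordered_eq_split_sum:
  "normal_ordered (evolution_kernel A\<^sub>1 A\<^sub>0 A\<^sub>m B s r) g \<omega> = split_sum (kernel_integral A\<^sub>1 A\<^sub>0 A\<^sub>m B s g r) \<omega>"
  by (simp add: normal_ordered_def split_sum_def kernel_integral_def evolution_kernel_eq_typed_kernel)

lemma measurable_typed_kernel [measurable (raw)]:
  fixes B :: "'k :: {banach, second_countable_topology} \<Rightarrow>\<^sub>L 'k"
  assumes \<sigma>: "\<sigma> \<in> measurable M config_measure" and \<tau>: "\<tau> \<in> measurable M config_measure"
    and \<upsilon>: "\<upsilon> \<in> measurable M config_measure"
    and r: "r \<in> borel_measurable M" and v: "v \<in> borel_measurable M"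
  shows "(\<lambda>m. typed_kernel B s (r m) (map (\<lambda>q. (q, A\<^sub>1)) (\<sigma> m) @ map (\<lambda>q. (q, A\<^sub>0)) (\<tau> m) @ map (\<lambda>q. (q, A\<^sub>m)) (\<upsilon> m)) (v m))
    \<in> borel_measurable M"
proof (rule measurable_config_cases[OF \<sigma>, where F = "\<lambda>m \<sigma>. typed_kernel B s (r m)
    (map (\<lambda>q. (q, A\<^sub>1)) \<sigma> @ map (\<lambda>q. (q, A\<^sub>0)) (\<tau> m) @ map (\<lambda>q. (q, A\<^sub>m)) (\<upsilon> m)) (v m)"])
  fix fs :: "(_ \<Rightarrow> real) list" assume fs: "\<And>f. f \<in> set fs \<Longrightarrow> f \<in> borel_measurable M"
  show "(\<lambda>m. typed_kernel B s (r m) (map (\<lambda>q. (q, A\<^sub>1)) (map (\<lambda>f. f m) fs) @ map (\<lambda>q. (q, A\<^sub>0)) (\<tau> m) @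
      map (\<lambda>q. (q, A\<^sub>m)) (\<upsilon> m)) (v m)) \<in> borel_measurable M"
  proof (rule measurable_config_cases[OF \<tau>, where F = "\<lambda>m \<tau>. typed_kernel B s (r m)
      (map (\<lambda>q. (q, A\<^sub>1)) (map (\<lambda>f. f m) fs) @ map (\<lambda>q. (q, A\<^sub>0)) \<tau> @ map (\<lambda>q. (q, A\<^sub>m)) (\<upsilon> m)) (v m)"])
    fix fs' :: "(_ \<Rightarrow> real) list" assume fs': "\<And>f. f \<in> set fs' \<Longrightarrow> f \<in> borel_measurable M"
    show "(\<lambda>m. typed_kernel B s (r m) (map (\<lambda>q. (q, A\<^sub>1)) (map (\<lambda>f. f m) fs) @ map (\<lambda>q. (q, A\<^sub>0)) (map (\<lambda>f. f m) fs') @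
        map (\<lambda>q. (q, A\<^sub>m)) (\<upsilon> m)) (v m)) \<in> borel_measurable M"
    proof (rule measurable_config_cases[OF \<upsilon>, where F = "\<lambda>m \<upsilon>. typed_kernel B s (r m)
        (map (\<lambda>q. (q, A\<^sub>1)) (map (\<lambda>f. f m) fs) @ map (\<lambda>q. (q, A\<^sub>0)) (map (\<lambda>f. f m) fs') @ map (\<lambda>q. (q, A\<^sub>m)) \<upsilon>) (v m)"])
      fix fs'' :: "(_ \<Rightarrow> real) list" assume fs'': "\<And>f. f \<in> set fs'' \<Longrightarrow> f \<in> borel_measurable M"
      have "(\<lambda>m. typed_kernel B s (r m) (map (\<lambda>(f, A). (f m, A))
          (map (\<lambda>f. (f, A\<^sub>1)) fs @ map (\<lambda>f. (f, A\<^sub>0)) fs' @ map (\<lambda>f. (f, A\<^sub>m)) fs'')) (v m)) \<in> borel_measurable M"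
        by (rule measurable_typed_kernel_map[OF _ r v]) (use fs fs' fs'' in auto)
      then show "(\<lambda>m. typed_kernel B s (r m) (map (\<lambda>q. (q, A\<^sub>1)) (map (\<lambda>f. f m) fs) @ map (\<lambda>q. (q, A\<^sub>0)) (map (\<lambda>f. f m) fs') @
          map (\<lambda>q. (q, A\<^sub>m)) (map (\<lambda>f. f m) fs'')) (v m)) \<in> borel_measurable M"
        by (simp add: o_def)
    qed
  qed
qed

text \<open>The conditions on R put the interval (s,t), and with it the points of the kernel, into
  the box that carries g, so that one R serves all bounds.\<close>

locale kernel_evolution =
  fixes A\<^sub>1 A\<^sub>0 A\<^sub>m B :: "'k :: separable_hilbert \<Rightarrow>\<^sub>L 'k" and s t :: real and g :: "real list \<Rightarrow> 'k"
    and C c R M :: real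
  assumes st: "s \<le> t" and sym: "symmetric g" and meas [measurable]: "g \<in> borel_measurable config_measure"
    and C: "0 \<le> C" and c: "1 \<le> c" and R: "0 \<le> R" "- R \<le> s" "t \<le> R"
    and le: "\<And>\<omega>. norm (g \<omega>) \<le> C * cutoff_power c R \<omega>"
    and M: "norm A\<^sub>1 \<le> M" "norm A\<^sub>0 \<le> M" "norm A\<^sub>m \<le> M"
begin

abbreviation typed_list :: "real list \<Rightarrow> real list \<Rightarrow> real list \<Rightarrow> (real \<times> ('k \<Rightarrow>\<^sub>L 'k)) list" where
  "typed_list \<sigma> \<tau> \<upsilon> \<equiv> map (\<lambda>q. (q, A\<^sub>1)) \<sigma> @ map (\<lambda>q. (q, A\<^sub>0)) \<tau> @ map (\<lambda>q. (q, A\<^sub>m)) \<upsilon>"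

abbreviation W :: "real \<Rightarrow> real list \<Rightarrow> real list \<Rightarrow> real list \<Rightarrow> 'k \<Rightarrow>\<^sub>L 'k" where
  "W r \<sigma> \<tau> \<upsilon> \<equiv> typed_kernel B s r (typed_list \<sigma> \<tau> \<upsilon>)"

abbreviation \<Phi> :: "real \<Rightarrow> real list \<Rightarrow> real list \<Rightarrow> real list \<Rightarrow> 'k" where
  "\<Phi> \<equiv> kernel_integral A\<^sub>1 A\<^sub>0 A\<^sub>m B s g"

definition "K = exp ((t - s) * norm B)"

lemma K_pos: "0 < K" by (simp add: K_def)

lemma M_nonneg: "0 \<le> M" using M(1) norm_ge_zero order_trans by blast

lemma c_nonneg: "0 \<le> c" using c by simp

lemma norm_W:
  assumes "s \<le> r" "r \<le> t"
  shows "norm (W r \<sigma> \<tau> \<upsilon>) \<le> K * (cutoff_power M R \<sigma> * cutoff_power M R \<tau> * cutoff_power M R \<upsilon>)"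
proof (cases "set \<sigma> \<subseteq> {-R..R} \<and> set \<tau> \<subseteq> {-R..R} \<and> set \<upsilon> \<subseteq> {-R..R}")
  case True
  have "norm (W r \<sigma> \<tau> \<upsilon>) \<le> exp ((r - s) * norm B) * M ^ length (typed_list \<sigma> \<tau> \<upsilon>)"
    by (rule norm_typed_kernel) (use M M_nonneg assms in auto)
  also have "\<dots> \<le> K * M ^ length (typed_list \<sigma> \<tau> \<upsilon>)"
    unfolding K_def using assms M_nonneg by (intro mult_right_mono) (auto intro: mult_right_mono)
  finally show ?thesis using True by (simp add: cutoff_power_def power_add)
next
  case False
  then obtain q where q: "q \<in> set \<sigma> \<union> set \<tau> \<union> set \<upsilon>" "q \<notin> {-R..R}" by blast
  then have "\<not> (s < q \<and> q < r)" using R assms by auto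
  moreover obtain A where "(q, A) \<in> set (typed_list \<sigma> \<tau> \<upsilon>)" using q by auto
  ultimately have "W r \<sigma> \<tau> \<upsilon> = 0" by (intro typed_kernel_eq_0[of "(q, A)"]) auto
  then show ?thesis using M_nonneg K_pos by (simp add: cutoff_power_nonneg)
qed

text \<open>A point of \<upsilon> occurs in the kernel, with factor M, and in g, with factor c. The
  resulting rate \<open>M * c\<close> explains the constant \<open>exp (2 * R * (M * c))\<close>
  after integration over \<upsilon>.\<close>

lemma norm_W_g:
  assumes "s \<le> r" "r \<le> t"
  shows "norm (W r \<sigma> \<tau> \<upsilon> (g (\<rho> @ \<upsilon>))) \<le>
    (K * C * (cutoff_power M R \<sigma> * cutoff_power M R \<tau> * cutoff_power c R \<rho>)) * cutoff_power (M * c) R \<upsilon>"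
proof -
  have "norm (W r \<sigma> \<tau> \<upsilon> (g (\<rho> @ \<upsilon>))) \<le> norm (W r \<sigma> \<tau> \<upsilon>) * norm (g (\<rho> @ \<upsilon>))"
    by (rule norm_blinfun)
  also have "\<dots> \<le> (K * (cutoff_power M R \<sigma> * cutoff_power M R \<tau> * cutoff_power M R \<upsilon>)) * (C * cutoff_power c R (\<rho> @ \<upsilon>))"
    using norm_W[OF assms] le K_pos M_nonneg
    by (intro mult_mono) (auto intro!: mult_nonneg_nonneg cutoff_power_nonneg)
  also have "\<dots> = (K * C * (cutoff_power M R \<sigma> * cutoff_power M R \<tau> * cutoff_power c R \<rho>)) * cutoff_power (M * c) R \<upsilon>"
    by (simp add: cutoff_power_append cutoff_power_mult[symmetric])
  finally show ?thesis .
qed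

lemma integrable_W_g:
  assumes "s \<le> r" "r \<le> t"
  shows "integrable config_measure (\<lambda>\<upsilon>. W r \<sigma> \<tau> \<upsilon> (g (\<rho> @ \<upsilon>)))"
proof (rule Bochner_Integration.integrable_bound)
  let ?D = "K * C * (cutoff_power M R \<sigma> * cutoff_power M R \<tau> * cutoff_power c R \<rho>)"
  show "integrable config_measure (\<lambda>\<upsilon>. ?D * cutoff_power (M * c) R \<upsilon>)"
    using M_nonneg c_nonneg R by simp
  show "AE \<upsilon> in config_measure. norm (W r \<sigma> \<tau> \<upsilon> (g (\<rho> @ \<upsilon>))) \<le> norm (?D * cutoff_power (M * c) R \<upsilon>)"
    using norm_W_g[OF assms] by (auto intro!: AE_I2 order_trans[OF _ abs_ge_self])
qed measurable

lemma norm_kernel_integral: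
  assumes "s \<le> r" "r \<le> t"
  shows "norm (\<Phi> r \<sigma> \<tau> \<rho>) \<le> (K * C * exp (2 * R * (M * c))) * (cutoff_power M R \<sigma> * cutoff_power M R \<tau> * cutoff_power c R \<rho>)"
proof -
  let ?D = "K * C * (cutoff_power M R \<sigma> * cutoff_power M R \<tau> * cutoff_power c R \<rho>)"
  have D: "0 \<le> ?D" using K_pos C M_nonneg c_nonneg by (simp add: cutoff_power_nonneg)
  have int: "integrable config_measure (\<lambda>\<upsilon>. ?D * cutoff_power (M * c) R \<upsilon>)"
    using M_nonneg c_nonneg R by simp
  have "norm (\<Phi> r \<sigma> \<tau> \<rho>) \<le> (\<integral>\<upsilon>. ?D * cutoff_power (M * c) R \<upsilon> \<partial>config_measure)"
    unfolding kernel_integral_def using integrable_W_g[OF assms] int norm_W_g[OF assms]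
    by (intro order_trans[OF integral_norm_bound] Bochner_Integration.integral_mono integrable_norm)
  also have "\<dots> = ?D * (\<integral>\<upsilon>. cutoff_power (M * c) R \<upsilon> \<partial>config_measure)"
    by simp
  also have "(\<integral>\<upsilon>. cutoff_power (M * c) R \<upsilon> \<partial>config_measure) = exp (2 * R * (M * c))"
    using M_nonneg c_nonneg R nn_integral_cutoff_power[of "M * c" R]
    by (subst integral_eq_nn_integral) (auto simp: cutoff_power_nonneg)
  finally show ?thesis by (simp add: mult_ac)
qed

lemma kernel_integral_eq_0:
  assumes "q \<in> set \<sigma> \<union> set \<tau>" "\<not> (s < q \<and> q < r)"
  shows "\<Phi> r \<sigma> \<tau> \<rho> = 0"
proof -
  have "W r \<sigma> \<tau> \<upsilon> = 0" for \<upsilon>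
  proof -
    obtain A where "(q, A) \<in> set (typed_list \<sigma> \<tau> \<upsilon>)" using assms(1) by auto
    then show ?thesis using assms(2) by (intro typed_kernel_eq_0[of "(q, A)"]) auto
  qed
  then show ?thesis by (simp add: kernel_integral_def)
qed

lemma kernel_integral_eqI:
  assumes "mset \<sigma> = mset \<sigma>'" "mset \<tau> = mset \<tau>'" "mset \<rho> = mset \<rho>'"
  shows "\<Phi> r \<sigma> \<tau> \<rho> = \<Phi> r \<sigma>' \<tau>' \<rho>'"
proof -
  have "W r \<sigma> \<tau> \<upsilon> = W r \<sigma>' \<tau>' \<upsilon>" for \<upsilon>
    by (rule typed_kernel_eqI) (simp add: assms)
  moreover have "g (\<rho> @ \<upsilon>) = g (\<rho>' @ \<upsilon>)" for \<upsilon>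
    using sym assms(3) by (simp add: symmetric_def)
  ultimately show ?thesis by (simp add: kernel_integral_def)
qed

lemma measurable_kernel_integral [measurable (raw)]:
  assumes [measurable]: "q \<in> borel_measurable N" "\<sigma> \<in> measurable N config_measure"
    "\<tau> \<in> measurable N config_measure" "\<rho> \<in> measurable N config_measure"
  shows "(\<lambda>m. \<Phi> (q m) (\<sigma> m) (\<tau> m) (\<rho> m)) \<in> borel_measurable N"
  unfolding kernel_integral_def by measurable

lemma integrable_kernel_integral:
  "integrable lborel (\<lambda>q. indicator {s<..<t} q *\<^sub>R \<Phi> q \<sigma> \<tau> \<rho>)"
  "integrable lborel (\<lambda>q. indicator {s<..<t} q *\<^sub>R \<Phi> q \<sigma> \<tau> (\<rho> @ [q]))"
proof -
  let ?D = "(K * C * exp (2 * R * (M * c))) * (cutoff_power M R \<sigma> * cutoff_power M R \<tau> * (c * cutoff_power c R \<rho>))"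
  have D: "integrable lborel (\<lambda>q. ?D * indicator {s<..<t} q)" using st by simp
  have nn: "0 \<le> cutoff_power M R \<sigma> * cutoff_power M R \<tau>" "0 \<le> K * C * exp (2 * R * (M * c))"
    using K_pos C M_nonneg by (auto simp: cutoff_power_nonneg)
  have "cutoff_power c R \<rho> \<le> c * cutoff_power c R \<rho>"
    using mult_right_mono[OF c cutoff_power_nonneg[OF c_nonneg]] by simp
  then have 1: "norm (\<Phi> q \<sigma> \<tau> \<rho>) \<le> ?D" if "s < q" "q < t" for q
    using that nn by (intro order_trans[OF norm_kernel_integral] mult_left_mono) auto
  have 2: "norm (\<Phi> q \<sigma> \<tau> (\<rho> @ [q])) \<le> ?D" if "s < q" "q < t" for q
    using that nn c_nonneg by (intro order_trans[OF norm_kernel_integral] mult_left_mono cutoff_power_snoc_le) auto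
  show "integrable lborel (\<lambda>q. indicator {s<..<t} q *\<^sub>R \<Phi> q \<sigma> \<tau> \<rho>)"
    by (rule Bochner_Integration.integrable_bound[OF D])
      (measurable, use 1 in \<open>auto simp: indicator_def intro!: AE_I2 order_trans[OF _ abs_ge_self]\<close>)
  show "integrable lborel (\<lambda>q. indicator {s<..<t} q *\<^sub>R \<Phi> q \<sigma> \<tau> (\<rho> @ [q]))"
    by (rule Bochner_Integration.integrable_bound[OF D])
      (measurable, use 2 in \<open>auto simp: indicator_def intro!: AE_I2 order_trans[OF _ abs_ge_self]\<close>)
qed

lemma integrable_kernel_integral':
  fixes A :: "'k \<Rightarrow>\<^sub>L 'k"
  assumes "r \<le> t"
  shows "integrable lborel (\<lambda>q. indicator {s<..<r} q *\<^sub>R A (\<Phi> q \<sigma> \<tau> \<rho>))"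
    and "integrable lborel (\<lambda>q. indicator {s<..<r} q *\<^sub>R A (\<Phi> q \<sigma> \<tau> (\<rho> @ [q])))"
proof -
  have "(\<lambda>q. indicator {s<..<r} q *\<^sub>R blinfun_apply A (f q)) =
      (\<lambda>q. indicator {..<r} q *\<^sub>R A (indicator {s<..<t} q *\<^sub>R f q))" for f and A :: "'k \<Rightarrow>\<^sub>L 'k"
    using assms by (auto simp: indicator_def fun_eq_iff)
  moreover have "integrable lborel (\<lambda>q. indicator {..<r} q *\<^sub>R A (indicator {s<..<t} q *\<^sub>R f q))"
    if "integrable lborel (\<lambda>q. indicator {s<..<t} q *\<^sub>R f q)" for f and A :: "'k \<Rightarrow>\<^sub>L 'k"
    by (rule integrable_mult_indicator) (simp, rule integrable_bounded_linear[OF blinfun.bounded_linear_right that])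
  ultimately show "integrable lborel (\<lambda>q. indicator {s<..<r} q *\<^sub>R A (\<Phi> q \<sigma> \<tau> \<rho>))"
    "integrable lborel (\<lambda>q. indicator {s<..<r} q *\<^sub>R A (\<Phi> q \<sigma> \<tau> (\<rho> @ [q])))"
    using integrable_kernel_integral by simp_all
qed

text \<open>Integrating the integral equation of the kernel over the annihilated points: a jump at an
  annihilated point becomes, by the sum-integral formula, a contribution to the Lebesgue part.\<close>

lemma kernel_integral_equation:
  assumes r: "s \<le> r" "r \<le> t"
  shows "\<Phi> r \<sigma> \<tau> \<rho> = (if \<sigma> = [] \<and> \<tau> = [] then g \<rho> else 0) +
    (\<integral>q. indicator {s<..<r} q *\<^sub>R (B (\<Phi> q \<sigma> \<tau> \<rho>) + A\<^sub>m (\<Phi> q \<sigma> \<tau> (\<rho> @ [q]))) \<partial>lborel) +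
    sum_delete (\<lambda>q \<sigma>'. if s < q \<and> q < r then A\<^sub>1 (\<Phi> q \<sigma>' \<tau> \<rho>) else 0) \<sigma> +
    sum_delete (\<lambda>q \<tau>'. if s < q \<and> q < r then A\<^sub>0 (\<Phi> q \<sigma> \<tau>' \<rho>) else 0) \<tau>"
proof -
  define v where "v \<upsilon> = g (\<rho> @ \<upsilon>)" for \<upsilon>
  have [measurable]: "v \<in> borel_measurable config_measure" unfolding v_def by measurable
  let ?T1 = "\<lambda>\<upsilon>. \<integral>q. indicator {s<..<r} q *\<^sub>R B (W q \<sigma> \<tau> \<upsilon> (v \<upsilon>)) \<partial>lborel"
  let ?T2 = "\<lambda>\<upsilon>. sum_delete (\<lambda>q \<sigma>'. if s < q \<and> q < r then A\<^sub>1 (W q \<sigma>' \<tau> \<upsilon> (v \<upsilon>)) else 0) \<sigma>"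
  let ?T3 = "\<lambda>\<upsilon>. sum_delete (\<lambda>q \<tau>'. if s < q \<and> q < r then A\<^sub>0 (W q \<sigma> \<tau>' \<upsilon> (v \<upsilon>)) else 0) \<tau>"
  let ?h = "\<lambda>q \<upsilon>. indicator {s<..<r} q *\<^sub>R A\<^sub>m (W q \<sigma> \<tau> \<upsilon> (g ((\<rho> @ [q]) @ \<upsilon>)))"
  \<comment> \<open>The initial value enters the equation of the kernel only when there are no
    points. The unit atom at the empty configuration turns it into \<open>g \<rho>\<close>.\<close>
  let ?T0 = "\<lambda>\<upsilon>. if \<upsilon> = [] then (if \<sigma> = [] \<and> \<tau> = [] then g \<rho> else 0) else 0"
  have eq: "W r \<sigma> \<tau> \<upsilon> (v \<upsilon>) = ?T0 \<upsilon> + ?T1 \<upsilon> + ?T2 \<upsilon> + ?T3 \<upsilon> + sum_delete ?h \<upsilon>" for \<upsilon>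
  proof -
    let ?k = "\<lambda>(q, A) ps. if s < q \<and> q < r then blinfun_apply A (typed_kernel B s q ps (v \<upsilon>)) else 0"
    have "sum_delete ?k (typed_list \<sigma> \<tau> \<upsilon>) = ?T2 \<upsilon> + ?T3 \<upsilon> +
        sum_delete (\<lambda>q \<upsilon>'. if s < q \<and> q < r then A\<^sub>m (W q \<sigma> \<tau> \<upsilon>' (v \<upsilon>)) else 0) \<upsilon>"
      by (simp add: sum_delete_append sum_delete_map add_ac)
    \<comment> \<open>A point deleted from \<upsilon> remains in the argument of g. Symmetry moves
      it next to \<rho>, so that the summand depends only on q and the remainder, as the
      sum-integral formula requires.\<close>
    also have "sum_delete (\<lambda>q \<upsilon>'. if s < q \<and> q < r then A\<^sub>m (W q \<sigma> \<tau> \<upsilon>' (v \<upsilon>)) else 0) \<upsilon> = sum_delete ?h \<upsilon>"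
    proof (rule sum_delete_cong)
      fix q \<upsilon>' assume m: "mset (\<upsilon>' @ [q]) = mset \<upsilon>"
      then have "mset (\<rho> @ \<upsilon>) = mset ((\<rho> @ [q]) @ \<upsilon>')" by (simp flip: m)
      then have "v \<upsilon> = g ((\<rho> @ [q]) @ \<upsilon>')" using sym unfolding v_def symmetric_def by blast
      then show "(if s < q \<and> q < r then A\<^sub>m (W q \<sigma> \<tau> \<upsilon>' (v \<upsilon>)) else 0) = ?h q \<upsilon>'"
        by (simp add: indicator_def)
    qed
    finally have sd: "sum_delete ?k (typed_list \<sigma> \<tau> \<upsilon>) = ?T2 \<upsilon> + ?T3 \<upsilon> + sum_delete ?h \<upsilon>" .
    have "(if typed_list \<sigma> \<tau> \<upsilon> = [] then v \<upsilon> else 0) = ?T0 \<upsilon>"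
      by (auto simp: v_def)
    then show ?thesis
      unfolding typed_kernel_integral_equation[OF r(1), of B "typed_list \<sigma> \<tau> \<upsilon>" "v \<upsilon>"] sd by (simp add: add_ac)
  qed
  let ?D = "K * C * (cutoff_power M R \<sigma> * cutoff_power M R \<tau> * cutoff_power c R \<rho>)"
  have nn: "0 \<le> K * C * (cutoff_power M R \<sigma> * cutoff_power M R \<tau>)"
    using K_pos C M_nonneg by (auto simp: cutoff_power_nonneg)
  have T0: "integrable config_measure ?T0" "(\<integral>\<upsilon>. ?T0 \<upsilon> \<partial>config_measure) = (if \<sigma> = [] \<and> \<tau> = [] then g \<rho> else 0)"
    by (rule integral_config_Nil)+
  have I1: "integrable (config_measure \<Otimes>\<^sub>M lborel) (\<lambda>(\<upsilon>, q). indicator {s<..<r} q *\<^sub>R B (W q \<sigma> \<tau> \<upsilon> (v \<upsilon>)))"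
  proof (rule integrable_config_lborel)
    fix \<upsilon> q
    have "norm (B (W q \<sigma> \<tau> \<upsilon> (v \<upsilon>))) \<le> norm B * (?D * cutoff_power (M * c) R \<upsilon>)" if "s < q" "q < r"
      unfolding v_def using that r by (intro order_trans[OF norm_blinfun] mult_left_mono norm_W_g) auto
    then show "norm (indicator {s<..<r} q *\<^sub>R B (W q \<sigma> \<tau> \<upsilon> (v \<upsilon>))) \<le> (norm B * ?D) * cutoff_power (M * c) R \<upsilon> * indicator {s<..<r} q"
      by (auto simp: indicator_def mult.assoc)
  qed (measurable, use M_nonneg c_nonneg R in auto)
  have T1: "integrable config_measure ?T1" "(\<integral>\<upsilon>. ?T1 \<upsilon> \<partial>config_measure) = (\<integral>q. indicator {s<..<r} q *\<^sub>R B (\<Phi> q \<sigma> \<tau> \<rho>) \<partial>lborel)"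
  proof -
    show "integrable config_measure ?T1"
      by (rule config_lborel.integrable_fst[OF I1])
    have "(\<integral>\<upsilon>. ?T1 \<upsilon> \<partial>config_measure) = (\<integral>q. (\<integral>\<upsilon>. indicator {s<..<r} q *\<^sub>R B (W q \<sigma> \<tau> \<upsilon> (v \<upsilon>)) \<partial>config_measure) \<partial>lborel)"
      using config_lborel.integral_fst[OF I1] config_lborel.integral_snd[OF I1] by simp
    also have "\<dots> = (\<integral>q. indicator {s<..<r} q *\<^sub>R B (\<Phi> q \<sigma> \<tau> \<rho>) \<partial>lborel)"
    proof (rule Bochner_Integration.integral_cong[OF refl])
      fix q
      show "(\<integral>\<upsilon>. indicator {s<..<r} q *\<^sub>R B (W q \<sigma> \<tau> \<upsilon> (v \<upsilon>)) \<partial>config_measure) = indicator {s<..<r} q *\<^sub>R B (\<Phi> q \<sigma> \<tau> \<rho>)"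
        using r integral_bounded_linear[OF blinfun.bounded_linear_right[of B] integrable_W_g[of q \<sigma> \<tau> \<rho>]]
        by (auto simp: v_def kernel_integral_def indicator_def)
    qed
    finally show "(\<integral>\<upsilon>. ?T1 \<upsilon> \<partial>config_measure) = (\<integral>q. indicator {s<..<r} q *\<^sub>R B (\<Phi> q \<sigma> \<tau> \<rho>) \<partial>lborel)" .
  qed
  have I: "integrable config_measure (\<lambda>\<upsilon>. if s < q \<and> q < r then A (W q \<sigma>' \<tau>' \<upsilon> (v \<upsilon>)) else 0)"
    and L: "(\<integral>\<upsilon>. (if s < q \<and> q < r then A (W q \<sigma>' \<tau>' \<upsilon> (v \<upsilon>)) else 0) \<partial>config_measure) =
      (if s < q \<and> q < r then A (\<Phi> q \<sigma>' \<tau>' \<rho>) else 0)" for A :: "'k \<Rightarrow>\<^sub>L 'k" and q \<sigma>' \<tau>'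
    using r integrable_bounded_linear[OF blinfun.bounded_linear_right[of A] integrable_W_g[of q \<sigma>' \<tau>' \<rho>]]
      integral_bounded_linear[OF blinfun.bounded_linear_right[of A] integrable_W_g[of q \<sigma>' \<tau>' \<rho>]]
    by (cases "s < q \<and> q < r"; auto simp: v_def kernel_integral_def)+
  have T2: "integrable config_measure ?T2" "(\<integral>\<upsilon>. ?T2 \<upsilon> \<partial>config_measure) =
      sum_delete (\<lambda>q \<sigma>'. if s < q \<and> q < r then A\<^sub>1 (\<Phi> q \<sigma>' \<tau> \<rho>) else 0) \<sigma>"
    and T3: "integrable config_measure ?T3" "(\<integral>\<upsilon>. ?T3 \<upsilon> \<partial>config_measure) =
      sum_delete (\<lambda>q \<tau>'. if s < q \<and> q < r then A\<^sub>0 (\<Phi> q \<sigma> \<tau>' \<rho>) else 0) \<tau>"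
    unfolding sum_delete_def
    by (rule Bochner_Integration.integrable_sum[OF I] trans[OF Bochner_Integration.integral_sum[OF I] sum.cong[OF refl L]])+
  have I4: "integrable (config_measure \<Otimes>\<^sub>M lborel) (\<lambda>(\<upsilon>, q). ?h q \<upsilon>)"
  proof (rule integrable_config_lborel)
    fix \<upsilon> q
    have "norm (A\<^sub>m (W q \<sigma> \<tau> \<upsilon> (g ((\<rho> @ [q]) @ \<upsilon>)))) \<le> norm A\<^sub>m * ((c * ?D) * cutoff_power (M * c) R \<upsilon>)" if "s < q" "q < r"
    proof (rule order_trans[OF norm_blinfun], rule mult_left_mono)
      have "norm (W q \<sigma> \<tau> \<upsilon> (g ((\<rho> @ [q]) @ \<upsilon>))) \<le> (K * C * (cutoff_power M R \<sigma> * cutoff_power M R \<tau> * cutoff_power c R (\<rho> @ [q]))) * cutoff_power (M * c) R \<upsilon>"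
        using that r by (intro norm_W_g) auto
      also have "\<dots> \<le> (K * C * (cutoff_power M R \<sigma> * cutoff_power M R \<tau> * (c * cutoff_power c R \<rho>))) * cutoff_power (M * c) R \<upsilon>"
        using K_pos C M_nonneg c_nonneg
        by (intro mult_right_mono mult_left_mono cutoff_power_snoc_le) (auto simp: cutoff_power_nonneg)
      finally show "norm (W q \<sigma> \<tau> \<upsilon> (g ((\<rho> @ [q]) @ \<upsilon>))) \<le> (c * ?D) * cutoff_power (M * c) R \<upsilon>"
        by (simp add: mult_ac)
    qed simp
    then show "norm (?h q \<upsilon>) \<le> (norm A\<^sub>m * (c * ?D)) * cutoff_power (M * c) R \<upsilon> * indicator {s<..<r} q"
      by (auto simp: indicator_def mult.assoc)
  qed (measurable, use M_nonneg c_nonneg R in auto)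
  have T4: "(\<integral>\<upsilon>. sum_delete ?h \<upsilon> \<partial>config_measure) = (\<integral>q. indicator {s<..<r} q *\<^sub>R A\<^sub>m (\<Phi> q \<sigma> \<tau> (\<rho> @ [q])) \<partial>lborel)"
  proof -
    have "(\<integral>\<upsilon>. sum_delete ?h \<upsilon> \<partial>config_measure) = (\<integral>q. (\<integral>\<upsilon>. ?h q \<upsilon> \<partial>config_measure) \<partial>lborel)"
      using integral_sum_delete[OF I4] config_lborel.integral_snd[OF I4] by simp
    also have "\<dots> = (\<integral>q. indicator {s<..<r} q *\<^sub>R A\<^sub>m (\<Phi> q \<sigma> \<tau> (\<rho> @ [q])) \<partial>lborel)"
    proof (rule Bochner_Integration.integral_cong[OF refl])
      fix q
      show "(\<integral>\<upsilon>. ?h q \<upsilon> \<partial>config_measure) = indicator {s<..<r} q *\<^sub>R A\<^sub>m (\<Phi> q \<sigma> \<tau> (\<rho> @ [q]))"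
        using r integral_bounded_linear[OF blinfun.bounded_linear_right[of A\<^sub>m] integrable_W_g[of q \<sigma> \<tau> "\<rho> @ [q]"]]
        by (auto simp: kernel_integral_def indicator_def)
    qed
    finally show ?thesis .
  qed
  have "\<Phi> r \<sigma> \<tau> \<rho> = (\<integral>\<upsilon>. ?T0 \<upsilon> + ?T1 \<upsilon> + ?T2 \<upsilon> + ?T3 \<upsilon> + sum_delete ?h \<upsilon> \<partial>config_measure)"
    unfolding eq[symmetric] by (simp add: kernel_integral_def v_def)
  also have "\<dots> = (\<integral>\<upsilon>. ?T0 \<upsilon> \<partial>config_measure) + (\<integral>\<upsilon>. ?T1 \<upsilon> \<partial>config_measure) + (\<integral>\<upsilon>. ?T2 \<upsilon> \<partial>config_measure) +
      (\<integral>\<upsilon>. ?T3 \<upsilon> \<partial>config_measure) + (\<integral>\<upsilon>. sum_delete ?h \<upsilon> \<partial>config_measure)"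
    using T0(1) T1(1) T2(1) T3(1) integrable_sum_delete[OF I4]
    by (simp only: Bochner_Integration.integral_add Bochner_Integration.integrable_add)
  also have "\<dots> = (if \<sigma> = [] \<and> \<tau> = [] then g \<rho> else 0) +
      ((\<integral>q. indicator {s<..<r} q *\<^sub>R B (\<Phi> q \<sigma> \<tau> \<rho>) \<partial>lborel) + (\<integral>q. indicator {s<..<r} q *\<^sub>R A\<^sub>m (\<Phi> q \<sigma> \<tau> (\<rho> @ [q])) \<partial>lborel)) +
      sum_delete (\<lambda>q \<sigma>'. if s < q \<and> q < r then A\<^sub>1 (\<Phi> q \<sigma>' \<tau> \<rho>) else 0) \<sigma> +
      sum_delete (\<lambda>q \<tau>'. if s < q \<and> q < r then A\<^sub>0 (\<Phi> q \<sigma> \<tau>' \<rho>) else 0) \<tau>"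
    unfolding T0(2) T1(2) T2(2) T3(2) T4 by (simp only: add_ac)
  also have "(\<integral>q. indicator {s<..<r} q *\<^sub>R B (\<Phi> q \<sigma> \<tau> \<rho>) \<partial>lborel) + (\<integral>q. indicator {s<..<r} q *\<^sub>R A\<^sub>m (\<Phi> q \<sigma> \<tau> (\<rho> @ [q])) \<partial>lborel) =
      (\<integral>q. indicator {s<..<r} q *\<^sub>R (B (\<Phi> q \<sigma> \<tau> \<rho>) + A\<^sub>m (\<Phi> q \<sigma> \<tau> (\<rho> @ [q]))) \<partial>lborel)"
    unfolding scaleR_add_right
    by (rule Bochner_Integration.integral_add[OF integrable_kernel_integral'[OF r(2)], symmetric])
  finally show ?thesis .
qed

text \<open>A kernel with end time q vanishes as soon as q is one of its points, so of the three
  places for q only \<rho> alone is left. The point q is then present without having acted.\<close>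

lemma split_sum_snoc_inert:
  "split_sum (\<Phi> q) (\<omega> @ [q]) = split_sum (\<lambda>\<sigma> \<tau> \<rho>. \<Phi> q \<sigma> \<tau> (\<rho> @ [q])) \<omega>"
proof -
  have "\<Phi> q (\<sigma> @ [q]) \<tau> \<rho> = 0" "\<Phi> q \<sigma> (\<tau> @ [q]) \<rho> = 0" for \<sigma> \<tau> \<rho>
    by (rule kernel_integral_eq_0[of q]; simp)+
  then show ?thesis by (simp add: split_sum_snoc)
qed

text \<open>Sum of \<open>kernel_integral_equation\<close> over all decompositions: the terms with
  \<open>A\<^sub>1\<close> and \<open>A\<^sub>0\<close> become deletions from \<omega>, the term
  with \<open>A\<^sub>m\<close> the value at \<open>\<omega> @ [q]\<close>. Setting the path to 0
  outside [s,t] keeps the bound uniform in r, since the kernel estimates hold for times in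
  [s,t].\<close>

lemma evolution_split_sum:
  "evolution A\<^sub>1 A\<^sub>0 A\<^sub>m B s t g (\<lambda>r \<omega>. if r \<in> {s..t} then split_sum (\<Phi> r) \<omega> else 0)"
  unfolding evolution_def
proof (intro conjI ballI allI)
  have m: "(\<lambda>(r, \<omega>). split_sum (\<Phi> r) \<omega>) \<in> borel_measurable (borel \<Otimes>\<^sub>M config_measure)"
  proof -
    have "(\<lambda>(m, \<sigma>, \<tau>, \<rho>). \<Phi> (fst m) \<sigma> \<tau> \<rho>) \<in> borel_measurable
        ((borel \<Otimes>\<^sub>M config_measure) \<Otimes>\<^sub>M config_measure \<Otimes>\<^sub>M config_measure \<Otimes>\<^sub>M config_measure)"
      unfolding kernel_integral_def by measurable
    from measurable_split_sum[OF measurable_snd this] show ?thesis by (simp add: case_prod_unfold)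
  qed
  show "dominated (\<lambda>r \<omega>. if r \<in> {s..t} then split_sum (\<Phi> r) \<omega> else 0)"
    unfolding dominated_def
  proof (intro conjI allI)
    have eq: "(\<lambda>(r, \<omega>). if r \<in> {s..t} then split_sum (\<Phi> r) \<omega> else 0) =
        (\<lambda>x. if fst x \<in> {s..t} then (\<lambda>(r, \<omega>). split_sum (\<Phi> r) \<omega>) x else 0)"
      by (auto simp: fun_eq_iff)
    show "(\<lambda>(r, \<omega>). if r \<in> {s..t} then split_sum (\<Phi> r) \<omega> else 0) \<in> borel_measurable (borel \<Otimes>\<^sub>M config_measure)"
      unfolding eq by (rule measurable_If[OF m]) auto
    show "symmetric (\<lambda>\<omega>. if r \<in> {s..t} then split_sum (\<Phi> r) \<omega> else 0)" for r
    proof (cases "r \<in> {s..t}")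
      case True
      have "symmetric (split_sum (\<Phi> r))" by (rule symmetric_split_sum) (rule kernel_integral_eqI)
      with True show ?thesis by simp
    next
      case False
      show ?thesis unfolding if_not_P[OF False] by (simp add: symmetric_def)
    qed
    let ?c = "M + M * c + c" and ?D = "K * C * exp (2 * R * (M * c))"
    have "1 \<le> ?c" using M_nonneg c by (simp add: add_increasing)
    moreover have "norm (if r \<in> {s..t} then split_sum (\<Phi> r) \<omega> else 0) \<le> ?D * cutoff_power ?c R \<omega>" for r \<omega>
    proof (cases "r \<in> {s..t}")
      case True
      then show ?thesis
        using norm_kernel_integral[of r] K_pos C M_nonneg c_nonneg by (simp add: norm_split_sum)
    next
      case False
      then show ?thesis
        using K_pos C M_nonneg c_nonneg by (auto intro!: mult_nonneg_nonneg cutoff_power_nonneg)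
    qed
    moreover have "0 \<le> ?D" using K_pos C by simp
    ultimately show "\<exists>C c R. 0 \<le> C \<and> 1 \<le> c \<and> 0 \<le> R \<and>
        (\<forall>r \<omega>. norm (if r \<in> {s..t} then split_sum (\<Phi> r) \<omega> else 0) \<le> C * cutoff_power c R \<omega>)"
      using R(1) by blast
  qed
  fix r \<omega> assume rr: "r \<in> {s..t}"
  then have r: "s \<le> r" "r \<le> t" by auto
  have sy: "symmetric (\<lambda>\<rho>. if s < q \<and> q < r then A\<^sub>0 (\<Phi> q \<sigma> \<tau> \<rho>) else 0)" for q \<sigma> \<tau>
    unfolding symmetric_def
    by (intro allI impI if_cong refl arg_cong[where f = "blinfun_apply A\<^sub>0"] kernel_integral_eqI)
  have if_linear: "split_sum (\<lambda>\<sigma> \<tau> \<rho>. if P then blinfun_apply A (\<Psi> \<sigma> \<tau> \<rho>) else 0) \<omega>' = (if P then A (split_sum \<Psi> \<omega>') else 0)"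
    for P and A :: "'k \<Rightarrow>\<^sub>L 'k" and \<Psi> \<omega>'
    using split_sum_linear[OF bounded_linear.linear[OF blinfun.bounded_linear_right[of A]], of \<Psi> \<omega>'] by simp
  have "split_sum (\<Phi> r) \<omega> =
      split_sum (\<lambda>\<sigma> \<tau> \<rho>. if \<sigma> = [] \<and> \<tau> = [] then g \<rho> else 0) \<omega> +
      split_sum (\<lambda>\<sigma> \<tau> \<rho>. \<integral>q. indicator {s<..<r} q *\<^sub>R (B (\<Phi> q \<sigma> \<tau> \<rho>) + A\<^sub>m (\<Phi> q \<sigma> \<tau> (\<rho> @ [q]))) \<partial>lborel) \<omega> +
      split_sum (\<lambda>\<sigma> \<tau> \<rho>. sum_delete (\<lambda>q \<sigma>'. if s < q \<and> q < r then A\<^sub>1 (\<Phi> q \<sigma>' \<tau> \<rho>) else 0) \<sigma>) \<omega> +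
      split_sum (\<lambda>\<sigma> \<tau> \<rho>. sum_delete (\<lambda>q \<tau>'. if s < q \<and> q < r then A\<^sub>0 (\<Phi> q \<sigma> \<tau>' \<rho>) else 0) \<tau>) \<omega>"
    unfolding split_sum_add[symmetric] by (intro arg_cong2[where f = split_sum] ext refl kernel_integral_equation[OF r])
  also have "split_sum (\<lambda>\<sigma> \<tau> \<rho>. if \<sigma> = [] \<and> \<tau> = [] then g \<rho> else 0) \<omega> = g \<omega>"
    by (rule split_sum_initial)
  also have "split_sum (\<lambda>\<sigma> \<tau> \<rho>. \<integral>q. indicator {s<..<r} q *\<^sub>R (B (\<Phi> q \<sigma> \<tau> \<rho>) + A\<^sub>m (\<Phi> q \<sigma> \<tau> (\<rho> @ [q]))) \<partial>lborel) \<omega> =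
      (\<integral>q. split_sum (\<lambda>\<sigma> \<tau> \<rho>. indicator {s<..<r} q *\<^sub>R (B (\<Phi> q \<sigma> \<tau> \<rho>) + A\<^sub>m (\<Phi> q \<sigma> \<tau> (\<rho> @ [q])))) \<omega> \<partial>lborel)"
    by (rule integral_split_sum[symmetric])
      (unfold scaleR_add_right, intro Bochner_Integration.integrable_add integrable_kernel_integral'[OF r(2)])
  also have "\<dots> = (\<integral>q. indicator {s<..<r} q *\<^sub>R (B (split_sum (\<Phi> q) \<omega>) + A\<^sub>m (split_sum (\<Phi> q) (\<omega> @ [q]))) \<partial>lborel)"
  proof (rule Bochner_Integration.integral_cong[OF refl])
    fix q
    have lin: "linear (\<lambda>x. indicator {s<..<r} q *\<^sub>R blinfun_apply A x)" for A :: "'k \<Rightarrow>\<^sub>L 'k"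
      by (intro linearI) (simp_all add: blinfun.add_right scaleR_add_right blinfun.scaleR_right)
    show "split_sum (\<lambda>\<sigma> \<tau> \<rho>. indicator {s<..<r} q *\<^sub>R (B (\<Phi> q \<sigma> \<tau> \<rho>) + A\<^sub>m (\<Phi> q \<sigma> \<tau> (\<rho> @ [q])))) \<omega> =
        indicator {s<..<r} q *\<^sub>R (B (split_sum (\<Phi> q) \<omega>) + A\<^sub>m (split_sum (\<Phi> q) (\<omega> @ [q])))"
      unfolding scaleR_add_right split_sum_add split_sum_linear[OF lin, symmetric] split_sum_snoc_inert ..
  qed
  also have "split_sum (\<lambda>\<sigma> \<tau> \<rho>. sum_delete (\<lambda>q \<sigma>'. if s < q \<and> q < r then A\<^sub>1 (\<Phi> q \<sigma>' \<tau> \<rho>) else 0) \<sigma>) \<omega> =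
      sum_delete (\<lambda>q \<omega>'. if s < q \<and> q < r then A\<^sub>1 (split_sum (\<Phi> q) \<omega>') else 0) \<omega>"
    unfolding split_sum_delete1[of "\<lambda>q \<sigma> \<tau> \<rho>. if s < q \<and> q < r then A\<^sub>1 (\<Phi> q \<sigma> \<tau> \<rho>) else 0"] if_linear ..
  also have "split_sum (\<lambda>\<sigma> \<tau> \<rho>. sum_delete (\<lambda>q \<tau>'. if s < q \<and> q < r then A\<^sub>0 (\<Phi> q \<sigma> \<tau>' \<rho>) else 0) \<tau>) \<omega> =
      sum_delete (\<lambda>q \<omega>'. if s < q \<and> q < r then A\<^sub>0 (split_sum (\<Phi> q) (\<omega>' @ [q])) else 0) \<omega>"
    unfolding split_sum_delete2[of "\<lambda>q \<sigma> \<tau> \<rho>. if s < q \<and> q < r then A\<^sub>0 (\<Phi> q \<sigma> \<tau> \<rho>) else 0", OF sy] if_linear split_sum_snoc_inert ..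
  finally have main: "split_sum (\<Phi> r) \<omega> = g \<omega> +
      (\<integral>q. indicator {s<..<r} q *\<^sub>R (B (split_sum (\<Phi> q) \<omega>) + A\<^sub>m (split_sum (\<Phi> q) (\<omega> @ [q]))) \<partial>lborel) +
      sum_delete (\<lambda>q \<omega>'. if s < q \<and> q < r then A\<^sub>1 (split_sum (\<Phi> q) \<omega>') else 0) \<omega> +
      sum_delete (\<lambda>q \<omega>'. if s < q \<and> q < r then A\<^sub>0 (split_sum (\<Phi> q) (\<omega>' @ [q])) else 0) \<omega>" .
  let ?G = "\<lambda>r \<omega>. if r \<in> {s..t} then split_sum (\<Phi> r) \<omega> else 0"
  have 1: "(\<lambda>q. indicator {s<..<r} q *\<^sub>R (B (split_sum (\<Phi> q) \<omega>) + A\<^sub>m (split_sum (\<Phi> q) (\<omega> @ [q])))) =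
      (\<lambda>q. indicator {s<..<r} q *\<^sub>R (B (?G q \<omega>) + A\<^sub>m (?G q (\<omega> @ [q]))))"
    using r by (auto simp: indicator_def fun_eq_iff)
  have 2: "sum_delete (\<lambda>q \<omega>'. if s < q \<and> q < r then A\<^sub>1 (split_sum (\<Phi> q) \<omega>') else 0) \<omega> +
      sum_delete (\<lambda>q \<omega>'. if s < q \<and> q < r then A\<^sub>0 (split_sum (\<Phi> q) (\<omega>' @ [q])) else 0) \<omega> =
      sum_delete (\<lambda>q \<omega>'. if s < q \<and> q < r then A\<^sub>1 (?G q \<omega>') + A\<^sub>0 (?G q (\<omega>' @ [q])) else 0) \<omega>"
    unfolding sum_delete_add[symmetric] using r by (intro sum_delete_cong) auto
  show "?G r \<omega> = g \<omega> + (\<integral>q. indicator {s<..<r} q *\<^sub>R (B (?G q \<omega>) + A\<^sub>m (?G q (\<omega> @ [q]))) \<partial>lborel) +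
      sum_delete (\<lambda>q \<omega>'. if s < q \<and> q < r then A\<^sub>1 (?G q \<omega>') + A\<^sub>0 (?G q (\<omega>' @ [q])) else 0) \<omega>"
    unfolding 2[symmetric] 1[symmetric] using main rr by (simp add: add_ac)
qed

end

theorem evolution_normal_ordered:
  fixes A\<^sub>1 A\<^sub>0 A\<^sub>m B :: "'k :: separable_hilbert \<Rightarrow>\<^sub>L 'k"
  assumes g: "dominated (\<lambda>_. g)" and "s \<le> t"
  shows "evolution A\<^sub>1 A\<^sub>0 A\<^sub>m B s t g
    (\<lambda>r \<omega>. if r \<in> {s..t} then normal_ordered (evolution_kernel A\<^sub>1 A\<^sub>0 A\<^sub>m B s r) g \<omega> else 0)"
proof -
  have "(\<lambda>(r :: real, \<omega>). g \<omega>) \<in> borel_measurable (borel \<Otimes>\<^sub>M config_measure)"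
    using g by (simp add: dominated_def)
  from measurable_compose[OF measurable_Pair1'[of 0] this] have m: "g \<in> borel_measurable config_measure"
    by simp
  obtain C c R where *: "0 \<le> C" "1 \<le> c" "0 \<le> R" "\<And>\<omega>. norm (g \<omega>) \<le> C * cutoff_power c R \<omega>"
    using g unfolding dominated_def by blast
  \<comment> \<open>The box of g is enlarged until it contains s and t.\<close>
  let ?R = "max R (max \<bar>s\<bar> \<bar>t\<bar>)"
  have "norm (g \<omega>) \<le> C * cutoff_power c ?R \<omega>" for \<omega>
  proof -
    have "cutoff_power c R \<omega> \<le> cutoff_power c ?R \<omega>"
      using *(2) by (intro cutoff_power_mono) auto
    with *(1) have "C * cutoff_power c R \<omega> \<le> C * cutoff_power c ?R \<omega>" by (rule mult_left_mono[rotated])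
    with *(4) show ?thesis by (rule order_trans)
  qed
  then interpret kernel_evolution A\<^sub>1 A\<^sub>0 A\<^sub>m B s t g C c ?R "max (norm A\<^sub>1) (max (norm A\<^sub>0) (norm A\<^sub>m))"
    using * assms m by unfold_locales (auto simp: dominated_def)
  show ?thesis
    using evolution_split_sum by (simp only: normal_ordered_eq_split_sum)
qed

section \<open>Hilbert spaces\<close>

text \<open>A minimising sequence is Cauchy by the parallelogram law, and its limit is a nearest
  point. The result serves twice: for the Riesz representation and for the density of the test
  functions.\<close>

lemma closed_subspace_projection:
  fixes S :: "'a :: {real_inner, complete_space} set"
  assumes S: "subspace S" and "closed S"
  obtains p where "p \<in> S" "\<And>y. y \<in> S \<Longrightarrow> (x - p) \<bullet> y = 0"
proof -
  have ne: "S \<noteq> {}" using subspace_0[OF S] by auto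
  define d where "d = infdist x S"
  have d: "0 \<le> d" "\<And>y. y \<in> S \<Longrightarrow> d \<le> norm (x - y)"
    unfolding d_def using infdist_nonneg infdist_le by (auto simp: dist_norm[symmetric])
  have "\<exists>y\<in>S. (norm (x - y))\<^sup>2 < d\<^sup>2 + 1 / real (Suc n)" for n
  proof -
    have "d < sqrt (d\<^sup>2 + 1 / real (Suc n))" using d(1) by (intro real_less_rsqrt) simp
    then obtain y where y: "y \<in> S" "dist x y < sqrt (d\<^sup>2 + 1 / real (Suc n))"
      unfolding d_def infdist_notempty[OF ne] using ne by (subst (asm) cINF_less_iff) auto
    then have "(norm (x - y))\<^sup>2 < (sqrt (d\<^sup>2 + 1 / real (Suc n)))\<^sup>2"
      by (intro power_strict_mono) (auto simp: dist_norm)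
    then show ?thesis using y(1) by (auto simp: add_nonneg_nonneg)
  qed
  then obtain y where y: "\<And>n. y n \<in> S" "\<And>n. (norm (x - y n))\<^sup>2 < d\<^sup>2 + 1 / real (Suc n)"
    by metis
  have par: "(norm (y m - y n))\<^sup>2 \<le> 2 / real (Suc m) + 2 / real (Suc n)" for m n
  proof -
    have "(1/2) *\<^sub>R (y m + y n) \<in> S" using S y(1) by (intro subspace_scale subspace_add)
    then have "d\<^sup>2 \<le> (norm (x - (1/2) *\<^sub>R (y m + y n)))\<^sup>2"
      using d by (intro power_mono) auto
    moreover have "(norm (y m - y n))\<^sup>2 = 2 * (norm (x - y m))\<^sup>2 + 2 * (norm (x - y n))\<^sup>2 - 4 * (norm (x - (1/2) *\<^sub>R (y m + y n)))\<^sup>2"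
      by (simp add: power2_norm_eq_inner inner_diff_left inner_diff_right inner_add_left inner_add_right inner_commute algebra_simps)
    ultimately show ?thesis using y(2)[of m] y(2)[of n] by simp
  qed
  have "Cauchy y"
  proof (rule CauchyI)
    fix e :: real assume e: "0 < e"
    obtain N where N: "4 / e\<^sup>2 < real (Suc N)" using reals_Archimedean2 less_trans[OF _ of_nat_less_iff[THEN iffD2, OF lessI]] by blast
    have "norm (y m - y n) < e" if "m \<ge> N" "n \<ge> N" for m n
    proof -
      have "2 / real (Suc m) \<le> 2 / real (Suc N)" "2 / real (Suc n) \<le> 2 / real (Suc N)"
        using that by (auto intro!: divide_left_mono)
      then have "(norm (y m - y n))\<^sup>2 \<le> 4 / real (Suc N)" using par[of m n] by simp
      also have "\<dots> < e\<^sup>2" using N e by (simp add: field_simps)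
      finally show ?thesis using e by (simp add: power2_less_imp_less)
    qed
    then show "\<exists>M. \<forall>m\<ge>M. \<forall>n\<ge>M. norm (y m - y n) < e" by blast
  qed
  then obtain p where p: "y \<longlonglongrightarrow> p" using Cauchy_convergent convergent_def by blast
  have pS: "p \<in> S" using closed_sequentially[OF \<open>closed S\<close>] y(1) p by blast
  have "(\<lambda>n. d\<^sup>2 + 1 / real (Suc n)) \<longlonglongrightarrow> d\<^sup>2 + 0"
    by (intro tendsto_add tendsto_const LIMSEQ_Suc[OF lim_1_over_n])
  moreover have "(\<lambda>n. (norm (x - y n))\<^sup>2) \<longlonglongrightarrow> (norm (x - p))\<^sup>2"
    by (intro tendsto_intros p)
  ultimately have xp: "(norm (x - p))\<^sup>2 \<le> d\<^sup>2"
    using y(2) by (intro LIMSEQ_le[of _ _ "\<lambda>n. d\<^sup>2 + 1 / real (Suc n)"]) (auto intro: less_imp_le)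
  have "(x - p) \<bullet> z = 0" if z: "z \<in> S" for z
  proof -
    let ?a = "(x - p) \<bullet> z"
    have q: "2 * r * ?a \<le> r\<^sup>2 * (norm z)\<^sup>2" for r
    proof -
      have "p + r *\<^sub>R z \<in> S" using S pS z by (intro subspace_add subspace_scale)
      then have "d\<^sup>2 \<le> (norm (x - (p + r *\<^sub>R z)))\<^sup>2" using d by (intro power_mono) auto
      also have "\<dots> = (norm (x - p))\<^sup>2 - 2 * r * ?a + r\<^sup>2 * (norm z)\<^sup>2"
        by (simp add: power2_norm_eq_inner inner_diff_left inner_diff_right inner_add_left inner_add_right inner_commute power2_eq_square[of r] algebra_simps)
      finally show ?thesis using xp by linarith
    qed
    show ?thesis
    proof (cases "z = 0")
      case False
      then have nz: "0 < (norm z)\<^sup>2" by simp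
      \<comment> \<open>This choice of r minimises |x - p - r z|.\<close>
      have "2 * (?a / (norm z)\<^sup>2) * ?a \<le> (?a / (norm z)\<^sup>2)\<^sup>2 * (norm z)\<^sup>2" by (rule q)
      also have "\<dots> = ?a\<^sup>2 / (norm z)\<^sup>2" using nz by (simp add: power_divide power2_eq_square)
      finally have "?a\<^sup>2 / (norm z)\<^sup>2 \<le> 0" by (simp add: power2_eq_square)
      then have "?a\<^sup>2 \<le> 0" using nz by (simp add: divide_le_0_iff)
      then show ?thesis by simp
    qed simp
  qed
  with pS show thesis by (rule that)
qed

text \<open>Projecting a vector with \<open>f x \<noteq> 0\<close> onto the null space of f leaves a
  residual z that spans the orthogonal complement of this null space; f is determined by its value
  at z.\<close>

lemma riesz_representation:
  fixes f :: "'a :: {real_inner, complete_space} \<Rightarrow> real"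
  assumes f: "bounded_linear f"
  obtains y where "\<And>x. f x = y \<bullet> x"
proof (cases "\<forall>x. f x = 0")
  case True
  then show thesis by (intro that[of 0]) simp
next
  case False
  interpret f: bounded_linear f by (rule f)
  obtain x where x: "f x \<noteq> 0" using False by blast
  let ?S = "{x. f x = 0}"
  have "subspace ?S" by (auto simp: subspace_def f.add f.scaleR f.zero)
  moreover have "closed ?S"
    by (intro closed_Collect_eq linear_continuous_on f continuous_on_const)
  ultimately obtain p where "p \<in> ?S" "\<And>y. y \<in> ?S \<Longrightarrow> (x - p) \<bullet> y = 0"
    by (rule closed_subspace_projection[where x = x]) (rule that)
  then have p: "f p = 0" "\<And>y. f y = 0 \<Longrightarrow> (x - p) \<bullet> y = 0" by auto
  let ?z = "x - p"
  have fz: "f ?z \<noteq> 0" using x p by (simp add: f.diff)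
  then have "?z \<noteq> 0" by (metis f.zero)
  then have zz: "?z \<bullet> ?z \<noteq> 0" by simp
  have "f v = ((f ?z / (?z \<bullet> ?z)) *\<^sub>R ?z) \<bullet> v" for v
  proof -
    have "f (v - (f v / f ?z) *\<^sub>R ?z) = 0" using fz by (simp only: f.diff f.scaleR) simp
    then have "?z \<bullet> (v - (f v / f ?z) *\<^sub>R ?z) = 0" by (rule p(2))
    then have "?z \<bullet> v = (f v / f ?z) * (?z \<bullet> ?z)"
      by (simp only: inner_diff_right inner_scaleR_right eq_iff_diff_eq_0[symmetric])
    then show ?thesis using fz zz by simp
  qed
  then show thesis by (rule that)
qed

lemma scaleC_zero_right [simp]: "c *\<^sub>C (0 :: 'a :: complex_inner) = 0"
  by (rule linear_0[OF bounded_linear.linear[OF bounded_linear_scaleC]])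

lemma inner_scaleC_left: "(c *\<^sub>C x) \<bullet> y = x \<bullet> (cnj c *\<^sub>C (y :: 'a :: complex_inner))"
  by (simp add: inner_eq_Re_cinner cinner_scaleC_left cinner_scaleC_right)

text \<open>The Riesz representation for the real inner product gives a real adjoint. As
  \<open>cinner\<close> is assembled from the real inner products with x and with \<i> times x,
  complex linearity of \<open>A\<close> makes this the complex adjoint.\<close>

lemma hadjoint_exists:
  fixes A :: "'k :: separable_hilbert \<Rightarrow>\<^sub>L 'k"
  assumes A: "A \<in> bounded_operators"
  obtains A' :: "'k \<Rightarrow>\<^sub>L 'k" where "\<And>x y. A' x \<bullet> y = x \<bullet> A y" "\<And>x y. cinner (A' x) y = cinner x (A y)"
proof -
  have "\<exists>z. \<forall>y. x \<bullet> A y = z \<bullet> y" for x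
  proof -
    have "bounded_linear (\<lambda>y. x \<bullet> A y)"
      by (intro bounded_linear_compose[OF bounded_linear_inner_right blinfun.bounded_linear_right])
    then show ?thesis using riesz_representation by metis
  qed
  then obtain f where f: "\<And>x y. f x \<bullet> y = x \<bullet> A y" by metis
  have eqI: "u = w" if "\<And>y. u \<bullet> y = w \<bullet> y" for u w :: 'k
    using that vector_eq_rdot by blast
  have "bounded_linear f"
  proof (rule bounded_linear_intro[where K = "norm A"])
    show "f (x + y) = f x + f y" for x y by (rule eqI) (simp add: f inner_add_left)
    show "f (r *\<^sub>R x) = r *\<^sub>R f x" for r x by (rule eqI) (simp add: f)
    show "norm (f x) \<le> norm x * norm A" for x
    proof (cases "f x = 0")
      case False
      have "(norm (f x))\<^sup>2 = x \<bullet> A (f x)" by (simp add: power2_norm_eq_inner f)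
      also have "\<dots> \<le> norm x * norm (A (f x))" using Cauchy_Schwarz_ineq2[of x "A (f x)"] by linarith
      also have "\<dots> \<le> norm x * (norm A * norm (f x))" by (intro mult_left_mono norm_blinfun) simp
      finally show ?thesis using False by (simp add: power2_eq_square)
    qed simp
  qed
  then have app: "blinfun_apply (Blinfun f) = f" by (rule bounded_linear_Blinfun_apply)
  have Ac: "A (c *\<^sub>C x) = c *\<^sub>C A x" for c x using A by (simp add: bounded_operators_def)
  show thesis
  proof (rule that[of "Blinfun f"])
    show "Blinfun f x \<bullet> y = x \<bullet> A y" for x y by (simp add: app f)
    show "cinner (Blinfun f x) y = cinner x (A y)" for x y
      by (simp add: cinner_eq_Complex app f inner_scaleC_left Ac)
  qed
qed

text \<open>The only property of \<open>hadjoint\<close> used below. The real inner product suffices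
  because norms and energies involve real parts only.\<close>

lemma inner_hadjoint:
  fixes A :: "'k :: separable_hilbert \<Rightarrow>\<^sub>L 'k"
  assumes A: "A \<in> bounded_operators"
  shows "hadjoint A x \<bullet> y = x \<bullet> A y"
proof -
  obtain A' :: "'k \<Rightarrow>\<^sub>L 'k" where A': "\<And>x y. A' x \<bullet> y = x \<bullet> A y" "\<And>x y. cinner (A' x) y = cinner x (A y)" by (rule hadjoint_exists[OF A]) blast
  have "hadjoint A = A'"
    unfolding hadjoint_def
  proof (rule the_equality)
    fix A'' assume *: "\<forall>x y. cinner (blinfun_apply A'' x) y = cinner x (blinfun_apply A y)"
    show "A'' = A'"
    proof (rule blinfun_eqI)
      fix x
      have "A'' x \<bullet> y = A' x \<bullet> y" for y
        using * A'(2) by (simp add: inner_eq_Re_cinner)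
      then show "A'' x = A' x" using vector_eq_rdot by blast
    qed
  qed (use A' in simp)
  with A'(1) show ?thesis by simp
qed

section \<open>Completeness of Fock space\<close>

lemma rep_fock: "rep_fock x \<in> square_integrable" and fock_of_rep_fock: "fock_of (rep_fock x) = x"
  using Quotient3_rep_reflp[OF Quotient3_fock, of x] Quotient3_abs_rep[OF Quotient3_fock, of x]
  by (auto simp: fock_rel_def)

lemma fock_of_eq_iff:
  assumes "f \<in> square_integrable" "g \<in> square_integrable"
  shows "fock_of f = fock_of g \<longleftrightarrow> (AE \<omega> in config_measure. f \<omega> = g \<omega>)"
  using Quotient3_rel[OF Quotient3_fock, of f g] assms by (auto simp: fock_rel_def)

lemma fock_of_add:
  "f \<in> square_integrable \<Longrightarrow> g \<in> square_integrable \<Longrightarrow> fock_of f + fock_of g = fock_of (\<lambda>\<omega>. f \<omega> + g \<omega>)"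
  by (rule plus_fock.abs_eq) (auto simp: fock_rel_def)

lemma fock_of_scaleC: "f \<in> square_integrable \<Longrightarrow> c *\<^sub>C fock_of f = fock_of (\<lambda>\<omega>. c *\<^sub>C f \<omega>)"
  by (rule scaleC_fock.abs_eq) (auto simp: fock_rel_def)

lemma minus_eq_scaleC: "f - g = f + (-1) *\<^sub>C (g :: 'a :: complex_inner)"
  using scaleC_of_real[of "-1" g] by simp

lemma square_integrable_diff:
  assumes "f \<in> square_integrable" "g \<in> square_integrable"
  shows "(\<lambda>\<omega>. f \<omega> - g \<omega>) \<in> square_integrable"
  unfolding minus_eq_scaleC by (intro square_integrable_add square_integrable_scaleC assms)

lemma fock_of_diff:
  assumes "f \<in> square_integrable" "g \<in> square_integrable"
  shows "fock_of f - fock_of g = fock_of (\<lambda>\<omega>. f \<omega> - g \<omega>)"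
  unfolding minus_eq_scaleC using assms by (simp add: fock_of_scaleC fock_of_add square_integrable_scaleC)

lemma inner_fock_of:
  assumes "f \<in> square_integrable" "g \<in> square_integrable"
  shows "fock_of f \<bullet> fock_of g = (\<integral>\<omega>. f \<omega> \<bullet> g \<omega> \<partial>config_measure)"
proof -
  have "cinner (fock_of f) (fock_of g) = (\<integral>\<omega>. cinner (f \<omega>) (g \<omega>) \<partial>config_measure)"
    using assms by (intro cinner_fock.abs_eq) (auto simp: fock_rel_def)
  then show ?thesis
    using integrable_cinner[OF assms] by (simp add: inner_eq_Re_cinner)
qed

lemma norm_fock_of:
  assumes "f \<in> square_integrable"
  shows "(norm (fock_of f))\<^sup>2 = (\<integral>\<omega>. (norm (f \<omega>))\<^sup>2 \<partial>config_measure)"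
  using inner_fock_of[OF assms assms] by (simp add: power2_norm_eq_inner)

lemma nn_integral_norm_fock_of:
  assumes "f \<in> square_integrable"
  shows "(\<integral>\<^sup>+\<omega>. (norm (f \<omega>))\<^sup>2 \<partial>config_measure) = ennreal ((norm (fock_of f))\<^sup>2)"
  using assms by (simp add: norm_fock_of nn_integral_eq_integral square_integrable_def)

lemma symmetric_binary: "symmetric f \<Longrightarrow> symmetric g \<Longrightarrow> symmetric (\<lambda>\<omega>. h (f \<omega>) (g \<omega>))"
  unfolding symmetric_def by metis

text \<open>Riesz-Fischer: a rapidly convergent subsequence has representatives that converge almost
  everywhere, and Fatou's lemma identifies the pointwise limit as a limit in norm.\<close>

instance fock :: (separable_hilbert) complete_space
proof
  fix X :: "nat \<Rightarrow> 'a fock" assume X: "Cauchy X"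
  have "\<forall>k. \<exists>N. \<forall>m\<ge>N. \<forall>n\<ge>N. dist (X m) (X n) < (1/2) ^ k"
    using X by (auto simp: Cauchy_def)
  then obtain N where N: "\<And>k m n. m \<ge> N k \<Longrightarrow> n \<ge> N k \<Longrightarrow> dist (X m) (X n) < (1/2) ^ k"
    by metis
  \<comment> \<open>The summand 1 makes r strictly increasing, while \<open>r k\<close> still
    exceeds \<open>N k\<close>.\<close>
  define r where "r k = (\<Sum>j\<le>k. N j + 1)" for k
  have r: "strict_mono r" unfolding strict_mono_Suc_iff by (simp add: r_def)
  have rN: "N k \<le> r k" for k
    using member_le_sum[of k "{..k}" "\<lambda>j. N j + 1"] by (simp add: r_def)
  have dX: "dist (X (r m)) (X (r k)) < (1/2) ^ k" if "k \<le> m" for k m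
    using that rN[of k] strict_mono_leD[OF r that] by (intro N) auto
  define f where "f k = rep_fock (X (r k))" for k
  have f: "f k \<in> square_integrable" "fock_of (f k) = X (r k)" for k
    by (simp_all add: f_def rep_fock fock_of_rep_fock)
  have fm [measurable]: "f k \<in> borel_measurable config_measure" and fs: "symmetric (f k)" for k
    using f(1)[of k] by (auto simp: square_integrable_def)
  have nf: "(\<integral>\<^sup>+\<omega>. (norm (f m \<omega> - f k \<omega>))\<^sup>2 \<partial>config_measure) \<le> ennreal (((1/2) ^ k)\<^sup>2)" if "k \<le> m" for k m
  proof -
    have "(\<integral>\<^sup>+\<omega>. (norm (f m \<omega> - f k \<omega>))\<^sup>2 \<partial>config_measure) = ennreal ((dist (X (r m)) (X (r k)))\<^sup>2)"
      using nn_integral_norm_fock_of[OF square_integrable_diff[OF f(1)[of m] f(1)[of k]]] f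
      by (simp add: dist_norm fock_of_diff[symmetric])
    also have "\<dots> \<le> ennreal (((1/2) ^ k)\<^sup>2)"
      using dX[OF that] by (intro ennreal_leI power_mono) auto
    finally show ?thesis .
  qed
  define h where "h k \<omega> = f (Suc k) \<omega> - f k \<omega>" for k \<omega>
  have [measurable]: "h k \<in> borel_measurable config_measure" for k unfolding h_def[abs_def] by measurable
  \<comment> \<open>The integral of |h_k|^2 is at most 4^(-k), so the weight 2^k leaves a convergent
    series. Pointwise, |h_k| \<le> 2^(-k) + 2^k |h_k|^2 then gives absolute convergence.\<close>
  have "(\<integral>\<^sup>+\<omega>. (\<Sum>k. ennreal (2 ^ k * (norm (h k \<omega>))\<^sup>2)) \<partial>config_measure) = (\<Sum>k. \<integral>\<^sup>+\<omega>. ennreal (2 ^ k * (norm (h k \<omega>))\<^sup>2) \<partial>config_measure)"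
    by (rule nn_integral_suminf) measurable
  also have "\<dots> \<le> (\<Sum>k. ennreal ((1/2) ^ k))"
  proof (rule suminf_le)
    fix k
    have "(\<integral>\<^sup>+\<omega>. ennreal (2 ^ k * (norm (h k \<omega>))\<^sup>2) \<partial>config_measure) = ennreal (2 ^ k) * (\<integral>\<^sup>+\<omega>. (norm (h k \<omega>))\<^sup>2 \<partial>config_measure)"
      by (simp add: ennreal_mult nn_integral_cmult)
    also have "\<dots> \<le> ennreal (2 ^ k) * ennreal (((1/2) ^ k)\<^sup>2)"
      unfolding h_def by (intro mult_left_mono nf) auto
    also have "\<dots> = ennreal ((1/2) ^ k)"
      by (simp add: ennreal_mult[symmetric] power2_eq_square power_mult_distrib[symmetric] mult.assoc[symmetric])
    finally show "(\<integral>\<^sup>+\<omega>. ennreal (2 ^ k * (norm (h k \<omega>))\<^sup>2) \<partial>config_measure) \<le> ennreal ((1/2) ^ k)" .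
  qed simp_all
  finally have "(\<integral>\<^sup>+\<omega>. (\<Sum>k. ennreal (2 ^ k * (norm (h k \<omega>))\<^sup>2)) \<partial>config_measure) \<le> (\<Sum>k. ennreal ((1/2) ^ k))" .
  moreover have "(\<Sum>k. ennreal ((1/2) ^ k)) \<noteq> top"
    by (rule ennreal_suminf_neq_top) (auto intro: summable_geometric)
  ultimately have fin: "(\<integral>\<^sup>+\<omega>. (\<Sum>k. ennreal (2 ^ k * (norm (h k \<omega>))\<^sup>2)) \<partial>config_measure) \<noteq> \<infinity>"
    by (auto simp: top_unique)
  have conv: "AE \<omega> in config_measure. convergent (\<lambda>k. f k \<omega>)"
  proof -
    have "AE \<omega> in config_measure. (\<Sum>k. ennreal (2 ^ k * (norm (h k \<omega>))\<^sup>2)) \<noteq> \<infinity>"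
      by (rule nn_integral_PInf_AE[OF _ fin]) measurable
    then show ?thesis
  proof eventually_elim
    fix \<omega> assume "(\<Sum>k. ennreal (2 ^ k * (norm (h k \<omega>))\<^sup>2)) \<noteq> \<infinity>"
    then have "summable (\<lambda>k. 2 ^ k * (norm (h k \<omega>))\<^sup>2)"
      by (intro summable_suminf_not_top) auto
    then have s: "summable (\<lambda>k. (1/2) ^ k + 2 ^ k * (norm (h k \<omega>))\<^sup>2)"
      by (intro summable_add summable_geometric) auto
    have "summable (\<lambda>k. norm (h k \<omega>))"
    proof (rule summable_comparison_test[OF _ s], intro exI allI impI)
      fix k
      let ?a = "sqrt ((1/2) ^ k)" and ?b = "sqrt (2 ^ k) * norm (h k \<omega>)"
      have "?a * ?b = norm (h k \<omega>)"
        by (simp add: real_sqrt_mult[symmetric] power_mult_distrib[symmetric] mult.assoc[symmetric])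
      moreover have "2 * ?a * ?b \<le> ?a\<^sup>2 + ?b\<^sup>2" by (rule sum_squares_bound)
      moreover have "?a\<^sup>2 + ?b\<^sup>2 = (1/2) ^ k + 2 ^ k * (norm (h k \<omega>))\<^sup>2"
        by (simp add: power_mult_distrib)
      moreover have "0 \<le> norm (h k \<omega>)" by simp
      ultimately have "norm (h k \<omega>) \<le> (1/2) ^ k + 2 ^ k * (norm (h k \<omega>))\<^sup>2"
        by (simp only: mult.assoc)
      then show "norm (norm (h k \<omega>)) \<le> (1/2) ^ k + 2 ^ k * (norm (h k \<omega>))\<^sup>2" by simp
    qed
    then have "summable (\<lambda>k. h k \<omega>)" by (rule summable_norm_cancel)
    then have "convergent (\<lambda>n. \<Sum>k<n. h k \<omega>)" by (simp add: summable_iff_convergent)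
    moreover have "(\<Sum>k<n. h k \<omega>) = f n \<omega> - f 0 \<omega>" for n
      unfolding h_def by (rule sum_lessThan_telescope)
    ultimately have "convergent (\<lambda>n. f n \<omega> - f 0 \<omega>)" by simp
    then have "convergent (\<lambda>n. (f n \<omega> - f 0 \<omega>) + f 0 \<omega>)" by (intro convergent_add convergent_const)
    then show "convergent (\<lambda>k. f k \<omega>)" by simp
  qed
  qed
  \<comment> \<open>\<open>lim\<close> is taken at every configuration, also where the sequence
    diverges, so F is symmetric everywhere and not only almost everywhere.\<close>
  define F where "F \<omega> = lim (\<lambda>k. f k \<omega>)" for \<omega>
  have [measurable]: "F \<in> borel_measurable config_measure" unfolding F_def[abs_def] by measurable
  have Fs: "symmetric F"
    unfolding symmetric_def
  proof (intro allI impI)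
    fix xs ys :: "real list" assume "mset xs = mset ys"
    then have "(\<lambda>k. f k xs) = (\<lambda>k. f k ys)"
      using fs unfolding symmetric_def by blast
    then show "F xs = F ys" unfolding F_def by (simp only:)
  qed
  have Fn: "(\<integral>\<^sup>+\<omega>. (norm (F \<omega> - f k \<omega>))\<^sup>2 \<partial>config_measure) \<le> ennreal (((1/2) ^ k)\<^sup>2)" for k
  proof -
    have "(\<integral>\<^sup>+\<omega>. (norm (F \<omega> - f k \<omega>))\<^sup>2 \<partial>config_measure) = (\<integral>\<^sup>+\<omega>. liminf (\<lambda>m. ennreal ((norm (f m \<omega> - f k \<omega>))\<^sup>2)) \<partial>config_measure)"
    proof (rule nn_integral_cong_AE)
      show "AE \<omega> in config_measure. ennreal ((norm (F \<omega> - f k \<omega>))\<^sup>2) = liminf (\<lambda>m. ennreal ((norm (f m \<omega> - f k \<omega>))\<^sup>2))"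
        using conv
      proof eventually_elim
        case (elim \<omega>)
        then have "(\<lambda>m. f m \<omega>) \<longlonglongrightarrow> F \<omega>" by (simp add: F_def convergent_LIMSEQ_iff)
        then have "(\<lambda>m. ennreal ((norm (f m \<omega> - f k \<omega>))\<^sup>2)) \<longlonglongrightarrow> ennreal ((norm (F \<omega> - f k \<omega>))\<^sup>2)"
          by (intro tendsto_intros tendsto_ennrealI)
        then show ?case by (intro lim_imp_Liminf[symmetric] sequentially_bot)
      qed
    qed
    also have "\<dots> \<le> liminf (\<lambda>m. \<integral>\<^sup>+\<omega>. ennreal ((norm (f m \<omega> - f k \<omega>))\<^sup>2) \<partial>config_measure)"
      by (rule nn_integral_liminf) measurable
    also have "\<dots> \<le> limsup (\<lambda>m. \<integral>\<^sup>+\<omega>. ennreal ((norm (f m \<omega> - f k \<omega>))\<^sup>2) \<partial>config_measure)"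
      by (rule Liminf_le_Limsup) simp
    also have "\<dots> \<le> ennreal (((1/2) ^ k)\<^sup>2)"
      by (rule Limsup_bounded) (auto intro!: eventually_sequentiallyI[of k] nf)
    finally show ?thesis .
  qed
  have Fd: "(\<lambda>\<omega>. F \<omega> - f k \<omega>) \<in> square_integrable" for k
    unfolding square_integrable_def
  proof (intro CollectI conjI)
    show "symmetric (\<lambda>\<omega>. F \<omega> - f k \<omega>)" by (rule symmetric_binary[OF Fs fs])
    show "integrable config_measure (\<lambda>\<omega>. (norm (F \<omega> - f k \<omega>))\<^sup>2)"
      using Fn[of k] by (intro integrableI_bounded) (auto simp: top_unique less_top intro: le_less_trans)
  qed measurable
  have "F \<in> square_integrable"
    using square_integrable_add[OF Fd[of 0] f(1)[of 0]] by simp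
  have "dist (X (r k)) (fock_of F) \<le> (1/2) ^ k" for k
  proof -
    have "ennreal ((norm (fock_of F - fock_of (f k)))\<^sup>2) \<le> ennreal (((1/2) ^ k)\<^sup>2)"
      using Fn[of k] nn_integral_norm_fock_of[OF Fd[of k]] fock_of_diff[OF \<open>F \<in> square_integrable\<close> f(1)[of k]] by simp
    then have "(norm (fock_of F - fock_of (f k)))\<^sup>2 \<le> ((1/2) ^ k)\<^sup>2"
      by (subst (asm) ennreal_le_iff) auto
    then have "norm (fock_of F - fock_of (f k)) \<le> (1/2) ^ k"
      by (rule power2_le_imp_le) simp
    then show ?thesis by (simp add: dist_norm f(2) norm_minus_commute)
  qed
  then have "(\<lambda>k. dist (X (r k)) (fock_of F)) \<longlonglongrightarrow> 0"
    by (intro Lim_null_comparison[OF always_eventually LIMSEQ_realpow_zero[of "1/2"]]) simp_all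
  then have "(X \<circ> r) \<longlonglongrightarrow> fock_of F"
    by (subst tendsto_dist_iff) (simp add: o_def)
  then have "X \<longlonglongrightarrow> fock_of F" by (rule Cauchy_converges_subseq[OF X r])
  then show "convergent X" by (rule convergentI)
qed

section \<open>Test functions\<close>

lemma topspace_config [simp]: "topspace config_topology = UNIV"
proof -
  have "{x \<in> topspace (euclidean_top n). chart n x \<in> UNIV} = topspace (euclidean_top n)" for n by blast
  then have "openin config_topology UNIV"
    unfolding openin_config_topology by (simp only: openin_topspace) simp
  then show ?thesis using openin_subset by blast
qed

lemma continuous_map_chart: "continuous_map (euclidean_top n) config_topology (chart n)"
  by (simp add: continuous_map_def openin_config_topology)

text \<open>The universal property of a disjoint union; every configuration lies in the image of the
  chart of its length.\<close>

lemma continuous_map_from_config: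
  "continuous_map config_topology Y g \<longleftrightarrow> (\<forall>n. continuous_map (euclidean_top n) Y (\<lambda>x. g (chart n x)))"
proof (intro iffI allI)
  show "continuous_map (euclidean_top n) Y (\<lambda>x. g (chart n x))" if "continuous_map config_topology Y g" for n
    using continuous_map_compose[OF continuous_map_chart that] by (simp add: o_def)
  assume *: "\<forall>n. continuous_map (euclidean_top n) Y (\<lambda>x. g (chart n x))"
  show "continuous_map config_topology Y g"
    unfolding continuous_map_def
  proof (intro conjI allI impI)
    show "g \<in> topspace config_topology \<rightarrow> topspace Y"
    proof
      fix \<omega>
      have "(\<lambda>i\<in>{..<length \<omega>}. \<omega> ! i) \<in> topspace (euclidean_top (length \<omega>))" by simp
      with *[rule_format, of "length \<omega>"] have "g (chart (length \<omega>) (\<lambda>i\<in>{..<length \<omega>}. \<omega> ! i)) \<in> topspace Y"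
        unfolding continuous_map_def by blast
      then show "g \<omega> \<in> topspace Y" by (simp only: chart_restrict_nth)
    qed
    show "openin config_topology {\<omega> \<in> topspace config_topology. g \<omega> \<in> U}" if "openin Y U" for U
      unfolding openin_config_topology
    proof
      fix n
      have "openin (euclidean_top n) {x \<in> topspace (euclidean_top n). g (chart n x) \<in> U}"
        by (rule openin_continuous_map_preimage[OF *[rule_format] that])
      then show "openin (euclidean_top n) {x \<in> topspace (euclidean_top n). chart n x \<in> {\<omega> \<in> topspace config_topology. g \<omega> \<in> U}}"
        by (simp only: mem_Collect_eq topspace_config UNIV_I simp_thms)
    qed
  qed
qed

definition config_box :: "nat \<Rightarrow> real list set" where
  "config_box n = {\<omega>. length \<omega> \<le> n \<and> set \<omega> \<subseteq> {- real n..real n}}"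

text \<open>A finite union of continuous images of compact cubes, one for each number of
  points.\<close>

lemma compactin_config_box: "compactin config_topology (config_box n)"
proof -
  have "config_box n = (\<Union>k\<in>{..n}. chart k ` PiE {..<k} (\<lambda>_. {- real n..real n}))"
  proof (intro subset_antisym subsetI)
    fix \<omega> assume w: "\<omega> \<in> config_box n"
    then have "(\<lambda>i\<in>{..<length \<omega>}. \<omega> ! i) \<in> PiE {..<length \<omega>} (\<lambda>_. {- real n..real n})"
      by (auto simp: config_box_def dest: nth_mem)
    then have "\<omega> \<in> chart (length \<omega>) ` PiE {..<length \<omega>} (\<lambda>_. {- real n..real n})"
      using chart_restrict_nth[of \<omega>] by (metis imageI)
    with w show "\<omega> \<in> (\<Union>k\<in>{..n}. chart k ` PiE {..<k} (\<lambda>_. {- real n..real n}))"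
      by (auto simp: config_box_def)
  next
    fix \<omega> assume "\<omega> \<in> (\<Union>k\<in>{..n}. chart k ` PiE {..<k} (\<lambda>_. {- real n..real n}))"
    then obtain k x where "k \<le> n" "x \<in> PiE {..<k} (\<lambda>_. {- real n..real n})" "\<omega> = chart k x" by blast
    then show "\<omega> \<in> config_box n"
      by (simp add: config_box_def chart_def PiE_iff image_subset_iff)
  qed
  also have "compactin config_topology \<dots>"
  proof (rule compactin_Union)
    fix S assume "S \<in> (\<lambda>k. chart k ` PiE {..<k} (\<lambda>_. {- real n..real n})) ` {..n}"
    then obtain k where "S = chart k ` PiE {..<k} (\<lambda>_. {- real n..real n})" by blast
    then show "compactin config_topology S"
      using image_compactin[OF _ continuous_map_chart, of k] by (simp add: compactin_PiE)
  qed simp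
  finally show ?thesis .
qed

lemma closedin_config_box: "closedin config_topology (config_box n)"
proof -
  have "openin (euclidean_top k) {x \<in> topspace (euclidean_top k). chart k x \<in> - config_box n}" for k
  proof (cases "k \<le> n")
    case True
    have "{x \<in> topspace (euclidean_top k). chart k x \<in> - config_box n} =
        (\<Union>i\<in>{..<k}. {x \<in> topspace (euclidean_top k). x i \<in> - {- real n..real n}})"
      using True by (auto simp: config_box_def chart_def image_subset_iff)
    also have "openin (euclidean_top k) \<dots>"
    proof (rule openin_Union)
      fix S assume "S \<in> (\<lambda>i. {x \<in> topspace (euclidean_top k). x i \<in> - {- real n..real n}}) ` {..<k}"
      then obtain i where i: "i \<in> {..<k}" "S = {x \<in> topspace (euclidean_top k). x i \<in> - {- real n..real n}}" by blast
      have "open (- {- real n..real n})" by (rule open_Compl) simp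
      then show "openin (euclidean_top k) S"
        unfolding i(2) by (intro openin_continuous_map_preimage[OF continuous_map_product_projection[OF i(1)]]) simp
    qed
    finally show ?thesis .
  next
    case False
    then have "{x \<in> topspace (euclidean_top k). chart k x \<in> - config_box n} = topspace (euclidean_top k)"
      by (auto simp: config_box_def)
    then show ?thesis by (simp only: openin_topspace)
  qed
  then show ?thesis
    by (simp add: closedin_def openin_config_topology Compl_eq_Diff_UNIV[symmetric])
qed

lemma test_functionsI:
  assumes "symmetric g" "\<And>n. continuous_map (euclidean_top n) euclidean (\<lambda>x. g (chart n x))"
    and "\<And>\<omega>. g \<omega> \<noteq> 0 \<Longrightarrow> \<omega> \<in> config_box n"
  shows "g \<in> test_functions"
proof -
  have "config_topology closure_of {\<omega>. g \<omega> \<noteq> 0} \<subseteq> config_box n"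
    using assms(3) by (intro closure_of_minimal closedin_config_box) auto
  then have "compactin config_topology (config_topology closure_of {\<omega>. g \<omega> \<noteq> 0})"
    by (rule closed_compactin[OF compactin_config_box]) simp
  with assms(1,2) show ?thesis
    by (simp add: test_functions_def continuous_map_from_config)
qed

lemma
  assumes "g \<in> test_functions"
  shows test_functions_symmetric: "symmetric g"
    and test_functions_continuous: "continuous_map (euclidean_top n) euclidean (\<lambda>x. g (chart n x))"
  using assms continuous_map_from_config[of euclidean g] unfolding test_functions_def by blast+

text \<open>The open sets \<open>U m\<close> bound the length, the coordinates and the value of g at
  once, so compactness of the support yields a single n for all three.\<close>

lemma test_functions_bounded:
  assumes g: "g \<in> test_functions"
  obtains n where "\<And>\<omega>. g \<omega> \<noteq> 0 \<Longrightarrow> \<omega> \<in> config_box n" "\<And>\<omega>. norm (g \<omega>) \<le> real n"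
proof -
  let ?S = "config_topology closure_of {\<omega>. g \<omega> \<noteq> 0}"
  define U where "U m = {\<omega>. length \<omega> < m \<and> set \<omega> \<subseteq> {- real m<..<real m} \<and> norm (g \<omega>) < real m}" for m
  have op: "openin config_topology (U m)" for m
  proof -
    have "openin (euclidean_top k) {x \<in> topspace (euclidean_top k). chart k x \<in> U m}" for k
    proof (cases "k < m")
      case True
      have c: "continuous_map (euclidean_top k) euclidean (\<lambda>x. g (chart k x))"
        by (rule test_functions_continuous[OF g])
      have "{x \<in> topspace (euclidean_top k). chart k x \<in> U m} = PiE {..<k} (\<lambda>_. {- real m<..<real m}) \<inter>
          {x \<in> topspace (euclidean_top k). g (chart k x) \<in> ball 0 (real m)}"
      proof (rule set_eqI)
        fix x
        show "x \<in> {x \<in> topspace (euclidean_top k). chart k x \<in> U m} \<longleftrightarrow>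
            x \<in> PiE {..<k} (\<lambda>_. {- real m<..<real m}) \<inter> {x \<in> topspace (euclidean_top k). g (chart k x) \<in> ball 0 (real m)}"
          using True by (auto simp: U_def PiE_iff image_subset_iff chart_def[of k x, THEN arg_cong[where f = set]])
      qed
      moreover have "openin (euclidean_top k) (PiE {..<k} (\<lambda>_. {- real m<..<real m}))"
        by (subst openin_PiE) auto
      moreover have "openin (euclidean_top k) {x \<in> topspace (euclidean_top k). g (chart k x) \<in> ball 0 (real m)}"
        by (rule openin_continuous_map_preimage[OF c]) simp
      ultimately show ?thesis by (simp only: openin_Int)
    next
      case False
      then have "{x \<in> topspace (euclidean_top k). chart k x \<in> U m} = {}" by (auto simp: U_def)
      then show ?thesis by (simp only: openin_empty)
    qed
    then show ?thesis by (simp add: openin_config_topology)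
  qed
  have cov: "?S \<subseteq> \<Union> (range U)"
  proof
    fix \<omega>
    obtain n where n: "length \<omega> \<le> n" "set \<omega> \<subseteq> {- real n..real n}" using config_bounded by blast
    obtain l :: nat where l: "norm (g \<omega>) < real l" using reals_Archimedean2 by blast
    have "\<omega> \<in> U (Suc (max n l))" using n l by (fastforce simp: U_def subset_iff)
    then show "\<omega> \<in> \<Union> (range U)" by blast
  qed
  have "compactin config_topology ?S" using g by (simp add: test_functions_def)
  then have "(\<forall>V\<in>range U. openin config_topology V) \<and> ?S \<subseteq> \<Union> (range U) \<longrightarrow>
      (\<exists>\<F>. finite \<F> \<and> \<F> \<subseteq> range U \<and> ?S \<subseteq> \<Union>\<F>)"
    unfolding compactin_def by (elim conjE allE)
  with op cov obtain \<F> where F: "finite \<F>" "\<F> \<subseteq> range U" "?S \<subseteq> \<Union>\<F>"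
    by blast
  then obtain I where I: "finite I" "\<F> = U ` I" by (metis finite_subset_image)
  define n where "n = Max (insert 0 I)"
  have n: "m \<le> n" if "m \<in> I" for m using that I by (simp add: n_def)
  have *: "\<omega> \<in> config_box n \<and> norm (g \<omega>) \<le> real n" if "g \<omega> \<noteq> 0" for \<omega>
  proof -
    have "\<omega> \<in> ?S" using that closure_of_subset[of "{\<omega>. g \<omega> \<noteq> 0}" config_topology] by auto
    then obtain m where m: "m \<in> I" "\<omega> \<in> U m" using F I by auto
    then have "real m \<le> real n" using n by simp
    with m show ?thesis by (fastforce simp: U_def config_box_def subset_iff)
  qed
  show thesis
  proof (rule that)
    show "norm (g \<omega>) \<le> real n" for \<omega> using *[of \<omega>] by (cases "g \<omega> = 0") auto
  qed (use * in blast)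
qed

text \<open>Composed with restriction, h becomes continuous on all real sequences, where the Borel
  sets agree with the product \<sigma>-algebra. Padding with zeros pulls the result back to n
  coordinates.\<close>

lemma borel_measurable_continuous_euclidean_top:
  fixes h :: "(nat \<Rightarrow> real) \<Rightarrow> 'a :: topological_space"
  assumes h: "continuous_map (euclidean_top n) euclidean h"
  shows "h \<in> borel_measurable (lebesgue_pow n)"
proof -
  have "continuous_map (product_topology (\<lambda>_. euclideanreal) UNIV) (euclidean_top n) (\<lambda>x. restrict x {..<n})"
    by (auto simp: continuous_map_componentwise intro: continuous_map_product_projection)
  from continuous_map_compose[OF this h] have "continuous_on UNIV (\<lambda>x. h (restrict x {..<n}))"
    by (simp add: o_def euclidean_product_topology)
  then have "(\<lambda>x. h (restrict x {..<n})) \<in> borel_measurable borel"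
    by (rule borel_measurable_continuous_onI)
  then have m: "(\<lambda>x. h (restrict x {..<n})) \<in> borel_measurable (PiM UNIV (\<lambda>_. borel))"
    using measurable_cong_sets[OF sets_PiM_equal_borel refl] by blast
  have "(\<lambda>x i. if i \<in> {..<n} then x i else 0) \<in> measurable (lebesgue_pow n) (PiM UNIV (\<lambda>_. borel :: real measure))"
  proof (rule measurable_PiM_single')
    fix i :: nat
    show "(\<lambda>x. if i \<in> {..<n} then x i else 0) \<in> borel_measurable (lebesgue_pow n)"
      by (cases "i \<in> {..<n}") auto
  qed auto
  from measurable_compose[OF this m]
  have "(\<lambda>x. h (restrict (\<lambda>i. if i \<in> {..<n} then x i else 0) {..<n})) \<in> borel_measurable (lebesgue_pow n)" .
  also have "?this \<longleftrightarrow> h \<in> borel_measurable (lebesgue_pow n)"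
  proof (rule measurable_cong)
    fix x assume "x \<in> space (lebesgue_pow n)"
    then have "restrict (\<lambda>i. if i \<in> {..<n} then x i else 0) {..<n} = x"
      by (auto simp: space_PiM fun_eq_iff PiE_def extensional_def)
    then show "h (restrict (\<lambda>i. if i \<in> {..<n} then x i else 0) {..<n}) = h x" by simp
  qed
  finally show ?thesis .
qed

lemma dominated_test_function:
  assumes g: "g \<in> test_functions"
  shows "dominated (\<lambda>_. g)"
proof -
  have "g \<in> borel_measurable config_measure"
    by (intro measurable_from_config_measure borel_measurable_continuous_euclidean_top test_functions_continuous[OF g])
  then have "(\<lambda>(r :: real, \<omega>). g \<omega>) \<in> borel_measurable (borel \<Otimes>\<^sub>M config_measure)"
    by (simp add: case_prod_unfold)
  moreover obtain n where n: "\<And>\<omega>. g \<omega> \<noteq> 0 \<Longrightarrow> \<omega> \<in> config_box n" "\<And>\<omega>. norm (g \<omega>) \<le> real n"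
    by (rule test_functions_bounded[OF g]) (rule that)
  have "norm (g \<omega>) \<le> real n * cutoff_power 1 (real n) \<omega>" for \<omega>
  proof (cases "g \<omega> = 0")
    case False
    then show ?thesis using n[of \<omega>] by (simp add: cutoff_power_def config_box_def)
  qed (simp add: cutoff_power_nonneg)
  then have "0 \<le> real n \<and> 1 \<le> (1 :: real) \<and> 0 \<le> real n \<and> (\<forall>(r :: real) \<omega>. norm (g \<omega>) \<le> real n * cutoff_power 1 (real n) \<omega>)"
    by simp
  then have "\<exists>C c R. 0 \<le> C \<and> 1 \<le> c \<and> 0 \<le> R \<and> (\<forall>(r :: real) \<omega>. norm (g \<omega>) \<le> C * cutoff_power c R \<omega>)"
    by blast
  ultimately show ?thesis
    using test_functions_symmetric[OF g] by (simp add: dominated_def)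
qed

lemma square_integrable_dominated:
  fixes G :: "real \<Rightarrow> real list \<Rightarrow> 'k :: separable_hilbert"
  assumes "dominated G"
  shows "G r \<in> square_integrable"
  using integrable_dominated_inner[OF assms assms, of r r] assms
    measurable_evolution_pair[OF assms measurable_const measurable_ident, of r]
  by (simp add: square_integrable_def dominated_def power2_norm_eq_inner)

lemma test_functions_square_integrable: "g \<in> test_functions \<Longrightarrow> g \<in> square_integrable"
  using square_integrable_dominated[OF dominated_test_function, of g] by simp

lemma test_functions_linear:
  fixes g h :: "real list \<Rightarrow> 'k :: separable_hilbert"
  assumes g: "g \<in> test_functions" and h: "h \<in> test_functions"
    and f: "continuous_on UNIV (case_prod f)" "f 0 0 = (0 :: 'k)"
  shows "(\<lambda>\<omega>. f (g \<omega>) (h \<omega>)) \<in> test_functions"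
proof -
  obtain n where n: "\<And>\<omega>. g \<omega> \<noteq> 0 \<Longrightarrow> \<omega> \<in> config_box n" "\<And>\<omega>. norm (g \<omega>) \<le> real n"
    by (rule test_functions_bounded[OF g]) (rule that)
  obtain m where m: "\<And>\<omega>. h \<omega> \<noteq> 0 \<Longrightarrow> \<omega> \<in> config_box m" "\<And>\<omega>. norm (h \<omega>) \<le> real m"
    by (rule test_functions_bounded[OF h]) (rule that)
  show ?thesis
  proof (rule test_functionsI[where n = "max n m"])
    show "symmetric (\<lambda>\<omega>. f (g \<omega>) (h \<omega>))"
      by (rule symmetric_binary[OF test_functions_symmetric[OF g] test_functions_symmetric[OF h]])
    show "continuous_map (euclidean_top k) euclidean (\<lambda>x. f (g (chart k x)) (h (chart k x)))" for k
    proof -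
      have "continuous_map (euclidean_top k) euclidean (\<lambda>x. g (chart k x))" "continuous_map (euclidean_top k) euclidean (\<lambda>x. h (chart k x))"
        by (intro test_functions_continuous g h)+
      then have "continuous_map (euclidean_top k) euclidean (\<lambda>x. (g (chart k x), h (chart k x)))"
        by (subst prod_topology_euclidean[symmetric]) (simp only: continuous_map_paired)
      moreover have "continuous_map euclidean euclidean (case_prod f)" using f by simp
      ultimately have "continuous_map (euclidean_top k) euclidean (case_prod f \<circ> (\<lambda>x. (g (chart k x), h (chart k x))))"
        by (rule continuous_map_compose)
      then show ?thesis by (simp add: o_def)
    qed
    fix \<omega> assume "f (g \<omega>) (h \<omega>) \<noteq> 0"
    then have "g \<omega> \<noteq> 0 \<or> h \<omega> \<noteq> 0" using f by auto
    then have "\<omega> \<in> config_box n \<or> \<omega> \<in> config_box m" using n m by blast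
    then show "\<omega> \<in> config_box (max n m)" by (auto simp: config_box_def subset_iff)
  qed
qed

lemma test_functions_add: "g \<in> test_functions \<Longrightarrow> h \<in> test_functions \<Longrightarrow> (\<lambda>\<omega>. g \<omega> + h \<omega>) \<in> test_functions"
  by (rule test_functions_linear[where f = "(+)"]) (auto simp: case_prod_unfold intro!: continuous_intros)

lemma test_functions_scaleC: "g \<in> test_functions \<Longrightarrow> (\<lambda>\<omega>. c *\<^sub>C g \<omega>) \<in> test_functions"
  by (rule test_functions_linear[where f = "\<lambda>x _. c *\<^sub>C x" and h = g])
    (auto simp: case_prod_unfold intro!: bounded_linear.continuous_on[OF bounded_linear_scaleC] continuous_intros)

lemma test_functions_uminus:
  assumes g: "g \<in> test_functions"
  shows "(\<lambda>\<omega>. g (map uminus \<omega>)) \<in> test_functions"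
proof -
  obtain n where n: "\<And>\<omega>. g \<omega> \<noteq> 0 \<Longrightarrow> \<omega> \<in> config_box n" "\<And>\<omega>. norm (g \<omega>) \<le> real n"
    by (rule test_functions_bounded[OF g]) (rule that)
  show ?thesis
  proof (rule test_functionsI[where n = n])
    show "symmetric (\<lambda>\<omega>. g (map uminus \<omega>))"
      by (rule symmetric_uminus[OF test_functions_symmetric[OF g]])
    show "continuous_map (euclidean_top k) euclidean (\<lambda>x. g (map uminus (chart k x)))" for k
    proof -
      have "continuous_map (euclidean_top k) (euclidean_top k) (\<lambda>x. \<lambda>i\<in>{..<k}. - x i)"
        by (auto simp: continuous_map_componentwise intro!: continuous_map_minus continuous_map_product_projection)
      from continuous_map_compose[OF this test_functions_continuous[OF g]]
      have "continuous_map (euclidean_top k) euclidean (\<lambda>x. g (chart k (\<lambda>i\<in>{..<k}. - x i)))"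
        by (simp only: o_def)
      moreover have "chart k (\<lambda>i\<in>{..<k}. - x i) = map uminus (chart k x)" for x
        by (simp add: chart_def)
      ultimately show ?thesis by simp
    qed
    fix \<omega> assume "g (map uminus \<omega>) \<noteq> 0"
    then have "map uminus \<omega> \<in> config_box n" by (rule n(1))
    then show "\<omega> \<in> config_box n" by (auto simp: config_box_def subset_iff)
  qed
qed

section \<open>Permanents of one-particle functions\<close>

text \<open>The permanent of the matrix of values \<phi>_i(q_j), expanded along its first row, and 0
  if the matrix is not square. As a function of the configuration it is the unnormalised symmetric
  tensor product of the \<phi>_i.\<close>

fun permanent :: "(real \<Rightarrow> real) list \<Rightarrow> real list \<Rightarrow> real" where
  "permanent [] \<omega> = (if \<omega> = [] then 1 else 0)"
| "permanent (\<phi> # \<phi>s) \<omega> = sum_delete (\<lambda>q \<omega>'. \<phi> q * permanent \<phi>s \<omega>') \<omega>"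

lemma symmetric_permanent: "symmetric (permanent \<phi>s)"
proof (induction \<phi>s)
  case Nil
  show ?case by (auto simp: symmetric_def)
next
  case (Cons \<phi> \<phi>s)
  have s: "permanent \<phi>s xs = permanent \<phi>s ys" if "mset xs = mset ys" for xs ys
    using Cons that unfolding symmetric_def by blast
  show ?case
    unfolding symmetric_def permanent.simps
    by (intro allI impI sum_delete_eqI arg_cong2[where f = "(*)"] refl s)
qed

lemma permanent_nonzero:
  assumes "\<And>\<phi> q. \<phi> \<in> set \<phi>s \<Longrightarrow> \<phi> q \<noteq> 0 \<Longrightarrow> q \<in> S" "permanent \<phi>s \<omega> \<noteq> 0"
  shows "length \<omega> = length \<phi>s \<and> set \<omega> \<subseteq> S"
  using assms
proof (induction \<phi>s arbitrary: \<omega>)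
  case Nil
  then show ?case by (auto split: if_splits)
next
  case (Cons \<phi> \<phi>s)
  obtain q \<omega>' where *: "mset (\<omega>' @ [q]) = mset \<omega>" "\<phi> q * permanent \<phi>s \<omega>' \<noteq> 0"
    using Cons.prems(2) sum_delete_neutral[of \<omega> "\<lambda>q \<omega>'. \<phi> q * permanent \<phi>s \<omega>'"] by auto
  have "length \<omega>' = length \<phi>s \<and> set \<omega>' \<subseteq> S"
    using * Cons.prems(1) by (intro Cons.IH) auto
  moreover have "q \<in> S" using * Cons.prems(1)[of \<phi> q] by auto
  moreover have "length \<omega> = Suc (length \<omega>')" using mset_eq_length[OF *(1)] by simp
  moreover have "set \<omega> = insert q (set \<omega>')" using mset_eq_setD[OF *(1)] by simp
  ultimately show ?case by simp
qed

lemma permanent_bounds: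
  assumes "\<And>\<phi> q. \<phi> \<in> set \<phi>s \<Longrightarrow> 0 \<le> \<phi> q \<and> \<phi> q \<le> 1"
  shows "0 \<le> permanent \<phi>s \<omega> \<and> permanent \<phi>s \<omega> \<le> fact (length \<phi>s)"
  using assms
proof (induction \<phi>s arbitrary: \<omega>)
  case (Cons \<phi> \<phi>s)
  have IH: "0 \<le> permanent \<phi>s \<omega> \<and> permanent \<phi>s \<omega> \<le> fact (length \<phi>s)" for \<omega>
    by (rule Cons.IH) (use Cons.prems in simp)
  have \<phi>: "0 \<le> \<phi> q" "\<phi> q \<le> 1" for q using Cons.prems[of \<phi> q] by auto
  have nn: "0 \<le> permanent (\<phi> # \<phi>s) \<omega>"
    unfolding permanent.simps sum_delete_def using IH \<phi> by (intro sum_nonneg mult_nonneg_nonneg) auto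
  moreover have "permanent (\<phi> # \<phi>s) \<omega> \<le> fact (length (\<phi> # \<phi>s))"
  proof (cases "length \<omega> = length (\<phi> # \<phi>s)")
    case True
    have "permanent (\<phi> # \<phi>s) \<omega> \<le> (\<Sum>i<length \<omega>. 1 * fact (length \<phi>s))"
      unfolding permanent.simps sum_delete_def using IH \<phi> by (intro sum_mono mult_mono) auto
    also have "\<dots> = fact (length (\<phi> # \<phi>s))" using True by simp
    finally show ?thesis .
  next
    case False
    then have "permanent (\<phi> # \<phi>s) \<omega> = 0" using permanent_nonzero[of "\<phi> # \<phi>s" UNIV \<omega>] by blast
    then show ?thesis by simp
  qed
  ultimately show ?case by blast
qed simp

lemma continuous_map_permanent:
  assumes "\<And>\<phi>. \<phi> \<in> set \<phi>s \<Longrightarrow> continuous_on UNIV \<phi>" "\<And>f. f \<in> set fs \<Longrightarrow> continuous_map X euclideanreal f"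
  shows "continuous_map X euclideanreal (\<lambda>x. permanent \<phi>s (map (\<lambda>f. f x) fs))"
  using assms
proof (induction \<phi>s arbitrary: fs)
  case Nil
  show ?case by (cases fs) auto
next
  case (Cons \<phi> \<phi>s)
  have "continuous_map X euclideanreal (\<lambda>x. \<Sum>i\<in>{..<length fs}. \<phi> ((fs ! i) x) * permanent \<phi>s (map (\<lambda>f. f x) (take i fs @ drop (Suc i) fs)))"
  proof (intro continuous_map_sum continuous_map_real_mult)
    fix i assume i: "i \<in> {..<length fs}"
    have "continuous_map X euclideanreal (\<phi> \<circ> (fs ! i))"
      using i Cons.prems by (intro continuous_map_compose[of X euclideanreal]) auto
    then show "continuous_map X euclideanreal (\<lambda>x. \<phi> ((fs ! i) x))" by (simp add: o_def)
    show "continuous_map X euclideanreal (\<lambda>x. permanent \<phi>s (map (\<lambda>f. f x) (take i fs @ drop (Suc i) fs)))"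
      using Cons.prems by (intro Cons.IH) (auto dest: in_set_takeD in_set_dropD)
  qed simp
  also have "(\<lambda>x. \<Sum>i\<in>{..<length fs}. \<phi> ((fs ! i) x) * permanent \<phi>s (map (\<lambda>f. f x) (take i fs @ drop (Suc i) fs))) =
      (\<lambda>x. permanent (\<phi> # \<phi>s) (map (\<lambda>f. f x) fs))"
    unfolding permanent.simps sum_delete_def by (intro ext sum.cong) (auto simp: take_map drop_map)
  finally show ?case .
qed

lemma permanent_test_function:
  assumes "\<And>\<phi>. \<phi> \<in> set \<phi>s \<Longrightarrow> continuous_on UNIV \<phi>" "\<And>\<phi> q. \<phi> \<in> set \<phi>s \<Longrightarrow> \<phi> q \<noteq> 0 \<Longrightarrow> \<bar>q\<bar> \<le> real n"
  shows "(\<lambda>\<omega>. permanent \<phi>s \<omega> *\<^sub>R x) \<in> test_functions"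
proof (rule test_functionsI[where n = "max n (length \<phi>s)"])
  show "symmetric (\<lambda>\<omega>. permanent \<phi>s \<omega> *\<^sub>R x)"
    using symmetric_permanent[of \<phi>s] unfolding symmetric_def by metis
  show "continuous_map (euclidean_top k) euclidean (\<lambda>y. permanent \<phi>s (chart k y) *\<^sub>R x)" for k
  proof -
    have "continuous_map (euclidean_top k) euclideanreal (\<lambda>y. permanent \<phi>s (map (\<lambda>f. f y) (map (\<lambda>i y. y i) [0..<k])))"
      using assms(1) by (intro continuous_map_permanent) (auto intro: continuous_map_product_projection)
    then have "continuous_map (euclidean_top k) euclideanreal (\<lambda>y. permanent \<phi>s (chart k y))"
      by (simp add: chart_def o_def)
    moreover have "continuous_map euclideanreal euclidean (\<lambda>c. c *\<^sub>R x)"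
      by (auto intro!: continuous_intros)
    ultimately have "continuous_map (euclidean_top k) euclidean ((\<lambda>c. c *\<^sub>R x) \<circ> (\<lambda>y. permanent \<phi>s (chart k y)))"
      by (rule continuous_map_compose)
    then show ?thesis by (simp add: o_def)
  qed
  fix \<omega> assume "permanent \<phi>s \<omega> *\<^sub>R x \<noteq> 0"
  then have "length \<omega> = length \<phi>s \<and> set \<omega> \<subseteq> {q. \<bar>q\<bar> \<le> real n}"
    using assms(2) by (intro permanent_nonzero) auto
  then show "\<omega> \<in> config_box (max n (length \<phi>s))"
    by (fastforce simp: config_box_def subset_iff abs_le_iff)
qed

section \<open>Density of the test functions\<close>

text \<open>Continuous substitutes for the indicator of (a,b), with ramps of slope k at both ends.
  The rational parameters leave only countably many of them, so that exceptional null sets can be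
  united.\<close>

definition trapezoid :: "rat \<times> rat \<times> nat \<Rightarrow> real \<Rightarrow> real" where
  "trapezoid = (\<lambda>(a, b, k) q. max 0 (min 1 (real k * (q - of_rat a))) * max 0 (min 1 (real k * (of_rat b - q))))"

lemma trapezoid_bounds: "0 \<le> trapezoid z q \<and> trapezoid z q \<le> 1"
  by (cases z) (auto simp: trapezoid_def intro!: mult_nonneg_nonneg mult_le_one)

lemma continuous_trapezoid: "continuous_on UNIV (trapezoid z)"
  by (cases z) (auto simp: trapezoid_def intro!: continuous_intros)

lemma measurable_trapezoid [measurable]: "trapezoid z \<in> borel_measurable borel"
  by (rule borel_measurable_continuous_onI[OF continuous_trapezoid])

lemma trapezoid_support: "trapezoid (a, b, k) q \<noteq> 0 \<Longrightarrow> of_rat a < q \<and> q < of_rat b"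
proof (rule ccontr)
  assume nz: "trapezoid (a, b, k) q \<noteq> 0" and "\<not> (of_rat a < q \<and> q < of_rat b)"
  then have "real k * (q - of_rat a) \<le> 0 \<or> real k * (of_rat b - q) \<le> 0"
    by (auto intro: mult_nonneg_nonpos)
  then have "trapezoid (a, b, k) q = 0" by (auto simp: trapezoid_def)
  with nz show False by simp
qed

lemma ex_trapezoid_bound: "\<exists>n::nat. \<forall>q. trapezoid z q \<noteq> 0 \<longrightarrow> \<bar>q\<bar> \<le> real n"
proof -
  obtain a b k where z: "z = (a, b, k)" by (cases z)
  obtain n :: nat where n: "max \<bar>of_rat a\<bar> \<bar>of_rat b\<bar> \<le> (real n)" using real_arch_simple by blast
  have "\<bar>q\<bar> \<le> real n" if "trapezoid z q \<noteq> 0" for q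
    using trapezoid_support[of a b k q] that n unfolding z by linarith
  then show ?thesis by blast
qed

lemma ex_trapezoid_bound_list: "\<exists>n::nat. \<forall>z\<in>set zs. \<forall>q. trapezoid z q \<noteq> 0 \<longrightarrow> \<bar>q\<bar> \<le> real n"
proof (induction zs)
  case (Cons z zs)
  then obtain m n :: nat where m: "\<forall>z\<in>set zs. \<forall>q. trapezoid z q \<noteq> 0 \<longrightarrow> \<bar>q\<bar> \<le> real m"
    and n: "\<forall>q. trapezoid z q \<noteq> 0 \<longrightarrow> \<bar>q\<bar> \<le> real n" using ex_trapezoid_bound by blast
  have "\<forall>z'\<in>set (z # zs). \<forall>q. trapezoid z' q \<noteq> 0 \<longrightarrow> \<bar>q\<bar> \<le> real (max m n)"
  proof (intro ballI allI impI)
    fix z' q assume z': "z' \<in> set (z # zs)" "trapezoid z' q \<noteq> 0"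
    have "\<bar>q\<bar> \<le> real m \<or> \<bar>q\<bar> \<le> real n"
    proof (cases "z' = z")
      case True
      with z' n show ?thesis by blast
    next
      case False
      with z'(1) have "z' \<in> set zs" by simp
      with z'(2) m show ?thesis by blast
    qed
    then show "\<bar>q\<bar> \<le> real (max m n)" by auto
  qed
  then show ?case by blast
qed simp

text \<open>The right end m is rational, so only the left end x has to be approximated, from above.
  The error of \<open>a k\<close> stays below 1/(k+1), so that it remains at most 1 after
  multiplication by the slope k.\<close>

lemma trapezoid_limit:
  assumes "- real m \<le> x" "x < real m"
  obtains z where "\<And>k. (\<forall>q. trapezoid (z k) q \<noteq> 0 \<longrightarrow> q \<in> {- real m..real m})"
    "\<And>q. (\<lambda>k. trapezoid (z k) q) \<longlonglongrightarrow> indicator {x<..<real m} q"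
proof -
  have "\<exists>a. x < of_rat a \<and> of_rat a < x + 1 / real (Suc k)" for k
    by (rule of_rat_dense) simp
  then obtain a where a: "\<And>k. x < of_rat (a k)" "\<And>k. of_rat (a k) < x + 1 / real (Suc k)" by metis
  define z where "z k = (a k, of_nat m :: rat, k)" for k :: nat
  show thesis
  proof (rule that[of z])
    show "\<forall>q. trapezoid (z k) q \<noteq> 0 \<longrightarrow> q \<in> {- real m..real m}" for k
      using trapezoid_support[of "a k" "of_nat m" k] a(1)[of k] assms by (fastforce simp: z_def)
    fix q
    show "(\<lambda>k. trapezoid (z k) q) \<longlonglongrightarrow> indicator {x<..<real m} q"
    proof (cases "x < q \<and> q < real m")
      case True
      \<comment> \<open>The constant is 2 and not 1 because replacing x by \<open>a k\<close> costs
        up to 1 after multiplication by k.\<close>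
      obtain N1 :: nat where N1: "2 / (q - x) < real N1" using reals_Archimedean2 by blast
      obtain N2 :: nat where N2: "1 / (real m - q) < real N2" using reals_Archimedean2 by blast
      have "trapezoid (z k) q = 1" if "max N1 N2 \<le> k" for k
      proof -
        have k1: "2 / (q - x) < real k" and k2: "1 / (real m - q) < real k"
          using that N1 N2 by (auto intro: less_le_trans)
        have k1': "2 < real k * (q - x)" using k1 True by (simp add: divide_less_eq)
        have k2': "1 < real k * (real m - q)" using k2 True by (simp add: divide_less_eq)
        have kp: "0 < real k" using k1 True by (meson divide_pos_pos diff_gt_0_iff_gt less_trans zero_less_numeral)
        have "real k * (1 / real (Suc k)) \<le> 1" by (simp add: divide_le_eq)
        moreover have "real k * (of_rat (a k) - x) \<le> real k * (1 / real (Suc k))"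
          using a(2)[of k] kp by (intro mult_left_mono) auto
        ultimately have "real k * (of_rat (a k) - x) \<le> 1" by (rule order_trans[rotated])
        then have "1 \<le> real k * (q - of_rat (a k))"
          using k1' by (simp add: right_diff_distrib)
        with k2' show ?thesis by (simp add: trapezoid_def z_def of_rat_of_nat_eq)
      qed
      then have "eventually (\<lambda>k. trapezoid (z k) q = 1) sequentially"
        unfolding eventually_sequentially by blast
      then have "(\<lambda>k. trapezoid (z k) q) \<longlonglongrightarrow> 1" by (rule tendsto_eventually)
      with True show ?thesis by simp
    next
      case False
      have "trapezoid (z k) q = 0" for k
      proof (rule ccontr)
        assume "trapezoid (z k) q \<noteq> 0"
        then have "of_rat (a k) < q \<and> q < of_rat (of_nat m)" unfolding z_def by (rule trapezoid_support)
        then show False using a(1)[of k] False by (simp add: of_rat_of_nat_eq)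
      qed
      with False show ?thesis by (auto simp: indicator_def)
    qed
  qed
qed

text \<open>After a cutoff to [-m,m], bounded convergence of the trapezoids shows that the integrals
  over half lines vanish. Half lines are an intersection-stable generator of the Borel sets, so the
  integral over every Borel set vanishes.\<close>

lemma AE_eq_0_if_trapezoid_integrals_eq_0:
  fixes F :: "real \<Rightarrow> 'k :: {banach, second_countable_topology}"
  assumes int: "\<And>m::nat. integrable lborel (\<lambda>q. indicator {- real m..real m} q *\<^sub>R F q)"
    and zero: "\<And>z. (\<integral>q. trapezoid z q *\<^sub>R F q \<partial>lborel) = 0"
  shows "AE q in lborel. F q = 0"
proof -
  have "AE q in lborel. indicator {- real m..real m} q *\<^sub>R F q = 0" for m :: nat
  proof -
    define Fm where "Fm q = indicator {- real m..real m} q *\<^sub>R F q" for q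
    have Fm: "integrable lborel Fm" using int by (simp add: Fm_def[abs_def])
    then have [measurable]: "Fm \<in> borel_measurable lborel" by auto
    have mid: "(\<integral>q. indicator {x<..<real m} q *\<^sub>R Fm q \<partial>lborel) = 0" if x: "- real m \<le> x" "x < real m" for x
    proof -
      obtain z where z: "\<And>k. (\<forall>q. trapezoid (z k) q \<noteq> 0 \<longrightarrow> q \<in> {- real m..real m})"
        "\<And>q. (\<lambda>k. trapezoid (z k) q) \<longlonglongrightarrow> indicator {x<..<real m} q"
        by (rule trapezoid_limit[OF x]) (rule that)
      have "(\<lambda>k. \<integral>q. trapezoid (z k) q *\<^sub>R Fm q \<partial>lborel) \<longlonglongrightarrow> (\<integral>q. indicator {x<..<real m} q *\<^sub>R Fm q \<partial>lborel)"
      proof (rule integral_dominated_convergence[where w = "\<lambda>q. norm (Fm q)"])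
        show "AE q in lborel. (\<lambda>k. trapezoid (z k) q *\<^sub>R Fm q) \<longlonglongrightarrow> indicator {x<..<real m} q *\<^sub>R Fm q"
          using z(2) by (intro AE_I2 tendsto_scaleR tendsto_const)
        show "AE q in lborel. norm (trapezoid (z k) q *\<^sub>R Fm q) \<le> norm (Fm q)" for k
        proof (rule AE_I2)
          fix q
          have "\<bar>trapezoid (z k) q\<bar> \<le> 1" using trapezoid_bounds[of "z k" q] by simp
          from mult_right_mono[OF this norm_ge_zero[of "Fm q"]]
          show "norm (trapezoid (z k) q *\<^sub>R Fm q) \<le> norm (Fm q)" by simp
        qed
      qed (use Fm in auto)
      moreover have "trapezoid (z k) q *\<^sub>R Fm q = trapezoid (z k) q *\<^sub>R F q" for k q
        using z(1)[of k] by (cases "trapezoid (z k) q = 0") (auto simp: Fm_def)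
      ultimately show ?thesis using zero by (simp add: LIMSEQ_const_iff)
    qed
    have half: "(\<integral>q. indicator {x<..} q *\<^sub>R Fm q \<partial>lborel) = 0" for x
    proof (cases "x < real m")
      case True
      let ?x = "max x (- real m)"
      show ?thesis
      proof (cases "?x < real m")
        case True2: True
        have "(\<integral>q. indicator {x<..} q *\<^sub>R Fm q \<partial>lborel) = (\<integral>q. indicator {?x<..<real m} q *\<^sub>R Fm q \<partial>lborel)"
        proof (rule integral_cong_AE)
          show "AE q in lborel. indicator {x<..} q *\<^sub>R Fm q = indicator {?x<..<real m} q *\<^sub>R Fm q"
            using AE_lborel_singleton[of "real m"] AE_lborel_singleton[of "- real m"]
            by eventually_elim (auto simp: Fm_def indicator_def)
        qed measurable
        then show ?thesis using mid[of ?x] True2 by simp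
      next
        case False
        \<comment> \<open>The interval is empty although x < m; this forces -m \<ge> m. The cut-off
          function is then supported in one point.\<close>
        then have "m = 0" using True by auto
        have "(\<integral>q. indicator {x<..} q *\<^sub>R Fm q \<partial>lborel) = (\<integral>q. 0 \<partial>(lborel :: real measure))"
        proof (rule integral_cong_AE)
          show "AE q in lborel. indicator {x<..} q *\<^sub>R Fm q = 0"
            using AE_lborel_singleton[of 0] by eventually_elim (use \<open>m = 0\<close> in \<open>auto simp: Fm_def indicator_def\<close>)
        qed measurable
        then show ?thesis by simp
      qed
    next
      case False
      then have "(\<lambda>q. indicator {x<..} q *\<^sub>R Fm q) = (\<lambda>_. 0)" by (auto simp: Fm_def indicator_def)
      then show ?thesis by simp
    qed
    have total: "(\<integral>q. Fm q \<partial>lborel) = 0"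
    proof -
      have "indicator {- real m - 1<..} q *\<^sub>R Fm q = Fm q" for q by (auto simp: Fm_def indicator_def)
      then show ?thesis using half[of "- real m - 1"] by simp
    qed
    have bor: "sets borel = sigma_sets UNIV (range (greaterThan :: real \<Rightarrow> _))"
      by (subst borel_Ioi) (rule sets_measure_of, simp)
    have "set_lebesgue_integral lborel A Fm = 0" if "A \<in> sets lborel" for A
    proof -
      have "A \<in> sigma_sets UNIV (range greaterThan)"
        using that unfolding sets_lborel bor .
      then show ?thesis
      proof (rule sigma_sets_induct_disjoint[rotated 2])
        show "Int_stable (range (greaterThan :: real \<Rightarrow> _))"
        proof (rule Int_stableI)
          fix A B :: "real set" assume "A \<in> range greaterThan" "B \<in> range greaterThan"
          then obtain a b where "A = {a<..}" "B = {b<..}" by auto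
          then have "A \<inter> B = {max a b<..}" by auto
          then show "A \<inter> B \<in> range greaterThan" by blast
        qed
      next
        fix A assume "A \<in> range (greaterThan :: real \<Rightarrow> _)"
        then show "set_lebesgue_integral lborel A Fm = 0" using half by (auto simp: set_lebesgue_integral_def)
      next
        fix A assume A: "A \<in> sigma_sets UNIV (range (greaterThan :: real \<Rightarrow> _))" "set_lebesgue_integral lborel A Fm = 0"
        have m: "A \<in> sets borel" using A(1) unfolding bor .
        have "indicator (UNIV - A) q *\<^sub>R Fm q = Fm q - indicator A q *\<^sub>R Fm q" for q
          by (auto simp: indicator_def)
        then show "set_lebesgue_integral lborel (UNIV - A) Fm = 0"
          using A(2) total integrable_mult_indicator[OF _ Fm, of A] m Fm by (simp add: set_lebesgue_integral_def)
      next
        fix A :: "nat \<Rightarrow> real set"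
        assume A: "disjoint_family A" "range A \<subseteq> sigma_sets UNIV (range greaterThan)" "\<And>i. set_lebesgue_integral lborel (A i) Fm = 0"
        have m: "A i \<in> sets lborel" for i using A(2) unfolding sets_lborel bor by blast
        have "set_lebesgue_integral lborel (\<Union>i. A i) Fm = (\<Sum>i. set_lebesgue_integral lborel (A i) Fm)"
        proof (rule lebesgue_integral_countable_add[OF m])
          show "A i \<inter> A j = {}" if "i \<noteq> j" for i j using A(1) that by (auto simp: disjoint_family_on_def)
          show "set_integrable lborel (\<Union>i. A i) Fm"
            unfolding set_integrable_def using m by (intro integrable_mult_indicator Fm) auto
        qed
        then show "set_lebesgue_integral lborel (\<Union>i. A i) Fm = 0" using A(3) by simp
      qed (auto simp: set_lebesgue_integral_def)
    qed
    then have "AE q in lborel. Fm q = 0" by (rule sigma_finite_measure.density_zero[OF sigma_finite_lborel Fm])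
    then show ?thesis by (simp add: Fm_def)
  qed
  then have "AE q in lborel. \<forall>m::nat. indicator {- real m..real m} q *\<^sub>R F q = 0"
    by (subst AE_all_countable) simp
  then show ?thesis
  proof eventually_elim
    case (elim q)
    obtain m :: nat where "\<bar>q\<bar> \<le> real m" using real_arch_simple by blast
    then have "indicator {- real m..real m} q = (1 :: real)" by (auto simp: indicator_def abs_le_iff)
    with elim[rule_format, of m] show ?case by simp
  qed
qed

section \<open>From one particle to n particles\<close>

definition layer :: "nat \<Rightarrow> nat \<Rightarrow> real list \<Rightarrow> real" where
  "layer n m \<omega> = (if length \<omega> = n then cutoff_power 1 (real m) \<omega> else 0)"

lemma measurable_layer [measurable]: "layer n m \<in> borel_measurable config_measure"
  unfolding layer_def[abs_def] by measurable

lemma layer_bounds: "0 \<le> layer n m \<omega>" "layer n m \<omega> \<le> 1"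
  by (auto simp: layer_def cutoff_power_def)

lemma layer_snoc: "layer (Suc n) m (\<omega> @ [q]) = layer n m \<omega> * indicator {- real m..real m} q"
  by (simp add: layer_def cutoff_power_snoc)

lemma layer_mono: "m \<le> m' \<Longrightarrow> layer n m \<omega> * layer n m' \<omega> = layer n m \<omega>"
  by (fastforce simp: layer_def cutoff_power_def subset_iff)

text \<open>For symmetric f every deletion reproduces the full integrand, so
  \<open>sum_delete\<close> gives n + 1 equal copies, and the sum-integral formula carries
  integrability over to the pair of \<omega> and q.\<close>

lemma integrable_layer_snoc:
  fixes f :: "real list \<Rightarrow> 'k :: {banach, second_countable_topology}"
  assumes [measurable]: "f \<in> borel_measurable config_measure" and sym: "symmetric f"
    and int: "integrable config_measure (\<lambda>\<omega>. layer (Suc n) m \<omega> *\<^sub>R f \<omega>)"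
  shows "integrable (config_measure \<Otimes>\<^sub>M lborel) (\<lambda>(\<omega>, q). layer (Suc n) m (\<omega> @ [q]) *\<^sub>R f (\<omega> @ [q]))"
proof (rule integrableI_bounded)
  let ?h = "\<lambda>q \<omega>. ennreal (norm (layer (Suc n) m (\<omega> @ [q]) *\<^sub>R f (\<omega> @ [q])))"
  have sl: "layer (Suc n) m \<omega> *\<^sub>R f \<omega> = layer (Suc n) m \<omega>' *\<^sub>R f \<omega>'" if "mset \<omega> = mset \<omega>'" for \<omega> \<omega>'
  proof -
    have "f \<omega> = f \<omega>'" using sym that unfolding symmetric_def by blast
    then show ?thesis
      unfolding layer_def cutoff_power_def mset_eq_length[OF that] mset_eq_setD[OF that] by simp
  qed
  show "(\<lambda>(\<omega>, q). layer (Suc n) m (\<omega> @ [q]) *\<^sub>R f (\<omega> @ [q])) \<in> borel_measurable (config_measure \<Otimes>\<^sub>M lborel)"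
    by measurable
  have mh: "case_prod ?h \<in> borel_measurable (borel \<Otimes>\<^sub>M config_measure)"
    unfolding case_prod_unfold by measurable
  have mz: "(\<lambda>z. ?h (snd z) (fst z)) \<in> borel_measurable (config_measure \<Otimes>\<^sub>M lborel)"
    by measurable
  have "(\<integral>\<^sup>+z. norm (case z of (\<omega>, q) \<Rightarrow> layer (Suc n) m (\<omega> @ [q]) *\<^sub>R f (\<omega> @ [q])) \<partial>(config_measure \<Otimes>\<^sub>M lborel)) =
      (\<integral>\<^sup>+\<omega>. \<integral>\<^sup>+q. ?h q \<omega> \<partial>lborel \<partial>config_measure)"
    unfolding case_prod_unfold by (rule lborel.nn_integral_fst[OF mz, unfolded fst_conv snd_conv, symmetric])
  also have "\<dots> = (\<integral>\<^sup>+\<omega>. sum_delete ?h \<omega> \<partial>config_measure)"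
    by (rule nn_integral_sum_delete[OF mh, symmetric])
  also have "\<dots> = (\<integral>\<^sup>+\<omega>. of_nat (Suc n) * ennreal (norm (layer (Suc n) m \<omega> *\<^sub>R f \<omega>)) \<partial>config_measure)"
  proof (rule nn_integral_cong)
    fix \<omega>
    have "sum_delete ?h \<omega> = sum_delete (\<lambda>_ _. ennreal (norm (layer (Suc n) m \<omega> *\<^sub>R f \<omega>))) \<omega>"
      by (rule sum_delete_cong) (rule arg_cong[OF sl])
    also have "\<dots> = of_nat (length \<omega>) * ennreal (norm (layer (Suc n) m \<omega> *\<^sub>R f \<omega>))"
      by (simp add: sum_delete_def)
    also have "\<dots> = of_nat (Suc n) * ennreal (norm (layer (Suc n) m \<omega> *\<^sub>R f \<omega>))"
      by (cases "length \<omega> = Suc n") (simp_all add: layer_def)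
    finally show "sum_delete ?h \<omega> = of_nat (Suc n) * ennreal (norm (layer (Suc n) m \<omega> *\<^sub>R f \<omega>))" .
  qed
  also have "\<dots> = of_nat (Suc n) * (\<integral>\<^sup>+\<omega>. norm (layer (Suc n) m \<omega> *\<^sub>R f \<omega>) \<partial>config_measure)"
    by (rule nn_integral_cmult) measurable
  also have "\<dots> < \<infinity>"
    using int by (simp add: integrable_iff_bounded ennreal_mult_less_top of_nat_less_top del: of_nat_Suc)
  finally show "(\<integral>\<^sup>+z. norm (case z of (\<omega>, q) \<Rightarrow> layer (Suc n) m (\<omega> @ [q]) *\<^sub>R f (\<omega> @ [q])) \<partial>(config_measure \<Otimes>\<^sub>M lborel)) < \<infinity>" .
qed

lemma measurable_permanent [measurable]:
  "permanent (map trapezoid zs) \<in> borel_measurable config_measure"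
proof (induction zs)
  case Nil
  have [measurable]: "Measurable.pred config_measure (\<lambda>\<omega>. \<omega> = [])"
    unfolding length_0_conv[symmetric] by measurable
  show ?case by simp measurable
next
  case (Cons z zs)
  note [measurable] = Cons
  show ?case unfolding list.map permanent.simps by measurable
qed

lemma permanent_layer:
  obtains m where "\<And>\<omega>. permanent (map trapezoid zs) \<omega> * layer (length zs) m \<omega> = permanent (map trapezoid zs) \<omega>"
    "\<And>z q. z \<in> set zs \<Longrightarrow> trapezoid z q \<noteq> 0 \<Longrightarrow> \<bar>q\<bar> \<le> real m"
proof -
  obtain m :: nat where m: "\<forall>z\<in>set zs. \<forall>q. trapezoid z q \<noteq> 0 \<longrightarrow> \<bar>q\<bar> \<le> real m"
    using ex_trapezoid_bound_list by blast
  show thesis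
  proof (rule that[of m])
    fix \<omega>
    show "permanent (map trapezoid zs) \<omega> * layer (length zs) m \<omega> = permanent (map trapezoid zs) \<omega>"
    proof (cases "permanent (map trapezoid zs) \<omega> = 0")
      case False
      have "q \<in> {- real m..real m}" if "\<phi> \<in> set (map trapezoid zs)" "\<phi> q \<noteq> 0" for \<phi> q
      proof -
        have "\<exists>z\<in>set zs. \<phi> = trapezoid z" using that(1) unfolding set_map by blast
        then have "\<bar>q\<bar> \<le> real m" using m that(2) by blast
        then show ?thesis by (auto simp: abs_le_iff)
      qed
      then have "length \<omega> = length (map trapezoid zs) \<and> set \<omega> \<subseteq> {- real m..real m}"
        using False by (intro permanent_nonzero) auto
      then show ?thesis by (simp add: layer_def cutoff_power_def)
    qed simp
  qed (use m in blast)
qed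

lemma permanent_trapezoid_bounds: "\<bar>permanent (map trapezoid zs) \<omega>\<bar> \<le> fact (length zs)"
proof -
  have "0 \<le> permanent (map trapezoid zs) \<omega> \<and> permanent (map trapezoid zs) \<omega> \<le> fact (length (map trapezoid zs))"
    by (rule permanent_bounds) (use trapezoid_bounds in auto)
  then show ?thesis by simp
qed

lemma integrable_permanent:
  fixes f :: "real list \<Rightarrow> 'k :: {banach, second_countable_topology}"
  assumes [measurable]: "f \<in> borel_measurable config_measure"
    and int: "\<And>m. integrable config_measure (\<lambda>\<omega>. layer (length zs) m \<omega> *\<^sub>R f \<omega>)"
  shows "integrable config_measure (\<lambda>\<omega>. permanent (map trapezoid zs) \<omega> *\<^sub>R f \<omega>)"
proof -
  obtain m where m: "\<And>\<omega>. permanent (map trapezoid zs) \<omega> * layer (length zs) m \<omega> = permanent (map trapezoid zs) \<omega>"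
    by (rule permanent_layer) (rule that)
  show ?thesis
  proof (rule Bochner_Integration.integrable_bound)
    show "integrable config_measure (\<lambda>\<omega>. (fact (length zs) :: real) *\<^sub>R (layer (length zs) m \<omega> *\<^sub>R f \<omega>))"
      using int by (intro integrable_scaleR_right)
    show "AE \<omega> in config_measure. norm (permanent (map trapezoid zs) \<omega> *\<^sub>R f \<omega>) \<le> norm ((fact (length zs) :: real) *\<^sub>R (layer (length zs) m \<omega> *\<^sub>R f \<omega>))"
    proof (rule AE_I2)
      fix \<omega>
      have "norm (permanent (map trapezoid zs) \<omega> *\<^sub>R f \<omega>) = \<bar>permanent (map trapezoid zs) \<omega>\<bar> * (layer (length zs) m \<omega> * norm (f \<omega>))"
        by (subst m[symmetric]) (simp add: abs_mult layer_bounds)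
      also have "\<dots> \<le> fact (length zs) * (layer (length zs) m \<omega> * norm (f \<omega>))"
        by (intro mult_right_mono permanent_trapezoid_bounds mult_nonneg_nonneg layer_bounds norm_ge_zero)
      finally show "norm (permanent (map trapezoid zs) \<omega> *\<^sub>R f \<omega>) \<le> norm ((fact (length zs) :: real) *\<^sub>R (layer (length zs) m \<omega> *\<^sub>R f \<omega>))"
        by (simp add: layer_bounds)
    qed
  qed measurable
qed

text \<open>Induction on the number of particles: for almost every position \<open>q\<close> of one particle, the
  function \<open>\<omega> \<mapsto> f (\<omega> @ [q])\<close> satisfies the hypotheses with one particle fewer; countably many
  trapezoids keep the exceptional set null.\<close>

lemma AE_eq_0_if_permanent_integrals_eq_0:
  fixes f :: "real list \<Rightarrow> 'k :: {banach, second_countable_topology, real_inner}"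
  assumes "f \<in> borel_measurable config_measure" "symmetric f"
    and "\<And>m. integrable config_measure (\<lambda>\<omega>. layer n m \<omega> *\<^sub>R f \<omega>)"
    and "\<And>zs. length zs = n \<Longrightarrow> (\<integral>\<omega>. permanent (map trapezoid zs) \<omega> *\<^sub>R f \<omega> \<partial>config_measure) = 0"
  shows "AE \<omega> in config_measure. length \<omega> = n \<longrightarrow> f \<omega> = 0"
  using assms
proof (induction n arbitrary: f)
  case 0
  have "(\<integral>\<omega>. permanent (map trapezoid []) \<omega> *\<^sub>R f \<omega> \<partial>config_measure) = (\<integral>\<omega>. (if \<omega> = [] then f [] else 0) \<partial>config_measure)"
    by (intro Bochner_Integration.integral_cong) auto
  also have "\<dots> = f []" by (rule integral_config_Nil)
  finally have "f [] = 0" using "0.prems"(4)[of "[]"] by simp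
  then show ?case by (auto intro!: AE_I2)
next
  case (Suc n)
  note [measurable] = Suc.prems(1)
  have fs: "f xs = f ys" if "mset xs = mset ys" for xs ys
    using Suc.prems(2) that unfolding symmetric_def by blast
  have I: "integrable (config_measure \<Otimes>\<^sub>M lborel) (\<lambda>(\<omega>, q). (layer n m \<omega> * indicator {- real m..real m} q) *\<^sub>R f (\<omega> @ [q]))" for m
    using integrable_layer_snoc[OF Suc.prems(1,2) Suc.prems(3)] by (simp only: layer_snoc)
  \<comment> \<open>The integrability behind Fubini, for a one-particle factor u times a permanent.
    It is used with u an indicator and with u a trapezoid.\<close>
  have P: "integrable (config_measure \<Otimes>\<^sub>M lborel) (\<lambda>(\<omega>, q). (u q * permanent (map trapezoid zs) \<omega>) *\<^sub>R f (\<omega> @ [q]))"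
    if zs: "length zs = n" and [measurable]: "u \<in> borel_measurable borel" and u: "\<And>q. \<bar>u q\<bar> \<le> 1" "\<And>q. u q \<noteq> 0 \<Longrightarrow> \<bar>q\<bar> \<le> real l"
    for zs u and l :: nat
  proof -
    obtain m0 where m0: "\<And>\<omega>. permanent (map trapezoid zs) \<omega> * layer (length zs) m0 \<omega> = permanent (map trapezoid zs) \<omega>"
      by (rule permanent_layer) (rule that)
    let ?m = "max m0 l"
    have m: "permanent (map trapezoid zs) \<omega> * layer n ?m \<omega> = permanent (map trapezoid zs) \<omega>" for \<omega>
      using m0[of \<omega>] layer_mono[of m0 ?m n \<omega>] zs by (metis max.cobounded1 mult.assoc)
    have i: "u q * indicator {- real ?m..real ?m} q = u q" for q
      using u(2)[of q] by (cases "u q = 0") (auto simp: indicator_def abs_le_iff)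
    show ?thesis
    proof (rule Bochner_Integration.integrable_bound)
      show "integrable (config_measure \<Otimes>\<^sub>M lborel) (\<lambda>z. (fact n :: real) *\<^sub>R (case z of (\<omega>, q) \<Rightarrow> (layer n ?m \<omega> * indicator {- real ?m..real ?m} q) *\<^sub>R f (\<omega> @ [q])))"
        by (rule integrable_scaleR_right[OF I])
      show "AE z in config_measure \<Otimes>\<^sub>M lborel. norm (case z of (\<omega>, q) \<Rightarrow> (u q * permanent (map trapezoid zs) \<omega>) *\<^sub>R f (\<omega> @ [q])) \<le>
          norm ((fact n :: real) *\<^sub>R (case z of (\<omega>, q) \<Rightarrow> (layer n ?m \<omega> * indicator {- real ?m..real ?m} q) *\<^sub>R f (\<omega> @ [q])))"
      proof (rule AE_I2, clarify)
        fix \<omega> q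
        have "norm ((u q * permanent (map trapezoid zs) \<omega>) *\<^sub>R f (\<omega> @ [q])) =
            norm (((u q * indicator {- real ?m..real ?m} q) * (permanent (map trapezoid zs) \<omega> * layer n ?m \<omega>)) *\<^sub>R f (\<omega> @ [q]))"
          unfolding i m ..
        also have "\<dots> = (\<bar>u q\<bar> * \<bar>permanent (map trapezoid zs) \<omega>\<bar>) * (layer n ?m \<omega> * indicator {- real ?m..real ?m} q * norm (f (\<omega> @ [q])))"
          by (simp add: abs_mult layer_bounds)
        also have "\<dots> \<le> (1 * fact n) * (layer n ?m \<omega> * indicator {- real ?m..real ?m} q * norm (f (\<omega> @ [q])))"
          using permanent_trapezoid_bounds[of zs \<omega>] zs u(1)
          by (intro mult_right_mono mult_mono mult_nonneg_nonneg layer_bounds norm_ge_zero) auto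
        finally show "norm ((u q * permanent (map trapezoid zs) \<omega>) *\<^sub>R f (\<omega> @ [q])) \<le>
            norm ((fact n :: real) *\<^sub>R ((layer n ?m \<omega> * indicator {- real ?m..real ?m} q) *\<^sub>R f (\<omega> @ [q])))"
          by (simp add: abs_mult layer_bounds mult.assoc)
      qed
    qed measurable
  qed
  have "AE q in lborel. (\<integral>\<omega>. permanent (map trapezoid zs) \<omega> *\<^sub>R f (\<omega> @ [q]) \<partial>config_measure) = 0" if zs: "length zs = n" for zs
  proof (rule AE_eq_0_if_trapezoid_integrals_eq_0)
    fix m :: nat
    have "integrable lborel (\<lambda>q. \<integral>\<omega>. (indicator {- real m..real m} q * permanent (map trapezoid zs) \<omega>) *\<^sub>R f (\<omega> @ [q]) \<partial>config_measure)"
      by (rule config_lborel.integrable_snd[OF P[OF zs, where l = m]]) (auto simp: indicator_def abs_le_iff split: if_splits)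
    then show "integrable lborel (\<lambda>q. indicator {- real m..real m} q *\<^sub>R (\<integral>\<omega>. permanent (map trapezoid zs) \<omega> *\<^sub>R f (\<omega> @ [q]) \<partial>config_measure))"
      by (simp add: scaleR_scaleR[symmetric] del: scaleR_scaleR)
  next
    fix z
    obtain l :: nat where l: "\<forall>q. trapezoid z q \<noteq> 0 \<longrightarrow> \<bar>q\<bar> \<le> real l" using ex_trapezoid_bound by blast
    have int: "integrable (config_measure \<Otimes>\<^sub>M lborel) (\<lambda>(\<omega>, q). (trapezoid z q * permanent (map trapezoid zs) \<omega>) *\<^sub>R f (\<omega> @ [q]))"
      using trapezoid_bounds l by (intro P[OF zs, where l = l]) auto
    have "(\<integral>q. trapezoid z q *\<^sub>R (\<integral>\<omega>. permanent (map trapezoid zs) \<omega> *\<^sub>R f (\<omega> @ [q]) \<partial>config_measure) \<partial>lborel) =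
        (\<integral>q. (\<integral>\<omega>. (trapezoid z q * permanent (map trapezoid zs) \<omega>) *\<^sub>R f (\<omega> @ [q]) \<partial>config_measure) \<partial>lborel)"
      by (simp add: scaleR_scaleR[symmetric] del: scaleR_scaleR)
    also have "\<dots> = (\<integral>(\<omega>, q). (trapezoid z q * permanent (map trapezoid zs) \<omega>) *\<^sub>R f (\<omega> @ [q]) \<partial>(config_measure \<Otimes>\<^sub>M lborel))"
      by (rule config_lborel.integral_snd[OF int])
    also have "\<dots> = (\<integral>\<omega>. sum_delete (\<lambda>q \<omega>'. (trapezoid z q * permanent (map trapezoid zs) \<omega>') *\<^sub>R f (\<omega>' @ [q])) \<omega> \<partial>config_measure)"
      by (rule integral_sum_delete[OF int, symmetric])
    \<comment> \<open>The recursion of \<open>permanent\<close> is a sum over deletions, so the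
      sum-integral formula rebuilds a permanent with one more factor.\<close>
    also have "\<dots> = (\<integral>\<omega>. permanent (map trapezoid (z # zs)) \<omega> *\<^sub>R f \<omega> \<partial>config_measure)"
    proof (rule Bochner_Integration.integral_cong[OF refl])
      fix \<omega>
      have "sum_delete (\<lambda>q \<omega>'. (trapezoid z q * permanent (map trapezoid zs) \<omega>') *\<^sub>R f (\<omega>' @ [q])) \<omega> =
          sum_delete (\<lambda>q \<omega>'. (trapezoid z q * permanent (map trapezoid zs) \<omega>') *\<^sub>R f \<omega>) \<omega>"
        by (intro sum_delete_cong arg_cong2[where f = "(*\<^sub>R)"] refl fs)
      also have "\<dots> = permanent (map trapezoid (z # zs)) \<omega> *\<^sub>R f \<omega>"
        by (simp add: sum_delete_def scaleR_sum_left)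
      finally show "sum_delete (\<lambda>q \<omega>'. (trapezoid z q * permanent (map trapezoid zs) \<omega>') *\<^sub>R f (\<omega>' @ [q])) \<omega> =
          permanent (map trapezoid (z # zs)) \<omega> *\<^sub>R f \<omega>" .
    qed
    also have "\<dots> = 0" by (rule Suc.prems(4)) (simp add: zs)
    finally show "(\<integral>q. trapezoid z q *\<^sub>R (\<integral>\<omega>. permanent (map trapezoid zs) \<omega> *\<^sub>R f (\<omega> @ [q]) \<partial>config_measure) \<partial>lborel) = 0" .
  qed
  then have A1: "AE q in lborel. \<forall>zs\<in>{zs. length zs = n}. (\<integral>\<omega>. permanent (map trapezoid zs) \<omega> *\<^sub>R f (\<omega> @ [q]) \<partial>config_measure) = 0"
    by (subst AE_ball_countable) auto
  have A2: "AE q in lborel. \<forall>m. integrable config_measure (\<lambda>\<omega>. (layer n m \<omega> * indicator {- real m..real m} q) *\<^sub>R f (\<omega> @ [q]))"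
    unfolding AE_all_countable using config_lborel.AE_integrable_snd[OF I] by blast
  have "AE q in lborel. AE \<omega> in config_measure. length \<omega> = n \<longrightarrow> f (\<omega> @ [q]) = 0"
    using A1 A2
  proof eventually_elim
    case (elim q)
    show ?case
    proof (rule Suc.IH)
      show "(\<lambda>\<omega>. f (\<omega> @ [q])) \<in> borel_measurable config_measure" by measurable
      show "symmetric (\<lambda>\<omega>. f (\<omega> @ [q]))" unfolding symmetric_def by (intro allI impI fs) simp
      show "(\<integral>\<omega>. permanent (map trapezoid zs) \<omega> *\<^sub>R f (\<omega> @ [q]) \<partial>config_measure) = 0" if "length zs = n" for zs
        using elim(1) that by blast
      show "integrable config_measure (\<lambda>\<omega>. layer n m \<omega> *\<^sub>R f (\<omega> @ [q]))" for m
      proof -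
        obtain l :: nat where l: "\<bar>q\<bar> \<le> real l" using real_arch_simple by blast
        let ?m = "max m l"
        have "- real ?m \<le> q \<and> q \<le> real ?m" using l by (auto simp: abs_le_iff)
        then have i: "indicator {- real ?m..real ?m} q = (1 :: real)" by (simp add: indicator_def)
        have "integrable config_measure (\<lambda>\<omega>. layer n ?m \<omega> *\<^sub>R f (\<omega> @ [q]))"
          using elim(2)[rule_format, of ?m] unfolding i by simp
        then show ?thesis
        proof (rule Bochner_Integration.integrable_bound)
          show "AE \<omega> in config_measure. norm (layer n m \<omega> *\<^sub>R f (\<omega> @ [q])) \<le> norm (layer n ?m \<omega> *\<^sub>R f (\<omega> @ [q]))"
          proof (rule AE_I2)
            fix \<omega>
            have "layer n m \<omega> = layer n m \<omega> * layer n ?m \<omega>" using layer_mono[of m ?m n \<omega>] by simp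
            also have "\<dots> \<le> layer n ?m \<omega>" using layer_bounds by (intro mult_left_le_one_le) auto
            finally show "norm (layer n m \<omega> *\<^sub>R f (\<omega> @ [q])) \<le> norm (layer n ?m \<omega> *\<^sub>R f (\<omega> @ [q]))"
              using layer_bounds(1)[of n m \<omega>] layer_bounds(1)[of n ?m \<omega>] by (simp add: mult_right_mono)
          qed
        qed measurable
      qed
    qed
  qed
  then have A: "AE q in lborel. (\<integral>\<^sup>+\<omega>. (if length \<omega> = n \<and> f (\<omega> @ [q]) \<noteq> 0 then 1 else 0) \<partial>config_measure) = 0"
  proof eventually_elim
    case (elim q)
    then have "AE \<omega> in config_measure. (if length \<omega> = n \<and> f (\<omega> @ [q]) \<noteq> 0 then 1 else 0 :: ennreal) = 0"
      by eventually_elim auto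
    then show ?case by (subst nn_integral_0_iff_AE) auto
  qed
  let ?h = "\<lambda>q \<omega>. if length \<omega> = n \<and> f (\<omega> @ [q]) \<noteq> 0 then 1 else 0 :: ennreal"
  \<comment> \<open>A configuration of n + 1 points at which f does not vanish is counted at least
    once, through its last point.\<close>
  have "(\<integral>\<^sup>+\<omega>. (if length \<omega> = Suc n \<and> f \<omega> \<noteq> 0 then 1 else 0) \<partial>config_measure) \<le> (\<integral>\<^sup>+\<omega>. sum_delete ?h \<omega> \<partial>config_measure)"
  proof (rule nn_integral_mono)
    fix \<omega>
    show "(if length \<omega> = Suc n \<and> f \<omega> \<noteq> 0 then 1 else 0) \<le> sum_delete ?h \<omega>"
    proof (cases "length \<omega> = Suc n \<and> f \<omega> \<noteq> 0")
      case True
      then obtain \<omega>' q where w: "\<omega> = \<omega>' @ [q]" by (metis length_0_conv nat.distinct(1) rev_exhaust)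
      have "(1 :: ennreal) = ?h q \<omega>'" using True w by simp
      also have "\<dots> \<le> sum_delete ?h \<omega>" unfolding w sum_delete_snoc by (rule add_increasing) simp_all
      finally show ?thesis using True by simp
    next
      case False
      then show ?thesis unfolding if_not_P[OF False] by simp
    qed
  qed
  also have "\<dots> = (\<integral>\<^sup>+\<omega>. \<integral>\<^sup>+q. ?h q \<omega> \<partial>lborel \<partial>config_measure)"
    by (rule nn_integral_sum_delete) measurable
  also have "\<dots> = (\<integral>\<^sup>+q. \<integral>\<^sup>+\<omega>. ?h q \<omega> \<partial>config_measure \<partial>lborel)"
    by (rule config_lborel.Fubini'[symmetric]) measurable
  also have "\<dots> = 0" using A by (subst nn_integral_0_iff_AE) auto
  finally have "(\<integral>\<^sup>+\<omega>. (if length \<omega> = Suc n \<and> f \<omega> \<noteq> 0 then 1 else 0) \<partial>config_measure) = 0" by simp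
  then have "AE \<omega> in config_measure. (if length \<omega> = Suc n \<and> f \<omega> \<noteq> 0 then 1 else 0 :: ennreal) = 0"
    by (subst (asm) nn_integral_0_iff_AE) auto
  then show ?case by eventually_elim (auto split: if_splits)
qed

section \<open>Density in Fock space\<close>

text \<open>On each layer f is integrable, because |f| \<le> 1 + |f|^2 and the layer has finite
  measure. Permanents of trapezoids times a fixed vector x are test functions, so orthogonality
  supplies the hypothesis of \<open>AE_eq_0_if_permanent_integrals_eq_0\<close>, tested against
  every x.\<close>

lemma square_integrable_orthogonal_test_functions:
  fixes f :: "real list \<Rightarrow> 'k :: separable_hilbert"
  assumes f: "f \<in> square_integrable" and orth: "\<And>g. g \<in> test_functions \<Longrightarrow> (\<integral>\<omega>. f \<omega> \<bullet> g \<omega> \<partial>config_measure) = 0"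
  shows "AE \<omega> in config_measure. f \<omega> = 0"
proof -
  have fm [measurable]: "f \<in> borel_measurable config_measure" and sym: "symmetric f"
    and sq: "integrable config_measure (\<lambda>\<omega>. (norm (f \<omega>))\<^sup>2)"
    using f by (auto simp: square_integrable_def)
  have int: "integrable config_measure (\<lambda>\<omega>. layer n m \<omega> *\<^sub>R f \<omega>)" for n m
  proof (rule Bochner_Integration.integrable_bound)
    show "integrable config_measure (\<lambda>\<omega>. cutoff_power 1 (real m) \<omega> + (norm (f \<omega>))\<^sup>2)"
      using sq by simp
    show "AE \<omega> in config_measure. norm (layer n m \<omega> *\<^sub>R f \<omega>) \<le> norm (cutoff_power 1 (real m) \<omega> + (norm (f \<omega>))\<^sup>2)"
    proof (rule AE_I2)
      fix \<omega>
      have "norm (f \<omega>) \<le> 1 + (norm (f \<omega>))\<^sup>2"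
        using sum_squares_bound[of 1 "norm (f \<omega>)"] norm_ge_zero[of "f \<omega>"] by (simp only: power_one)
      then show "norm (layer n m \<omega> *\<^sub>R f \<omega>) \<le> norm (cutoff_power 1 (real m) \<omega> + (norm (f \<omega>))\<^sup>2)"
        by (auto simp: layer_def cutoff_power_def)
    qed
  qed measurable
  have "AE \<omega> in config_measure. length \<omega> = n \<longrightarrow> f \<omega> = 0" for n
  proof (rule AE_eq_0_if_permanent_integrals_eq_0[OF fm sym int])
    fix zs :: "(rat \<times> rat \<times> nat) list" assume "length zs = n"
    have pi: "integrable config_measure (\<lambda>\<omega>. permanent (map trapezoid zs) \<omega> *\<^sub>R f \<omega>)"
      by (rule integrable_permanent[OF fm int])
    have "(\<integral>\<omega>. permanent (map trapezoid zs) \<omega> *\<^sub>R f \<omega> \<partial>config_measure) \<bullet> x = 0" for x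
    proof -
      obtain m :: nat where m: "\<forall>z\<in>set zs. \<forall>q. trapezoid z q \<noteq> 0 \<longrightarrow> \<bar>q\<bar> \<le> real m"
        using ex_trapezoid_bound_list by blast
      have "(\<lambda>\<omega>. permanent (map trapezoid zs) \<omega> *\<^sub>R x) \<in> test_functions"
        using m continuous_trapezoid by (intro permanent_test_function[where n = m]) auto
      then have "(\<integral>\<omega>. f \<omega> \<bullet> (permanent (map trapezoid zs) \<omega> *\<^sub>R x) \<partial>config_measure) = 0" by (rule orth)
      moreover have "(\<integral>\<omega>. permanent (map trapezoid zs) \<omega> *\<^sub>R f \<omega> \<partial>config_measure) \<bullet> x =
          (\<integral>\<omega>. (permanent (map trapezoid zs) \<omega> *\<^sub>R f \<omega>) \<bullet> x \<partial>config_measure)"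
        by (rule integral_inner_left[symmetric]) (rule pi)
      ultimately show ?thesis by simp
    qed
    then show "(\<integral>\<omega>. permanent (map trapezoid zs) \<omega> *\<^sub>R f \<omega> \<partial>config_measure) = 0"
      using inner_eq_zero_iff by blast
  qed
  then have "AE \<omega> in config_measure. \<forall>n. length \<omega> = n \<longrightarrow> f \<omega> = 0"
    unfolding AE_all_countable by blast
  then show ?thesis by eventually_elim simp
qed

lemma subspace_test_functions: "subspace (fock_of ` test_functions :: 'k :: separable_hilbert fock set)"
proof (rule subspaceI)
  let ?D = "fock_of ` test_functions :: 'k fock set"
  have z: "(\<lambda>_. 0 :: 'k) \<in> test_functions"
    by (rule test_functionsI[where n = 0]) (auto simp: symmetric_def)
  then show "0 \<in> ?D" by (auto simp: zero_fock.abs_eq)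
  show "x + y \<in> ?D" if "x \<in> ?D" "y \<in> ?D" for x y
    using that by (auto simp: fock_of_add test_functions_square_integrable intro!: imageI test_functions_add)
  show "c *\<^sub>R x \<in> ?D" if "x \<in> ?D" for c x
    using that by (auto simp: scaleC_of_real[symmetric] fock_of_scaleC test_functions_square_integrable intro!: imageI test_functions_scaleC)
qed

lemma subspace_closure:
  fixes S :: "'a :: real_normed_vector set"
  assumes S: "subspace S" shows "subspace (closure S)"
proof (rule subspaceI)
  show "0 \<in> closure S" using subspace_0[OF S] closure_subset by blast
  show "x + y \<in> closure S" if xy: "x \<in> closure S" "y \<in> closure S" for x y
  proof -
    obtain u v where "\<And>n. u n \<in> S" "u \<longlonglongrightarrow> x" "\<And>n. v n \<in> S" "v \<longlonglongrightarrow> y"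
      using xy unfolding closure_sequential by blast
    then show ?thesis
      unfolding closure_sequential by (intro exI[of _ "\<lambda>n. u n + v n"]) (auto intro: tendsto_add subspace_add[OF S])
  qed
  show "c *\<^sub>R x \<in> closure S" if x: "x \<in> closure S" for c x
  proof -
    obtain u where "\<And>n. u n \<in> S" "u \<longlonglongrightarrow> x" using x unfolding closure_sequential by blast
    then show ?thesis
      unfolding closure_sequential by (intro exI[of _ "\<lambda>n. c *\<^sub>R u n"]) (auto intro: tendsto_intros subspace_scale[OF S])
  qed
qed

text \<open>Completeness of Fock space provides the projection onto the closure. The residual is
  orthogonal to all test functions and therefore vanishes.\<close>

lemma dense_test_functions: "closure (fock_of ` test_functions) = (UNIV :: 'k :: separable_hilbert fock set)"
proof (rule subset_antisym[OF subset_UNIV subsetI])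
  let ?D = "fock_of ` test_functions :: 'k fock set"
  fix x :: "'k fock"
  obtain p where p: "p \<in> closure ?D" "\<And>y. y \<in> closure ?D \<Longrightarrow> (x - p) \<bullet> y = 0"
    by (rule closed_subspace_projection[where x = x, OF subspace_closure[OF subspace_test_functions] closed_closure])
      (rule that)
  define f where "f = rep_fock (x - p)"
  have f: "f \<in> square_integrable" "fock_of f = x - p"
    unfolding f_def by (rule rep_fock fock_of_rep_fock)+
  have "AE \<omega> in config_measure. f \<omega> = 0"
  proof (rule square_integrable_orthogonal_test_functions[OF f(1)])
    fix g :: "real list \<Rightarrow> 'k" assume g: "g \<in> test_functions"
    have "(x - p) \<bullet> fock_of g = 0" by (rule p(2)) (rule subsetD[OF closure_subset imageI[OF g]])
    then show "(\<integral>\<omega>. f \<omega> \<bullet> g \<omega> \<partial>config_measure) = 0"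
      using inner_fock_of[OF f(1) test_functions_square_integrable[OF g]] f(2) by simp
  qed
  then have "fock_of f = fock_of (\<lambda>_. 0)"
    using fock_of_eq_iff[OF f(1) square_integrable_zero] by simp
  then have "x - p = 0" using f(2) by (simp add: zero_fock.abs_eq)
  with p(1) show "x \<in> closure ?D" by simp
qed

section \<open>Isometries given on dense subspaces\<close>

lemma dense_equality:
  fixes f g :: "'a :: topological_space \<Rightarrow> 'b :: t2_space"
  assumes "closure S = UNIV" "continuous_on UNIV f" "continuous_on UNIV g" "\<And>x. x \<in> S \<Longrightarrow> f x = g x"
  shows "f x = g x"
proof -
  have "closure S \<subseteq> {x. f x = g x}"
    using assms by (intro closure_minimal closed_Collect_eq) auto
  with assms(1) show ?thesis by auto
qed

lemma dense_inner_eqI: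
  fixes x y :: "'a :: real_inner"
  assumes "closure S = UNIV" "\<And>z. z \<in> S \<Longrightarrow> x \<bullet> z = y \<bullet> z"
  shows "x = y"
proof -
  have "x \<bullet> z = y \<bullet> z" for z
    by (rule dense_equality[OF assms(1) _ _ assms(2)]) (auto intro!: continuous_intros)
  then show ?thesis using vector_eq_rdot[of x y] by blast
qed

lemma isometry_bounded_linear:
  assumes "linear U" "\<And>x. norm (U x) = norm x" shows "bounded_linear U"
  using assms by (intro bounded_linear_intro[where K = 1]) (simp_all add: linear_add linear_scale)

lemma isometry_inner:
  fixes U :: "'a :: real_inner \<Rightarrow> 'b :: real_inner"
  assumes "\<And>x y. U (x + y) = U x + U y" "\<And>x. norm (U x) = norm x"
  shows "U x \<bullet> U y = x \<bullet> y"
  by (simp only: dot_norm assms(1)[symmetric] assms(2))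

lemma unitaryI:
  assumes add: "\<And>x y. U (x + y) = U x + U y" and scale: "\<And>c x. U (c *\<^sub>C x) = c *\<^sub>C U x"
    and "\<And>x. norm (U x) = norm x" "surj U"
  shows "unitary U"
proof -
  have "U x \<bullet> U y = x \<bullet> y" for x y by (rule isometry_inner) (fact assms)+
  then have "cinner (U x) (U y) = cinner x y" for x y
    by (simp only: cinner_eq_Complex scale[symmetric])
  with assms show ?thesis by (simp add: unitary_def)
qed

lemma unitary_norm:
  assumes "unitary U" shows "norm (U x) = norm x"
  using assms by (simp add: unitary_def norm_eq_sqrt_inner inner_eq_Re_cinner)

text \<open>The map from \<open>e i\<close> to \<open>u i\<close> is given on indices only. The
  relation with v fixes the inner products of \<open>u i\<close> with a dense set in terms of the
  vector \<open>e i\<close>, which shows at once that the map is well defined and linear on the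
  image of e. Being isometric there, it extends by uniform continuity.\<close>

lemma dense_isometry_extension:
  fixes e u v :: "'i \<Rightarrow> 'a :: {real_inner, complete_space}"
  assumes dense: "closure (e ` I) = UNIV" and sub: "subspace (e ` I)"
    and adj: "\<And>i j. i \<in> I \<Longrightarrow> j \<in> I \<Longrightarrow> u i \<bullet> e j = e i \<bullet> v j"
    and iso: "\<And>i. i \<in> I \<Longrightarrow> norm (u i) = norm (e i)"
  obtains U where "linear U" "\<And>x. norm (U x) = norm x" "\<And>i. i \<in> I \<Longrightarrow> U (e i) = u i"
proof -
  let ?S = "e ` I"
  \<comment> \<open>Any other index with the same vector gives the same value, by
    \<open>Pe\<close>.\<close>
  define k where "k x = (SOME i. i \<in> I \<and> e i = x)" for x
  have k: "k x \<in> I" "e (k x) = x" if "x \<in> ?S" for x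
    using someI_ex[of "\<lambda>i. i \<in> I \<and> e i = x"] that unfolding k_def by blast+
  define P where "P x = u (k x)" for x
  have eq: "a = b" if "\<And>j. j \<in> I \<Longrightarrow> a \<bullet> e j = b \<bullet> e j" for a b
    using dense_inner_eqI[OF dense] that by blast
  have Pj: "P x \<bullet> e j = x \<bullet> v j" if "x \<in> ?S" "j \<in> I" for x j
    using adj[OF k(1)[OF that(1)] that(2)] k(2)[OF that(1)] by (simp add: P_def)
  have Pe: "P (e i) = u i" if "i \<in> I" for i
    by (rule eq) (simp add: that Pj adj)
  have Padd: "P (x + y) = P x + P y" if "x \<in> ?S" "y \<in> ?S" for x y
    by (rule eq) (simp add: that subspace_add[OF sub] Pj inner_add_left)
  have Pscale: "P (c *\<^sub>R x) = c *\<^sub>R P x" if "x \<in> ?S" for c x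
    by (rule eq) (simp add: that subspace_scale[OF sub] Pj)
  have Pdiff: "P (x - y) = P x - P y" if "x \<in> ?S" "y \<in> ?S" for x y
    by (rule eq) (simp add: that subspace_diff[OF sub] Pj inner_diff_left)
  have Pnorm: "norm (P x) = norm x" if "x \<in> ?S" for x
    using iso[OF k(1)[OF that]] k(2)[OF that] by (simp add: P_def)
  have dP: "dist (P x) (P y) = dist x y" if "x \<in> ?S" "y \<in> ?S" for x y
    unfolding dist_norm Pdiff[OF that, symmetric] by (rule Pnorm) (rule subspace_diff[OF sub that])
  have "uniformly_continuous_on ?S P"
    unfolding uniformly_continuous_on_def
  proof (intro allI impI)
    fix d :: real assume "0 < d"
    then show "\<exists>r>0. \<forall>x\<in>?S. \<forall>x'\<in>?S. dist x' x < r \<longrightarrow> dist (P x') (P x) < d"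
      by (intro exI[of _ d]) (simp add: dP)
  qed
  then obtain U where U: "uniformly_continuous_on (closure ?S) U" "\<And>x. x \<in> ?S \<Longrightarrow> P x = U x"
    by (rule uniformly_continuous_on_extension_on_closure) (rule that)
  have cont: "continuous_on UNIV U"
    using uniformly_continuous_imp_continuous[OF U(1)] dense by simp
  have cU: "(\<lambda>n. U (a n)) \<longlonglongrightarrow> U x" if "a \<longlonglongrightarrow> x" for a x
    using continuous_on_tendsto_compose[OF cont that] by simp
  have seq: "\<exists>a. (\<forall>n. a n \<in> ?S) \<and> a \<longlonglongrightarrow> x" for x
    using dense closure_sequential[of x ?S] by simp
  show thesis
  proof
    show "U (e i) = u i" if "i \<in> I" for i using U(2)[of "e i"] Pe that by simp
    show "norm (U x) = norm x" for x
      by (rule dense_equality[OF dense]) (auto intro!: continuous_intros cont simp: U(2)[symmetric] Pnorm)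
    show "linear U"
    proof (rule linearI)
      fix x y
      obtain a b where ab: "\<And>n. a n \<in> ?S" "a \<longlonglongrightarrow> x" "\<And>n. b n \<in> ?S" "b \<longlonglongrightarrow> y" using seq by metis
      have "U (a n + b n) = U (a n) + U (b n)" for n
        using Padd[OF ab(1,3)] U(2) ab(1,3) subspace_add[OF sub] by simp
      then have "(\<lambda>n. U (a n) + U (b n)) \<longlonglongrightarrow> U (x + y)"
        using cU[OF tendsto_add[OF ab(2,4)]] by simp
      moreover have "(\<lambda>n. U (a n) + U (b n)) \<longlonglongrightarrow> U x + U y"
        by (intro tendsto_add cU ab)
      ultimately show "U (x + y) = U x + U y" by (rule LIMSEQ_unique)
    next
      fix c x
      show "U (c *\<^sub>R x) = c *\<^sub>R U x"
        by (rule dense_equality[OF dense])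
          (auto intro!: continuous_intros continuous_on_compose2[OF cont] simp: U(2)[symmetric] Pscale subspace_scale[OF sub])
    qed
  qed
qed

text \<open>Both u and v extend, to isometries U and V that are adjoint to each other. Expanding |U
  (V y) - y|^2 gives 0, so U is onto. Adjointness and isometry are real statements; complex
  homogeneity enters through \<open>scale\<close>.\<close>

lemma dense_unitary_extension:
  fixes e u v :: "'i \<Rightarrow> 'a :: {complex_inner, complete_space}"
  assumes dense: "closure (e ` I) = UNIV" and sub: "subspace (e ` I)"
    and adj: "\<And>i j. i \<in> I \<Longrightarrow> j \<in> I \<Longrightarrow> u i \<bullet> e j = e i \<bullet> v j"
    and iso: "\<And>i. i \<in> I \<Longrightarrow> norm (u i) = norm (e i)" "\<And>i. i \<in> I \<Longrightarrow> norm (v i) = norm (e i)"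
    and scale: "\<And>c i. i \<in> I \<Longrightarrow> \<exists>j\<in>I. e j = c *\<^sub>C e i \<and> u j = c *\<^sub>C u i"
  obtains U where "unitary U" "\<And>i. i \<in> I \<Longrightarrow> U (e i) = u i"
proof -
  obtain U where U: "linear U" "\<And>x. norm (U x) = norm x" "\<And>i. i \<in> I \<Longrightarrow> U (e i) = u i"
    by (rule dense_isometry_extension[OF dense sub adj iso(1)]) (assumption | rule that | blast)+
  have adj': "v i \<bullet> e j = e i \<bullet> u j" if "i \<in> I" "j \<in> I" for i j
    using adj[OF that(2,1)] by (simp add: inner_commute)
  obtain V where V: "linear V" "\<And>x. norm (V x) = norm x" "\<And>i. i \<in> I \<Longrightarrow> V (e i) = v i"
    by (rule dense_isometry_extension[OF dense sub adj' iso(2)]) (assumption | rule that | blast)+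
  have cU: "continuous_on X U" and cV: "continuous_on X V" for X
    using isometry_bounded_linear[OF U(1,2)] isometry_bounded_linear[OF V(1,2)]
    by (auto intro: linear_continuous_on)
  have UVe: "U (e i) \<bullet> y = e i \<bullet> V y" if "i \<in> I" for i y
    by (rule dense_equality[OF dense]) (auto intro!: continuous_intros cV simp: U(3) V(3) adj that)
  have UV: "U x \<bullet> y = x \<bullet> V y" for x y
    by (rule dense_equality[OF dense]) (auto intro!: continuous_intros cU simp: UVe)
  have nV: "V y \<bullet> V y = y \<bullet> y" and nU: "U y \<bullet> U y = y \<bullet> y" for y
    using U(2)[of y] V(2)[of y] by (simp_all add: norm_eq)
  have "U (V y) = y" for y
  proof -
    have "U (V y) \<bullet> U (V y) = y \<bullet> y" by (simp only: nU nV)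
    moreover have "U (V y) \<bullet> y = y \<bullet> y" by (simp only: UV nV)
    ultimately have "(U (V y) - y) \<bullet> (U (V y) - y) = 0"
      by (simp only: inner_diff_left inner_diff_right inner_commute[of y "U (V y)"])
    then show ?thesis by simp
  qed
  then have "surj U" by (metis surj_def)
  moreover have "U (c *\<^sub>C x) = c *\<^sub>C U x" for c x
  proof (rule dense_equality[OF dense, where f = "\<lambda>x. U (c *\<^sub>C x)" and g = "\<lambda>x. c *\<^sub>C U x"])
    show "continuous_on UNIV (\<lambda>x. U (c *\<^sub>C x))"
      by (rule continuous_on_compose2[OF cU[of UNIV] bounded_linear.continuous_on[OF bounded_linear_scaleC continuous_on_id] subset_UNIV])
    show "continuous_on UNIV (\<lambda>x. c *\<^sub>C U x)"
      by (rule bounded_linear.continuous_on[OF bounded_linear_scaleC cU])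
    fix x assume "x \<in> e ` I"
    then obtain i where i: "i \<in> I" "x = e i" by blast
    obtain j where "j \<in> I" "e j = c *\<^sub>C e i" "u j = c *\<^sub>C u i" using scale[OF i(1)] by blast
    then show "U (c *\<^sub>C x) = c *\<^sub>C U x" using U(3)[of j] U(3)[of i] i by simp
  qed
  ultimately have "unitary U"
    using U(2) linear_add[OF U(1)] by (intro unitaryI) auto
  with U(3) show thesis by (rule that[rotated])
qed


section \<open>The energy form\<close>

definition energy_form ::
  "('k \<Rightarrow>\<^sub>L 'k) \<Rightarrow> ('k \<Rightarrow>\<^sub>L 'k) \<Rightarrow> ('k \<Rightarrow>\<^sub>L 'k) \<Rightarrow> ('k \<Rightarrow>\<^sub>L 'k) \<Rightarrow> 'k \<Rightarrow> 'k :: real_inner \<Rightarrow> real" where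
  "energy_form A\<^sub>1 A\<^sub>0 A\<^sub>m B x y =
     2 * (x \<bullet> (B x + A\<^sub>m y)) + ((norm (A\<^sub>1 x + A\<^sub>0 y + y))\<^sup>2 - (norm y)\<^sup>2)"

text \<open>The form is the sum of a quadratic part in x, a mixed part and a quadratic part in y.
  The operator in the x part is symmetric, so polarisation makes it vanish; the mixed part vanishes
  by testing with all y.\<close>

lemma energy_form_eq_0_iff:
  fixes A\<^sub>1 A\<^sub>0 A\<^sub>m B A\<^sub>1' A\<^sub>0' A\<^sub>m' B' :: "'k :: real_inner \<Rightarrow>\<^sub>L 'k"
  assumes adj: "\<And>x y. A\<^sub>1 x \<bullet> y = x \<bullet> A\<^sub>1' y" "\<And>x y. A\<^sub>0 x \<bullet> y = x \<bullet> A\<^sub>0' y"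
      "\<And>x y. A\<^sub>m x \<bullet> y = x \<bullet> A\<^sub>m' y" "\<And>x y. B x \<bullet> y = x \<bullet> B' y"
  shows "(\<forall>x y. energy_form A\<^sub>1 A\<^sub>0 A\<^sub>m B x y = 0) \<longleftrightarrow>
    (\<forall>x. B x + B' x + A\<^sub>1' (A\<^sub>1 x) = 0) \<and> (\<forall>x. A\<^sub>m' x + A\<^sub>1 x + A\<^sub>0' (A\<^sub>1 x) = 0) \<and>
    (\<forall>y. norm (A\<^sub>0 y + y) = norm y)" (is "?L \<longleftrightarrow> ?R")
proof -
  let ?S = "\<lambda>x. B x + B' x + A\<^sub>1' (A\<^sub>1 x)" and ?T = "\<lambda>x. A\<^sub>m' x + A\<^sub>1 x + A\<^sub>0' (A\<^sub>1 x)"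
  have E: "energy_form A\<^sub>1 A\<^sub>0 A\<^sub>m B x y = x \<bullet> ?S x + 2 * (?T x \<bullet> y) + ((norm (A\<^sub>0 y + y))\<^sup>2 - (norm y)\<^sup>2)" for x y
  proof -
    have "(norm (A\<^sub>1 x + A\<^sub>0 y + y))\<^sup>2 = A\<^sub>1 x \<bullet> A\<^sub>1 x + 2 * (A\<^sub>1 x \<bullet> (A\<^sub>0 y + y)) + (norm (A\<^sub>0 y + y))\<^sup>2"
      unfolding power2_norm_eq_inner add.assoc by (simp add: inner_add inner_commute algebra_simps)
    moreover have "A\<^sub>1 x \<bullet> A\<^sub>1 x = x \<bullet> A\<^sub>1' (A\<^sub>1 x)" by (rule adj)
    moreover have "A\<^sub>1 x \<bullet> A\<^sub>0 y = A\<^sub>0' (A\<^sub>1 x) \<bullet> y" using adj(2)[of y "A\<^sub>1 x"] by (simp add: inner_commute)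
    moreover have "x \<bullet> A\<^sub>m y = A\<^sub>m' x \<bullet> y" using adj(3)[of y x] by (simp add: inner_commute)
    moreover have "x \<bullet> B x = x \<bullet> B' x" using adj(4)[of x x] by (simp add: inner_commute)
    ultimately show ?thesis
      by (simp add: energy_form_def inner_add_right inner_add_left)
  qed
  show ?thesis
  proof
    assume L: ?L
    have S0: "x \<bullet> ?S x = 0" for x using E[of x 0] L by (simp add: blinfun.zero_right)
    have sym: "y \<bullet> ?S x = x \<bullet> ?S y" for x y
      using adj(1)[of y "A\<^sub>1 x"] adj(1)[of x "A\<^sub>1 y"] adj(4)[of x y] adj(4)[of y x]
      by (simp add: inner_add_right inner_commute)
    have "x \<bullet> ?S y = 0" for x y
    proof -
      have "?S (x + y) = ?S x + ?S y" by (simp add: blinfun.add_right)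
      then have "(x + y) \<bullet> (?S x + ?S y) = 0" using S0[of "x + y"] by simp
      then show ?thesis using S0[of x] S0[of y] sym[of x y] by (simp add: inner_add_left inner_add_right)
    qed
    then have 1: "\<forall>x. ?S x = 0" by (meson inner_eq_zero_iff)
    have 2: "\<forall>y. (norm (A\<^sub>0 y + y))\<^sup>2 = (norm y)\<^sup>2"
      using E[of 0] L 1 by (simp add: blinfun.zero_right)
    have "?T x \<bullet> y = 0" for x y using E[of x y] L 1 2 by simp
    then have "\<forall>x. ?T x = 0" by (meson inner_eq_zero_iff)
    with 1 2 show ?R by simp
  next
    assume ?R then show ?L by (simp add: E)
  qed
qed

text \<open>The two norm conditions say that \<Upsilon> = 1 + \<open>A\<^sub>0\<close> and its
  adjoint are isometric, that is, \<Upsilon> is unitary. The mixed condition of the second form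
  reads \<open>A\<^sub>1\<close> = - \<Upsilon> \<open>hadjoint A\<^sub>m\<close>, and the adjoint
  of \<Upsilon> carries it into that of the first. The quadratic parts in x give the two expressions
  for \<open>B + hadjoint B\<close>.\<close>

lemma energy_forms_eq_0_iff_unitary:
  fixes A\<^sub>1 A\<^sub>0 A\<^sub>m B :: "'k :: separable_hilbert \<Rightarrow>\<^sub>L 'k"
  assumes b: "A\<^sub>1 \<in> bounded_operators" "A\<^sub>0 \<in> bounded_operators" "A\<^sub>m \<in> bounded_operators" "B \<in> bounded_operators"
  shows "(\<forall>x y. energy_form A\<^sub>1 A\<^sub>0 A\<^sub>m B x y = 0) \<and>
      (\<forall>x y. energy_form (hadjoint A\<^sub>m) (hadjoint A\<^sub>0) (hadjoint A\<^sub>1) (hadjoint B) x y = 0) \<longleftrightarrow>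
    (\<exists>\<Upsilon> \<in> bounded_operators. unitary (blinfun_apply \<Upsilon>) \<and>
        A\<^sub>0 = \<Upsilon> - id_blinfun \<and>
        A\<^sub>1 = - (\<Upsilon> o\<^sub>L hadjoint A\<^sub>m) \<and>
        B + hadjoint B = - (hadjoint A\<^sub>1 o\<^sub>L A\<^sub>1) \<and>
        - (hadjoint A\<^sub>1 o\<^sub>L A\<^sub>1) = - (A\<^sub>m o\<^sub>L hadjoint A\<^sub>m))" (is "?L \<longleftrightarrow> ?R")
proof -
  note adj = inner_hadjoint[OF b(1)] inner_hadjoint[OF b(2)] inner_hadjoint[OF b(3)] inner_hadjoint[OF b(4)]
  have adj': "A\<^sub>1 x \<bullet> y = x \<bullet> hadjoint A\<^sub>1 y" "A\<^sub>0 x \<bullet> y = x \<bullet> hadjoint A\<^sub>0 y"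
      "A\<^sub>m x \<bullet> y = x \<bullet> hadjoint A\<^sub>m y" "B x \<bullet> y = x \<bullet> hadjoint B y" for x y
    using adj[of y x] by (simp_all add: inner_commute)
  have L: "?L \<longleftrightarrow>
    ((\<forall>x. B x + hadjoint B x + hadjoint A\<^sub>1 (A\<^sub>1 x) = 0) \<and> (\<forall>x. hadjoint A\<^sub>m x + A\<^sub>1 x + hadjoint A\<^sub>0 (A\<^sub>1 x) = 0) \<and>
      (\<forall>y. norm (A\<^sub>0 y + y) = norm y)) \<and>
    ((\<forall>x. hadjoint B x + B x + A\<^sub>m (hadjoint A\<^sub>m x) = 0) \<and> (\<forall>x. A\<^sub>1 x + hadjoint A\<^sub>m x + A\<^sub>0 (hadjoint A\<^sub>m x) = 0) \<and>
      (\<forall>y. norm (hadjoint A\<^sub>0 y + y) = norm y))"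
    by (intro arg_cong2[where f = conj] energy_form_eq_0_iff adj adj')
  show ?thesis
  proof
    assume ?L
    note * = this[unfolded L]
    define \<Upsilon> where "\<Upsilon> = A\<^sub>0 + id_blinfun"
    have U: "\<Upsilon> x = A\<^sub>0 x + x" for x by (simp add: \<Upsilon>_def blinfun.add_left)
    \<comment> \<open>This is the adjoint of \<Upsilon>. That it is isometric makes it a right
      inverse, hence \<Upsilon> is onto.\<close>
    let ?V = "\<lambda>x. hadjoint A\<^sub>0 x + x"
    have UV: "\<Upsilon> (?V y) = y" for y
    proof -
      have "x \<bullet> \<Upsilon> (?V y) = x \<bullet> y" for x
      proof -
        have "x \<bullet> \<Upsilon> (?V y) = ?V x \<bullet> ?V y"
          using adj'(2)[of "?V y" x] by (simp add: U inner_add_right inner_add_left inner_commute)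
        also have "\<dots> = x \<bullet> y"
          by (rule isometry_inner) (use * in \<open>simp_all add: blinfun.add_right\<close>)
        finally show ?thesis .
      qed
      then show ?thesis using vector_eq_ldot by blast
    qed
    have Ub: "\<Upsilon> \<in> bounded_operators"
      using b(2) by (simp add: bounded_operators_def U scaleC_add_right)
    show ?R
    proof (intro bexI[OF _ Ub] conjI)
      show "unitary (blinfun_apply \<Upsilon>)"
      proof (rule unitaryI)
        show "surj (blinfun_apply \<Upsilon>)" using UV by (metis surj_def)
        show "norm (\<Upsilon> x) = norm x" for x using * by (simp add: U)
      qed (use Ub in \<open>simp_all add: bounded_operators_def blinfun.add_right\<close>)
      show "A\<^sub>0 = \<Upsilon> - id_blinfun" by (simp add: \<Upsilon>_def)
      have 2: "A\<^sub>1 x = - (hadjoint A\<^sub>m x + A\<^sub>0 (hadjoint A\<^sub>m x))" for x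
        by (rule iffD2[OF eq_neg_iff_add_eq_0]) (use * in \<open>simp add: add.assoc\<close>)
      show "A\<^sub>1 = - (\<Upsilon> o\<^sub>L hadjoint A\<^sub>m)"
        by (rule blinfun_eqI) (simp add: 2 U blinfun.minus_left)
      have 3: "B x + hadjoint B x = - hadjoint A\<^sub>1 (A\<^sub>1 x)" "hadjoint B x + B x = - A\<^sub>m (hadjoint A\<^sub>m x)" for x
        using * by (simp_all add: eq_neg_iff_add_eq_0)
      show "B + hadjoint B = - (hadjoint A\<^sub>1 o\<^sub>L A\<^sub>1)"
        by (rule blinfun_eqI) (simp add: 3 blinfun.minus_left blinfun.add_left)
      show "- (hadjoint A\<^sub>1 o\<^sub>L A\<^sub>1) = - (A\<^sub>m o\<^sub>L hadjoint A\<^sub>m)"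
      proof (rule blinfun_eqI)
        fix x
        show "(- (hadjoint A\<^sub>1 o\<^sub>L A\<^sub>1)) x = (- (A\<^sub>m o\<^sub>L hadjoint A\<^sub>m)) x"
          using 3[of x] by (simp add: blinfun.minus_left add.commute)
      qed
    qed
  next
    assume ?R
    then obtain \<Upsilon> where u: "unitary (blinfun_apply \<Upsilon>)" and A0: "A\<^sub>0 = \<Upsilon> - id_blinfun"
      and A1: "A\<^sub>1 = - (\<Upsilon> o\<^sub>L hadjoint A\<^sub>m)" and B1: "B + hadjoint B = - (hadjoint A\<^sub>1 o\<^sub>L A\<^sub>1)"
      and B2: "- (hadjoint A\<^sub>1 o\<^sub>L A\<^sub>1) = - (A\<^sub>m o\<^sub>L hadjoint A\<^sub>m)" by blast
    have U: "A\<^sub>0 x + x = \<Upsilon> x" for x by (simp add: A0 blinfun.diff_left)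
    have nU: "norm (\<Upsilon> x) = norm x" for x by (rule unitary_norm[OF u])
    have iU: "\<Upsilon> x \<bullet> \<Upsilon> y = x \<bullet> y" for x y by (rule isometry_inner) (simp_all add: nU blinfun.add_right)
    let ?V = "\<lambda>x. hadjoint A\<^sub>0 x + x"
    have VU: "?V (\<Upsilon> y) = y" for y
    proof -
      have "x \<bullet> ?V (\<Upsilon> y) = x \<bullet> y" for x
        using iU[of x y] adj'(2)[of x "\<Upsilon> y"] by (simp add: U[symmetric] inner_add_right inner_add_left)
      then show ?thesis using vector_eq_ldot by blast
    qed
    have nV: "norm (?V y) = norm y" for y
    proof -
      obtain z where "y = \<Upsilon> z" using u unfolding unitary_def surj_def by blast
      then show ?thesis using VU[of z] nU[of z] by simp
    qed
    have A1': "A\<^sub>1 x = - \<Upsilon> (hadjoint A\<^sub>m x)" for x by (simp add: A1 blinfun.minus_left)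
    have b1: "B x + hadjoint B x = - hadjoint A\<^sub>1 (A\<^sub>1 x)" for x
      using arg_cong[OF B1, of "\<lambda>F. blinfun_apply F x"] by (simp add: blinfun.minus_left blinfun.add_left)
    have b2: "hadjoint A\<^sub>1 (A\<^sub>1 x) = A\<^sub>m (hadjoint A\<^sub>m x)" for x
      using arg_cong[OF B2, of "\<lambda>F. blinfun_apply F x"] by (simp add: blinfun.minus_left)
    have "hadjoint A\<^sub>m x + A\<^sub>1 x + hadjoint A\<^sub>0 (A\<^sub>1 x) = 0" for x
      using VU[of "hadjoint A\<^sub>m x"] by (simp add: A1' blinfun.minus_right algebra_simps)
    moreover have "A\<^sub>1 x + hadjoint A\<^sub>m x + A\<^sub>0 (hadjoint A\<^sub>m x) = 0" for x
      using U[of "hadjoint A\<^sub>m x"] A1'[of x] by (simp add: algebra_simps)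
    moreover have "hadjoint B x + B x + A\<^sub>m (hadjoint A\<^sub>m x) = 0" for x
      using b1[of x] b2[of x] by (simp add: add.commute)
    ultimately show ?L
      unfolding L using b1 by (simp add: U nU nV)
  qed
qed

section \<open>The energy rate at the initial time\<close>

lemma energy_form_bound:
  fixes A\<^sub>1 A\<^sub>0 A\<^sub>m B :: "'k :: real_inner \<Rightarrow>\<^sub>L 'k"
  obtains K where "0 \<le> K" "\<And>x y D. norm x \<le> D \<Longrightarrow> norm y \<le> D \<Longrightarrow> \<bar>energy_form A\<^sub>1 A\<^sub>0 A\<^sub>m B x y\<bar> \<le> K * D\<^sup>2"
proof -
  let ?N = "norm A\<^sub>1 + norm A\<^sub>0 + 1"
  show thesis
  proof (rule that[of "2 * (norm B + norm A\<^sub>m) + (?N\<^sup>2 + 1)"])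
    fix x y :: 'k and D :: real assume D: "norm x \<le> D" "norm y \<le> D"
    have D0: "0 \<le> D" using D(1) norm_ge_zero order_trans by blast
    have "\<bar>x \<bullet> (B x + A\<^sub>m y)\<bar> \<le> norm x * norm (B x + A\<^sub>m y)"
      by (rule Cauchy_Schwarz_ineq2)
    also have "\<dots> \<le> D * (norm B * D + norm A\<^sub>m * D)"
      using D D0 by (intro mult_mono order_trans[OF norm_triangle_ineq] add_mono order_trans[OF norm_blinfun] mult_left_mono) auto
    finally have 1: "\<bar>x \<bullet> (B x + A\<^sub>m y)\<bar> \<le> (norm B + norm A\<^sub>m) * D\<^sup>2"
      by (simp add: algebra_simps power2_eq_square)
    have "norm (A\<^sub>1 x + A\<^sub>0 y + y) \<le> norm A\<^sub>1 * D + norm A\<^sub>0 * D + D"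
      using D by (intro order_trans[OF norm_triangle_ineq] add_mono order_trans[OF norm_blinfun] mult_left_mono) auto
    also have "\<dots> = ?N * D" by (simp add: algebra_simps)
    finally have 2: "(norm (A\<^sub>1 x + A\<^sub>0 y + y))\<^sup>2 \<le> ?N\<^sup>2 * D\<^sup>2"
      unfolding power_mult_distrib[symmetric] by (intro power_mono) auto
    have 3: "(norm y)\<^sup>2 \<le> D\<^sup>2" using D by (intro power_mono) auto
    have "\<bar>energy_form A\<^sub>1 A\<^sub>0 A\<^sub>m B x y\<bar> \<le> 2 * ((norm B + norm A\<^sub>m) * D\<^sup>2) + (?N\<^sup>2 * D\<^sup>2 + D\<^sup>2)"
      using 1 2 3 zero_le_power2[of "norm (A\<^sub>1 x + A\<^sub>0 y + y)"] zero_le_power2[of "norm y"]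
      unfolding energy_form_def by linarith
    then show "\<bar>energy_form A\<^sub>1 A\<^sub>0 A\<^sub>m B x y\<bar> \<le> (2 * (norm B + norm A\<^sub>m) + (?N\<^sup>2 + 1)) * D\<^sup>2"
      by (simp add: algebra_simps)
  qed simp
qed

lemma tendsto_energy_form:
  assumes "(f \<longlongrightarrow> x) F" "(g \<longlongrightarrow> y) F"
  shows "((\<lambda>n. energy_form A\<^sub>1 A\<^sub>0 A\<^sub>m B (f n) (g n)) \<longlongrightarrow> energy_form A\<^sub>1 A\<^sub>0 A\<^sub>m B x y) F"
proof -
  have b: "((\<lambda>n. blinfun_apply A (h n)) \<longlongrightarrow> A z) F" if "(h \<longlongrightarrow> z) F" for A :: "'b \<Rightarrow>\<^sub>L 'b" and h z
    using bounded_linear.tendsto[OF blinfun.bounded_linear_right that] .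
  show ?thesis
    unfolding energy_form_def by (intro tendsto_intros b assms)
qed

lemma measurable_energy_form [measurable (raw)]:
  fixes f g :: "'a \<Rightarrow> 'k :: separable_hilbert"
  assumes [measurable]: "f \<in> borel_measurable M" "g \<in> borel_measurable M"
  shows "(\<lambda>x. energy_form A\<^sub>1 A\<^sub>0 A\<^sub>m B (f x) (g x)) \<in> borel_measurable M"
  unfolding energy_form_def by measurable

text \<open>As long as no point of \<omega> lies in (s,r) there is no jump, and only the drift
  integral separates \<open>G r\<close> from the initial value.\<close>

lemma evolution_near_initial:
  fixes G :: "real \<Rightarrow> real list \<Rightarrow> 'k :: separable_hilbert"
  assumes G: "evolution A\<^sub>1 A\<^sub>0 A\<^sub>m B s t g G" and r: "s \<le> r" "r \<le> t"
    and gap: "\<And>p. p \<in> set \<omega> \<Longrightarrow> \<not> (s < p \<and> p < r)"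
    and K: "\<And>q. norm (B (G q \<omega>) + A\<^sub>m (G q (\<omega> @ [q]))) \<le> K"
  shows "norm (G r \<omega> - g \<omega>) \<le> K * (r - s)"
proof -
  let ?F = "\<lambda>q. indicator {s<..<r} q *\<^sub>R (B (G q \<omega>) + A\<^sub>m (G q (\<omega> @ [q])))"
  have i: "integrable lborel ?F"
    by (rule integrable_evolution_integrand) (use G in \<open>simp add: evolution_def\<close>)
  have n: "sum_delete (\<lambda>q \<omega>'. if s < q \<and> q < r then A\<^sub>1 (G q \<omega>') + A\<^sub>0 (G q (\<omega>' @ [q])) else 0) \<omega> = 0"
  proof (rule sum_delete_neutral)
    fix q \<omega>' assume "mset (\<omega>' @ [q]) = mset \<omega>"
    then have "q \<in> set \<omega>" using mset_eq_setD by fastforce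
    then show "(if s < q \<and> q < r then A\<^sub>1 (G q \<omega>') + A\<^sub>0 (G q (\<omega>' @ [q])) else 0) = 0" using gap by auto
  qed
  have "G r \<omega> = g \<omega> + (\<integral>q. ?F q \<partial>lborel) + sum_delete (\<lambda>q \<omega>'. if s < q \<and> q < r then A\<^sub>1 (G q \<omega>') + A\<^sub>0 (G q (\<omega>' @ [q])) else 0) \<omega>"
    using G r unfolding evolution_def by simp
  then have "G r \<omega> - g \<omega> = (\<integral>q. ?F q \<partial>lborel)" unfolding n by simp
  also have "norm \<dots> \<le> (\<integral>q. norm (?F q) \<partial>lborel)" by (rule integral_norm_bound)
  also have "\<dots> \<le> (\<integral>q. K * indicator {s<..<r} q \<partial>lborel)"
  proof (rule integral_mono)
    show "integrable lborel (\<lambda>q. norm (?F q))" by (rule integrable_norm[OF i])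
    show "integrable lborel (\<lambda>q. K * indicator {s<..<r} q)" using r(1) by simp
    show "norm (?F q) \<le> K * indicator {s<..<r} q" for q
      using K[of q] by (cases "q \<in> {s<..<r}") auto
  qed
  also have "\<dots> = K * (r - s)" using r(1) by simp
  finally show ?thesis .
qed

lemma evolution_energy_limit:
  fixes G :: "real \<Rightarrow> real list \<Rightarrow> 'k :: separable_hilbert"
  assumes G: "evolution A\<^sub>1 A\<^sub>0 A\<^sub>m B 0 1 g G" and g: "dominated (\<lambda>_. g)"
    and cont: "\<And>\<omega>. isCont (\<lambda>q. g (\<omega> @ [q])) 0"
    and q: "\<And>n. 0 < q n" "\<And>n. q n \<le> 1" "q \<longlonglongrightarrow> 0"
  shows "(\<lambda>n. \<integral>\<omega>. energy_form A\<^sub>1 A\<^sub>0 A\<^sub>m B (G (q n) \<omega>) (G (q n) (\<omega> @ [q n])) \<partial>config_measure)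
    \<longlonglongrightarrow> (\<integral>\<omega>. energy_form A\<^sub>1 A\<^sub>0 A\<^sub>m B (g \<omega>) (g (\<omega> @ [0])) \<partial>config_measure)"
proof -
  have dG: "dominated G" using G by (simp add: evolution_def)
  note [measurable (raw)] = measurable_evolution_pair[OF dG] measurable_evolution_pair[OF g measurable_const]
  obtain K where K: "0 \<le> K" "\<And>x y D. norm x \<le> D \<Longrightarrow> norm y \<le> D \<Longrightarrow> \<bar>energy_form A\<^sub>1 A\<^sub>0 A\<^sub>m B x y\<bar> \<le> K * D\<^sup>2"
    using energy_form_bound[of A\<^sub>1 A\<^sub>0 A\<^sub>m B] by blast
  obtain C c R where *: "0 \<le> C" "1 \<le> c" "0 \<le> R"
    "\<And>r \<omega>. norm (G r \<omega>) \<le> C * cutoff_power c R \<omega>"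
    "\<And>r q \<omega>. norm (G r (\<omega> @ [q])) \<le> C * cutoff_power c R \<omega>" using dominated_bound[OF dG] by blast
  let ?L = "\<lambda>\<omega>. (norm B + norm A\<^sub>m) * (C * cutoff_power c R \<omega>)"
  have L: "norm (B (G p \<omega>) + A\<^sub>m (G p (\<omega> @ [p]))) \<le> ?L \<omega>" for p \<omega>
  proof -
    have "norm (B (G p \<omega>) + A\<^sub>m (G p (\<omega> @ [p]))) \<le> norm B * norm (G p \<omega>) + norm A\<^sub>m * norm (G p (\<omega> @ [p]))"
      by (intro order_trans[OF norm_triangle_ineq] add_mono norm_blinfun)
    also have "\<dots> \<le> ?L \<omega>"
      unfolding distrib_right by (intro add_mono mult_left_mono * norm_ge_zero)
    finally show ?thesis .
  qed
  show ?thesis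
  proof (rule integral_dominated_convergence[where w = "\<lambda>\<omega>. K * C\<^sup>2 * cutoff_power (c\<^sup>2) R \<omega>"])
    show "integrable config_measure (\<lambda>\<omega>. K * C\<^sup>2 * cutoff_power (c\<^sup>2) R \<omega>)" using * by simp
    show "AE \<omega> in config_measure. norm (energy_form A\<^sub>1 A\<^sub>0 A\<^sub>m B (G (q n) \<omega>) (G (q n) (\<omega> @ [q n]))) \<le> K * C\<^sup>2 * cutoff_power (c\<^sup>2) R \<omega>" for n
      using K(2)[OF *(4,5)] by (intro AE_I2) (simp add: power_mult_distrib cutoff_power_square mult.assoc)
    show "AE \<omega> in config_measure. (\<lambda>n. energy_form A\<^sub>1 A\<^sub>0 A\<^sub>m B (G (q n) \<omega>) (G (q n) (\<omega> @ [q n])))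
        \<longlonglongrightarrow> energy_form A\<^sub>1 A\<^sub>0 A\<^sub>m B (g \<omega>) (g (\<omega> @ [0]))"
    proof (rule AE_I2, rule tendsto_energy_form)
      fix \<omega>
      \<comment> \<open>The positive points of \<omega> keep a distance from 0, so for large n none
        of them lies in the interval from 0 to \<open>q n\<close>.\<close>
      have "eventually (\<lambda>n. \<forall>p\<in>set \<omega>. 0 < p \<longrightarrow> q n < p) sequentially"
        by (intro eventually_ball_finite ballI) (auto intro: eventually_mono[OF order_tendstoD(2)[OF q(3)]])
      then have ev: "eventually (\<lambda>n. \<forall>p\<in>set \<omega>. \<not> (0 < p \<and> p < q n)) sequentially"
        by eventually_elim auto
      have "(\<lambda>n. G (q n) \<omega> - g \<omega>) \<longlonglongrightarrow> 0"
      proof (rule tendsto_0_le[OF q(3), where K = "?L \<omega>"], use ev in eventually_elim)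
        case (elim n)
        then have "norm (G (q n) \<omega> - g \<omega>) \<le> ?L \<omega> * (q n - 0)"
          by (intro evolution_near_initial[OF G] L) (use q in \<open>auto simp: less_imp_le\<close>)
        then show ?case using q(1)[of n] by (simp add: mult.commute)
      qed
      then show "(\<lambda>n. G (q n) \<omega>) \<longlonglongrightarrow> g \<omega>" by (rule LIM_zero_cancel)
      \<comment> \<open>The appended point \<open>q n\<close> is the end of the open interval and
        causes no jump, so \<open>ev\<close> is enough. The bound at \<open>\<omega> @ [q n]\<close>
        costs one more factor c.\<close>
      have "(\<lambda>n. G (q n) (\<omega> @ [q n]) - g (\<omega> @ [q n])) \<longlonglongrightarrow> 0"
      proof (rule tendsto_0_le[OF q(3), where K = "(norm B + norm A\<^sub>m) * (C * (c * cutoff_power c R \<omega>))"], use ev in eventually_elim)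
        case (elim n)
        then have "norm (G (q n) (\<omega> @ [q n]) - g (\<omega> @ [q n])) \<le> ?L (\<omega> @ [q n]) * (q n - 0)"
          by (intro evolution_near_initial[OF G] L) (use q in \<open>auto simp: less_imp_le\<close>)
        also have "\<dots> \<le> (norm B + norm A\<^sub>m) * (C * (c * cutoff_power c R \<omega>)) * (q n - 0)"
          using q(1)[of n] * by (intro mult_right_mono mult_left_mono cutoff_power_snoc_le) auto
        finally show ?case using q(1)[of n] by (simp add: mult.commute)
      qed
      moreover have "(\<lambda>n. g (\<omega> @ [q n])) \<longlonglongrightarrow> g (\<omega> @ [0])"
        by (rule isCont_tendsto_compose[OF cont q(3)])
      ultimately have "(\<lambda>n. (G (q n) (\<omega> @ [q n]) - g (\<omega> @ [q n])) + g (\<omega> @ [q n])) \<longlonglongrightarrow> 0 + g (\<omega> @ [0])"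
        by (rule tendsto_add)
      then show "(\<lambda>n. G (q n) (\<omega> @ [q n])) \<longlonglongrightarrow> g (\<omega> @ [0])" by simp
    qed
  qed measurable
qed

text \<open>
  Since the energy is conserved on \<open>[0, t]\<close> for all small \<open>t\<close>, the continuous energy rate vanishes
  at time \<open>0\<close>.
\<close>

lemma initial_energy_rate_eq_0:
  fixes g :: "real list \<Rightarrow> 'k :: separable_hilbert"
  assumes iso: "\<And>t. 0 < t \<Longrightarrow>
      (\<integral>\<omega>. (norm (normal_ordered (evolution_kernel A\<^sub>1 A\<^sub>0 A\<^sub>m B 0 t) g \<omega>))\<^sup>2 \<partial>config_measure) = (\<integral>\<omega>. (norm (g \<omega>))\<^sup>2 \<partial>config_measure)"
    and g: "dominated (\<lambda>_. g)" and cont: "\<And>\<omega>. isCont (\<lambda>q. g (\<omega> @ [q])) 0"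
  shows "(\<integral>\<omega>. energy_form A\<^sub>1 A\<^sub>0 A\<^sub>m B (g \<omega>) (g (\<omega> @ [0])) \<partial>config_measure) = 0" (is "?I0 = 0")
proof -
  define G where "G r \<omega> = (if r \<in> {0..1} then normal_ordered (evolution_kernel A\<^sub>1 A\<^sub>0 A\<^sub>m B 0 r) g \<omega> else 0)" for r \<omega>
  have G: "evolution A\<^sub>1 A\<^sub>0 A\<^sub>m B 0 1 g G"
    unfolding G_def[abs_def] by (rule evolution_normal_ordered[OF g]) simp
  have dG: "dominated G" using G by (simp add: evolution_def)
  note [measurable (raw)] = measurable_evolution_pair[OF dG]
  define I where "I q = (\<integral>\<omega>. energy_form A\<^sub>1 A\<^sub>0 A\<^sub>m B (G q \<omega>) (G q (\<omega> @ [q])) \<partial>config_measure)" for q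
  have [measurable]: "I \<in> borel_measurable borel"
    unfolding I_def[abs_def] by measurable
  have I0: "(\<integral>q. indicator {0<..<t} q * I q \<partial>lborel) = 0" if t: "0 < t" "t \<le> 1" for t
  proof -
    have "evolution A\<^sub>1 A\<^sub>0 A\<^sub>m B 0 t g G" using G t(2) by (auto simp: evolution_def)
    from evolution_energy[OF this] iso[OF t(1)] t show ?thesis
      by (simp add: I_def energy_form_def G_def cong: if_cong)
  qed
  have small: "\<bar>?I0\<bar> \<le> e" if e: "0 < e" for e
  proof -
    \<comment> \<open>Dominated convergence gives limits along sequences. A neighbourhood of 0 in
      which \<open>I\<close> is close to \<open>?I0\<close> is obtained by contradiction, from a
      sequence with \<open>q n < 1 / real (Suc n)\<close>.\<close>
    have "\<exists>d>0. d \<le> 1 \<and> (\<forall>q. 0 < q \<and> q < d \<longrightarrow> \<bar>I q - ?I0\<bar> \<le> e)"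
    proof (rule ccontr)
      assume neg: "\<not> ?thesis"
      have "\<exists>q. 0 < q \<and> q < 1 / real (Suc n) \<and> \<not> \<bar>I q - ?I0\<bar> \<le> e" for n
      proof -
        have "0 < 1 / real (Suc n)" "1 / real (Suc n) \<le> 1" by simp_all
        with neg show ?thesis by blast
      qed
      then obtain q where q: "\<And>n. 0 < q n" "\<And>n. q n < 1 / real (Suc n)" "\<And>n. \<not> \<bar>I (q n) - ?I0\<bar> \<le> e" by metis
      have q0: "q \<longlonglongrightarrow> 0"
      proof (rule tendsto_sandwich[OF _ _ tendsto_const lim_inverse_n'[THEN LIMSEQ_Suc]])
        show "\<forall>\<^sub>F n in sequentially. 0 \<le> q n" using q(1) by (simp add: less_imp_le)
        show "\<forall>\<^sub>F n in sequentially. q n \<le> 1 / real (Suc n)" using q(2) by (intro always_eventually allI less_imp_le)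
      qed
      have q1: "q n \<le> 1" for n
      proof -
        have "1 / real (Suc n) \<le> 1" by simp
        with q(2)[of n] show ?thesis by linarith
      qed
      have "(\<lambda>n. I (q n)) \<longlonglongrightarrow> ?I0"
        unfolding I_def by (rule evolution_energy_limit[OF G g cont q(1) q1 q0])
      from LIMSEQ_D[OF this e] obtain n where "norm (I (q n) - ?I0) < e" by blast
      with q(3)[of n] show False by simp
    qed
    then obtain d where d: "0 < d" "d \<le> 1" "\<And>q. 0 < q \<Longrightarrow> q < d \<Longrightarrow> \<bar>I q - ?I0\<bar> \<le> e" by blast
    have ii: "integrable lborel (\<lambda>q. indicator {0<..<d} q * I q)"
    proof (rule Bochner_Integration.integrable_bound)
      show "integrable lborel (\<lambda>q. (\<bar>?I0\<bar> + e) * indicator {0<..<d} q)" using d by simp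
      show "AE q in lborel. norm (indicator {0<..<d} q * I q) \<le> norm ((\<bar>?I0\<bar> + e) * indicator {0<..<d} q)"
      proof (rule AE_I2)
        fix q :: real
        show "norm (indicator {0<..<d} q * I q) \<le> norm ((\<bar>?I0\<bar> + e) * indicator {0<..<d} q)"
          using d(3)[of q] e by (cases "q \<in> {0<..<d}") auto
      qed
    qed measurable
    \<comment> \<open>Since \<open>I\<close> integrates to 0 over (0,d), the mean of
      \<open>?I0 - I q\<close> over this interval is \<open>?I0\<close> itself.\<close>
    have "d * ?I0 = (\<integral>q. indicator {0<..<d} q * ?I0 \<partial>lborel) - (\<integral>q. indicator {0<..<d} q * I q \<partial>lborel)"
      using I0[OF d(1,2)] d(1) by simp
    also have "\<dots> = (\<integral>q. indicator {0<..<d} q * ?I0 - indicator {0<..<d} q * I q \<partial>lborel)"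
      using ii d by (intro Bochner_Integration.integral_diff[symmetric]) auto
    also have "\<bar>\<dots>\<bar> \<le> (\<integral>q. \<bar>indicator {0<..<d} q * ?I0 - indicator {0<..<d} q * I q\<bar> \<partial>lborel)"
      by (rule integral_abs_bound)
    also have "\<dots> \<le> (\<integral>q. e * indicator {0<..<d} q \<partial>lborel)"
    proof (rule integral_mono)
      show "integrable lborel (\<lambda>q. \<bar>indicator {0<..<d} q * ?I0 - indicator {0<..<d} q * I q\<bar>)"
        using ii d by (intro integrable_abs Bochner_Integration.integrable_diff) auto
      show "integrable lborel (\<lambda>q. e * indicator {0<..<d} q)" using d by simp
      fix q :: real
      show "\<bar>indicator {0<..<d} q * ?I0 - indicator {0<..<d} q * I q\<bar> \<le> e * indicator {0<..<d} q"
        using d(3)[of q] by (cases "q \<in> {0<..<d}") auto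
    qed
    also have "\<dots> = d * e" using d(1) by (simp add: mult.commute)
    finally have "d * \<bar>?I0\<bar> \<le> d * e" using d(1) by (simp add: abs_mult)
    then show ?thesis using d(1) by simp
  qed
  have "\<bar>?I0\<bar> \<le> 0" by (rule field_le_epsilon) (use small in simp)
  then show ?thesis by simp
qed

lemma isometric_iff_energy_form_eq_0:
  fixes A\<^sub>1 A\<^sub>0 A\<^sub>m B :: "'k :: separable_hilbert \<Rightarrow>\<^sub>L 'k"
  shows "(\<forall>s t. s < t \<longrightarrow> (\<forall>g\<in>test_functions.
      (\<integral>\<omega>. (norm (normal_ordered (evolution_kernel A\<^sub>1 A\<^sub>0 A\<^sub>m B s t) g \<omega>))\<^sup>2 \<partial>config_measure) =
      (\<integral>\<omega>. (norm (g \<omega>))\<^sup>2 \<partial>config_measure))) \<longleftrightarrow>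
    (\<forall>x y. energy_form A\<^sub>1 A\<^sub>0 A\<^sub>m B x y = 0)" (is "?L \<longleftrightarrow> ?R")
proof
  assume R: ?R
  show ?L
  proof (intro allI impI ballI)
    fix s t :: real and g :: "real list \<Rightarrow> 'k" assume st: "s < t" and g: "g \<in> test_functions"
    have "energy_form A\<^sub>1 A\<^sub>0 A\<^sub>m B x y = 0" for x y using R by blast
    with evolution_energy[OF evolution_normal_ordered[OF dominated_test_function[OF g], of s t A\<^sub>1 A\<^sub>0 A\<^sub>m B]] st
    show "(\<integral>\<omega>. (norm (normal_ordered (evolution_kernel A\<^sub>1 A\<^sub>0 A\<^sub>m B s t) g \<omega>))\<^sup>2 \<partial>config_measure) =
      (\<integral>\<omega>. (norm (g \<omega>))\<^sup>2 \<partial>config_measure)"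
      by (simp add: energy_form_def[symmetric])
  qed
next
  assume L: ?L
  let ?\<phi> = "\<lambda>q :: real. max 0 (1 - \<bar>q\<bar>)"
  let ?Q = "energy_form A\<^sub>1 A\<^sub>0 A\<^sub>m B"
  \<comment> \<open>The test function below is x at the empty configuration and y at the one-point
    configuration at 0. Other one-point configurations q also contribute, through the form at
    \<open>?\<phi> q *\<^sub>R y\<close> and 0; the condition on y removes them. It holds for y = 0,
    which gives \<open>?Q x 0 = 0\<close> for all x and thereby the condition for every y.\<close>
  have *: "?Q x y = 0" if y: "?Q y 0 = 0" for x y
  proof -
    define g where "g \<omega> = permanent [] \<omega> *\<^sub>R x + permanent [?\<phi>] \<omega> *\<^sub>R y" for \<omega>
    have g: "g \<in> test_functions"
      unfolding g_def[abs_def]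
      by (intro test_functions_add permanent_test_function[where n = 1]) (auto intro!: continuous_intros split: if_splits)
    have gs: "g (\<omega> @ [q]) = (if \<omega> = [] then ?\<phi> q *\<^sub>R y else 0)" for \<omega> q
      by (simp add: g_def sum_delete_snoc sum_delete_neutral)
    have "(\<integral>\<omega>. ?Q (g \<omega>) (g (\<omega> @ [0])) \<partial>config_measure) = 0"
    proof (rule initial_energy_rate_eq_0[OF _ dominated_test_function[OF g]])
      show "isCont (\<lambda>q. g (\<omega> @ [q])) 0" for \<omega>
      proof -
        have "continuous_on UNIV (\<lambda>q. g (\<omega> @ [q]))"
          unfolding gs by (cases "\<omega> = []") (auto intro!: continuous_intros)
        then show ?thesis by (simp add: continuous_on_eq_continuous_at)
      qed
    qed (use L g in blast)
    moreover have "?Q (g \<omega>) (g (\<omega> @ [0])) = (if \<omega> = [] then ?Q x y else 0)" for \<omega>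
    proof (cases \<omega> rule: rev_cases)
      case Nil then show ?thesis by (simp add: gs) (simp add: g_def)
    next
      case (snoc \<omega>' q)
      have "?Q (a *\<^sub>R y) 0 = a\<^sup>2 * ?Q y 0" for a
        by (simp add: energy_form_def blinfun.scaleR_right blinfun.zero_right power_mult_distrib power2_eq_square algebra_simps)
      moreover have "?Q 0 0 = 0" by (simp add: energy_form_def blinfun.zero_right)
      moreover have "g ((\<omega>' @ [q]) @ [0]) = 0" by (simp only: gs) simp
      ultimately show ?thesis using y by (simp add: snoc gs)
    qed
    ultimately show ?thesis using integral_config_Nil(1)[of "?Q x y"] by simp
  qed
  have "?Q 0 0 = 0" by (simp add: energy_form_def blinfun.zero_right)
  then show ?R using * by blast
qed

section \<open>Extension to Fock space\<close>

lemma integral_config_uminus: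
  fixes f :: "real list \<Rightarrow> 'a :: {banach, second_countable_topology}"
  assumes "f \<in> borel_measurable config_measure"
  shows "(\<integral>\<omega>. f (map uminus \<omega>) \<partial>config_measure) = (\<integral>\<omega>. f \<omega> \<partial>config_measure)"
  using integral_distr[OF measurable_map_real_config[of uminus] assms] by (simp add: distr_config_uminus)

text \<open>Serves for complex homogeneity of the normal ordered operator on test functions: the
  scaled path is an evolution from the scaled initial value, and the adjoint relation identifies its
  final value in Fock space with that of the kernel evolution.\<close>

lemma evolution_scaleC:
  fixes A\<^sub>1 A\<^sub>0 A\<^sub>m B :: "'k :: separable_hilbert \<Rightarrow>\<^sub>L 'k"
  assumes b: "A\<^sub>1 \<in> bounded_operators" "A\<^sub>0 \<in> bounded_operators" "A\<^sub>m \<in> bounded_operators" "B \<in> bounded_operators"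
    and G: "evolution A\<^sub>1 A\<^sub>0 A\<^sub>m B s t g G"
  shows "evolution A\<^sub>1 A\<^sub>0 A\<^sub>m B s t (\<lambda>\<omega>. z *\<^sub>C g \<omega>) (\<lambda>r \<omega>. z *\<^sub>C G r \<omega>)"
  unfolding evolution_def
proof (intro conjI ballI allI)
  have dG: "dominated G" using G by (simp add: evolution_def)
  have "(\<lambda>x. z *\<^sub>C G (fst x) (snd x)) \<in> borel_measurable (borel \<Otimes>\<^sub>M config_measure)"
    using dG by (intro borel_measurable_scaleC) (simp add: dominated_def case_prod_unfold)
  moreover have "symmetric (\<lambda>\<omega>. z *\<^sub>C G r \<omega>)" for r
    using symmetric_binary[of "G r" "G r" "\<lambda>x _. z *\<^sub>C x"] dG by (simp add: dominated_def)
  moreover obtain C c R where *: "0 \<le> C" "1 \<le> c" "0 \<le> R" "\<And>r \<omega>. norm (G r \<omega>) \<le> C * cutoff_power c R \<omega>"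
    using dG unfolding dominated_def by blast
  have "norm (z *\<^sub>C G r \<omega>) \<le> (cmod z * C) * cutoff_power c R \<omega>" for r \<omega>
    using mult_left_mono[OF *(4), of "cmod z"] by (simp add: norm_scaleC mult.assoc)
  with * have "\<exists>C c R. 0 \<le> C \<and> 1 \<le> c \<and> 0 \<le> R \<and> (\<forall>r \<omega>. norm (z *\<^sub>C G r \<omega>) \<le> C * cutoff_power c R \<omega>)"
    by (intro exI[of _ "cmod z * C"] exI[of _ c] exI[of _ R]) simp
  ultimately show "dominated (\<lambda>r \<omega>. z *\<^sub>C G r \<omega>)"
    unfolding dominated_def by (simp add: case_prod_unfold)
  have scale: "A (z *\<^sub>C x) = z *\<^sub>C A x" if "A \<in> bounded_operators" for A :: "'k \<Rightarrow>\<^sub>L 'k" and x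
    using that by (simp add: bounded_operators_def)
  interpret z: bounded_linear "\<lambda>x :: 'k. z *\<^sub>C x" by (rule bounded_linear_scaleC)
  fix r \<omega> assume r: "r \<in> {s..t}"
  let ?F = "\<lambda>q. indicator {s<..<r} q *\<^sub>R (B (G q \<omega>) + A\<^sub>m (G q (\<omega> @ [q])))"
  let ?H = "\<lambda>q \<omega>'. if s < q \<and> q < r then A\<^sub>1 (G q \<omega>') + A\<^sub>0 (G q (\<omega>' @ [q])) else 0"
  have "G r \<omega> = g \<omega> + (\<integral>q. ?F q \<partial>lborel) + sum_delete ?H \<omega>"
    using G r unfolding evolution_def by blast
  then have "z *\<^sub>C G r \<omega> = z *\<^sub>C g \<omega> + z *\<^sub>C (\<integral>q. ?F q \<partial>lborel) + z *\<^sub>C sum_delete ?H \<omega>"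
    by (simp only: z.add)
  also have "z *\<^sub>C (\<integral>q. ?F q \<partial>lborel) = (\<integral>q. z *\<^sub>C ?F q \<partial>lborel)"
    by (rule integral_bounded_linear[OF bounded_linear_scaleC integrable_evolution_integrand[OF dG], symmetric])
  also have "(\<lambda>q. z *\<^sub>C ?F q) = (\<lambda>q. indicator {s<..<r} q *\<^sub>R (B (z *\<^sub>C G q \<omega>) + A\<^sub>m (z *\<^sub>C G q (\<omega> @ [q]))))"
    by (simp add: z.scaleR z.add scale[OF b(3)] scale[OF b(4)])
  also have "z *\<^sub>C sum_delete ?H \<omega> = sum_delete (\<lambda>q \<omega>'. z *\<^sub>C ?H q \<omega>') \<omega>"
    by (rule sum_delete_linear[OF z.linear_axioms])
  also have "(\<lambda>q \<omega>'. z *\<^sub>C ?H q \<omega>') = (\<lambda>q \<omega>'. if s < q \<and> q < r then A\<^sub>1 (z *\<^sub>C G q \<omega>') + A\<^sub>0 (z *\<^sub>C G q (\<omega>' @ [q])) else 0)"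
    by (auto simp: fun_eq_iff z.add scale[OF b(1)] scale[OF b(2)])
  finally show "z *\<^sub>C G r \<omega> = z *\<^sub>C g \<omega> +
      (\<integral>q. indicator {s<..<r} q *\<^sub>R (B (z *\<^sub>C G q \<omega>) + A\<^sub>m (z *\<^sub>C G q (\<omega> @ [q]))) \<partial>lborel) +
      sum_delete (\<lambda>q \<omega>'. if s < q \<and> q < r then A\<^sub>1 (z *\<^sub>C G q \<omega>') + A\<^sub>0 (z *\<^sub>C G q (\<omega>' @ [q])) else 0) \<omega>" .
qed

lemma normal_ordered_square_integrable:
  assumes "g \<in> test_functions" "s \<le> t"
  shows "normal_ordered (evolution_kernel A\<^sub>1 A\<^sub>0 A\<^sub>m B s t) g \<in> square_integrable"
proof -
  have "dominated (\<lambda>r \<omega>. if r \<in> {s..t} then normal_ordered (evolution_kernel A\<^sub>1 A\<^sub>0 A\<^sub>m B s r) g \<omega> else 0)"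
    using evolution_normal_ordered[OF dominated_test_function[OF assms(1)] assms(2)] by (simp add: evolution_def)
  from square_integrable_dominated[OF this, of t] show ?thesis using assms(2) by simp
qed

text \<open>The candidate for the adjoint: the forward operator on (-t,-s) conjugated with the
  reflection of time. For this purpose F is the kernel with adjoint coefficients, creation and
  annihilation exchanged.\<close>

definition reflected_operator ::
  "(real \<Rightarrow> real \<Rightarrow> real list \<Rightarrow> real list \<Rightarrow> real list \<Rightarrow> ('k :: separable_hilbert \<Rightarrow>\<^sub>L 'k)) \<Rightarrow> real \<Rightarrow> real \<Rightarrow>
    (real list \<Rightarrow> 'k) \<Rightarrow> real list \<Rightarrow> 'k" where
  "reflected_operator F s t h \<omega> = normal_ordered (F (- t) (- s)) (\<lambda>\<omega>. h (map uminus \<omega>)) (map uminus \<omega>)"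

lemma
  fixes A\<^sub>1 A\<^sub>0 A\<^sub>m B :: "'k :: separable_hilbert \<Rightarrow>\<^sub>L 'k"
  assumes h: "h \<in> test_functions" and st: "s \<le> t"
  shows reflected_operator_square_integrable:
      "reflected_operator (evolution_kernel A\<^sub>1 A\<^sub>0 A\<^sub>m B) s t h \<in> square_integrable"
    and norm_reflected_operator:
      "(norm (fock_of (reflected_operator (evolution_kernel A\<^sub>1 A\<^sub>0 A\<^sub>m B) s t h)))\<^sup>2 =
        (\<integral>\<omega>. (norm (normal_ordered (evolution_kernel A\<^sub>1 A\<^sub>0 A\<^sub>m B (- t) (- s)) (\<lambda>\<omega>. h (map uminus \<omega>)) \<omega>))\<^sup>2 \<partial>config_measure)"
    and backward_evolution_reflected_operator:
      "\<exists>H. backward_evolution A\<^sub>1 A\<^sub>0 A\<^sub>m B s t h H \<and> H s = reflected_operator (evolution_kernel A\<^sub>1 A\<^sub>0 A\<^sub>m B) s t h"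
proof -
  let ?N = "normal_ordered (evolution_kernel A\<^sub>1 A\<^sub>0 A\<^sub>m B (- t) (- s)) (\<lambda>\<omega>. h (map uminus \<omega>))"
  note h' = test_functions_uminus[OF h]
  have N: "?N \<in> square_integrable"
    using st by (intro normal_ordered_square_integrable h') simp
  let ?G = "\<lambda>r \<omega>. if r \<in> {- t..- s} then normal_ordered (evolution_kernel A\<^sub>1 A\<^sub>0 A\<^sub>m B (- t) r) (\<lambda>\<omega>. h (map uminus \<omega>)) \<omega> else 0"
  have "evolution A\<^sub>1 A\<^sub>0 A\<^sub>m B (- t) (- s) (\<lambda>\<omega>. h (map uminus \<omega>)) ?G"
    using st by (intro evolution_normal_ordered dominated_test_function h') simp
  from backward_evolution_uminus[OF this]
  have H: "backward_evolution A\<^sub>1 A\<^sub>0 A\<^sub>m B s t h (\<lambda>r \<omega>. ?G (- r) (map uminus \<omega>))" .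
  have Hs: "(\<lambda>\<omega>. ?G (- s) (map uminus \<omega>)) = reflected_operator (evolution_kernel A\<^sub>1 A\<^sub>0 A\<^sub>m B) s t h"
    using st by (simp add: reflected_operator_def fun_eq_iff)
  show "\<exists>H. backward_evolution A\<^sub>1 A\<^sub>0 A\<^sub>m B s t h H \<and> H s = reflected_operator (evolution_kernel A\<^sub>1 A\<^sub>0 A\<^sub>m B) s t h"
    using H Hs by blast
  have "dominated (\<lambda>r \<omega>. ?G (- r) (map uminus \<omega>))" using H by (simp only: backward_evolution_def)
  from square_integrable_dominated[OF this, of s]
  show si: "reflected_operator (evolution_kernel A\<^sub>1 A\<^sub>0 A\<^sub>m B) s t h \<in> square_integrable"
    unfolding Hs .
  have [measurable]: "?N \<in> borel_measurable config_measure" using N by (simp add: square_integrable_def)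
  have "(\<lambda>\<omega>. (norm (?N \<omega>))\<^sup>2) \<in> borel_measurable config_measure" by measurable
  from integral_config_uminus[OF this]
  show "(norm (fock_of (reflected_operator (evolution_kernel A\<^sub>1 A\<^sub>0 A\<^sub>m B) s t h)))\<^sup>2 = (\<integral>\<omega>. (norm (?N \<omega>))\<^sup>2 \<partial>config_measure)"
    unfolding norm_fock_of[OF si] by (simp add: reflected_operator_def)
qed

text \<open>If U is a unitary extension, the adjoint relation and density force \<open>V h\<close>
  to represent the preimage of h under U, so V is isometric too. Conversely, two isometric maps in
  duality are the input of \<open>dense_unitary_extension\<close>.\<close>

lemma unitary_extension_iff:
  fixes A\<^sub>1 A\<^sub>0 A\<^sub>m B :: "'k :: separable_hilbert \<Rightarrow>\<^sub>L 'k"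
  assumes b: "A\<^sub>1 \<in> bounded_operators" "A\<^sub>0 \<in> bounded_operators" "A\<^sub>m \<in> bounded_operators" "B \<in> bounded_operators"
    and st: "s \<le> t"
  defines "T \<equiv> normal_ordered (evolution_kernel A\<^sub>1 A\<^sub>0 A\<^sub>m B s t)"
    and "V \<equiv> reflected_operator (evolution_kernel (hadjoint A\<^sub>m) (hadjoint A\<^sub>0) (hadjoint A\<^sub>1) (hadjoint B)) s t"
  shows "(\<exists>U :: 'k fock \<Rightarrow> 'k fock. unitary U \<and> extends_to_fock T U) \<longleftrightarrow>
    (\<forall>g\<in>test_functions. norm (fock_of (T g)) = norm (fock_of g)) \<and>
    (\<forall>h\<in>test_functions. norm (fock_of (V h)) = norm (fock_of h))" (is "?L \<longleftrightarrow> ?R")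
proof -
  have T: "T g \<in> square_integrable" if "g \<in> test_functions" for g
    unfolding T_def by (rule normal_ordered_square_integrable[OF that st])
  have V: "V g \<in> square_integrable" if "g \<in> test_functions" for g
    unfolding V_def by (rule reflected_operator_square_integrable[OF that st])
  note sq = test_functions_square_integrable
  have adj: "A\<^sub>1 x \<bullet> y = x \<bullet> hadjoint A\<^sub>1 y" "A\<^sub>0 x \<bullet> y = x \<bullet> hadjoint A\<^sub>0 y"
      "A\<^sub>m x \<bullet> y = x \<bullet> hadjoint A\<^sub>m y" "B x \<bullet> y = x \<bullet> hadjoint B y" for x y
    using inner_hadjoint[OF b(1), of y x] inner_hadjoint[OF b(2), of y x] inner_hadjoint[OF b(3), of y x]
      inner_hadjoint[OF b(4), of y x] by (simp_all add: inner_commute)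
  \<comment> \<open>Stated for any evolution that starts from g, in order to cover the scaled path
    in \<open>scale\<close> as well as the normal ordered one.\<close>
  have ev: "fock_of (G t) \<bullet> fock_of h = fock_of g \<bullet> fock_of (V h)"
    if G: "evolution A\<^sub>1 A\<^sub>0 A\<^sub>m B s t g G" and h: "h \<in> test_functions" and g: "g \<in> test_functions" for g h G
  proof -
    obtain H where H: "backward_evolution (hadjoint A\<^sub>m) (hadjoint A\<^sub>0) (hadjoint A\<^sub>1) (hadjoint B) s t h H" "H s = V h"
      using backward_evolution_reflected_operator[OF h st] unfolding V_def by blast
    have "G t \<in> square_integrable"
      by (rule square_integrable_dominated) (use G in \<open>simp add: evolution_def\<close>)
    then show ?thesis
      using evolution_adjoint[OF G H(1) st adj] unfolding inner_fock_of[OF sq[OF g] V[OF h]] H(2)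
      by (simp add: inner_fock_of sq h)
  qed
  have evT: "evolution A\<^sub>1 A\<^sub>0 A\<^sub>m B s t g (\<lambda>r \<omega>. if r \<in> {s..t} then normal_ordered (evolution_kernel A\<^sub>1 A\<^sub>0 A\<^sub>m B s r) g \<omega> else 0)"
    if "g \<in> test_functions" for g
    by (rule evolution_normal_ordered[OF dominated_test_function[OF that] st])
  have Tt: "(\<lambda>\<omega>. if t \<in> {s..t} then normal_ordered (evolution_kernel A\<^sub>1 A\<^sub>0 A\<^sub>m B s t) g \<omega> else 0) = T g" for g
    using st by (simp add: T_def)
  have TV: "fock_of (T g) \<bullet> fock_of h = fock_of g \<bullet> fock_of (V h)" if "g \<in> test_functions" "h \<in> test_functions" for g h
    using ev[OF evT[OF that(1)] that(2,1)] unfolding Tt .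
  show ?thesis
  proof
    assume ?L
    then obtain U :: "'k fock \<Rightarrow> 'k fock" where U: "unitary U"
      and UT: "\<And>g. g \<in> test_functions \<Longrightarrow> U (fock_of g) = fock_of (T g)"
      by (auto simp: extends_to_fock_def)
    have "norm (fock_of (V h)) = norm (fock_of h)" if h: "h \<in> test_functions" for h
    proof -
      obtain f where f: "fock_of h = U f" using U unfolding unitary_def surj_def by blast
      have "fock_of (V h) = f"
      proof (rule dense_inner_eqI[OF dense_test_functions])
        fix z :: "'k fock" assume "z \<in> fock_of ` test_functions"
        then obtain g where g: "g \<in> test_functions" "z = fock_of g" by blast
        have "fock_of (V h) \<bullet> z = U z \<bullet> U f"
          using TV[OF g(1) h] UT[OF g(1)] g(2) f by (simp add: inner_commute)
        also have "\<dots> = z \<bullet> f"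
          by (rule isometry_inner) (use U unitary_norm[OF U] in \<open>simp_all add: unitary_def\<close>)
        finally show "fock_of (V h) \<bullet> z = f \<bullet> z" by (simp add: inner_commute)
      qed
      then show ?thesis using unitary_norm[OF U, of f] f by simp
    qed
    moreover have "norm (fock_of (T g)) = norm (fock_of g)" if "g \<in> test_functions" for g
      using unitary_norm[OF U, of "fock_of g"] UT[OF that] by simp
    ultimately show ?R by blast
  next
    assume R: ?R
    have scale: "\<exists>j\<in>test_functions. fock_of j = z *\<^sub>C fock_of g \<and> fock_of (T j) = z *\<^sub>C fock_of (T g)"
      if g: "g \<in> test_functions" for z g
    proof (intro bexI conjI)
      show zg: "(\<lambda>\<omega>. z *\<^sub>C g \<omega>) \<in> test_functions" by (rule test_functions_scaleC[OF g])
      show "fock_of (\<lambda>\<omega>. z *\<^sub>C g \<omega>) = z *\<^sub>C fock_of g" using fock_of_scaleC[OF sq[OF g]] by simp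
      show "fock_of (T (\<lambda>\<omega>. z *\<^sub>C g \<omega>)) = z *\<^sub>C fock_of (T g)"
      proof (rule dense_inner_eqI[OF dense_test_functions])
        fix w :: "'k fock" assume "w \<in> fock_of ` test_functions"
        then obtain h where h: "h \<in> test_functions" "w = fock_of h" by blast
        have "fock_of (\<lambda>\<omega>. z *\<^sub>C T g \<omega>) \<bullet> fock_of h = fock_of (\<lambda>\<omega>. z *\<^sub>C g \<omega>) \<bullet> fock_of (V h)"
          using ev[OF evolution_scaleC[OF b evT[OF g], of z] h(1) zg] st by (simp add: T_def)
        then show "fock_of (T (\<lambda>\<omega>. z *\<^sub>C g \<omega>)) \<bullet> w = (z *\<^sub>C fock_of (T g)) \<bullet> w"
          using TV[OF zg h(1)] h(2) fock_of_scaleC[OF T[OF g]] by simp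
      qed
    qed
    obtain U :: "'k fock \<Rightarrow> 'k fock" where "unitary U" "\<And>g. g \<in> test_functions \<Longrightarrow> U (fock_of g) = fock_of (T g)"
    proof (rule dense_unitary_extension[OF dense_test_functions subspace_test_functions, where u = "\<lambda>g. fock_of (T g)" and v = "\<lambda>h. fock_of (V h)"])
      show "fock_of (T g) \<bullet> fock_of h = fock_of g \<bullet> fock_of (V h)" if "g \<in> test_functions" "h \<in> test_functions" for g h
        by (rule TV[OF that])
    qed (use R scale in blast)+
    then show ?L using T by (auto simp: extends_to_fock_def)
  qed
qed

theorem theorem4p5p1:
  fixes A\<^sub>1 A\<^sub>0 A\<^sub>m B :: "'k :: separable_hilbert \<Rightarrow>\<^sub>L 'k"
  assumes "A\<^sub>1 \<in> bounded_operators" "A\<^sub>0 \<in> bounded_operators" "A\<^sub>m \<in> bounded_operators"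
    and "B \<in> bounded_operators"
  shows
    "(\<forall>s t. s < t \<longrightarrow>
        (\<exists>U :: 'k fock \<Rightarrow> 'k fock. unitary U \<and>
          extends_to_fock (normal_ordered (evolution_kernel A\<^sub>1 A\<^sub>0 A\<^sub>m B s t)) U))
     \<longleftrightarrow>
     (\<exists>\<Upsilon> \<in> bounded_operators. unitary (blinfun_apply \<Upsilon>) \<and>
        A\<^sub>0 = \<Upsilon> - id_blinfun \<and>
        A\<^sub>1 = - (\<Upsilon> o\<^sub>L hadjoint A\<^sub>m) \<and>
        B + hadjoint B = - (hadjoint A\<^sub>1 o\<^sub>L A\<^sub>1) \<and>
        - (hadjoint A\<^sub>1 o\<^sub>L A\<^sub>1) = - (A\<^sub>m o\<^sub>L hadjoint A\<^sub>m))"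
proof -
  let ?T = "\<lambda>s t. normal_ordered (evolution_kernel A\<^sub>1 A\<^sub>0 A\<^sub>m B s t)"
  let ?K = "evolution_kernel (hadjoint A\<^sub>m) (hadjoint A\<^sub>0) (hadjoint A\<^sub>1) (hadjoint B)"
  let ?I = "\<lambda>f :: real list \<Rightarrow> 'k. \<integral>\<omega>. (norm (f \<omega>))\<^sup>2 \<partial>config_measure"
  note sq = test_functions_square_integrable
  have 1: "norm (fock_of (?T s t g)) = norm (fock_of g) \<longleftrightarrow> ?I (?T s t g) = ?I g"
    if "s < t" "g \<in> test_functions" for s t g
    unfolding norm_fock_of[OF normal_ordered_square_integrable[OF that(2) less_imp_le[OF that(1)]], symmetric]
      norm_fock_of[OF sq[OF that(2)], symmetric] by simp
  have 2: "norm (fock_of (reflected_operator ?K s t h)) = norm (fock_of h) \<longleftrightarrow>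
      ?I (normal_ordered (?K (- t) (- s)) (\<lambda>\<omega>. h (map uminus \<omega>))) = ?I (\<lambda>\<omega>. h (map uminus \<omega>))"
    if st: "s < t" and h: "h \<in> test_functions" for s t h
  proof -
    have [measurable]: "h \<in> borel_measurable config_measure" using sq[OF h] by (simp add: square_integrable_def)
    have "(\<lambda>\<omega>. (norm (h \<omega>))\<^sup>2) \<in> borel_measurable config_measure" by measurable
    from integral_config_uminus[OF this] have "?I (\<lambda>\<omega>. h (map uminus \<omega>)) = (norm (fock_of h))\<^sup>2"
      by (simp add: norm_fock_of[OF sq[OF h]])
    then show ?thesis
      unfolding norm_reflected_operator[OF h less_imp_le[OF st], symmetric] by simp
  qed
  \<comment> \<open>Reflection permutes the test functions and, in \<open>S\<close>, the intervals.
    Quantified over all of them, isometry of the reflected operators becomes isometry of the forward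
    operators with adjoint coefficients.\<close>
  have R: "(\<forall>h\<in>test_functions. P (\<lambda>\<omega>. h (map uminus \<omega>))) \<longleftrightarrow> (\<forall>h\<in>test_functions. P h)" for P :: "(real list \<Rightarrow> 'k) \<Rightarrow> bool"
  proof (intro iffI ballI)
    fix h :: "real list \<Rightarrow> 'k" assume *: "\<forall>h\<in>test_functions. P (\<lambda>\<omega>. h (map uminus \<omega>))" "h \<in> test_functions"
    have "P (\<lambda>\<omega>. h (map uminus (map uminus \<omega>)))" by (rule bspec[OF *(1) test_functions_uminus[OF *(2)]])
    then show "P h" by (simp add: o_def)
  next
    fix h :: "real list \<Rightarrow> 'k" assume *: "\<forall>h\<in>test_functions. P h" "h \<in> test_functions"
    show "P (\<lambda>\<omega>. h (map uminus \<omega>))" by (rule bspec[OF *(1) test_functions_uminus[OF *(2)]])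
  qed
  have S: "(\<forall>s t. s < t \<longrightarrow> P (- t) (- s)) \<longleftrightarrow> (\<forall>s t. s < t \<longrightarrow> P s t)" for P :: "real \<Rightarrow> real \<Rightarrow> bool"
  proof (intro iffI allI impI)
    fix s t :: real assume *: "\<forall>s t. s < t \<longrightarrow> P (- t) (- s)" "s < t"
    from *(1)[rule_format, of "- t" "- s"] *(2) show "P s t" by simp
  qed simp
  have "(\<forall>s t. s < t \<longrightarrow> (\<exists>U :: 'k fock \<Rightarrow> 'k fock. unitary U \<and> extends_to_fock (?T s t) U)) \<longleftrightarrow>
      (\<forall>s t. s < t \<longrightarrow> (\<forall>g\<in>test_functions. ?I (?T s t g) = ?I g) \<and>
        (\<forall>h\<in>test_functions. ?I (normal_ordered (?K (- t) (- s)) h) = ?I h))" (is "_ = (\<forall>s t. _ \<longrightarrow> ?P s t)")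
  proof (intro all_cong1 imp_cong refl)
    fix s t :: real assume st: "s < t"
    show "(\<exists>U :: 'k fock \<Rightarrow> 'k fock. unitary U \<and> extends_to_fock (?T s t) U) = ?P s t"
      unfolding unitary_extension_iff[OF assms less_imp_le[OF st]]
        R[of "\<lambda>h. ?I (normal_ordered (?K (- t) (- s)) h) = ?I h", symmetric]
      by (intro arg_cong2[where f = conj] ball_cong refl 1 2 st)
  qed
  also have "\<dots> \<longleftrightarrow> (\<forall>s t. s < t \<longrightarrow> (\<forall>g\<in>test_functions. ?I (?T s t g) = ?I g)) \<and>
      (\<forall>s t. s < t \<longrightarrow> (\<forall>h\<in>test_functions. ?I (normal_ordered (?K (- t) (- s)) h) = ?I h))"
    by (simp only: imp_conjR all_conj_distrib)
  also have "(\<forall>s t. s < t \<longrightarrow> (\<forall>h\<in>test_functions. ?I (normal_ordered (?K (- t) (- s)) h) = ?I h)) \<longleftrightarrow>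
      (\<forall>s t. s < t \<longrightarrow> (\<forall>h\<in>test_functions. ?I (normal_ordered (?K s t) h) = ?I h))"
    by (rule S)
  finally show ?thesis
    unfolding isometric_iff_energy_form_eq_0 energy_forms_eq_0_iff_unitary[OF assms] .
qed

end
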